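(* Let $m\ge 2$, $n=2m+1$, and let $G=G_n=\mathrm{SO}_n(q)$, $P=P_n$, $L=L_n$, $L'=L'_n$, $U=U_n$, $A$, $s$, $t$, $L_K$, $Q_K$, $R$, $P^{\pm}_{n-3}$ be as defined in the context. Let $\sigma\in\mathrm{Irr}(L)$ with $A\le\ker(\sigma)$. Then the following statements hold. (a) ${}^t\sigma\downarrow^{{}^tP}_{L}={}^t\sigma$ (on the left $\sigma$ is inflated to $P$, so that ${}^t\sigma$ is a character of ${}^tP$; on the right ${}^t\sigma$ is the conjugate character of $L$). In particular, ${}^t\sigma\downarrow^{{}^tP}_{{}^tP\cap P}\uparrow_{{}^tP\cap P}^{P}=({}^t\sigma)\uparrow_L^P$. (b) Let $\nu\in\mathrm{Irr}(P_{n-2})$ be of Type $1$. View $\nu$ as an irreducible character of the groups $L_K=A\times L_{n-2}=A\times A_{n-2}\times L_{n-2}'$ and $RQ_K$ via inflation. Then $$({}^s\nu)\uparrow_{RQ_K}^P={}^0\psi_\nu+{}^1\psi_\Sigma,\qquad \Sigma:=R_{L_K}^{L}({}^s\nu),$$ where $R_{L_K}^L$ is Harish-Chandra induction (inflation from $L_K$ to $Q_K$ followed by induction from $Q_K$ to $L$). (c) Suppose $m\ge 3$ and let $r:=s_{m-1}$. Let $\nu\in\mathrm{Irr}(P_{n-2})$ be of Type $0$, i.e. $\nu={}^0\psi_{\nu_0}$ for some $\nu_0\in\mathrm{Irr}(P_{n-4})$. Consider $\nu_0$ by inflation as an irreducible character of the $r$-invariant group ${}^rP_{n-2}\cap P_{n-2}$,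 so that ${}^r\nu_0\in\mathrm{Irr}({}^rP_{n-2}\cap P_{n-2})$. Then $$({}^s\nu)\uparrow_{RQ_K}^P={}^0\psi_\Sigma,\qquad \Sigma:=({}^r\nu_0)\uparrow_{{}^rP_{n-2}\cap P_{n-2}}^{P_{n-2}}.$$ (d) Let $\nu\in\mathrm{Irr}(P_{n-2})$ be of Type $+$, say $\nu={}^+\psi_{\vartheta_0}$ with $\vartheta_0\in\mathrm{Irr}(L_{n-2}^+)$. Let $\tilde\vartheta_0\in\mathrm{Irr}(P_{n-3}^+)$ be the inflation of $\vartheta_0$ and $\vartheta:=R_{L_{n-2}^+}^{L_n^+}(\vartheta_0):=\tilde\vartheta_0\uparrow_{P_{n-3}^+}^{L_n^+}$. Then $({}^s\nu)\uparrow_{RQ_K}^P={}^+\psi_\vartheta$. (e) Let $\nu\in\mathrm{Irr}(P_{n-2})$ be of Type $-$, say $\nu={}^-\psi_{\vartheta_0}$ with $\vartheta_0\in\mathrm{Irr}(L_{n-2}^-)$. Let $\tilde\vartheta_0\in\mathrm{Irr}(P_{n-3}^-)$ be the inflation of $\vartheta_0$ and $\vartheta:=R_{L_{n-2}^-}^{L_n^-}(\vartheta_0):=\tilde\vartheta_0\uparrow_{P_{n-3}^-}^{L_n^-}$. Then $({}^s\nu)\uparrow_{RQ_K}^P={}^-\psi_\vartheta$.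
   Context: **Orthogonal groups.** $q$ is an arbitrary prime power. For an odd integer $k=2l+1\ge1$, vectors in $\mathbb F_q^{k}$ are written $\mathbf v=[v_l,\dots,v_1,v_0,v_1',\dots,v_l']^{\mathrm{tr}}$ with standard basis $e_l,\dots,e_1,e_0,e_1',\dots,e_l'$, and $Q_k(\mathbf v)=v_0^2+\sum_{j=1}^l v_jv_j'$; $J_k'$ is the Gram matrix of its polar form $Q_k(\mathbf v+\mathbf v')-Q_k(\mathbf v)-Q_k(\mathbf v')$. Fix $\nu\in\mathbb F_q$ with $X^2+X+\nu$ irreducible over $\mathbb{F}_q$ (this constant is unrelated to the character $\nu$ in the claim). For $\mathbf w=[w_l,\dots,w_1,w_1',\dots,w_l']^{\mathrm{tr}}\in\mathbb F_q^{2l}$ put $Q_{2l}^+(\mathbf w)=\sum_{j=1}^l w_jw_j'$ and $Q_{2l}^-(\mathbf w)=w_1^2+w_1w_1'+\nu w_1'^2+\sum_{j=2}^l w_jw_j'$. $\mathrm{GO}_k(q)$, $\mathrm{GO}^\pm_{2l}(q)$ are the isometry groups of $Q_k$, $Q^\pm_{2l}$ in the respective general linear group; $\mathrm{SO}_k(q)=\mathrm{GO}_k(q)\cap\mathrm{SL}_k(q)$; $\mathrm{GO}_0^\pm(q)=\{1\}$. **Parabolic subgroup.** For odd $n=2m+1$ put $G_n=\mathrm{SO}_n(q)$. For $\mathbf x\in G_{n-2}$, $a\in\mathbb F_q^\times$, $\mathbf v\in\mathbb F_q^{n-2}$ let $$\mathbf s_n(\mathbf x,a)=\begin{bmatrix}a&&\\&\mathbf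 x&\\&&a^{-1}\end{bmatrix},\qquad \mathbf u_n(\mathbf v)=\begin{bmatrix}1&-\mathbf v^{\mathrm{tr}}J'_{n-2}&-Q_{n-2}(\mathbf v)\\&I_{n-2}&\mathbf v\\&&1\end{bmatrix}.$$ $P_n$ is the stabilizer in $G_n$ of the line $\langle e_m\rangle$; $P_n=U_n\rtimes L_n$ with $U_n=\{\mathbf u_n(\mathbf v)\}$, $L_n=\{\mathbf s_n(\mathbf x,a)\}=L_n'\times A$, $L_n'=\{\mathbf s_n(\mathbf x,1)\}$, $A=\{\mathbf s_n(I_{n-2},a)\}$. Via $\mathbf x\mapsto\mathbf s_n(\mathbf x,1)$, $G_{n-2}$ and its subgroups $P_{n-2},L_{n-2},U_{n-2}, L_{n-2}'$ are regarded as subgroups of $L_n'\le G_n$ (and iterate). ${}^gX=gXg^{-1}$, ${}^g\chi(x)=\chi(g^{-1}xg)$; $\uparrow,\downarrow$ denote induction and restriction. Put ($m\ge2$) $$s=\begin{bmatrix}J_2&&\\&I_{n-4}&\\&&J_2\end{bmatrix},\quad t=\begin{bmatrix}&&&&1\\&I_{m-1}&&&\\&&-1&&\\&&&I_{m-1}&\\1&&&&\end{bmatrix},$$ $J_2$ being the $2\times2$ matrix with ones on the antidiagonal, zeros elsewhere. For $m\ge3$, $r=s_{m-1}=\mathrm{diag}(1,J_2,I_{n-6},J_2,1)$ (block diagonal). $A_{n-2}={}^sA=\{\mathrm{diag}(1,b,I_{n-4},b^{-1},1)\mid b\in\mathbb F_q^\times\}$, $L_{n-2}'=\{\mathrm{diag}(I_2,\mathbf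 x,I_2)\mid\mathbf x\in\mathrm{SO}_{n-4}(q)\}$, $L_{n-2}=A_{n-2}\times L_{n-2}'$, $L_K=A\times L_{n-2}$, $Q_K=A\times P_{n-2}$, $R=\{\mathbf u_n(\mathbf v)\mid v_{m-1}'=0\}$. One has ${}^sP_n\cap P_n=RQ_K$, which is $s$-invariant, and ${}^tP_n\cap P_n=L_n$. Characters of $P_{n-2}$ are inflated to $RQ_K=R(A\times P_{n-2})$ with $RA$ in the kernel; Type 1 characters of $P_{n-2}$ are those with $U_{n-2}$ in the kernel, viewed also as characters of $L_{n-2}$ and of $L_K$ ($A$ in the kernel). For (c): ${}^rP_{n-2}\cap P_{n-2}$ consists of the matrices in $P_{n-2}\leq G_n$ of the form $$\begin{bmatrix}1&&&&&&\\&a&.&*&*&*&\\&&b&*&*&*&\\&&&\mathbf x&*&*&\\&&&&b^{-1}&.&\\&&&&&a^{-1}&\\&&&&&&1\end{bmatrix},\quad \mathbf x\in\mathrm{SO}_{n-6}(q),\ a,b\in\mathbb F_q^\times,$$ and a character of $P_{n-4}$ is inflated to it along the homomorphism sending such a matrix to its central block $\begin{bmatrix}b&*&*\\&\mathbf x&*\\&&b^{-1}\end{bmatrix}\in P_{n-4}$. **Characters of $P_n$.** Fix a non-trivial irreducible character $\xi$ of $(\mathbb F_q,+)$. Let $Q_k'(\mathbf v)=v_0^2+v_1^2+v_1v_1'+\nu v_1'^2+\sum_{j=2}^l v_jv_j'$ ($k=2l+1\geq 3$). Fix $\nu'\in\mathbb F_q^\times$ and $\mathbf b_3'\in\mathrm{GL}_3(q)$,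 independent of $k$, such that $\mathbf b_k=\mathrm{diag}(\nu'I_{l-1},\mathbf b_3',I_{l-1})$ satisfies $Q'_k(\mathbf b_k\mathbf v)=\nu'Q_k(\mathbf v)$ for all $\mathbf{v}$. For $n\ge5$ define linear characters of $U_n$ by $\lambda^0(\mathbf u_n(\mathbf v))=\xi(v_{m-1}')$, $\lambda^+(\mathbf u_n(\mathbf v))=\xi(v_0)$, $\lambda^-(\mathbf u_n(\mathbf v))=\xi((\mathbf b_{n-2}\mathbf v)_0)$ (subscript $0$: middle coordinate). With $1_{U_n}$ they represent the $L_n$-orbits on $\mathrm{Irr}(U_n)$. Their inertia groups in $P_n$ are $I^0=U_n\tilde P_{n-2}$, $I^\pm=U_nL_n^\pm$, where $\tilde P_{n-2}=\{\mathbf s_n(\mathbf x,a)\mid \mathbf x\in P_{n-2},\ \mathbf xe_{m-1}=ae_{m-1}\}$, $$L_n^+=\Big\{\mathbf s_n\Big(\begin{bmatrix}A&.&B\\.&a&.\\C&.&D\end{bmatrix},a\Big)\ \Big|\ \begin{bmatrix}A&B\\C&D\end{bmatrix}\in\mathrm{GO}_{n-3}^+(q),\ a=\det\begin{bmatrix}A&B\\C&D\end{bmatrix}\Big\},$$ $$L_n^-=\Big\{\mathbf s_n\Big(\mathbf b_{n-2}^{-1}\begin{bmatrix}A&.&B\\.&a&.\\C&.&D\end{bmatrix}\mathbf b_{n-2},a\Big)\ \Big|\ \begin{bmatrix}A&B\\C&D\end{bmatrix}\in\mathrm{GO}_{n-3}^-(q),\ a=\det\begin{bmatrix}A&B\\C&D\end{bmatrix}\Big\}$$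 ($A,B,C,D$ of size $(m-1)\times(m-1)$, dots are zeros; so $L_n^\pm\cong\mathrm{GO}_{n-3}^\pm(q)$). Let $\hat\lambda^\varepsilon$ be the extension of $\lambda^\varepsilon$ to $I^\varepsilon$ trivial on the complement $\tilde P_{n-2}$, resp. $L_n^\pm$. The irreducible characters of $P_n$ are: Type $1$ (with $U_n$ in the kernel): ${}^1\psi_\sigma=\mathrm{Infl}_{L_n}^{P_n}\sigma$, $\sigma\in\mathrm{Irr}(L_n)$; Type $0$ (covering $\lambda^0$): ${}^0\psi_\mu=(\hat\lambda^0\cdot\mathrm{Infl}_{\tilde P_{n-2}}^{I^0}\tilde\mu)\uparrow_{I^0}^{P_n}$, $\mu\in\mathrm{Irr}(P_{n-2})$, $\tilde\mu(\mathbf s_n(\mathbf x,a))=\mu(\mathbf x)$; Type $\pm$ (covering $\lambda^\pm$): ${}^\pm\psi_\vartheta=(\hat\lambda^\pm\cdot\mathrm{Infl}_{L_n^\pm}^{I^\pm}\vartheta)\uparrow_{I^\pm}^{P_n}$, $\vartheta\in\mathrm{Irr}(L_n^\pm)$. The notation ${}^\varepsilon\psi$ is extended additively to non-irreducible characters. For $n=3$ only Types $1$ and $+$ exist: $\lambda^+(\mathbf u_3(\mathbf v))=\xi(v_0)$, $L_3^+=\{1\}$, ${}^+\psi_1=\lambda^+\uparrow_{U_3}^{P_3}$. **Groups $P_{n-3}^\pm$.** For $m>2$, $P_{n-3}^+$ is the subgroup of all $\mathbf s_n(\mathbf y,a)\in L_n^+$ with $$\mathbf y=\begin{bmatrix}b&*&.&*&*\\&A&.&B&*\\&.&a&.&.\\&C&.&D&*\\&&&&b^{-1}\end{bmatrix},\quad\begin{bmatrix}A&B\\C&D\end{bmatrix}\in\mathrm{GO}_{n-5}^+(q),\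 a=\det\begin{bmatrix}A&B\\C&D\end{bmatrix},\ b\in\mathbb F_q^\times,$$ and $P_{n-3}^-$ is the subgroup of all $\mathbf s_n(\mathbf b_{n-2}^{-1}\mathbf y\,\mathbf b_{n-2},a)\in L_n^-$ with $\mathbf y$ of the same shape but $\begin{bmatrix}A&B\\C&D\end{bmatrix}\in\mathrm{GO}^-_{n-5}(q)$. For $m=2$, $P_2^+=\{\mathrm{diag}(1,b,1,b^{-1},1)\mid b\in\mathbb F_q^\times\}$. The inflations are $$\tilde\vartheta_0(\mathbf s_n(\mathbf y,a))=\vartheta_0\Big(\mathbf s_{n-2}\Big(\begin{bmatrix}A&.&B\\.&a&.\\C&.&D\end{bmatrix},a\Big)\Big)\ \text{ on }P_{n-3}^+,$$ $$\tilde\vartheta_0(\mathbf s_n(\mathbf b_{n-2}^{-1}\mathbf y\,\mathbf b_{n-2},a))=\vartheta_0\Big(\mathbf s_{n-2}\Big(\mathbf b_{n-4}^{-1}\begin{bmatrix}A&.&B\\.&a&.\\C&.&D\end{bmatrix}\mathbf b_{n-4},a\Big)\Big)\ \text{ on }P_{n-3}^-;$$ for $m=2$ (Type $+$), $\tilde\vartheta_0$ is the trivial character of $P_2^+$. *)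

theory Defs
  imports Complex_Main "Jordan_Normal_Form.VS_Connect"
begin

section \<open>Characters of finite groups\<close>

definition GL :: "nat \<Rightarrow> 'a::field mat monoid" where
  "GL d = units_of (ring_mat TYPE('a) d ())"

definition tr :: "'a::comm_monoid_add mat \<Rightarrow> 'a" where
  "tr A = (\<Sum>i<dim_row A. A $$ (i, i))"

definition representation :: "('g, 'b) monoid_scheme \<Rightarrow> nat \<Rightarrow> ('g \<Rightarrow> complex mat) \<Rightarrow> bool" where
  "representation G d \<rho> \<longleftrightarrow> \<rho> \<in> hom G (GL d)"

definition irreducible_rep :: "('g, 'b) monoid_scheme \<Rightarrow> nat \<Rightarrow> ('g \<Rightarrow> complex mat) \<Rightarrow> bool" where
  "irreducible_rep G d \<rho> \<longleftrightarrow> representation G d \<rho> \<and> d > 0 \<and>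
     (\<forall>W. VectorSpace.subspace class_ring W (module_vec TYPE(complex) d) \<and>
          (\<forall>g\<in>carrier G. \<forall>w\<in>W. \<rho> g *\<^sub>v w \<in> W)
        \<longrightarrow> W = {0\<^sub>v d} \<or> W = carrier_vec d)"

text \<open>Characters and class functions of a group are total functions that vanish outside the
  group, so that equality of class functions is plain equality. All operations below preserve
  this convention.\<close>

definition rep_char :: "('g, 'b) monoid_scheme \<Rightarrow> ('g \<Rightarrow> complex mat) \<Rightarrow> 'g \<Rightarrow> complex" where
  "rep_char G \<rho> = (\<lambda>g. if g \<in> carrier G then tr (\<rho> g) else 0)"

definition characters :: "('g, 'b) monoid_scheme \<Rightarrow> ('g \<Rightarrow> complex) set" where
  "characters G = {rep_char G \<rho> | \<rho> d. representation G d \<rho>}"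

definition Irr :: "('g, 'b) monoid_scheme \<Rightarrow> ('g \<Rightarrow> complex) set" where
  "Irr G = {rep_char G \<rho> | \<rho> d. irreducible_rep G d \<rho>}"

definition ker_char :: "('g, 'b) monoid_scheme \<Rightarrow> ('g \<Rightarrow> complex) \<Rightarrow> 'g set" where
  "ker_char G \<chi> = {g \<in> carrier G. \<chi> g = \<chi> \<one>\<^bsub>G\<^esub>}"

definition restr :: "'g set \<Rightarrow> ('g \<Rightarrow> complex) \<Rightarrow> 'g \<Rightarrow> complex" where
  "restr H \<chi> = (\<lambda>g. if g \<in> H then \<chi> g else 0)"

text \<open>In the following, \<open>G\<close> is an ambient group and \<open>H\<close>, \<open>K\<close>, \<open>N\<close>, \<open>X\<close> are (the carriers of)
  subgroups of \<open>G\<close>. \<open>ind G H K\<close> is induction from \<open>H\<close> to \<open>K\<close>.\<close>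

definition ind :: "('g, 'b) monoid_scheme \<Rightarrow> 'g set \<Rightarrow> 'g set \<Rightarrow> ('g \<Rightarrow> complex) \<Rightarrow> 'g \<Rightarrow> complex" where
  "ind G H K \<chi> = (\<lambda>g. if g \<in> K
     then (\<Sum>x\<in>K. if inv\<^bsub>G\<^esub> x \<otimes>\<^bsub>G\<^esub> g \<otimes>\<^bsub>G\<^esub> x \<in> H then \<chi> (inv\<^bsub>G\<^esub> x \<otimes>\<^bsub>G\<^esub> g \<otimes>\<^bsub>G\<^esub> x) else 0)
          / of_nat (card H)
     else 0)"

definition conj_set :: "('g, 'b) monoid_scheme \<Rightarrow> 'g \<Rightarrow> 'g set \<Rightarrow> 'g set" where
  "conj_set G g X = (\<lambda>x. g \<otimes>\<^bsub>G\<^esub> x \<otimes>\<^bsub>G\<^esub> inv\<^bsub>G\<^esub> g) ` X"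

definition conj_char :: "('g, 'b) monoid_scheme \<Rightarrow> 'g \<Rightarrow> ('g \<Rightarrow> complex) \<Rightarrow> 'g \<Rightarrow> complex" where
  "conj_char G g \<chi> = (\<lambda>x. if x \<in> carrier G then \<chi> (inv\<^bsub>G\<^esub> g \<otimes>\<^bsub>G\<^esub> x \<otimes>\<^bsub>G\<^esub> g) else 0)"

text \<open>For a semidirect product \<open>NK\<close> with \<open>N\<close> normal: \<open>infl G N K \<chi>\<close> is the inflation of the
  character \<open>\<chi>\<close> of \<open>K\<close> to \<open>NK\<close> with kernel containing \<open>N\<close>, and \<open>ext_char G N K \<phi>\<close> is the
  extension of the linear character \<open>\<phi>\<close> of \<open>N\<close> to \<open>NK\<close> that is trivial on \<open>K\<close>.\<close>

definition infl :: "('g, 'b) monoid_scheme \<Rightarrow> 'g set \<Rightarrow> 'g set \<Rightarrow> ('g \<Rightarrow> complex) \<Rightarrow> 'g \<Rightarrow> complex" where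
  "infl G N K \<chi> = (\<lambda>g. if g \<in> N <#>\<^bsub>G\<^esub> K
     then \<chi> (THE k. k \<in> K \<and> (\<exists>u\<in>N. g = u \<otimes>\<^bsub>G\<^esub> k)) else 0)"

definition ext_char :: "('g, 'b) monoid_scheme \<Rightarrow> 'g set \<Rightarrow> 'g set \<Rightarrow> ('g \<Rightarrow> complex) \<Rightarrow> 'g \<Rightarrow> complex" where
  "ext_char G N K \<phi> = (\<lambda>g. if g \<in> N <#>\<^bsub>G\<^esub> K
     then \<phi> (THE u. u \<in> N \<and> (\<exists>k\<in>K. g = u \<otimes>\<^bsub>G\<^esub> k)) else 0)"

definition additive_group :: "'a::ab_group_add monoid" where
  "additive_group = \<lparr>carrier = UNIV, mult = (+), one = 0\<rparr>"

section \<open>Quadratic forms and orthogonal groups\<close>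

text \<open>A vector of dimension \<open>k = 2 * l + 1\<close> is indexed as \<open>v_l, ..., v_1, v_0, v_1', ..., v_l'\<close>
  and one of dimension \<open>k = 2 * l\<close> as \<open>v_l, ..., v_1, v_1', ..., v_l'\<close>. In both cases
  \<open>cf v j\<close> is the coordinate \<open>v_j\<close> and \<open>cf' v j\<close> the coordinate \<open>v_j'\<close> (\<open>1 \<le> j \<le> l\<close>);
  in odd dimension \<open>cf v 0\<close> is \<open>v_0\<close>.\<close>

definition cf :: "'a vec \<Rightarrow> nat \<Rightarrow> 'a" where
  "cf v j = v $ (dim_vec v div 2 - j)"

definition cf' :: "'a vec \<Rightarrow> nat \<Rightarrow> 'a" where
  "cf' v j = v $ ((dim_vec v - 1) div 2 + j)"

definition Q_odd :: "'a::field vec \<Rightarrow> 'a" where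
  "Q_odd v = (cf v 0)\<^sup>2 + (\<Sum>j=1..dim_vec v div 2. cf v j * cf' v j)"

definition Q_plus :: "'a::field vec \<Rightarrow> 'a" where
  "Q_plus w = (\<Sum>j=1..dim_vec w div 2. cf w j * cf' w j)"

definition Q_minus :: "'a::field \<Rightarrow> 'a vec \<Rightarrow> 'a" where
  "Q_minus \<nu> w = (cf w 1)\<^sup>2 + cf w 1 * cf' w 1 + \<nu> * (cf' w 1)\<^sup>2
     + (\<Sum>j=2..dim_vec w div 2. cf w j * cf' w j)"

definition Q_odd' :: "'a::field \<Rightarrow> 'a vec \<Rightarrow> 'a" where
  "Q_odd' \<nu> v = (cf v 0)\<^sup>2 + (cf v 1)\<^sup>2 + cf v 1 * cf' v 1 + \<nu> * (cf' v 1)\<^sup>2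
     + (\<Sum>j=2..dim_vec v div 2. cf v j * cf' v j)"

definition J' :: "nat \<Rightarrow> 'a::field mat" where
  "J' k = mat k k (\<lambda>(i, j). Q_odd (unit_vec k i + unit_vec k j)
     - Q_odd (unit_vec k i) - Q_odd (unit_vec k j))"

definition isometries :: "nat \<Rightarrow> ('a::field vec \<Rightarrow> 'a) \<Rightarrow> 'a mat set" where
  "isometries k Q = {g \<in> carrier (GL k). \<forall>v\<in>carrier_vec k. Q (g *\<^sub>v v) = Q v}"

definition GO :: "nat \<Rightarrow> 'a::field mat set" where
  "GO k = isometries k Q_odd"

definition GO_plus :: "nat \<Rightarrow> 'a::field mat set" where
  "GO_plus k = isometries k Q_plus"

definition GO_minus :: "'a::field \<Rightarrow> nat \<Rightarrow> 'a mat set" where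
  "GO_minus \<nu> k = isometries k (Q_minus \<nu>)"

definition SO :: "nat \<Rightarrow> 'a::field mat set" where
  "SO k = {g \<in> GO k. det g = 1}"

section \<open>The parabolic subgroup\<close>

abbreviation scalar_block :: "'a \<Rightarrow> 'a mat" where
  "scalar_block a \<equiv> mat 1 1 (\<lambda>_. a)"

definition s_mat :: "'a::field mat \<Rightarrow> 'a \<Rightarrow> 'a mat" where
  "s_mat x a = diag_block_mat [scalar_block a, x, scalar_block (inverse a)]"

text \<open>The embedding \<open>x \<mapsto> s_n(x, 1)\<close> of \<open>G_{n-2}\<close> into \<open>G_n\<close>.\<close>

definition emb :: "'a::field mat \<Rightarrow> 'a mat" where
  "emb x = s_mat x 1"

text \<open>The matrix without its first and last row and column: the block \<open>x\<close> of \<open>s_mat x a\<close>.\<close>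

definition mid :: "'a mat \<Rightarrow> 'a mat" where
  "mid g = mat (dim_row g - 2) (dim_col g - 2) (\<lambda>(i, j). g $$ (i + 1, j + 1))"

definition u_mat :: "nat \<Rightarrow> 'a::field vec \<Rightarrow> 'a mat" where
  "u_mat n v = mat n n (\<lambda>(i, j).
     if i = j then 1
     else if i = 0 then (if j = n - 1 then - Q_odd v else - (v \<bullet> col (J' (n - 2)) (j - 1)))
     else if j = n - 1 then v $ (i - 1)
     else 0)"

text \<open>The first basis vector \<open>e_m\<close> has index 0.\<close>

definition P_grp :: "nat \<Rightarrow> 'a::field mat set" where
  "P_grp n = {g \<in> SO n. (\<lambda>v. g *\<^sub>v v) ` {c \<cdot>\<^sub>v unit_vec n 0 | c. True} = {c \<cdot>\<^sub>v unit_vec n 0 | c. True}}"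

definition U_grp :: "nat \<Rightarrow> 'a::field mat set" where
  "U_grp n = u_mat n ` carrier_vec (n - 2)"

definition L_grp :: "nat \<Rightarrow> 'a::field mat set" where
  "L_grp n = {s_mat x a | x a. x \<in> SO (n - 2) \<and> a \<noteq> 0}"

definition A_grp :: "nat \<Rightarrow> 'a::field mat set" where
  "A_grp n = {s_mat (1\<^sub>m (n - 2)) a | a. a \<noteq> 0}"

definition J2 :: "'a::field mat" where
  "J2 = mat 2 2 (\<lambda>(i, j). if i \<noteq> j then 1 else 0)"

definition s_elt :: "nat \<Rightarrow> 'a::field mat" where
  "s_elt n = diag_block_mat [J2, 1\<^sub>m (n - 4), J2]"

definition t_elt :: "nat \<Rightarrow> 'a::field mat" where
  "t_elt n = mat n n (\<lambda>(i, j).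
     if i = 0 \<or> i = n - 1 then (if i + j = n - 1 then 1 else 0)
     else if i = j then (if i = n div 2 then - 1 else 1)
     else 0)"

definition r_elt :: "nat \<Rightarrow> 'a::field mat" where
  "r_elt n = diag_block_mat [1\<^sub>m 1, J2, 1\<^sub>m (n - 6), J2, 1\<^sub>m 1]"

text \<open>\<open>P_emb n\<close>, \<open>L_emb n\<close> and \<open>U_emb n\<close> are \<open>P_{n-2}\<close>, \<open>L_{n-2}\<close> and \<open>U_{n-2}\<close>
  regarded as subgroups of \<open>G_n\<close>.\<close>

definition P_emb :: "nat \<Rightarrow> 'a::field mat set" where
  "P_emb n = emb ` P_grp (n - 2)"

definition L_emb :: "nat \<Rightarrow> 'a::field mat set" where
  "L_emb n = emb ` L_grp (n - 2)"

definition U_emb :: "nat \<Rightarrow> 'a::field mat set" where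
  "U_emb n = emb ` U_grp (n - 2)"

definition LK_grp :: "nat \<Rightarrow> 'a::field mat set" where
  "LK_grp n = A_grp n <#>\<^bsub>GL n\<^esub> L_emb n"

definition QK_grp :: "nat \<Rightarrow> 'a::field mat set" where
  "QK_grp n = A_grp n <#>\<^bsub>GL n\<^esub> P_emb n"

text \<open>The last coordinate \<open>v_{m-1}'\<close> of a vector of dimension \<open>n - 2 = 2 * (m - 1) + 1\<close>
  is \<open>cf' v ((n - 2) div 2)\<close>.\<close>

definition R_grp :: "nat \<Rightarrow> 'a::field mat set" where
  "R_grp n = {u_mat n v | v. v \<in> carrier_vec (n - 2) \<and> cf' v ((n - 2) div 2) = 0}"

definition RQK_grp :: "nat \<Rightarrow> 'a::field mat set" where
  "RQK_grp n = R_grp n <#>\<^bsub>GL n\<^esub> QK_grp n"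

text \<open>A character of \<open>P_{n-2}\<close> (matrices of size \<open>n - 2\<close>) as a character of \<open>P_emb n\<close>, its
  inflation to \<open>RQ_K\<close>, and for a character of Type 1 the associated character of \<open>L_K\<close>.\<close>

definition char_emb :: "nat \<Rightarrow> ('a::field mat \<Rightarrow> complex) \<Rightarrow> 'a mat \<Rightarrow> complex" where
  "char_emb n \<chi> = (\<lambda>g. if g \<in> P_emb n then \<chi> (mid g) else 0)"

definition infl_RQK :: "nat \<Rightarrow> ('a::field mat \<Rightarrow> complex) \<Rightarrow> 'a mat \<Rightarrow> complex" where
  "infl_RQK n \<chi> = infl (GL n) (R_grp n <#>\<^bsub>GL n\<^esub> A_grp n) (P_emb n) (char_emb n \<chi>)"

definition char_LK :: "nat \<Rightarrow> ('a::field mat \<Rightarrow> complex) \<Rightarrow> 'a mat \<Rightarrow> complex" where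
  "char_LK n \<chi> = infl (GL n) (A_grp n) (L_emb n) (restr (L_emb n) (char_emb n \<chi>))"

definition HC_LK :: "nat \<Rightarrow> ('a::field mat \<Rightarrow> complex) \<Rightarrow> 'a mat \<Rightarrow> complex" where
  "HC_LK n \<chi> = ind (GL n) (QK_grp n) (L_grp n) (infl (GL n) (U_emb n) (LK_grp n) \<chi>)"

text \<open>\<open>infl_central H \<chi>\<close> is the inflation of \<open>\<chi>\<close>, a character of \<open>P_{n-4}\<close>, to a group \<open>H\<close> of
  matrices of size \<open>n\<close> along the map to the central block of size \<open>n - 4\<close>.\<close>

definition infl_central :: "'a mat set \<Rightarrow> ('a mat \<Rightarrow> complex) \<Rightarrow> 'a mat \<Rightarrow> complex" where
  "infl_central H \<chi> = (\<lambda>g. if g \<in> H then \<chi> (mid (mid g)) else 0)"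

section \<open>Characters of the parabolic subgroup\<close>

definition b_mat :: "'a::field \<Rightarrow> 'a mat \<Rightarrow> nat \<Rightarrow> 'a mat" where
  "b_mat \<nu>' b3 k = diag_block_mat [\<nu>' \<cdot>\<^sub>m 1\<^sub>m (k div 2 - 1), b3, 1\<^sub>m (k div 2 - 1)]"

text \<open>The character \<open>u_mat n v \<mapsto> f v\<close> of \<open>U_n\<close>.\<close>

definition U_char :: "nat \<Rightarrow> ('a::field vec \<Rightarrow> complex) \<Rightarrow> 'a mat \<Rightarrow> complex" where
  "U_char n f = (\<lambda>g. if g \<in> U_grp n then f (the_inv_into (carrier_vec (n - 2)) (u_mat n) g) else 0)"

definition lam_zero :: "('a::field \<Rightarrow> complex) \<Rightarrow> nat \<Rightarrow> 'a mat \<Rightarrow> complex" where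
  "lam_zero \<xi> n = U_char n (\<lambda>v. \<xi> (cf' v ((n - 2) div 2)))"

definition lam_plus :: "('a::field \<Rightarrow> complex) \<Rightarrow> nat \<Rightarrow> 'a mat \<Rightarrow> complex" where
  "lam_plus \<xi> n = U_char n (\<lambda>v. \<xi> (cf v 0))"

definition lam_minus :: "('a::field \<Rightarrow> complex) \<Rightarrow> 'a \<Rightarrow> 'a mat \<Rightarrow> nat \<Rightarrow> 'a mat \<Rightarrow> complex" where
  "lam_minus \<xi> \<nu>' b3 n = U_char n (\<lambda>v. \<xi> (cf (b_mat \<nu>' b3 (n - 2) *\<^sub>v v) 0))"

text \<open>\<open>cross g a\<close> inserts a middle row and column, zero except for the entry \<open>a\<close> at their
  crossing, into a matrix of even size: \<open>[A, B; C, D]\<close> becomes \<open>[A, 0, B; 0, a, 0; C, 0, D]\<close>.\<close>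

definition cross :: "'a::field mat \<Rightarrow> 'a \<Rightarrow> 'a mat" where
  "cross g a = (let p = dim_row g div 2; f = (\<lambda>i. if i < p then i else i - 1) in
     mat (2 * p + 1) (2 * p + 1) (\<lambda>(i, j).
       if i = p \<and> j = p then a else if i = p \<or> j = p then 0 else g $$ (f i, f j)))"

definition P_tilde :: "nat \<Rightarrow> 'a::field mat set" where
  "P_tilde n = {s_mat x a | x a. x \<in> P_grp (n - 2) \<and> a \<noteq> 0 \<and>
     x *\<^sub>v unit_vec (n - 2) 0 = a \<cdot>\<^sub>v unit_vec (n - 2) 0}"

definition L_plus :: "nat \<Rightarrow> 'a::field mat set" where
  "L_plus n = {s_mat (cross g a) a | g a. g \<in> GO_plus (n - 3) \<and> a = det g}"

definition L_minus :: "'a::field \<Rightarrow> 'a \<Rightarrow> 'a mat \<Rightarrow> nat \<Rightarrow> 'a mat set" where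
  "L_minus \<nu> \<nu>' b3 n = (let b = b_mat \<nu>' b3 (n - 2) in
     {s_mat (inv\<^bsub>GL (n - 2)\<^esub> b * cross g a * b) a | g a. g \<in> GO_minus \<nu> (n - 3) \<and> a = det g})"

definition I_zero :: "nat \<Rightarrow> 'a::field mat set" where
  "I_zero n = U_grp n <#>\<^bsub>GL n\<^esub> P_tilde n"

definition I_plus :: "nat \<Rightarrow> 'a::field mat set" where
  "I_plus n = U_grp n <#>\<^bsub>GL n\<^esub> L_plus n"

definition I_minus :: "'a::field \<Rightarrow> 'a \<Rightarrow> 'a mat \<Rightarrow> nat \<Rightarrow> 'a mat set" where
  "I_minus \<nu> \<nu>' b3 n = U_grp n <#>\<^bsub>GL n\<^esub> L_minus \<nu> \<nu>' b3 n"

text \<open>The four families are given by formulas that are linear in the last argument, so the same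
  formulas are their additive extensions to reducible characters.\<close>

definition psi_one :: "nat \<Rightarrow> ('a::field mat \<Rightarrow> complex) \<Rightarrow> 'a mat \<Rightarrow> complex" where
  "psi_one n \<sigma> = infl (GL n) (U_grp n) (L_grp n) \<sigma>"

definition psi_zero ::
  "('a::field \<Rightarrow> complex) \<Rightarrow> nat \<Rightarrow> ('a mat \<Rightarrow> complex) \<Rightarrow> 'a mat \<Rightarrow> complex" where
  "psi_zero \<xi> n \<mu> = ind (GL n) (I_zero n) (P_grp n)
     (\<lambda>g. ext_char (GL n) (U_grp n) (P_tilde n) (lam_zero \<xi> n) g *
          infl (GL n) (U_grp n) (P_tilde n) (\<lambda>h. if h \<in> P_tilde n then \<mu> (mid h) else 0) g)"

definition psi_plus ::
  "('a::field \<Rightarrow> complex) \<Rightarrow> nat \<Rightarrow> ('a mat \<Rightarrow> complex) \<Rightarrow> 'a mat \<Rightarrow> complex" where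
  "psi_plus \<xi> n \<theta> = ind (GL n) (I_plus n) (P_grp n)
     (\<lambda>g. ext_char (GL n) (U_grp n) (L_plus n) (lam_plus \<xi> n) g *
          infl (GL n) (U_grp n) (L_plus n) \<theta> g)"

definition psi_minus ::
  "('a::field \<Rightarrow> complex) \<Rightarrow> 'a \<Rightarrow> 'a \<Rightarrow> 'a mat \<Rightarrow> nat \<Rightarrow> ('a mat \<Rightarrow> complex) \<Rightarrow> 'a mat \<Rightarrow> complex" where
  "psi_minus \<xi> \<nu> \<nu>' b3 n \<theta> = ind (GL n) (I_minus \<nu> \<nu>' b3 n) (P_grp n)
     (\<lambda>g. ext_char (GL n) (U_grp n) (L_minus \<nu> \<nu>' b3 n) (lam_minus \<xi> \<nu>' b3 n) g *
          infl (GL n) (U_grp n) (L_minus \<nu> \<nu>' b3 n) \<theta> g)"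

section \<open>The groups \<open>P_{n-3}\<^sup>\<plusminus>\<close>\<close>

text \<open>The matrices \<open>y\<close> of size \<open>k\<close> with block rows \<open>[b, *, 0, *, *]\<close>, \<open>[0, A, 0, B, *]\<close>,
  \<open>[0, 0, a, 0, 0]\<close>, \<open>[0, C, 0, D, *]\<close>, \<open>[0, 0, 0, 0, 1/b]\<close>, where \<open>[A, B; C, D] \<in> X\<close> has
  determinant \<open>a\<close>.\<close>

definition parabolic_shape :: "nat \<Rightarrow> 'a::field mat set \<Rightarrow> 'a \<Rightarrow> 'a mat set" where
  "parabolic_shape k X a = {y \<in> carrier_mat k k. \<exists>b g. b \<noteq> 0 \<and> g \<in> X \<and> a = det g \<and>
     mid y = cross g a \<and> y $$ (0, 0) = b \<and> y $$ (k - 1, k - 1) = inverse b \<and>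
     (\<forall>i\<in>{1..<k}. y $$ (i, 0) = 0) \<and> (\<forall>j\<in>{0..<k - 1}. y $$ (k - 1, j) = 0) \<and>
     y $$ (0, k div 2) = 0 \<and> y $$ (k div 2, k - 1) = 0}"

definition P_plus :: "nat \<Rightarrow> 'a::field mat set" where
  "P_plus n = (if n = 5 then {mat_diag 5 (\<lambda>i. [1, b, 1, inverse b, 1] ! i) | b. b \<noteq> 0}
     else {s_mat y a | y a. s_mat y a \<in> L_plus n \<and> y \<in> parabolic_shape (n - 2) (GO_plus (n - 5)) a})"

definition P_minus :: "'a::field \<Rightarrow> 'a \<Rightarrow> 'a mat \<Rightarrow> nat \<Rightarrow> 'a mat set" where
  "P_minus \<nu> \<nu>' b3 n = (let b = b_mat \<nu>' b3 (n - 2) in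
     {s_mat (inv\<^bsub>GL (n - 2)\<^esub> b * y * b) a | y a.
        s_mat (inv\<^bsub>GL (n - 2)\<^esub> b * y * b) a \<in> L_minus \<nu> \<nu>' b3 n \<and>
        y \<in> parabolic_shape (n - 2) (GO_minus \<nu> (n - 5)) a})"

text \<open>Inflation of characters of \<open>L_{n-2}\<^sup>\<plusminus>\<close> to \<open>P_{n-3}\<^sup>\<plusminus>\<close>. For \<open>g = s_mat y a\<close>, the block
  \<open>[A, 0, B; 0, a, 0; C, 0, D]\<close> of \<open>y\<close> is \<open>mid y\<close>, \<open>y = mid g\<close>, and \<open>a\<close> is the first entry of \<open>g\<close>.\<close>

definition infl_P_plus :: "nat \<Rightarrow> ('a::field mat \<Rightarrow> complex) \<Rightarrow> 'a mat \<Rightarrow> complex" where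
  "infl_P_plus n \<theta> = (\<lambda>g. if g \<in> P_plus n
     then (if n = 5 then 1 else \<theta> (s_mat (mid (mid g)) (g $$ (0, 0)))) else 0)"

definition infl_P_minus ::
  "'a::field \<Rightarrow> 'a \<Rightarrow> 'a mat \<Rightarrow> nat \<Rightarrow> ('a mat \<Rightarrow> complex) \<Rightarrow> 'a mat \<Rightarrow> complex" where
  "infl_P_minus \<nu> \<nu>' b3 n \<theta> = (\<lambda>g. if g \<in> P_minus \<nu> \<nu>' b3 n then
     (let b = b_mat \<nu>' b3 (n - 2); b' = b_mat \<nu>' b3 (n - 4);
          y = b * mid g * inv\<^bsub>GL (n - 2)\<^esub> b
      in \<theta> (s_mat (inv\<^bsub>GL (n - 4)\<^esub> b' * mid y * b') (g $$ (0, 0)))) else 0)"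

end

theory Submission
  imports Defs "Jordan_Normal_Form.Spectral_Radius"
begin

text \<open>A character of \<open>P\<^sub>n\<close> is evaluated at \<open>g = u(v) s(x, a)\<close> through the coordinates \<open>v\<close>, \<open>x\<close>, \<open>a\<close>, and
  an induced character is an average of a function over the conjugates of \<open>g\<close>. Such an average is not
  affected by conjugating the function or by averaging it over further conjugations. For Types \<open>0\<close>, \<open>+\<close>
  and \<open>-\<close> the complement of \<open>U\<^sub>n\<close> in the inertia group is the stabilizer of a linear functional of \<open>v\<close>.
  Both sides are then averages of nearly the same function, whose support is cut out on the left by
  the vanishing of the last coordinate of \<open>v\<close> and on the right by the vanishing of the functional on
  the unipotent part of \<open>x\<close>. Averaging the one over a root subgroup in \<open>U\<^sub>n\<close> and the other over one in
  \<open>U\<^sub>n\<^sub>-\<^sub>2\<close> makes them equal; no information on the irreducible characters involved is needed. For Type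
  \<open>0\<close> a conjugation by \<open>r\<close> identifies the functional with the next coordinate. For Type \<open>1\<close>, averaging
  over \<open>U\<^sub>n\<close> and over the torus \<open>A\<close> splits the left side into its \<open>0\<close>- and \<open>1\<close>-parts.\<close>

section \<open>Averages over conjugates\<close>

text \<open>Let \<open>a\<close>, \<open>b\<close> be the first entries of \<open>g\<close> and
  \<open>mid g\<close>, and \<open>v\<close>, \<open>w\<close> their unipotent vectors. Conjugation
  by the outer root element with parameter \<open>t\<close> moves the last coordinate of
  \<open>v\<close> by \<open>t * (1 - a / b)\<close> and subtracts
  \<open>a / b * t * \<phi> w\<close> from the argument of \<open>\<xi>\<close>. The inner one moves
  \<open>\<phi> w\<close> by \<open>t * (1 - b / a)\<close> and adds \<open>t\<close> times the last
  coordinate of \<open>v\<close>. If \<open>a\<close> and \<open>b\<close> differ, exactly one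
  \<open>t\<close> meets the support condition on each side and the two arguments agree. If
  \<open>a = b\<close>, the condition is independent of \<open>t\<close>, and orthogonality of
  characters supplies the missing one. For Type \<open>1\<close> the functional is zero. The sum
  over \<open>t\<close> is then \<open>1\<close> where \<open>a\<close> and \<open>b\<close> differ,
  and \<open>q\<close> or \<open>0\<close> where they agree; subtracting \<open>1\<close> leaves a
  sum over the non-trivial characters, supported where \<open>a = b\<close>, that is, on the inertia
  group of \<open>\<lambda>\<^sup>0\<close>. Since \<open>q\<close> may be even, the polar form in
  odd dimension can be degenerate. Nondegeneracy is used only for the even-dimensional forms
  obtained by deleting the middle coordinate.\<close>

text \<open>The size of a matrix is written \<open>S2 k\<close>, \<open>S4 k\<close> or \<open>S6 k\<close>, so that passing to the central block needs no
  truncated subtraction.\<close>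

abbreviation S2 :: "nat \<Rightarrow> nat" where "S2 k \<equiv> Suc (Suc k)"
abbreviation S4 :: "nat \<Rightarrow> nat" where "S4 k \<equiv> Suc (Suc (Suc (Suc k)))"
abbreviation S6 :: "nat \<Rightarrow> nat" where "S6 k \<equiv> Suc (Suc (Suc (Suc (Suc (Suc k)))))"

text \<open>Left unnormalized: \<open>ind\<close> divides by the order of the subgroup one induces
  from, and this order differs between the two sides of each identity, so the constants are compared
  separately.\<close>

definition cavg :: "('g, 'b) monoid_scheme \<Rightarrow> 'g set \<Rightarrow> ('g \<Rightarrow> complex) \<Rightarrow> 'g \<Rightarrow> complex" where
  "cavg G P f g = (\<Sum>x\<in>P. f (inv\<^bsub>G\<^esub> x \<otimes>\<^bsub>G\<^esub> g \<otimes>\<^bsub>G\<^esub> x))"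

text \<open>The subgroup \<open>H\<close> survives only in the support of the averaged function and
  in the divisor. Inductions from unrelated subgroups can thus be compared without double
  cosets.\<close>

lemma ind_eq_cavg:
  "ind G H K \<chi> = (\<lambda>g. if g \<in> K then cavg G K (\<lambda>h. if h \<in> H then \<chi> h else 0) g / of_nat (card H) else 0)"
  unfolding ind_def cavg_def by auto

lemma cavg_add: "cavg G P (\<lambda>g. f g + f' g) g = cavg G P f g + cavg G P f' g"
  unfolding cavg_def by (simp add: sum.distrib)

lemma cavg_cmult: "cavg G P (\<lambda>g. c * f g) g = c * cavg G P f g"
  unfolding cavg_def by (simp add: sum_distrib_left)

context group begin

lemma inv_cancel_left:
  assumes "x \<in> carrier G" "y \<in> carrier G"
  shows "x \<otimes> (inv x \<otimes> y) = y" "inv x \<otimes> (x \<otimes> y) = y"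
  using assms by (simp_all add: m_assoc[symmetric])

lemma conj_cancel:
  assumes "x \<in> carrier G" "h \<in> carrier G"
  shows "x \<otimes> (inv x \<otimes> h \<otimes> x) \<otimes> inv x = h"
  using assms by (simp add: m_assoc inv_cancel_left)

lemma conj_by_conj:
  assumes "s \<in> carrier G" "x \<in> carrier G" "h \<in> carrier G"
  shows "inv s \<otimes> (inv (s \<otimes> x \<otimes> inv s) \<otimes> h \<otimes> (s \<otimes> x \<otimes> inv s)) \<otimes> s
    = inv x \<otimes> (inv s \<otimes> h \<otimes> s) \<otimes> x"
  using assms by (simp add: inv_mult_group m_assoc inv_cancel_left)

lemma cavg_cong:
  assumes "subgroup P G" "g \<in> P" "\<And>h. h \<in> P \<Longrightarrow> f h = f' h"
  shows "cavg G P f g = cavg G P f' g"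
  unfolding cavg_def
  by (rule sum.cong) (use assms in \<open>auto intro!: assms(3) subgroup.m_closed[OF assms(1)] subgroup.m_inv_closed[OF assms(1)]\<close>)

text \<open>Right translation by \<open>inv h\<close> permutes the range of summation.\<close>

lemma cavg_conj:
  assumes P: "subgroup P G" and h: "h \<in> P" and g: "g \<in> P"
  shows "cavg G P (\<lambda>g. f (h \<otimes> g \<otimes> inv h)) g = cavg G P f g"
proof -
  note cl = subgroup.m_closed[OF P] subgroup.m_inv_closed[OF P]
  have c: "x \<in> carrier G" if "x \<in> P" for x using subgroup.subset[OF P] that by auto
  have eq: "h \<otimes> (inv x \<otimes> g \<otimes> x) \<otimes> inv h = inv (x \<otimes> inv h) \<otimes> g \<otimes> (x \<otimes> inv h)" if "x \<in> P" for x
    using c[OF h] c[OF g] c[OF that] by (simp add: inv_mult_group m_assoc)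
  show ?thesis unfolding cavg_def
    by (rule sum.reindex_bij_witness[where j = "\<lambda>x. x \<otimes> inv h" and i = "\<lambda>x. x \<otimes> h"])
       (use h c[OF h] cl c eq in \<open>auto simp: m_assoc\<close>)
qed

text \<open>Every conjugate of \<open>f\<close> has the same average as \<open>f\<close>, so
  averaging \<open>f\<close> beforehand over a family \<open>k\<close> costs only the factor
  \<open>card Y\<close>. Root subgroups, the torus \<open>A\<close> and complements of
  \<open>U_n\<close> all enter as such families.\<close>

lemma cavg_average:
  assumes P: "subgroup P G" and g: "g \<in> P" and k: "\<And>y. y \<in> Y \<Longrightarrow> k y \<in> P"
    and eq: "\<And>h. h \<in> P \<Longrightarrow> (\<Sum>y\<in>Y. f (k y \<otimes> h \<otimes> inv (k y))) = f' h"
  shows "cavg G P f' g = of_nat (card Y) * cavg G P f g"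
proof -
  have "cavg G P f' g = cavg G P (\<lambda>h. \<Sum>y\<in>Y. f (k y \<otimes> h \<otimes> inv (k y))) g"
    by (rule cavg_cong[OF P g]) (simp add: eq)
  also have "\<dots> = (\<Sum>y\<in>Y. cavg G P (\<lambda>h. f (k y \<otimes> h \<otimes> inv (k y))) g)"
    unfolding cavg_def by (rule sum.swap)
  also have "\<dots> = (\<Sum>y\<in>Y. cavg G P f g)"
    by (rule sum.cong) (simp_all add: cavg_conj[OF P k g])
  finally show ?thesis by simp
qed

lemma restricted_hom_inv:
  assumes K: "subgroup K G" and G': "group G'" and f: "f \<in> hom (G\<lparr>carrier := K\<rparr>) G'" and k: "k \<in> K"
  shows "f (inv k) = inv\<^bsub>G'\<^esub> f k"
proof -
  have inv_consistent: "inv\<^bsub>G\<lparr>carrier := K\<rparr>\<^esub> k = inv k" by (rule m_inv_consistent[OF K k])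
  interpret group_hom "G\<lparr>carrier := K\<rparr>" G' f
    by (intro group_hom.intro group_hom_axioms.intro subgroup_imp_group K G' f)
  show ?thesis using hom_inv[of k] k inv_consistent by simp
qed

text \<open>A form of transitivity of induction. Since the retraction \<open>l\<close> fixes
  \<open>C\<close>, conjugating \<open>g\<close> by \<open>c\<close> conjugates \<open>l g\<close>
  by \<open>c\<close> and leaves \<open>\<Phi>\<close> unchanged. The sum over \<open>C\<close> that
  defines the inner \<open>ind\<close> is therefore a sum over conjugates of \<open>g\<close>, and
  the outer average absorbs it.\<close>

lemma cavg_infl_ind:
  assumes P: "subgroup P G" and g: "g \<in> P" and C: "subgroup C G" "C \<subseteq> P"
    and C0: "C0 \<subseteq> C"
    and l: "l \<in> hom (G\<lparr>carrier := P\<rparr>) G" "\<And>c. c \<in> C \<Longrightarrow> l c = c"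
    and \<Phi>: "\<And>c g. c \<in> C \<Longrightarrow> g \<in> P \<Longrightarrow> l g \<in> C \<Longrightarrow> \<Phi> (inv c \<otimes> g \<otimes> c) = \<Phi> g"
  shows "cavg G P (\<lambda>g. if l g \<in> C then \<Phi> g * ind G C0 C \<tau> (l g) else 0) g
    = of_nat (card C) / of_nat (card C0) * cavg G P (\<lambda>g. if l g \<in> C0 then \<Phi> g * \<tau> (l g) else 0) g"
proof -
  note cl = subgroup.m_closed[OF P] subgroup.m_inv_closed[OF P]
  have cP: "x \<in> carrier G" if "x \<in> P" for x using subgroup.subset[OF P] that by auto
  let ?f = "\<lambda>g. if l g \<in> C0 then \<Phi> g * \<tau> (l g) else 0"
  let ?f' = "\<lambda>g. of_nat (card C0) * (if l g \<in> C then \<Phi> g * ind G C0 C \<tau> (l g) else 0)"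
  let ?f'' = "\<lambda>g. if l g \<in> C then \<Phi> g * (\<Sum>x\<in>C. if inv x \<otimes> l g \<otimes> x \<in> C0 then \<tau> (inv x \<otimes> l g \<otimes> x) else 0) else 0"
  have lc: "l (inv c \<otimes> h \<otimes> c) = inv c \<otimes> l h \<otimes> c" if "c \<in> C" "h \<in> P" for c h
  proof -
    have "c \<in> P" "inv c \<in> P" "inv c \<in> C" using that C cl subgroup.m_inv_closed[OF C(1)] by auto
    then show ?thesis using that l(2) cl hom_mult[OF l(1)] by (auto)
  qed
  have lmem: "l h \<in> carrier G" if "h \<in> P" for h using hom_in_carrier[OF l(1)] that by auto
  have "(\<Sum>c\<in>C. ?f (inv c \<otimes> h \<otimes> inv (inv c))) = ?f'' h" if h: "h \<in> P" for h
  proof -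
    have "(\<Sum>c\<in>C. ?f (inv c \<otimes> h \<otimes> inv (inv c))) =
       (\<Sum>c\<in>C. if inv c \<otimes> l h \<otimes> c \<in> C0 then \<Phi> (inv c \<otimes> h \<otimes> c) * \<tau> (inv c \<otimes> l h \<otimes> c) else 0)"
      using C(2) cP by (intro sum.cong) (auto simp: lc h)
    also have "\<dots> = ?f'' h"
    proof (cases "l h \<in> C")
      case True
      then show ?thesis by (auto simp: sum_distrib_left \<Phi>[OF _ h True] intro!: sum.cong)
    next
      case False
      \<comment> \<open>\<open>C0\<close> lies in \<open>C\<close>, so an element outside
        \<open>C\<close> has no \<open>C\<close>-conjugate in \<open>C0\<close>, and both sides
        vanish.\<close>
      have "inv c \<otimes> l h \<otimes> c \<notin> C0" if "c \<in> C" for c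
      proof
        assume "inv c \<otimes> l h \<otimes> c \<in> C0"
        then have "c \<otimes> (inv c \<otimes> l h \<otimes> c) \<otimes> inv c \<in> C"
          using C0 that subgroup.m_closed[OF C(1)] subgroup.m_inv_closed[OF C(1)] by blast
        moreover have "c \<otimes> (inv c \<otimes> l h \<otimes> c) \<otimes> inv c = l h"
          using that C(2) cP lmem[OF h] by (intro conj_cancel) auto
        ultimately show False using False by simp
      qed
      then show ?thesis using False by (simp add: sum.neutral)
    qed
    finally show ?thesis .
  qed
  note av = cavg_average[where k = "\<lambda>c. inv c" and Y = C, OF P g _ this]
  have 1: "cavg G P ?f'' g = of_nat (card C) * cavg G P ?f g"
    by (rule av) (use C cl in auto)
  have "(\<lambda>g. if l g \<in> C then \<Phi> g * ind G C0 C \<tau> (l g) else 0) = (\<lambda>g. (1 / of_nat (card C0)) * ?f'' g)"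
    unfolding ind_def by (auto simp: fun_eq_iff)
  then have "cavg G P (\<lambda>g. if l g \<in> C then \<Phi> g * ind G C0 C \<tau> (l g) else 0) g = (1 / of_nat (card C0)) * cavg G P ?f'' g"
    by (simp only: cavg_cmult)
  then show ?thesis unfolding 1 by simp
qed

text \<open>The same absorption for an induced character that is pulled back along
  \<open>\<mu>\<close> after conjugation by \<open>s\<close>. The section \<open>e\<close> lifts
  each \<open>x\<close> in \<open>X\<close>, and conjugation of \<open>g\<close> by
  \<open>s \<otimes> e x \<otimes> inv s\<close> becomes conjugation by \<open>x\<close> of the
  pulled back argument.\<close>

lemma cavg_conj_infl_ind:
  assumes P: "subgroup P G" and g: "g \<in> P" and K: "subgroup K G" "K \<subseteq> P"
    and s: "s \<in> carrier G" "\<And>k. k \<in> carrier G \<Longrightarrow> inv s \<otimes> k \<otimes> s \<in> K \<longleftrightarrow> k \<in> K"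
    and G': "group G'" and X: "subgroup X G'"
    and \<mu>: "\<mu> \<in> hom (G\<lparr>carrier := K\<rparr>) G'" "\<And>k. k \<in> K \<Longrightarrow> \<mu> k \<in> X"
    and e: "\<And>x. x \<in> X \<Longrightarrow> e x \<in> K" "\<And>x. x \<in> X \<Longrightarrow> \<mu> (e x) = x"
  shows "cavg G P (\<lambda>g. if g \<in> K then ind G' I X \<eta> (\<mu> (inv s \<otimes> g \<otimes> s)) else 0) g
    = of_nat (card X) / of_nat (card I) *
      cavg G P (\<lambda>g. if g \<in> K \<and> \<mu> (inv s \<otimes> g \<otimes> s) \<in> I then \<eta> (\<mu> (inv s \<otimes> g \<otimes> s)) else 0) g"
proof -
  note cl = subgroup.m_closed[OF P] subgroup.m_inv_closed[OF P]
  note cK = subgroup.m_closed[OF K(1)] subgroup.m_inv_closed[OF K(1)]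
  have cP: "x \<in> carrier G" if "x \<in> P" for x using subgroup.subset[OF P] that by auto
  have cKG: "x \<in> carrier G" if "x \<in> K" for x using cP K(2) that by auto
  let ?f = "\<lambda>g. if g \<in> K \<and> \<mu> (inv s \<otimes> g \<otimes> s) \<in> I then \<eta> (\<mu> (inv s \<otimes> g \<otimes> s)) else 0"
  let ?f'' = "\<lambda>g. if g \<in> K then (\<Sum>x\<in>X. let y = inv\<^bsub>G'\<^esub> x \<otimes>\<^bsub>G'\<^esub> \<mu> (inv s \<otimes> g \<otimes> s) \<otimes>\<^bsub>G'\<^esub> x in
      if y \<in> I then \<eta> y else 0) else 0"
  let ?k = "\<lambda>x. inv (s \<otimes> e x \<otimes> inv s)"
  have kK: "s \<otimes> e x \<otimes> inv s \<in> K" if "x \<in> X" for x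
  proof -
    have "inv s \<otimes> (s \<otimes> e x \<otimes> inv s) \<otimes> s = e x" using s(1) cKG[OF e(1)[OF that]]
      by (simp add: m_assoc inv_cancel_left)
    then show ?thesis using s(2)[of "s \<otimes> e x \<otimes> inv s"] e(1)[OF that] s(1) cKG[OF e(1)[OF that]] by auto
  qed
  have 1: "(\<Sum>x\<in>X. ?f (?k x \<otimes> h \<otimes> inv (?k x))) = ?f'' h" if h: "h \<in> P" for h
  proof -
    have *: "?f (?k x \<otimes> h \<otimes> inv (?k x)) = (if h \<in> K then
      let y = inv\<^bsub>G'\<^esub> x \<otimes>\<^bsub>G'\<^esub> \<mu> (inv s \<otimes> h \<otimes> s) \<otimes>\<^bsub>G'\<^esub> x in if y \<in> I then \<eta> y else 0 else 0)" if x: "x \<in> X" for x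
    proof -
      let ?c = "s \<otimes> e x \<otimes> inv s"
      have c: "?c \<in> K" "inv ?c \<in> K" "inv (inv ?c) = ?c" using kK[OF x] cK cKG by auto
      have iff: "inv ?c \<otimes> h \<otimes> ?c \<in> K \<longleftrightarrow> h \<in> K"
      proof
        assume a: "inv ?c \<otimes> h \<otimes> ?c \<in> K"
        have "?c \<otimes> (inv ?c \<otimes> h \<otimes> ?c) \<otimes> inv ?c \<in> K" by (intro cK c a)
        then show "h \<in> K" unfolding conj_cancel[OF cKG[OF c(1)] cP[OF h]] .
      qed (intro cK c; assumption)
      have mu: "\<mu> (inv s \<otimes> (inv ?c \<otimes> h \<otimes> ?c) \<otimes> s) = inv\<^bsub>G'\<^esub> x \<otimes>\<^bsub>G'\<^esub> \<mu> (inv s \<otimes> h \<otimes> s) \<otimes>\<^bsub>G'\<^esub> x" if hK: "h \<in> K"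
      proof -
        have ex: "e x \<in> K" "e x \<in> carrier G" using e(1)[OF x] cKG by auto
        have hs: "inv s \<otimes> h \<otimes> s \<in> K" using s(2) hK cKG by auto
        have "inv s \<otimes> (inv ?c \<otimes> h \<otimes> ?c) \<otimes> s = inv (e x) \<otimes> (inv s \<otimes> h \<otimes> s) \<otimes> e x"
          by (rule conj_by_conj[OF s(1) ex(2) cKG[OF hK]])
        moreover have "\<mu> (inv (e x) \<otimes> (inv s \<otimes> h \<otimes> s) \<otimes> e x) = \<mu> (inv (e x)) \<otimes>\<^bsub>G'\<^esub> \<mu> (inv s \<otimes> h \<otimes> s) \<otimes>\<^bsub>G'\<^esub> \<mu> (e x)"
          using hom_mult[OF \<mu>(1)] hs ex cK by auto
        ultimately show ?thesis using restricted_hom_inv[OF K(1) G' \<mu>(1) ex(1)] e(2)[OF x] by simp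
      qed
      show ?thesis unfolding c(3) iff by (cases "h \<in> K") (simp_all add: mu Let_def)
    qed
    show ?thesis by (simp add: * cong: sum.cong)
  qed
  have 2: "cavg G P ?f'' g = of_nat (card X) * cavg G P ?f g"
    by (rule cavg_average[where k = ?k, OF P g _ 1]) (rule subsetD[OF K(2)], rule cK(2), erule kK)
  have 3: "cavg G P (\<lambda>g. if g \<in> K then ind G' I X \<eta> (\<mu> (inv s \<otimes> g \<otimes> s)) else 0) g
     = cavg G P (\<lambda>g. (1 / of_nat (card I)) * ?f'' g) g"
  proof (rule cavg_cong[OF P g])
    fix h assume h: "h \<in> P"
    have "\<mu> (inv s \<otimes> h \<otimes> s) \<in> X" if "h \<in> K" using s(2) that cKG \<mu>(2) by auto
    then show "(if h \<in> K then ind G' I X \<eta> (\<mu> (inv s \<otimes> h \<otimes> s)) else 0) = (1 / of_nat (card I)) * ?f'' h"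
      unfolding ind_def Let_def by auto
  qed
  show ?thesis unfolding 3 cavg_cmult 2 by simp
qed

text \<open>Induction is carried along an isomorphism. It is applied to \<open>P_tilde\<close>,
  which is a copy of the parabolic subgroup of the next smaller size.\<close>

lemma ind_transport:
  assumes K: "subgroup K G" and G': "group G'" and f: "f \<in> hom (G\<lparr>carrier := K\<rparr>) G'"
    and b: "bij_betw f K K'" and H: "H \<subseteq> K" "f ` H = H'" and g: "g \<in> K"
  shows "ind G' H' K' \<chi> (f g) = ind G H K (\<lambda>x. \<chi> (f x)) g"
proof -
  note cK = subgroup.m_closed[OF K] subgroup.m_inv_closed[OF K]
  have fH: "f x \<in> H' \<longleftrightarrow> x \<in> H" if "x \<in> K" for x
    using that H b unfolding bij_betw_def inj_on_def by blast
  have cd: "card H' = card H" using H b by (metis bij_betw_def card_image inj_on_subset)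
  have fg: "f (inv x \<otimes> g \<otimes> x) = inv\<^bsub>G'\<^esub> f x \<otimes>\<^bsub>G'\<^esub> f g \<otimes>\<^bsub>G'\<^esub> f x" if "x \<in> K" for x
    using that g cK hom_mult[OF f] restricted_hom_inv[OF K G' f] by auto
  have K'g: "f g \<in> K'" using b g by (auto simp: bij_betw_def)
  have "(\<Sum>x\<in>K'. if inv\<^bsub>G'\<^esub> x \<otimes>\<^bsub>G'\<^esub> f g \<otimes>\<^bsub>G'\<^esub> x \<in> H' then \<chi> (inv\<^bsub>G'\<^esub> x \<otimes>\<^bsub>G'\<^esub> f g \<otimes>\<^bsub>G'\<^esub> x) else 0)
     = (\<Sum>x\<in>K. if f (inv x \<otimes> g \<otimes> x) \<in> H' then \<chi> (f (inv x \<otimes> g \<otimes> x)) else 0)"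
    unfolding sum.reindex_bij_betw[OF b, symmetric] by (rule sum.cong) (auto simp: fg)
  also have "\<dots> = (\<Sum>x\<in>K. if inv x \<otimes> g \<otimes> x \<in> H then \<chi> (f (inv x \<otimes> g \<otimes> x)) else 0)"
    by (rule sum.cong) (auto simp: fH g cK)
  finally show ?thesis unfolding ind_def using K'g g cd by simp
qed

end

section \<open>Representations and characters\<close>

lemma GL_simps [simp]:
  "monoid.mult (GL n :: 'a::field mat monoid) = (*)" "one (GL n :: 'a mat monoid) = 1\<^sub>m n"
  by (simp_all add: GL_def units_of_def ring_mat_simps)

lemma GL_carrier: "A \<in> carrier (GL n :: 'a::field mat monoid) \<longleftrightarrow> A \<in> carrier_mat n n \<and> det A \<noteq> 0"
  unfolding GL_def units_of_def
  using unit_imp_det_non_zero[of A n "()"] det_non_zero_imp_unit[of A n "()"]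
  by (auto simp: Units_def ring_mat_simps)

lemma group_GL [simp, intro]: "group (GL n :: 'a::field mat monoid)"
  unfolding GL_def
  by (rule monoid.units_group) (simp add: ring.is_monoid ring_mat)

lemma subspaceI:
  assumes "W \<subseteq> carrier_vec d" "0\<^sub>v d \<in> W" "\<And>v w. v \<in> W \<Longrightarrow> w \<in> W \<Longrightarrow> v + w \<in> W"
    "\<And>c v. v \<in> W \<Longrightarrow> c \<cdot>\<^sub>v v \<in> W"
  shows "VectorSpace.subspace class_ring W (module_vec TYPE(complex) d)"
proof -
  interpret vec_space "TYPE(complex)" d .
  show ?thesis
    by (intro VectorSpace.subspace.intro vectorspace_axioms submodule.intro module_axioms)
       (use assms in \<open>auto simp: module_vec_simps\<close>)
qed

lemma repD:
  assumes "representation G d \<rho>" "x \<in> carrier G"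
  shows "\<rho> x \<in> carrier_mat d d" "det (\<rho> x) \<noteq> 0" "\<rho> x \<in> carrier (GL d)"
  using assms hom_in_carrier[of \<rho> G "GL d" x] by (auto simp: representation_def GL_carrier)

lemma rep_mult:
  assumes "representation G d \<rho>" "x \<in> carrier G" "y \<in> carrier G"
  shows "\<rho> (x \<otimes>\<^bsub>G\<^esub> y) = \<rho> x * \<rho> y"
  using assms by (auto simp: representation_def hom_def)

lemma rep_one:
  assumes "representation G d \<rho>" "group G"
  shows "\<rho> \<one>\<^bsub>G\<^esub> = 1\<^sub>m d"
proof -
  interpret group_hom G "GL d" \<rho> using assms
    by (intro group_hom.intro group_hom_axioms.intro) (auto simp: representation_def)
  show ?thesis using hom_one by simp
qed

lemma irreducible_repD:
  assumes "irreducible_rep G d \<rho>" "VectorSpace.subspace class_ring W (module_vec TYPE(complex) d)"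
    "\<And>g w. g \<in> carrier G \<Longrightarrow> w \<in> W \<Longrightarrow> \<rho> g *\<^sub>v w \<in> W"
  shows "W = {0\<^sub>v d} \<or> W = carrier_vec d"
  using assms unfolding irreducible_rep_def by blast

text \<open>Surjectivity is demanded only for the image of \<open>\<rho>\<close>. In
  \<open>char_LK_Irr\<close> the map reaches just a Levi complement, and this suffices because
  \<open>\<rho>\<close> factors through it.\<close>

lemma irreducible_rep_pullback_image:
  assumes "irreducible_rep G' d \<rho>" "f \<in> hom G G'" "\<And>y. y \<in> carrier G' \<Longrightarrow> \<exists>x\<in>carrier G. \<rho> y = \<rho> (f x)"
  shows "irreducible_rep G d (\<lambda>g. \<rho> (f g))"
  unfolding irreducible_rep_def
proof (intro conjI allI impI)
  show "representation G d (\<lambda>g. \<rho> (f g))"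
    using assms(1,2) by (auto simp: irreducible_rep_def representation_def hom_def Pi_def)
  show "d > 0" using assms(1) by (simp add: irreducible_rep_def)
next
  fix W assume W: "VectorSpace.subspace class_ring W (module_vec TYPE(complex) d) \<and>
     (\<forall>g\<in>carrier G. \<forall>w\<in>W. \<rho> (f g) *\<^sub>v w \<in> W)"
  show "W = {0\<^sub>v d} \<or> W = carrier_vec d"
  proof (rule irreducible_repD[OF assms(1)])
    show "VectorSpace.subspace class_ring W (module_vec TYPE(complex) d)" using W by blast
    show "\<rho> y *\<^sub>v w \<in> W" if "y \<in> carrier G'" "w \<in> W" for y w using assms(3)[OF that(1)] that(2) W by auto
  qed
qed

lemma irreducible_rep_pullback:
  assumes "irreducible_rep G' d \<rho>" "f \<in> hom G G'" "carrier G' \<subseteq> f ` carrier G"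
  shows "irreducible_rep G d (\<lambda>g. \<rho> (f g))"
  by (rule irreducible_rep_pullback_image[OF assms(1,2)]) (use assms(3) in blast)

lemma Irr_pullback:
  assumes "\<chi> \<in> Irr G'" "f \<in> hom G G'" "carrier G' \<subseteq> f ` carrier G"
  shows "(\<lambda>g. if g \<in> carrier G then \<chi> (f g) else 0) \<in> Irr G"
proof -
  obtain \<rho> d where \<rho>: "\<chi> = rep_char G' \<rho>" "irreducible_rep G' d \<rho>"
    using assms(1) by (auto simp: Irr_def)
  have "(\<lambda>g. if g \<in> carrier G then \<chi> (f g) else 0) = rep_char G (\<lambda>g. \<rho> (f g))"
    using hom_in_carrier[OF assms(2)] by (auto simp: \<rho>(1) rep_char_def fun_eq_iff)
  then show ?thesis using irreducible_rep_pullback[OF \<rho>(2) assms(2,3)] by (auto simp: Irr_def)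
qed

lemma characters_pullback:
  assumes "\<chi> \<in> characters G'" "f \<in> hom G G'"
  shows "(\<lambda>g. if g \<in> carrier G then \<chi> (f g) else 0) \<in> characters G"
proof -
  obtain \<rho> d where \<rho>: "\<chi> = rep_char G' \<rho>" "representation G' d \<rho>"
    using assms(1) by (auto simp: characters_def)
  have "(\<lambda>g. if g \<in> carrier G then \<chi> (f g) else 0) = rep_char G (\<lambda>g. \<rho> (f g))"
    using hom_in_carrier[OF assms(2)] by (auto simp: \<rho>(1) rep_char_def fun_eq_iff)
  moreover have "representation G d (\<lambda>g. \<rho> (f g))"
    using \<rho>(2) assms(2) by (auto simp: representation_def hom_def Pi_def)
  ultimately show ?thesis by (auto simp: characters_def)
qed

lemma Irr_characters: "\<chi> \<in> Irr G \<Longrightarrow> \<chi> \<in> characters G"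
  by (auto simp: Irr_def characters_def irreducible_rep_def)

lemma Irr_zero: "\<chi> \<in> Irr G \<Longrightarrow> g \<notin> carrier G \<Longrightarrow> \<chi> g = 0"
  by (auto simp: Irr_def rep_char_def)

text \<open>By Schur's lemma an irreducible representation of an abelian group consists of scalars.\<close>

lemma Irr_abelian_mult:
  fixes G (structure)
  assumes G: "comm_group G" and \<chi>: "\<chi> \<in> Irr G"
  shows "x \<in> carrier G \<Longrightarrow> y \<in> carrier G \<Longrightarrow> \<chi> (x \<otimes>\<^bsub>G\<^esub> y) = \<chi> x * \<chi> y" "\<chi> \<one>\<^bsub>G\<^esub> = 1"
proof -
  interpret comm_group G by fact
  obtain \<rho> d where \<rho>: "\<chi> = rep_char G \<rho>" "irreducible_rep G d \<rho>"
    using \<chi> by (auto simp: Irr_def)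
  have rep: "representation G d \<rho>" and d: "d > 0" using \<rho>(2) by (auto simp: irreducible_rep_def)
  have scalar: "\<exists>c. \<forall>v\<in>carrier_vec d. \<rho> x *\<^sub>v v = c \<cdot>\<^sub>v v" if x: "x \<in> carrier G" for x
  proof -
    note rx = repD(1)[OF rep x]
    obtain c w where w: "eigenvector (\<rho> x) w c"
      using spectrum_non_empty[OF rx d] by (auto simp: spectrum_def eigenvalue_def)
    \<comment> \<open>An eigenspace of \<open>\<rho> x\<close>. It is invariant because the group is
      commutative, hence it is the whole space.\<close>
    let ?W = "{v \<in> carrier_vec d. \<rho> x *\<^sub>v v = c \<cdot>\<^sub>v v}"
    have "?W = {0\<^sub>v d} \<or> ?W = carrier_vec d"
    proof (rule irreducible_repD[OF \<rho>(2) subspaceI])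
      show "0\<^sub>v d \<in> ?W" using rx by auto
      show "v + w \<in> ?W" if "v \<in> ?W" "w \<in> ?W" for v w
        using that rx by (auto simp: mult_add_distrib_mat_vec[OF rx] smult_add_distrib_vec)
      show "k \<cdot>\<^sub>v v \<in> ?W" if "v \<in> ?W" for k v
        using that rx by (auto simp: mult_mat_vec[OF rx] smult_smult_assoc mult.commute)
      show "\<rho> g *\<^sub>v v \<in> ?W" if g: "g \<in> carrier G" and v: "v \<in> ?W" for g v
      proof -
        note rg = repD(1)[OF rep g]
        have "\<rho> x *\<^sub>v (\<rho> g *\<^sub>v v) = \<rho> g *\<^sub>v (\<rho> x *\<^sub>v v)"
          using v rx rg rep_mult[OF rep x g] rep_mult[OF rep g x] m_comm[OF x g]
          by (metis (no_types, lifting) assoc_mult_mat_vec mem_Collect_eq)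
        then show ?thesis using v rg by (auto simp: mult_mat_vec[OF rg])
      qed
    qed auto
    moreover have "w \<in> ?W" "w \<noteq> 0\<^sub>v d" using w rx by (auto simp: eigenvector_def)
    ultimately show ?thesis by blast
  qed
  have d1: "d = 1"
  proof (rule ccontr)
    assume "d \<noteq> 1"
    \<comment> \<open>As every \<open>\<rho> g\<close> is scalar, every line is invariant; in
      dimension greater than \<open>1\<close> this contradicts irreducibility.\<close>
    let ?W = "{c \<cdot>\<^sub>v unit_vec d 0 | c. True} :: complex vec set"
    have "?W = {0\<^sub>v d} \<or> ?W = carrier_vec d"
    proof (rule irreducible_repD[OF \<rho>(2) subspaceI])
      show "0\<^sub>v d \<in> ?W" by (auto intro!: exI[of _ 0])
      show "v + w \<in> ?W" if "v \<in> ?W" "w \<in> ?W" for v w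
        using that by (auto simp: add_smult_distrib_vec[symmetric])
      show "k \<cdot>\<^sub>v v \<in> ?W" if "v \<in> ?W" for k v
        using that by (auto simp: smult_smult_assoc)
      show "\<rho> g *\<^sub>v v \<in> ?W" if g: "g \<in> carrier G" and v: "v \<in> ?W" for g v
        using scalar[OF g] v by (fastforce simp: smult_smult_assoc)
    qed auto
    moreover have "unit_vec d 0 \<in> ?W" by (auto intro!: exI[of _ 1])
    moreover have "unit_vec d 0 \<noteq> (0\<^sub>v d :: complex vec)" using d by simp
    ultimately have "unit_vec d 1 \<in> ?W" by auto
    then obtain c where "unit_vec d 1 = c \<cdot>\<^sub>v (unit_vec d 0 :: complex vec)" by auto
    then have "unit_vec d 1 $ 1 = (c \<cdot>\<^sub>v (unit_vec d 0 :: complex vec)) $ 1" by simp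
    then show False using d \<open>d \<noteq> 1\<close> by simp
  qed
  have ch: "\<chi> x = \<rho> x $$ (0, 0)" if "x \<in> carrier G" for x
    using that repD(1)[OF rep that] d1 by (simp add: \<rho>(1) rep_char_def tr_def)
  show "\<chi> (x \<otimes> y) = \<chi> x * \<chi> y" if x: "x \<in> carrier G" and y: "y \<in> carrier G"
    using repD(1)[OF rep x] repD(1)[OF rep y] d1
    by (simp add: ch x y rep_mult[OF rep x y] scalar_prod_def)
  show "\<chi> \<one> = 1" by (simp add: ch rep_one[OF rep] d1 is_group)
qed

text \<open>The fixed space of \<open>N\<close> is invariant under \<open>X\<close>, and the average of \<open>\<rho>\<close> over \<open>N\<close> maps
  into it; this average has trace \<open>\<chi> 1 \<noteq> 0\<close>.\<close>

lemma normal_in_ker_char: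
  fixes G (structure)
  assumes G: "group G" and \<rho>: "irreducible_rep G d \<rho>" and N: "subgroup N G" "finite N"
    and normal: "\<And>x u. x \<in> carrier G \<Longrightarrow> u \<in> N \<Longrightarrow> inv x \<otimes> u \<otimes> x \<in> N"
    and ker: "N \<subseteq> ker_char G (rep_char G \<rho>)" and u: "u \<in> N"
  shows "\<rho> u = 1\<^sub>m d"
proof -
  interpret group G by fact
  have rep: "representation G d \<rho>" and d: "d > 0" using \<rho> by (auto simp: irreducible_rep_def)
  have NG: "u \<in> carrier G" if "u \<in> N" for u using that subgroup.subset[OF N(1)] by auto
  note rN = repD(1)[OF rep NG]
  let ?W = "{v \<in> carrier_vec d. \<forall>u\<in>N. \<rho> u *\<^sub>v v = v}"
  have "?W = {0\<^sub>v d} \<or> ?W = carrier_vec d"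
  proof (rule irreducible_repD[OF \<rho> subspaceI])
    have "\<rho> u *\<^sub>v 0\<^sub>v d = 0\<^sub>v d" if "u \<in> N" for u using rN[OF that] by auto
    then show "0\<^sub>v d \<in> ?W" by auto
    show "v + w \<in> ?W" if "v \<in> ?W" "w \<in> ?W" for v w
      using that by (auto simp: mult_add_distrib_mat_vec[OF rN])
    show "k \<cdot>\<^sub>v v \<in> ?W" if "v \<in> ?W" for k v
      using that by (auto simp: mult_mat_vec[OF rN])
    show "\<rho> x *\<^sub>v v \<in> ?W" if x: "x \<in> carrier G" and v: "v \<in> ?W" for x v
    proof -
      note rx = repD(1)[OF rep x]
      have "\<rho> u *\<^sub>v (\<rho> x *\<^sub>v v) = \<rho> x *\<^sub>v v" if u: "u \<in> N" for u
      proof -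
        let ?u = "inv x \<otimes> u \<otimes> x"
        have u': "?u \<in> N" by (rule normal[OF x u])
        have "u \<otimes> x = x \<otimes> ?u" using x NG[OF u] by (simp add: m_assoc inv_cancel_left)
        then have "\<rho> u * \<rho> x = \<rho> x * \<rho> ?u"
          using rep_mult[OF rep NG[OF u] x] rep_mult[OF rep x NG[OF u']] by simp
        then have "\<rho> u *\<^sub>v (\<rho> x *\<^sub>v v) = \<rho> x *\<^sub>v (\<rho> ?u *\<^sub>v v)"
          using assoc_mult_mat_vec[OF rN[OF u] rx, of v] assoc_mult_mat_vec[OF rx rN[OF u'], of v] v by simp
        then show ?thesis using v u' by simp
      qed
      then show ?thesis using v rx by auto
    qed
  qed auto
  moreover have "?W \<noteq> {0\<^sub>v d}"
  proof
    assume W0: "?W = {0\<^sub>v d}"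
    \<comment> \<open>\<open>w j\<close> is column \<open>j\<close> of the sum of
      \<open>\<rho>\<close> over \<open>N\<close>. Left translation by an element of
      \<open>N\<close> permutes the summands, so the column is fixed by \<open>N\<close>.\<close>
    define w where "w j = vec d (\<lambda>i. \<Sum>u\<in>N. \<rho> u $$ (i, j))" for j
    have "w j \<in> ?W" if j: "j < d" for j
    proof -
      have "\<rho> u *\<^sub>v w j = w j" if u: "u \<in> N" for u
      proof (rule eq_vecI)
        fix i assume "i < dim_vec (w j)"
        then have i: "i < d" by (simp add: w_def)
        have "(\<rho> u *\<^sub>v w j) $ i = (\<Sum>k\<in>{0..<d}. \<Sum>u'\<in>N. \<rho> u $$ (i, k) * \<rho> u' $$ (k, j))"
          using rN[OF u] i by (simp add: w_def scalar_prod_def sum_distrib_left)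
        also have "\<dots> = (\<Sum>u'\<in>N. \<Sum>k\<in>{0..<d}. \<rho> u $$ (i, k) * \<rho> u' $$ (k, j))" by (rule sum.swap)
        also have "\<dots> = (\<Sum>u'\<in>N. \<rho> (u \<otimes> u') $$ (i, j))"
        proof (rule sum.cong)
          fix u' assume u': "u' \<in> N"
          show "(\<Sum>k\<in>{0..<d}. \<rho> u $$ (i, k) * \<rho> u' $$ (k, j)) = \<rho> (u \<otimes> u') $$ (i, j)"
            using rN[OF u] rN[OF u'] i j by (simp add: rep_mult[OF rep NG[OF u] NG[OF u']] scalar_prod_def)
        qed simp
        also have "\<dots> = (\<Sum>u'\<in>N. \<rho> u' $$ (i, j))"
          by (rule sum.reindex_bij_witness[where i = "\<lambda>x. inv u \<otimes> x" and j = "\<lambda>x. u \<otimes> x"])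
             (use u NG subgroup.m_closed[OF N(1)] subgroup.m_inv_closed[OF N(1)] in \<open>auto simp: inv_cancel_left\<close>)
        finally show "(\<rho> u *\<^sub>v w j) $ i = w j $ i" using i by (simp add: w_def)
      qed (use rN[OF u] in \<open>simp add: w_def\<close>)
      then show ?thesis by (simp add: w_def)
    qed
    then have "w j $ j = 0" if "j < d" for j using W0 that by (metis (no_types, lifting) index_zero_vec(1) singletonD)
    then have "(\<Sum>j<d. w j $ j) = 0" by simp
    moreover have "(\<Sum>j<d. w j $ j) = (\<Sum>u\<in>N. tr (\<rho> u))"
    proof -
      have "(\<Sum>j<d. w j $ j) = (\<Sum>j<d. \<Sum>u\<in>N. \<rho> u $$ (j, j))" by (simp add: w_def)
      also have "\<dots> = (\<Sum>u\<in>N. \<Sum>j<d. \<rho> u $$ (j, j))" by (rule sum.swap)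
      also have "\<dots> = (\<Sum>u\<in>N. tr (\<rho> u))"
        by (rule sum.cong) (use rN in \<open>auto simp: tr_def\<close>)
      finally show ?thesis .
    qed
    moreover have "tr (\<rho> u) = of_nat d" if "u \<in> N" for u
    proof -
      have "rep_char G \<rho> u = rep_char G \<rho> \<one>" using ker that by (auto simp: ker_char_def)
      then show ?thesis using NG[OF that] by (simp add: rep_char_def rep_one[OF rep] is_group tr_def)
    qed
    \<comment> \<open>The trace of the sum over \<open>N\<close> is \<open>card N * d\<close>,
      because \<open>N\<close> lies in the kernel of the character, and it is \<open>0\<close> if no
      nonzero vector is fixed.\<close>
    ultimately have "of_nat (card N * d) = (0::complex)" by simp
    then show False using N d subgroup.one_closed[OF N(1)] by (auto simp del: of_nat_mult)
  qed
  ultimately have W: "\<rho> u *\<^sub>v v = v" if "v \<in> carrier_vec d" for v using u that by blast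
  show ?thesis
  proof (rule eq_matI)
    fix i j assume ij: "i < dim_row (1\<^sub>m d)" "j < dim_col (1\<^sub>m d)"
    then have "\<rho> u $$ (i, j) = (\<rho> u *\<^sub>v unit_vec d j) $ i" using rN[OF u] by (simp)
    then show "\<rho> u $$ (i, j) = 1\<^sub>m d $$ (i, j)" using ij by (simp add: W)
  qed (use rN[OF u] in auto)
qed

section \<open>Block triangular matrices and quadratic forms\<close>

lemma sum_border:
  "(\<Sum>i<Suc (Suc k). f i) = f 0 + (\<Sum>i<k. f (Suc i)) + f (Suc k)" for f :: "nat \<Rightarrow> 'a::comm_monoid_add"
  using sum.lessThan_Suc_shift[of f k] by simp

lemma mult_mat_entry:
  assumes "A \<in> carrier_mat n n" "B \<in> carrier_mat n n" "i < n" "j < n"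
  shows "(A * B) $$ (i, j) = (\<Sum>l<n. A $$ (i, l) * B $$ (l, j))"
  using assms by (simp add: scalar_prod_def lessThan_atLeast0)

lemma mult_mat_vec_entry:
  assumes "A \<in> carrier_mat n n" "v \<in> carrier_vec n" "i < n"
  shows "(A *\<^sub>v v) $ i = (\<Sum>l<n. A $$ (i, l) * v $ l)"
  using assms by (simp add: scalar_prod_def lessThan_atLeast0)

text \<open>Block upper triangular, without any orthogonality condition, so that it also covers
  \<open>b_mat\<close>, which is not an isometry of \<open>Q_odd\<close>.\<close>

definition par :: "nat \<Rightarrow> 'a::field mat \<Rightarrow> bool" where
  "par n g \<longleftrightarrow> g \<in> carrier_mat n n \<and> (\<forall>i. 0 < i \<longrightarrow> i < n \<longrightarrow> g $$ (i, 0) = 0)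
     \<and> (\<forall>j. j < n - 1 \<longrightarrow> g $$ (n - 1, j) = 0)"

text \<open>In \<open>u_mat n v * s_mat x a\<close> the middle part of the last column is
  \<open>inverse a\<close> times \<open>v\<close>; the factor \<open>g $$ (0, 0)\<close> recovers
  \<open>v\<close> itself.\<close>

definition unip_vec :: "'a::field mat \<Rightarrow> 'a vec" where
  "unip_vec g = vec (dim_row g - 2) (\<lambda>i. g $$ (0, 0) * g $$ (i + 1, dim_row g - 1))"

definition levi :: "'a::field mat \<Rightarrow> 'a mat" where
  "levi g = s_mat (mid g) (g $$ (0, 0))"

definition midv :: "'a vec \<Rightarrow> 'a vec" where
  "midv v = vec (dim_vec v - 2) (\<lambda>i. v $ (i + 1))"

lemma dim_mid [simp]: "dim_row (mid g) = dim_row g - 2" "dim_col (mid g) = dim_col g - 2"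
  by (simp_all add: mid_def)

lemma dim_midv [simp]: "dim_vec (midv v) = dim_vec v - 2"
  by (simp add: midv_def)

lemma dim_unip_vec [simp]: "dim_vec (unip_vec g) = dim_row g - 2"
  by (simp add: unip_vec_def)

lemma mid_carrier [simp]: "g \<in> carrier_mat (S2 k) (S2 k) \<Longrightarrow> mid g \<in> carrier_mat k k"
  by (auto simp: mid_def)

lemma mid_entry [simp]:
  "i < dim_row g - 2 \<Longrightarrow> j < dim_col g - 2 \<Longrightarrow> mid g $$ (i, j) = g $$ (Suc i, Suc j)"
  by (auto simp: mid_def)

lemma midv_carrier [simp]: "v \<in> carrier_vec (S2 k) \<Longrightarrow> midv v \<in> carrier_vec k"
  by (intro carrier_vecI) (simp add: midv_def)

lemma midv_entry [simp]: "i < dim_vec v - 2 \<Longrightarrow> midv v $ i = v $ Suc i"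
  by (simp add: midv_def)

lemma unip_vec_carrier [simp]: "g \<in> carrier_mat (S2 k) (S2 k) \<Longrightarrow> unip_vec g \<in> carrier_vec k"
  by (intro carrier_vecI) (simp add: unip_vec_def)

lemma unip_vec_entry [simp]:
  "i < dim_row g - 2 \<Longrightarrow> unip_vec g $ i = g $$ (0, 0) * g $$ (Suc i, dim_row g - 1)"
  by (simp add: unip_vec_def)

lemma par_carrier: "par n g \<Longrightarrow> g \<in> carrier_mat n n" by (simp add: par_def)

lemma par_col: "par n g \<Longrightarrow> 0 < i \<Longrightarrow> i < n \<Longrightarrow> g $$ (i, 0) = 0" by (simp add: par_def)

lemma par_row: "par (S2 k) g \<Longrightarrow> j < Suc k \<Longrightarrow> g $$ (Suc k, j) = 0" by (simp add: par_def)

lemma less_Suc_Suc_cases: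
  assumes "i < Suc (Suc k)"
  obtains "i = 0" | j where "i = Suc j" "j < k" | "i = Suc k"
  using assms by (metis less_antisym less_Suc_eq_0_disj)

lemma par_mult:
  fixes g h :: "'a::field mat"
  assumes g: "par (S2 k) g" and h: "par (S2 k) h"
  shows "par (S2 k) (g * h)"
    and "(g * h) $$ (0, 0) = g $$ (0, 0) * h $$ (0, 0)"
    and "(g * h) $$ (Suc k, Suc k) = g $$ (Suc k, Suc k) * h $$ (Suc k, Suc k)"
    and "mid (g * h) = mid g * mid h"
    and "i < k \<Longrightarrow> (g * h) $$ (Suc i, Suc k) =
      (\<Sum>j<k. g $$ (Suc i, Suc j) * h $$ (Suc j, Suc k)) + g $$ (Suc i, Suc k) * h $$ (Suc k, Suc k)"
    and "j < k \<Longrightarrow> (g * h) $$ (0, Suc j) =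
      g $$ (0, 0) * h $$ (0, Suc j) + (\<Sum>i<k. g $$ (0, Suc i) * h $$ (Suc i, Suc j))"
proof -
  note c = par_carrier[OF g] par_carrier[OF h]
  note e = mult_mat_entry[OF c] sum_border par_col[OF g] par_col[OF h] par_row[OF g] par_row[OF h]
  show "par (S2 k) (g * h)"
    unfolding par_def using c by (auto simp: e simp del: index_mult_mat(1) sum.lessThan_Suc elim!: less_Suc_Suc_cases)
  show "(g * h) $$ (0, 0) = g $$ (0, 0) * h $$ (0, 0)"
    "(g * h) $$ (Suc k, Suc k) = g $$ (Suc k, Suc k) * h $$ (Suc k, Suc k)"
    "i < k \<Longrightarrow> (g * h) $$ (Suc i, Suc k) =
      (\<Sum>j<k. g $$ (Suc i, Suc j) * h $$ (Suc j, Suc k)) + g $$ (Suc i, Suc k) * h $$ (Suc k, Suc k)"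
    "j < k \<Longrightarrow> (g * h) $$ (0, Suc j) =
      g $$ (0, 0) * h $$ (0, Suc j) + (\<Sum>i<k. g $$ (0, Suc i) * h $$ (Suc i, Suc j))"
    by (simp_all add: e del: index_mult_mat(1) sum.lessThan_Suc)
  note m = mid_carrier[OF c(1)] mid_carrier[OF c(2)]
  have gh: "g * h \<in> carrier_mat (S2 k) (S2 k)" using c by simp
  show "mid (g * h) = mid g * mid h"
  proof (rule eq_matI)
    fix i j assume "i < dim_row (mid g * mid h)" "j < dim_col (mid g * mid h)"
    then have ij: "i < k" "j < k" using m by auto
    show "mid (g * h) $$ (i, j) = (mid g * mid h) $$ (i, j)"
      unfolding mult_mat_entry[OF m ij] using ij c gh by (simp add: e del: index_mult_mat(1) sum.lessThan_Suc)
  qed (use c in auto)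
qed

text \<open>The law of the semidirect product: \<open>unip_vec\<close> is a cocycle for the action
  of \<open>s_mat x a\<close> on vectors by \<open>a\<close> times \<open>x\<close>. The hypothesis
  \<open>hl\<close> clears the corner entries of \<open>h\<close> and holds in the orthogonal
  group.\<close>

lemma unip_vec_mult:
  fixes g h :: "'a::field mat"
  assumes g: "par (S2 k) g" and h: "par (S2 k) h"
    and hl: "h $$ (0, 0) * h $$ (Suc k, Suc k) = 1"
  shows "unip_vec (g * h) = unip_vec g + g $$ (0, 0) \<cdot>\<^sub>v (mid g *\<^sub>v unip_vec h)"
proof (rule eq_vecI)
  note c = par_carrier[OF g] par_carrier[OF h]
  note m = mid_carrier[OF c(1)] unip_vec_carrier[OF c(2)]
  have gh: "g * h \<in> carrier_mat (S2 k) (S2 k)" using c by simp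
  show "dim_vec (unip_vec (g * h)) = dim_vec (unip_vec g + g $$ (0, 0) \<cdot>\<^sub>v (mid g *\<^sub>v unip_vec h))"
    using c gh m by (simp add: unip_vec_def)
  fix i assume "i < dim_vec (unip_vec g + g $$ (0, 0) \<cdot>\<^sub>v (mid g *\<^sub>v unip_vec h))"
  then have i: "i < k" using c m by simp
  have "unip_vec (g * h) $ i = g $$ (0,0) * h $$ (0,0) *
      ((\<Sum>j<k. g $$ (Suc i, Suc j) * h $$ (Suc j, Suc k)) + g $$ (Suc i, Suc k) * h $$ (Suc k, Suc k))"
    using gh i c by (simp add: par_mult[OF g h] del: index_mult_mat(1))
  also have "\<dots> = g $$ (0,0) * g $$ (Suc i, Suc k) * (h $$ (0,0) * h $$ (Suc k, Suc k))
     + g $$ (0,0) * (\<Sum>j<k. g $$ (Suc i, Suc j) * (h $$ (0,0) * h $$ (Suc j, Suc k)))"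
    by (simp add: algebra_simps sum_distrib_left)
  also have "\<dots> = (unip_vec g + g $$ (0, 0) \<cdot>\<^sub>v (mid g *\<^sub>v unip_vec h)) $ i"
    using i c m by (simp add: hl mult_mat_vec_entry[OF m] del: index_mult_mat_vec)
  finally show "unip_vec (g * h) $ i = (unip_vec g + g $$ (0, 0) \<cdot>\<^sub>v (mid g *\<^sub>v unip_vec h)) $ i" .
qed

lemma det_first_col:
  fixes g :: "'a::field mat"
  assumes g: "g \<in> carrier_mat (Suc k) (Suc k)" and z: "\<And>i. 0 < i \<Longrightarrow> i < Suc k \<Longrightarrow> g $$ (i, 0) = 0"
  shows "det g = g $$ (0, 0) * det (mat_delete g 0 0)"
proof -
  have "det g = (\<Sum>i<Suc k. g $$ (i, 0) * cofactor g i 0)"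
    by (rule laplace_expansion_column[OF g]) simp
  also have "\<dots> = g $$ (0, 0) * cofactor g 0 0"
    using z by (simp add: sum.lessThan_Suc_shift del: sum.lessThan_Suc)
  finally show ?thesis by (simp add: cofactor_def)
qed

lemma det_last_row:
  fixes g :: "'a::field mat"
  assumes g: "g \<in> carrier_mat (Suc k) (Suc k)" and z: "\<And>j. j < k \<Longrightarrow> g $$ (k, j) = 0"
  shows "det g = g $$ (k, k) * det (mat_delete g k k)"
proof -
  have "det g = (\<Sum>j<Suc k. g $$ (k, j) * cofactor g k j)"
    by (rule laplace_expansion_row[OF g]) simp
  also have "\<dots> = g $$ (k, k) * cofactor g k k"
    using z by simp
  finally show ?thesis by (simp add: cofactor_def)
qed

lemma det_par:
  fixes g :: "'a::field mat"
  assumes g: "par (S2 k) g"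
  shows "det g = g $$ (0, 0) * det (mid g) * g $$ (Suc k, Suc k)"
proof -
  note c = par_carrier[OF g]
  let ?h = "mat_delete g 0 0"
  have h: "?h \<in> carrier_mat (Suc k) (Suc k)" using c by (auto simp: mat_delete_def)
  have he: "?h $$ (i, j) = g $$ (Suc i, Suc j)" if "i < Suc k" "j < Suc k" for i j
    using that c by (simp add: mat_delete_def)
  have "mat_delete ?h k k = mid g"
    using c by (intro eq_matI) (auto simp: mat_delete_def mid_def)
  then have "det ?h = g $$ (Suc k, Suc k) * det (mid g)"
    using det_last_row[OF h] par_row[OF g] by (simp add: he)
  then show ?thesis using det_first_col[OF c] par_col[OF g] by simp
qed

section \<open>The polar form in odd dimension\<close>

definition polar :: "('a::field vec \<Rightarrow> 'a) \<Rightarrow> 'a vec \<Rightarrow> 'a vec \<Rightarrow> 'a" where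
  "polar Q v w = Q (v + w) - Q v - Q w"

text \<open>The factor \<open>2\<close> stays: for even \<open>q\<close> the middle coordinate drops
  out and \<open>e_0\<close> spans the radical. This is why the later nondegeneracy argument first
  deletes the middle coordinate.\<close>

lemma polar_Q_odd:
  assumes "v \<in> carrier_vec k" "w \<in> carrier_vec k" "odd k"
  shows "polar Q_odd v w = 2 * cf v 0 * cf w 0 + (\<Sum>j=1..k div 2. cf v j * cf' w j + cf w j * cf' v j)"
proof -
  have d: "dim_vec v = k" "dim_vec w = k" using assms by auto
  have "(cf (v + w) j :: 'a) = cf v j + cf w j" for j using d \<open>odd k\<close> by (auto simp: cf_def elim!: oddE)
  moreover have "cf' (v + w) j = cf' v j + cf' w j" if "j \<in> {1..k div 2}" for j
    using that d \<open>odd k\<close> by (auto simp: cf'_def elim!: oddE)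
  ultimately have "(\<Sum>j=1..k div 2. cf (v + w) j * cf' (v + w) j) =
     (\<Sum>j=1..k div 2. cf v j * cf' v j) + (\<Sum>j=1..k div 2. cf w j * cf' w j) +
     (\<Sum>j=1..k div 2. cf v j * cf' w j + cf w j * cf' v j)"
    unfolding sum.distrib[symmetric] by (intro sum.cong) (simp_all add: algebra_simps)
  then show ?thesis using d \<open>\<And>j. cf (v + w) j = cf v j + cf w j\<close>
    by (simp add: polar_def Q_odd_def power2_eq_square algebra_simps)
qed

lemma polar_add_left:
  assumes "u \<in> carrier_vec k" "v \<in> carrier_vec k" "w \<in> carrier_vec k" "odd k"
  shows "polar Q_odd (u + v) w = polar Q_odd u w + polar Q_odd v w"
proof -
  have d: "dim_vec u = k" "dim_vec v = k" "dim_vec w = k" using assms by auto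
  have "cf (u + v) j = cf u j + cf v j" for j using d \<open>odd k\<close> by (auto simp: cf_def elim!: oddE)
  moreover have "cf' (u + v) j = cf' u j + cf' v j" if "j \<in> {1..k div 2}" for j
    using that d \<open>odd k\<close> by (auto simp: cf'_def elim!: oddE)
  ultimately have "(\<Sum>j=1..k div 2. cf (u + v) j * cf' w j + cf w j * cf' (u + v) j) =
     (\<Sum>j=1..k div 2. cf u j * cf' w j + cf w j * cf' u j) + (\<Sum>j=1..k div 2. cf v j * cf' w j + cf w j * cf' v j)"
    unfolding sum.distrib[symmetric] by (intro sum.cong) (simp_all add: algebra_simps)
  then show ?thesis
    unfolding polar_Q_odd[OF add_carrier_vec[OF assms(1,2)] assms(3,4)] polar_Q_odd[OF assms(1,3,4)]
      polar_Q_odd[OF assms(2,3,4)] \<open>\<And>j. cf (u + v) j = cf u j + cf v j\<close> by (simp add: algebra_simps)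
qed

lemma polar_smult_left:
  assumes "v \<in> carrier_vec k" "w \<in> carrier_vec k" "odd k"
  shows "polar Q_odd (c \<cdot>\<^sub>v v) w = c * polar Q_odd v w"
proof -
  have d: "dim_vec v = k" "dim_vec w = k" using assms by auto
  have "cf (c \<cdot>\<^sub>v v) j = c * cf v j" for j using d \<open>odd k\<close> by (auto simp: cf_def elim!: oddE)
  moreover have "cf' (c \<cdot>\<^sub>v v) j = c * cf' v j" if "j \<in> {1..k div 2}" for j
    using that d \<open>odd k\<close> by (auto simp: cf'_def elim!: oddE)
  ultimately have "(\<Sum>j=1..k div 2. cf (c \<cdot>\<^sub>v v) j * cf' w j + cf w j * cf' (c \<cdot>\<^sub>v v) j) =
     c * (\<Sum>j=1..k div 2. cf v j * cf' w j + cf w j * cf' v j)"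
    unfolding sum_distrib_left by (intro sum.cong) (simp_all add: algebra_simps)
  then show ?thesis
    unfolding polar_Q_odd[OF smult_carrier_vec[THEN iffD2, OF assms(1)] assms(2,3)] polar_Q_odd[OF assms]
      \<open>\<And>j. cf (c \<cdot>\<^sub>v v) j = c * cf v j\<close> by (simp add: algebra_simps)
qed

lemma polar_sym:
  assumes "v \<in> carrier_vec k" "w \<in> carrier_vec k"
  shows "polar Q v w = polar Q w v"
  using comm_add_vec[OF assms] by (simp add: polar_def)

lemma Q_odd_smult:
  assumes "v \<in> carrier_vec k" "odd k"
  shows "Q_odd (c \<cdot>\<^sub>v v) = c\<^sup>2 * Q_odd v"
proof -
  have d: "dim_vec v = k" using assms by auto
  have "cf (c \<cdot>\<^sub>v v) j = c * cf v j" for j using d \<open>odd k\<close> by (auto simp: cf_def elim!: oddE)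
  moreover have "cf' (c \<cdot>\<^sub>v v) j = c * cf' v j" if "j \<in> {1..k div 2}" for j
    using that d \<open>odd k\<close> by (auto simp: cf'_def elim!: oddE)
  ultimately show ?thesis using d
    by (simp add: Q_odd_def sum_distrib_left power2_eq_square algebra_simps)
qed

lemma linear_functional:
  fixes f :: "'a::field vec \<Rightarrow> 'a"
  assumes add: "\<And>v w. v \<in> carrier_vec k \<Longrightarrow> w \<in> carrier_vec k \<Longrightarrow> f (v + w) = f v + f w"
    and smult: "\<And>c v. v \<in> carrier_vec k \<Longrightarrow> f (c \<cdot>\<^sub>v v) = c * f v"
    and v: "v \<in> carrier_vec k"
  shows "f v = (\<Sum>i<k. v $ i * f (unit_vec k i))"
proof -
  \<comment> \<open>Truncations of \<open>v\<close>. Passing from \<open>m\<close> to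
    \<open>Suc m\<close> adds one multiple of a basis vector, so additivity and homogeneity carry an
    induction.\<close>
  let ?t = "\<lambda>m. vec k (\<lambda>i. if i < m then v $ i else 0)"
  have "m \<le> k \<Longrightarrow> f (?t m) = (\<Sum>i<m. v $ i * f (unit_vec k i))" for m
  proof (induction m)
    case 0
    have "?t 0 = 0 \<cdot>\<^sub>v (0\<^sub>v k)" by (intro eq_vecI) auto
    then show ?case using smult[of "0\<^sub>v k" 0] by simp
  next
    case (Suc m)
    have "?t (Suc m) = ?t m + v $ m \<cdot>\<^sub>v unit_vec k m"
      using Suc.prems by (intro eq_vecI) (auto simp: less_Suc_eq)
    then show ?case using Suc by (simp add: add smult)
  qed
  moreover have "?t k = v" using v by (intro eq_vecI) auto
  ultimately show ?thesis by (metis order_refl)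
qed

text \<open>\<open>J'\<close> is the Gram matrix of the polar form, so the first row of
  \<open>u_mat\<close> can be read as values of \<open>polar\<close>.\<close>

lemma dot_col_J':
  assumes "v \<in> carrier_vec k" "odd k" "j < k"
  shows "v \<bullet> col (J' k) j = polar Q_odd v (unit_vec k j)"
proof -
  have "v \<bullet> col (J' k) j = (\<Sum>i<k. v $ i * polar Q_odd (unit_vec k i) (unit_vec k j))"
    using assms by (simp add: scalar_prod_def J'_def polar_def lessThan_atLeast0)
  also have "\<dots> = polar Q_odd v (unit_vec k j)"
    by (rule linear_functional[symmetric, where f = "\<lambda>v. polar Q_odd v (unit_vec k j)"])
       (use assms in \<open>auto simp: polar_add_left polar_smult_left\<close>)
  finally show ?thesis .
qed

text \<open>Splits off the hyperbolic plane of the outermost coordinates. The passages between sizes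
  \<open>n\<close> and \<open>n - 2\<close> rest on this.\<close>

lemma Q_odd_border:
  assumes "v \<in> carrier_vec (S2 k)" "odd k"
  shows "Q_odd v = v $ 0 * v $ Suc k + Q_odd (midv v)"
proof -
  obtain l where k: "k = 2 * l + 1" using \<open>odd k\<close> by (elim oddE)
  have d: "dim_vec v = Suc (Suc k)" "dim_vec (midv v) = k" using assms by (auto simp: midv_def)
  have "cf v j = cf (midv v) j" if "j \<le> l" for j
    using that d k by (auto simp: cf_def midv_def Suc_diff_le)
  moreover have "cf' v j = cf' (midv v) j" if "1 \<le> j" "j \<le> l" for j
    using that d k by (auto simp: cf'_def midv_def)
  moreover have "{1..Suc l} = insert (Suc l) {1..l}" by auto
  ultimately show ?thesis using d k
    by (simp add: Q_odd_def cf_def cf'_def midv_def mult_2_right mult_2 ac_simps)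
qed

section \<open>Isometry groups and the special orthogonal group\<close>

lemma polar_isometry:
  assumes "g \<in> isometries n Q" "v \<in> carrier_vec n" "w \<in> carrier_vec n"
  shows "polar Q (g *\<^sub>v v) (g *\<^sub>v w) = polar Q v w"
proof -
  have g: "g \<in> carrier_mat n n" and Q: "\<And>v. v \<in> carrier_vec n \<Longrightarrow> Q (g *\<^sub>v v) = Q v"
    using assms(1) by (auto simp: isometries_def GL_carrier)
  show ?thesis using assms(2,3)
    by (simp add: polar_def mult_add_distrib_mat_vec[OF g, symmetric] Q)
qed

lemma isometriesI:
  assumes "g \<in> carrier_mat n n" "det g \<noteq> 0" "\<And>v. v \<in> carrier_vec n \<Longrightarrow> Q (g *\<^sub>v v) = Q v"
  shows "g \<in> isometries n Q"
  using assms by (auto simp: isometries_def GL_carrier)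

lemma subgroup_isometries: "subgroup (isometries n Q) (GL n)"
proof -
  interpret group "GL n :: 'a mat monoid" by simp
  show ?thesis
  proof (rule subgroupI)
    show "isometries n Q \<subseteq> carrier (GL n)" by (auto simp: isometries_def)
    show "isometries n Q \<noteq> {}"
      by (auto simp: isometries_def GL_carrier intro!: exI[of _ "1\<^sub>m n"])
    show "a \<otimes>\<^bsub>GL n\<^esub> b \<in> isometries n Q" if ab: "a \<in> isometries n Q" "b \<in> isometries n Q" for a b
    proof -
      have "a \<in> carrier_mat n n" "b \<in> carrier_mat n n" using ab by (auto simp: isometries_def GL_carrier)
      moreover have "a \<otimes>\<^bsub>GL n\<^esub> b \<in> carrier (GL n)" using ab by (intro m_closed) (auto simp: isometries_def)
      ultimately show ?thesis using ab
        by (auto simp: isometries_def)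
    qed
    show "inv\<^bsub>GL n\<^esub> a \<in> isometries n Q" if a: "a \<in> isometries n Q" for a
    proof -
      let ?b = "inv\<^bsub>GL n\<^esub> a"
      have ca: "a \<in> carrier (GL n)" using a by (auto simp: isometries_def)
      then have cb: "?b \<in> carrier (GL n)" by simp
      have "Q (?b *\<^sub>v v) = Q v" if v: "v \<in> carrier_vec n" for v
      proof -
        have am: "a \<in> carrier_mat n n" "?b \<in> carrier_mat n n" using ca cb by (auto simp: GL_carrier)
        have "a * ?b = 1\<^sub>m n" using r_inv[OF ca] by simp
        then have "a *\<^sub>v (?b *\<^sub>v v) = v" using assoc_mult_mat_vec[OF am v] v by simp
        moreover have "Q (a *\<^sub>v (?b *\<^sub>v v)) = Q (?b *\<^sub>v v)"
          using a am v by (auto simp: isometries_def)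
        ultimately show ?thesis by simp
      qed
      then show ?thesis using cb by (auto simp: isometries_def)
    qed
  qed
qed

lemma SO_iff:
  "g \<in> SO n \<longleftrightarrow> g \<in> carrier_mat n n \<and> det g = 1 \<and> (\<forall>v\<in>carrier_vec n. Q_odd (g *\<^sub>v v) = Q_odd v)"
  by (auto simp: SO_def GO_def isometries_def GL_carrier)

lemma SO_isometry: "g \<in> SO n \<Longrightarrow> g \<in> isometries n Q_odd"
  by (simp add: SO_def GO_def)

lemma det_GL_inv:
  fixes g :: "'a::field mat"
  assumes "g \<in> carrier (GL n)"
  shows "det (inv\<^bsub>GL n\<^esub> g) = inverse (det g)"
proof -
  interpret group "GL n :: 'a mat monoid" by simp
  have c: "g \<in> carrier_mat n n" "inv\<^bsub>GL n\<^esub> g \<in> carrier_mat n n"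
    using assms inv_closed[OF assms] by (auto simp: GL_carrier)
  have "g * inv\<^bsub>GL n\<^esub> g = 1\<^sub>m n" using r_inv[OF assms] by simp
  then have "det g * det (inv\<^bsub>GL n\<^esub> g) = 1" using det_mult[OF c] by simp
  then show ?thesis by (metis inverse_unique)
qed

lemma subgroup_SO: "subgroup (SO n) (GL n)"
proof -
  interpret group "GL n :: 'a mat monoid" by simp
  note I = subgroup_isometries[of n Q_odd]
  show ?thesis
  proof (rule subgroupI)
    show "SO n \<subseteq> carrier (GL n)" by (auto simp: SO_iff GL_carrier)
    have "1\<^sub>m n \<in> SO n" by (auto simp: SO_iff)
    then show "SO n \<noteq> {}" by blast
    show "a \<otimes>\<^bsub>GL n\<^esub> b \<in> SO n" if "a \<in> SO n" "b \<in> SO n" for a b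
      using that subgroup.m_closed[OF I, of a b] det_mult[of a n b]
      by (auto simp: SO_def GO_def isometries_def GL_carrier)
    show "inv\<^bsub>GL n\<^esub> a \<in> SO n" if "a \<in> SO n" for a
      using that subgroup.m_inv_closed[OF I, of a]
      by (auto simp: SO_def GO_def det_GL_inv isometries_def)
  qed
qed

section \<open>Coordinates on the parabolic subgroup\<close>

lemma polar_border:
  assumes v: "v \<in> carrier_vec (S2 k)" and w: "w \<in> carrier_vec (S2 k)" and k: "odd k"
  shows "polar Q_odd v w = v $ 0 * w $ Suc k + w $ 0 * v $ Suc k + polar Q_odd (midv v) (midv w)"
proof -
  have "midv (v + w) = midv v + midv w" using v w by (intro eq_vecI) auto
  then show ?thesis using v w
    by (simp add: polar_def Q_odd_border[OF _ k] algebra_simps)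
qed

lemma mult_mat_vec_unit:
  fixes A :: "'a::field mat"
  assumes "A \<in> carrier_mat n m" "j < m" "i < n"
  shows "(A *\<^sub>v unit_vec m j) $ i = A $$ (i, j)"
  using assms scalar_prod_right_unit[of j m "row A i"] by simp

text \<open>The line must be mapped onto itself, which needs a nonzero corner entry. Invertibility
  provides it once the rest of the first column vanishes.\<close>

lemma P_grp_iff:
  fixes g :: "'a::field mat"
  assumes "n > 0"
  shows "g \<in> P_grp n \<longleftrightarrow> g \<in> SO n \<and> (\<forall>i. 0 < i \<longrightarrow> i < n \<longrightarrow> g $$ (i, 0) = 0)"
proof (cases "g \<in> SO n")
  case True
  then have g: "g \<in> carrier_mat n n" "det g \<noteq> 0" by (auto simp: SO_iff)
  let ?e = "unit_vec n 0 :: 'a vec"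
  let ?E = "{c \<cdot>\<^sub>v ?e | c. True}"
  have ge: "(g *\<^sub>v ?e) $ i = g $$ (i, 0)" if "i < n" for i using mult_mat_vec_unit[OF g(1)] assms that by blast
  have mul: "g *\<^sub>v (c \<cdot>\<^sub>v ?e) = c \<cdot>\<^sub>v (g *\<^sub>v ?e)" for c using mult_mat_vec[OF g(1)] by simp
  have "(\<lambda>v. g *\<^sub>v v) ` ?E = ?E \<longleftrightarrow> (\<forall>i. 0 < i \<longrightarrow> i < n \<longrightarrow> g $$ (i, 0) = 0)"
  proof (intro iffI allI impI)
    fix i assume *: "(\<lambda>v. g *\<^sub>v v) ` ?E = ?E" and i: "0 < i" "i < n"
    have "?e \<in> ?E" by (auto intro!: exI[of _ 1])
    then have "g *\<^sub>v ?e \<in> ?E" using * by blast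
    then obtain c where "g *\<^sub>v ?e = c \<cdot>\<^sub>v ?e" by auto
    then show "g $$ (i, 0) = 0" using ge[OF i(2)] i by simp
  next
    assume *: "\<forall>i. 0 < i \<longrightarrow> i < n \<longrightarrow> g $$ (i, 0) = 0"
    have e: "g *\<^sub>v ?e = g $$ (0, 0) \<cdot>\<^sub>v ?e" using * g ge assms by (intro eq_vecI) auto
    have nz: "g $$ (0, 0) \<noteq> 0"
    proof
      assume "g $$ (0, 0) = 0"
      moreover obtain k where k: "n = Suc k" using assms gr0_conv_Suc by blast
      ultimately show False using det_first_col[of g k] g * by simp
    qed
    show "(\<lambda>v. g *\<^sub>v v) ` ?E = ?E"
    proof
      show "(\<lambda>v. g *\<^sub>v v) ` ?E \<subseteq> ?E" using mul e by (auto simp: smult_smult_assoc)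
      show "?E \<subseteq> (\<lambda>v. g *\<^sub>v v) ` ?E"
      proof
        fix x assume "x \<in> ?E"
        then obtain c where "x = c \<cdot>\<^sub>v ?e" by auto
        then have "x = g *\<^sub>v ((c / g $$ (0,0)) \<cdot>\<^sub>v ?e)" using nz by (simp only: mul e) (simp add: smult_smult_assoc)
        then show "x \<in> (\<lambda>v. g *\<^sub>v v) ` ?E" by auto
      qed
    qed
  qed
  then show ?thesis using True by (simp add: P_grp_def)
qed (simp add: P_grp_def)

lemma par_mult_vec:
  fixes g :: "'a::field mat"
  assumes g: "par (S2 k) g" and v: "v \<in> carrier_vec (S2 k)"
  shows "(g *\<^sub>v v) $ 0 = g $$ (0, 0) * v $ 0 + (\<Sum>j<k. g $$ (0, Suc j) * v $ Suc j) + g $$ (0, Suc k) * v $ Suc k"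
    and "(g *\<^sub>v v) $ Suc k = g $$ (Suc k, Suc k) * v $ Suc k"
    and "midv (g *\<^sub>v v) = mid g *\<^sub>v midv v + vec k (\<lambda>i. v $ Suc k * g $$ (Suc i, Suc k))"
proof -
  note c = par_carrier[OF g]
  note e = mult_mat_vec_entry[OF c v] sum_border par_col[OF g] par_row[OF g]
  show "(g *\<^sub>v v) $ 0 = g $$ (0, 0) * v $ 0 + (\<Sum>j<k. g $$ (0, Suc j) * v $ Suc j) + g $$ (0, Suc k) * v $ Suc k"
    "(g *\<^sub>v v) $ Suc k = g $$ (Suc k, Suc k) * v $ Suc k"
    by (simp_all add: e del: index_mult_mat_vec sum.lessThan_Suc)
  show "midv (g *\<^sub>v v) = mid g *\<^sub>v midv v + vec k (\<lambda>i. v $ Suc k * g $$ (Suc i, Suc k))"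
  proof (rule eq_vecI)
    fix i assume "i < dim_vec (mid g *\<^sub>v midv v + vec k (\<lambda>i. v $ Suc k * g $$ (Suc i, Suc k)))"
    then have i: "i < k" by simp
    have gv: "g *\<^sub>v v \<in> carrier_vec (S2 k)" using c v by simp
    have m: "mid g \<in> carrier_mat k k" "midv v \<in> carrier_vec k" using c v by auto
    have "midv (g *\<^sub>v v) $ i = (\<Sum>j<k. g $$ (Suc i, Suc j) * v $ Suc j) + g $$ (Suc i, Suc k) * v $ Suc k"
      using i gv c by (simp add: e del: index_mult_mat_vec sum.lessThan_Suc)
    also have "\<dots> = (mid g *\<^sub>v midv v) $ i + v $ Suc k * g $$ (Suc i, Suc k)"
      using i c v by (simp add: mult_mat_vec_entry[OF m] del: index_mult_mat_vec)
    finally show "midv (g *\<^sub>v v) $ i = (mid g *\<^sub>v midv v + vec k (\<lambda>i. v $ Suc k * g $$ (Suc i, Suc k))) $ i"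
      using i by simp
  qed (use c in simp)
qed

context
  fixes k :: nat
  assumes odd_k: "odd k"
begin

text \<open>Pairing with \<open>e_m\<close> reads off the last coordinate, so the vectors orthogonal
  to the fixed line are those with last coordinate \<open>0\<close>.\<close>

lemma polar_unit_0:
  assumes "w \<in> carrier_vec (S2 k)"
  shows "polar Q_odd (unit_vec (S2 k) 0) w = w $ Suc k"
proof -
  have "midv (unit_vec (S2 k) 0) = (0 :: 'a::field) \<cdot>\<^sub>v midv w" using assms by (intro eq_vecI) auto
  then show ?thesis
    using polar_border[OF unit_vec_carrier assms odd_k, of 0] polar_smult_left[of "midv w" k "midv w" 0] assms odd_k
    by simp
qed

text \<open>An isometry that fixes the isotropic line of \<open>e_m\<close> also preserves the
  hyperplane orthogonal to it. This gives the last row and the inverse corner entry, and the form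
  induced on the hyperplane modulo the line puts the middle block into \<open>SO k\<close>.\<close>

lemma P_par:
  assumes g: "g \<in> P_grp (S2 k)"
  shows "par (S2 k) g" "g $$ (0, 0) \<noteq> 0" "g $$ (Suc k, Suc k) = inverse (g $$ (0, 0))" "mid g \<in> SO k"
proof -
  let ?N = "Suc (Suc k)"
  have SO: "g \<in> SO ?N" and col: "\<And>i. 0 < i \<Longrightarrow> i < ?N \<Longrightarrow> g $$ (i, 0) = 0"
    using g by (auto simp: P_grp_iff)
  have c: "g \<in> carrier_mat ?N ?N" and det: "det g = 1" and Q: "\<And>v. v \<in> carrier_vec ?N \<Longrightarrow> Q_odd (g *\<^sub>v v) = Q_odd v"
    using SO by (auto simp: SO_iff)
  have ge: "g *\<^sub>v unit_vec ?N 0 = g $$ (0, 0) \<cdot>\<^sub>v unit_vec ?N 0"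
    by (intro eq_vecI) (use c col in \<open>auto simp: mult_mat_vec_unit[OF c] simp del: index_mult_mat_vec\<close>)
  have last: "g $$ (0, 0) * (g *\<^sub>v w) $ Suc k = w $ Suc k" if w: "w \<in> carrier_vec ?N" for w
  proof -
    have gw: "g *\<^sub>v w \<in> carrier_vec ?N" using c w by simp
    have "polar Q_odd (g *\<^sub>v unit_vec ?N 0) (g *\<^sub>v w) = w $ Suc k"
      using polar_isometry[OF SO_isometry[OF SO] _ w] polar_unit_0[OF w] by simp
    moreover have "polar Q_odd (g $$ (0, 0) \<cdot>\<^sub>v unit_vec ?N 0) (g *\<^sub>v w) = g $$ (0, 0) * (g *\<^sub>v w) $ Suc k"
      using polar_smult_left[of "unit_vec ?N 0" ?N "g *\<^sub>v w"] gw odd_k polar_unit_0[OF gw] by simp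
    ultimately show ?thesis by (simp only: ge)
  qed
  have last': "g $$ (0, 0) * g $$ (Suc k, j) = (if j = Suc k then 1 else 0)" if "j < ?N" for j
    using last[of "unit_vec ?N j"] that c by (simp add: mult_mat_vec_unit[OF c] del: index_mult_mat_vec)
  show nz: "g $$ (0, 0) \<noteq> 0" using last'[of "Suc k"] by auto
  show "g $$ (Suc k, Suc k) = inverse (g $$ (0, 0))"
    using last'[of "Suc k"] nz by (simp add: field_simps)
  have "g $$ (Suc k, j) = 0" if "j < Suc k" for j using last'[of j] that nz by simp
  then show par: "par ?N g" using c col by (auto simp: par_def)
  have "det (mid g) = 1"
    using det_par[OF par] det nz \<open>g $$ (Suc k, Suc k) = _\<close> by (simp add: field_simps)
  moreover have "Q_odd (mid g *\<^sub>v v) = Q_odd v" if v: "v \<in> carrier_vec k" for v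
  proof -
    \<comment> \<open>Padding \<open>v\<close> by zeros places it in the hyperplane, where the
      border terms of \<open>Q_odd\<close> vanish before and after applying
      \<open>g\<close>.\<close>
    let ?V = "vec ?N (\<lambda>i. if i = 0 \<or> i = Suc k then 0 else v $ (i - 1))"
    have V: "?V \<in> carrier_vec ?N" by simp
    have mV: "midv ?V = v" using v by (intro eq_vecI) auto
    have z: "vec k (\<lambda>i. ?V $ Suc k * g $$ (Suc i, Suc k)) = 0\<^sub>v k" by (intro eq_vecI) auto
    have "(g *\<^sub>v ?V) $ Suc k = 0" using par_mult_vec(2)[OF par V] by (simp del: index_mult_mat_vec)
    moreover have "midv (g *\<^sub>v ?V) = mid g *\<^sub>v v" using par_mult_vec(3)[OF par V]
      unfolding z mV right_zero_vec[OF mult_mat_vec_carrier[OF mid_carrier[OF c] v]] .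
    ultimately have "Q_odd (g *\<^sub>v ?V) = Q_odd (mid g *\<^sub>v v)"
      using Q_odd_border[of "g *\<^sub>v ?V" k] c odd_k by (simp del: index_mult_mat_vec)
    moreover have "Q_odd ?V = Q_odd v" using Q_odd_border[OF V odd_k] by (simp add: mV)
    ultimately show ?thesis using Q[OF V] by simp
  qed
  ultimately show "mid g \<in> SO k" using c by (auto simp: SO_iff)
qed

lemma P_carrier: "g \<in> P_grp (S2 k) \<Longrightarrow> g \<in> carrier_mat (S2 k) (S2 k)"
  by (simp add: P_par par_carrier)

text \<open>The first row of an element of the parabolic subgroup is determined by its other entries,
  because \<open>g e\<^sub>j\<close> and \<open>g e\<^sub>m'\<close> satisfy the same relations as \<open>e\<^sub>j\<close> and \<open>e\<^sub>m'\<close>.\<close>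

lemma P_first_row:
  assumes g: "g \<in> P_grp (S2 k)"
  shows "j < k \<Longrightarrow> g $$ (0, Suc j) = - polar Q_odd (mid g *\<^sub>v unit_vec k j) (unip_vec g)"
    and "g $$ (0, Suc k) = - (inverse (g $$ (0, 0)) * Q_odd (unip_vec g))"
proof -
  let ?N = "Suc (Suc k)" and ?a = "g $$ (0, 0)"
  note P = P_par[OF g] and c = P_carrier[OF g]
  have SO: "g \<in> SO ?N" using g by (simp add: P_grp_iff)
  let ?l = "g *\<^sub>v unit_vec ?N (Suc k)"
  have l: "?l \<in> carrier_vec ?N" using c by simp
  have u: "unip_vec g \<in> carrier_vec k" using c by simp
  have ml: "midv ?l = inverse ?a \<cdot>\<^sub>v unip_vec g"
    by (intro eq_vecI) (use c P(2) l in \<open>auto simp: mult_mat_vec_unit[OF c] simp del: index_mult_mat_vec\<close>)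
  have le: "?l $ 0 = g $$ (0, Suc k)" "?l $ Suc k = inverse ?a"
    using P(3) by (simp_all add: mult_mat_vec_unit[OF c] del: index_mult_mat_vec)
  show "g $$ (0, Suc k) = - (inverse ?a * Q_odd (unip_vec g))"
  proof -
    have z: "midv (unit_vec ?N (Suc k)) = (0::'a) \<cdot>\<^sub>v 0\<^sub>v k" by (intro eq_vecI) auto
    have "Q_odd (midv (unit_vec ?N (Suc k)) :: 'a vec) = 0"
      unfolding z using Q_odd_smult[of "0\<^sub>v k :: 'a vec" k 0] odd_k by simp
    then have "Q_odd (unit_vec ?N (Suc k) :: 'a vec) = 0"
      using Q_odd_border[of "unit_vec ?N (Suc k) :: 'a vec" k] odd_k by simp
    then have "Q_odd ?l = 0" using SO by (auto simp: SO_iff)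
    then have "g $$ (0, Suc k) * inverse ?a + (inverse ?a)\<^sup>2 * Q_odd (unip_vec g) = 0"
      using Q_odd_border[OF l odd_k] le ml Q_odd_smult[OF u odd_k] by simp
    then have "inverse ?a * (g $$ (0, Suc k) + inverse ?a * Q_odd (unip_vec g)) = 0"
      by (simp add: algebra_simps power2_eq_square)
    then show ?thesis using P(2) by (simp add: eq_neg_iff_add_eq_0)
  qed
  show "g $$ (0, Suc j) = - polar Q_odd (mid g *\<^sub>v unit_vec k j) (unip_vec g)" if j: "j < k"
  proof -
    let ?e = "unit_vec ?N (Suc j) :: 'a vec"
    have e: "?e \<in> carrier_vec ?N" by simp
    have me: "midv ?e = unit_vec k j" using j by (intro eq_vecI) (auto simp: unit_vec_def)
    have ml0: "midv (unit_vec ?N (Suc k)) = (0::'a) \<cdot>\<^sub>v 0\<^sub>v k" by (intro eq_vecI) auto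
    have "vec k (\<lambda>i. ?e $ Suc k * g $$ (Suc i, Suc k)) = 0\<^sub>v k" using j by (intro eq_vecI) auto
    then have mge: "midv (g *\<^sub>v ?e) = mid g *\<^sub>v unit_vec k j"
      using par_mult_vec(3)[OF P(1) e] right_zero_vec[OF mult_mat_vec_carrier[OF mid_carrier[OF c] unit_vec_carrier]]
      by (simp add: me)
    have m: "mid g *\<^sub>v unit_vec k j \<in> carrier_vec k"
      by (rule mult_mat_vec_carrier[OF mid_carrier[OF c] unit_vec_carrier])
    have ge: "g *\<^sub>v ?e \<in> carrier_vec ?N" using c by simp
    have "polar Q_odd ?e (unit_vec ?N (Suc k)) = 0"
      using polar_border[OF e unit_vec_carrier odd_k] j odd_k
      by (simp add: me ml0 polar_sym[of "unit_vec k j" k] polar_smult_left[where k = k])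
    then have "polar Q_odd (g *\<^sub>v ?e) ?l = 0"
      using polar_isometry[OF SO_isometry[OF SO] e, of "unit_vec ?N (Suc k)"] by simp
    then have "g $$ (0, Suc j) * inverse ?a + inverse ?a * polar Q_odd (unip_vec g) (mid g *\<^sub>v unit_vec k j) = 0"
      using polar_border[OF ge l odd_k] j P(1) polar_sym[OF m, of "inverse ?a \<cdot>\<^sub>v unip_vec g" Q_odd] u m odd_k
      by (simp add: le ml mge mult_mat_vec_unit[OF c] par_row polar_smult_left[where k = k] del: index_mult_mat_vec)
    then have "inverse ?a * (g $$ (0, Suc j) + polar Q_odd (unip_vec g) (mid g *\<^sub>v unit_vec k j)) = 0"
      by (simp add: algebra_simps)
    then show ?thesis using P(2) polar_sym[OF m u, of Q_odd] by (simp add: eq_neg_iff_add_eq_0)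
  qed
qed

text \<open>Corner entry, middle block and \<open>unip_vec\<close> are coordinates:
  \<open>P_first_row\<close> expresses the first row by them, and \<open>P_par\<close> fixes the
  first column and the last row. Identities in the parabolic subgroup are proved by comparing these
  three.\<close>

lemma P_eqI:
  assumes g: "g \<in> P_grp (S2 k)" and h: "h \<in> P_grp (S2 k)"
    and e: "g $$ (0, 0) = h $$ (0, 0)" "mid g = mid h" "unip_vec g = unip_vec h"
  shows "g = h"
proof (rule eq_matI)
  note c = P_carrier[OF g] P_carrier[OF h]
  have "g $$ (Suc i, Suc j) = h $$ (Suc i, Suc j)" if "i < k" "j < k" for i j
    using arg_cong[OF e(2), of "\<lambda>A. A $$ (i, j)"] c that by simp
  moreover have "g $$ (Suc i, Suc k) = h $$ (Suc i, Suc k)" if "i < k" for i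
    using arg_cong[OF e(3), of "\<lambda>A. A $ i"] c that e(1) P_par(2)[OF g] by simp
  ultimately show "g $$ (i, j) = h $$ (i, j)" if "i < dim_row h" "j < dim_col h" for i j
    using that c P_first_row[OF g] P_first_row[OF h] e P_par[OF g] P_par[OF h]
      par_col[OF P_par(1)[OF g]] par_col[OF P_par(1)[OF h]] par_row[OF P_par(1)[OF g]] par_row[OF P_par(1)[OF h]]
    by (auto elim!: less_Suc_Suc_cases)
qed (use P_carrier[OF g] P_carrier[OF h] in auto)

end

section \<open>The parabolic subgroup\<close>

lemma odd2: "odd k \<Longrightarrow> odd (S2 k)"
  by simp

lemma s_mat_eq:
  assumes "x \<in> carrier_mat k k"
  shows "s_mat x a = mat (S2 k) (S2 k) (\<lambda>(i, j).
    if i = 0 then (if j = 0 then a else 0)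
    else if i = Suc k then (if j = Suc k then inverse a else 0)
    else if j = 0 \<or> j = Suc k then 0 else x $$ (i - 1, j - 1))"
  using assms by (intro eq_matI) (auto simp: s_mat_def Let_def)

lemma s_mat_simps [simp]:
  assumes "x \<in> carrier_mat k k"
  shows "s_mat x a \<in> carrier_mat (S2 k) (S2 k)"
    and "s_mat x a $$ (0, 0) = a" and "s_mat x a $$ (Suc k, Suc k) = inverse a"
    and "mid (s_mat x a) = x" and "unip_vec (s_mat x a) = 0\<^sub>v k"
    and "par (S2 k) (s_mat x a)"
    and "j < k \<Longrightarrow> s_mat x a $$ (0, Suc j) = 0" and "s_mat x a $$ (0, Suc k) = 0"
    and "i < k \<Longrightarrow> s_mat x a $$ (Suc i, Suc k) = 0"
  unfolding s_mat_eq[OF assms] using assms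
  by (auto simp: par_def intro!: eq_matI eq_vecI)

lemma levi_s_mat [simp]: "x \<in> carrier_mat k k \<Longrightarrow> levi (s_mat x a) = s_mat x a"
  by (simp add: levi_def)

lemma mult_mat_zero_vec: "A \<in> carrier_mat n m \<Longrightarrow> A *\<^sub>v 0\<^sub>v m = 0\<^sub>v n"
  by (intro eq_vecI) auto

context
  fixes k :: nat
  assumes odd_k: "odd k"
begin

lemma s_mat_in_P:
  fixes a :: "'a::field"
  assumes x: "x \<in> SO k" and a: "a \<noteq> 0"
  shows "s_mat x a \<in> P_grp (S2 k)"
proof -
  have c: "x \<in> carrier_mat k k" using x by (simp add: SO_iff)
  note s = s_mat_simps[OF c, where a = a]
  have "Q_odd (s_mat x a *\<^sub>v v) = Q_odd v" if v: "v \<in> carrier_vec (S2 k)" for v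
  proof -
    have "vec k (\<lambda>i. v $ Suc k * s_mat x a $$ (Suc i, Suc k)) = 0\<^sub>v k" by (intro eq_vecI) (auto simp: s)
    then have "midv (s_mat x a *\<^sub>v v) = x *\<^sub>v midv v"
      using par_mult_vec(3)[OF s(6) v] right_zero_vec[OF mult_mat_vec_carrier[OF c midv_carrier[OF v]]] by (simp add: s)
    moreover have "(s_mat x a *\<^sub>v v) $ 0 = a * v $ 0" "(s_mat x a *\<^sub>v v) $ Suc k = inverse a * v $ Suc k"
      using par_mult_vec(1,2)[OF s(6) v] by (simp_all add: s del: index_mult_mat_vec)
    moreover have "Q_odd (x *\<^sub>v midv v) = Q_odd (midv v)" using x v by (simp add: SO_iff)
    moreover have "s_mat x a *\<^sub>v v \<in> carrier_vec (S2 k)" using s(1) v by simp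
    ultimately show ?thesis using Q_odd_border[OF v odd_k] Q_odd_border[of "s_mat x a *\<^sub>v v" k] odd_k a
      by (simp del: index_mult_mat_vec)
  qed
  moreover have "det (s_mat x a) = 1" using det_par[OF s(6)] x a by (simp add: s SO_iff)
  ultimately show ?thesis using s par_col[OF s(6)] by (auto simp: P_grp_iff SO_iff)
qed

lemma u_mat_simps [simp]:
  fixes v :: "'a::field vec"
  assumes v: "v \<in> carrier_vec k"
  shows "u_mat (S2 k) v \<in> carrier_mat (S2 k) (S2 k)"
    and "u_mat (S2 k) v $$ (0, 0) = 1" and "u_mat (S2 k) v $$ (Suc k, Suc k) = 1"
    and "mid (u_mat (S2 k) v) = 1\<^sub>m k" and "unip_vec (u_mat (S2 k) v) = v"
    and "par (S2 k) (u_mat (S2 k) v)"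
    and "j < k \<Longrightarrow> u_mat (S2 k) v $$ (0, Suc j) = - polar Q_odd v (unit_vec k j)"
    and "u_mat (S2 k) v $$ (0, Suc k) = - Q_odd v"
    and "i < k \<Longrightarrow> u_mat (S2 k) v $$ (Suc i, Suc k) = v $ i"
  using v odd_k dot_col_J'[OF v odd_k]
  by (auto simp: u_mat_def par_def intro!: eq_matI eq_vecI)

text \<open>Adding a multiple of \<open>v\<close> to the middle coordinates changes
  \<open>Q_odd\<close> by a polar term and a multiple of \<open>Q_odd v\<close>. The first row of
  \<open>u_mat\<close> is chosen to cancel exactly these.\<close>

lemma u_mat_in_P:
  fixes v :: "'a::field vec"
  assumes v: "v \<in> carrier_vec k"
  shows "u_mat (S2 k) v \<in> P_grp (S2 k)"
proof -
  let ?u = "u_mat (S2 k) v"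
  note u = u_mat_simps[OF v]
  have "Q_odd (?u *\<^sub>v w) = Q_odd w" if w: "w \<in> carrier_vec (S2 k)" for w
  proof -
    let ?c = "w $ Suc k"
    note mw = midv_carrier[OF w]
    have "vec k (\<lambda>i. ?c * ?u $$ (Suc i, Suc k)) = ?c \<cdot>\<^sub>v v" using v by (intro eq_vecI) (auto simp: u)
    then have 1: "midv (?u *\<^sub>v w) = midv w + ?c \<cdot>\<^sub>v v"
      using par_mult_vec(3)[OF u(6) w] mw by (simp add: u)
    have "(\<Sum>j<k. ?u $$ (0, Suc j) * w $ Suc j) = - (\<Sum>j<k. midv w $ j * polar Q_odd (unit_vec k j) v)"
      using w v by (simp add: u sum_negf[symmetric] polar_sym[of "unit_vec k _" k v] mult.commute)
    also have "\<dots> = - polar Q_odd (midv w) v"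
      by (subst linear_functional[where f = "\<lambda>w. polar Q_odd w v", OF _ _ mw])
        (rule polar_add_left polar_smult_left v odd_k refl | assumption)+
    finally have 2: "(?u *\<^sub>v w) $ 0 = w $ 0 - polar Q_odd (midv w) v - Q_odd v * ?c" "(?u *\<^sub>v w) $ Suc k = ?c"
      using par_mult_vec(1,2)[OF u(6) w] by (simp_all add: u del: index_mult_mat_vec)
    have 3: "Q_odd (midv w + ?c \<cdot>\<^sub>v v) = Q_odd (midv w) + ?c\<^sup>2 * Q_odd v + ?c * polar Q_odd (midv w) v"
    proof -
      have "polar Q_odd (midv w) (?c \<cdot>\<^sub>v v) = ?c * polar Q_odd (midv w) v"
        using polar_smult_left[OF v mw odd_k, of ?c] polar_sym[OF mw v, of Q_odd]
          polar_sym[OF mw, of "?c \<cdot>\<^sub>v v" Q_odd] v by simp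
      then show ?thesis using Q_odd_smult[OF v odd_k, of ?c] by (simp add: polar_def algebra_simps)
    qed
    have 4: "?u *\<^sub>v w \<in> carrier_vec (S2 k)" using u w by simp
    show ?thesis unfolding Q_odd_border[OF 4 odd_k] Q_odd_border[OF w odd_k] 1 2 3
      by (simp add: algebra_simps power2_eq_square)
  qed
  moreover have "det ?u = 1" using det_par[OF u(6)] by (simp add: u)
  ultimately show ?thesis using u par_col[OF u(6)] by (auto simp: P_grp_iff SO_iff)
qed

lemma subgroup_P: "subgroup (P_grp (S2 k) :: 'a::field mat set) (GL (S2 k))"
proof -
  let ?N = "Suc (Suc k)"
  interpret group "GL ?N :: 'a mat monoid" by simp
  note S = subgroup_SO[of ?N, where 'a = 'a]
  show ?thesis
  proof (rule subgroupI)
    show "(P_grp ?N :: 'a mat set) \<subseteq> carrier (GL ?N)" by (rule subset_trans[OF _ subgroup.subset[OF S]]) (auto simp: P_grp_def)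
    have "1\<^sub>m ?N \<in> P_grp ?N" by (auto simp: P_grp_iff SO_iff)
    then show "P_grp ?N \<noteq> ({} :: 'a mat set)" by blast
    show "a \<otimes>\<^bsub>GL ?N\<^esub> b \<in> P_grp ?N" if "a \<in> P_grp ?N" "b \<in> P_grp ?N" for a b :: "'a mat"
      using that subgroup.m_closed[OF S, of a b] par_mult(1)[OF P_par(1)[OF odd_k, of a] P_par(1)[OF odd_k, of b]]
      by (auto simp: P_grp_iff par_def simp del: index_mult_mat(1))
    show "inv\<^bsub>GL ?N\<^esub> a \<in> P_grp ?N" if a: "a \<in> P_grp ?N" for a :: "'a mat"
    proof -
      let ?b = "inv\<^bsub>GL ?N\<^esub> a"
      have aS: "a \<in> SO ?N" using a by (simp add: P_grp_iff)
      then have bS: "?b \<in> SO ?N" by (rule subgroup.m_inv_closed[OF S])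
      have c: "a \<in> carrier_mat ?N ?N" "?b \<in> carrier_mat ?N ?N" using aS bS by (auto simp: SO_iff)
      have ba: "?b * a = 1\<^sub>m ?N" using l_inv[of a] aS subgroup.subset[OF S] by auto
      have "?b $$ (i, 0) = 0" if i: "0 < i" "i < ?N" for i
      proof -
        have "(?b * a) $$ (i, 0) = ?b $$ (i, 0) * a $$ (0, 0)"
          using mult_mat_entry[OF c(2,1) i(2), of 0] a par_col[OF P_par(1)[OF odd_k a]]
          by (simp add: sum.lessThan_Suc_shift del: sum.lessThan_Suc index_mult_mat(1))
        then show ?thesis using i P_par(2)[OF odd_k a] by (simp add: ba)
      qed
      then show ?thesis using bS by (simp add: P_grp_iff)
    qed
  qed
qed

section \<open>The Levi decomposition, and inflation from subsets of the Levi factor\<close>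

lemma P_mult:
  fixes g h :: "'a::field mat"
  assumes g: "g \<in> P_grp (S2 k)" and h: "h \<in> P_grp (S2 k)"
  shows "g * h \<in> P_grp (S2 k)"
    and "(g * h) $$ (0, 0) = g $$ (0, 0) * h $$ (0, 0)"
    and "mid (g * h) = mid g * mid h"
    and "unip_vec (g * h) = unip_vec g + g $$ (0, 0) \<cdot>\<^sub>v (mid g *\<^sub>v unip_vec h)"
proof -
  note p = P_par[OF odd_k g] P_par[OF odd_k h]
  show "g * h \<in> P_grp (S2 k)" using subgroup.m_closed[OF subgroup_P g h] by simp
  show "(g * h) $$ (0, 0) = g $$ (0, 0) * h $$ (0, 0)" "mid (g * h) = mid g * mid h"
    using par_mult(2,4)[OF p(1,5)] by simp_all
  show "unip_vec (g * h) = unip_vec g + g $$ (0, 0) \<cdot>\<^sub>v (mid g *\<^sub>v unip_vec h)"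
    by (rule unip_vec_mult[OF p(1,5)]) (simp add: p)
qed

text \<open>Seeing \<open>L_n\<close> as the fixed points of the projection \<open>levi\<close>
  reduces its closure properties to multiplicativity of \<open>levi\<close>.\<close>

lemma L_grp_iff:
  fixes g :: "'a::field mat"
  shows "g \<in> L_grp (S2 k) \<longleftrightarrow> g \<in> P_grp (S2 k) \<and> levi g = g"
proof
  assume "g \<in> L_grp (S2 k)"
  then obtain x a where xa: "g = s_mat x a" "x \<in> SO k" "a \<noteq> 0" by (auto simp: L_grp_def)
  then have "x \<in> carrier_mat k k" by (simp add: SO_iff)
  then show "g \<in> P_grp (S2 k) \<and> levi g = g" using s_mat_in_P[OF xa(2,3)] xa(1) by simp
next
  assume g: "g \<in> P_grp (S2 k) \<and> levi g = g"
  then have "g = s_mat (mid g) (g $$ (0, 0))" by (simp add: levi_def)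
  then show "g \<in> L_grp (S2 k)"
    using P_par[OF odd_k, of g] g by (auto simp: L_grp_def intro!: exI[of _ "mid g"] exI[of _ "g $$ (0,0)"])
qed

lemma P_mid_carrier: "g \<in> P_grp (S2 k) \<Longrightarrow> mid g \<in> carrier_mat k k"
  by (rule mid_carrier) (rule P_carrier[OF odd_k])

lemma levi_simps:
  fixes g :: "'a::field mat"
  assumes g: "g \<in> P_grp (S2 k)"
  shows "levi g \<in> P_grp (S2 k)" "levi g $$ (0, 0) = g $$ (0, 0)" "mid (levi g) = mid g"
    "unip_vec (levi g) = 0\<^sub>v k" "levi (levi g) = levi g" "levi g \<in> L_grp (S2 k)"
proof -
  note m = P_mid_carrier[OF g]
  show 1: "levi g \<in> P_grp (S2 k)"
    unfolding levi_def by (rule s_mat_in_P) (use P_par[OF odd_k g] in auto)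
  show "levi g $$ (0, 0) = g $$ (0, 0)" "mid (levi g) = mid g"
    "unip_vec (levi g) = 0\<^sub>v k" and 2: "levi (levi g) = levi g"
    unfolding levi_def using m by simp_all
  show "levi g \<in> L_grp (S2 k)" using 1 2 by (simp add: L_grp_iff)
qed

lemma levi_mult:
  fixes g h :: "'a::field mat"
  assumes g: "g \<in> P_grp (S2 k)" and h: "h \<in> P_grp (S2 k)"
  shows "levi (g * h) = levi g * levi h"
proof (rule P_eqI[OF odd_k])
  note lg = levi_simps[OF g] and lh = levi_simps[OF h]
  note gh = P_mult[OF g h] and lgh = P_mult[OF lg(1) lh(1)]
  note l = levi_simps[OF gh(1)]
  note m = P_mid_carrier[OF g]
  show "levi (g * h) \<in> P_grp (S2 k)" by (rule l)
  show "levi g * levi h \<in> P_grp (S2 k)" by (rule lgh)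
  show "levi (g * h) $$ (0, 0) = (levi g * levi h) $$ (0, 0)" by (simp only: l gh lgh lg lh)
  show "mid (levi (g * h)) = mid (levi g * levi h)" by (simp only: l gh lgh lg lh)
  show "unip_vec (levi (g * h)) = unip_vec (levi g * levi h)"
    unfolding l lgh(4) lg lh mult_mat_zero_vec[OF m] by (intro eq_vecI) auto
qed

lemma P_decomp:
  fixes g :: "'a::field mat"
  assumes g: "g \<in> P_grp (S2 k)"
  shows "g = u_mat (S2 k) (unip_vec g) * levi g"
proof (rule P_eqI[OF odd_k g])
  note u = u_mat_in_P[OF unip_vec_carrier[OF P_carrier[OF odd_k g]]]
    u_mat_simps[OF unip_vec_carrier[OF P_carrier[OF odd_k g]]]
  note l = levi_simps[OF g] and p = P_mult[OF u(1) levi_simps(1)[OF g]]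
  show "u_mat (S2 k) (unip_vec g) * levi g \<in> P_grp (S2 k)" by (rule p)
  show "g $$ (0, 0) = (u_mat (S2 k) (unip_vec g) * levi g) $$ (0, 0)"
    unfolding p u l by simp
  show "mid g = mid (u_mat (S2 k) (unip_vec g) * levi g)"
    unfolding p u l left_mult_one_mat[OF P_mid_carrier[OF g]] ..
  show "unip_vec g = unip_vec (u_mat (S2 k) (unip_vec g) * levi g)"
    unfolding p(4) u l using P_carrier[OF odd_k g] by (intro eq_vecI) auto
qed

lemma u_mult_L:
  fixes v :: "'a::field vec"
  assumes v: "v \<in> carrier_vec k" and l: "l \<in> L_grp (S2 k)"
  shows "u_mat (S2 k) v * l \<in> P_grp (S2 k)"
    "levi (u_mat (S2 k) v * l) = l" "unip_vec (u_mat (S2 k) v * l) = v"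
proof -
  have lP: "l \<in> P_grp (S2 k)" "levi l = l" using l by (auto simp: L_grp_iff)
  note p = P_mult[OF u_mat_in_P[OF v] lP(1)]
  show "u_mat (S2 k) v * l \<in> P_grp (S2 k)" by (rule p)
  show "levi (u_mat (S2 k) v * l) = l"
    using v left_mult_one_mat[OF P_mid_carrier[OF lP(1)]] lP(2) by (simp add: p levi_def)
  have "unip_vec l = 0\<^sub>v k" using levi_simps(4)[OF lP(1)] lP(2) by simp
  then show "unip_vec (u_mat (S2 k) v * l) = v"
    unfolding p(4) using v by (intro eq_vecI) auto
qed

text \<open>Stated for every subset of \<open>L_n\<close>, so that one description serves
  \<open>L_n\<close> itself and the complements \<open>P_tilde\<close>, \<open>L_plus\<close>,
  \<open>L_minus\<close> in the inertia groups.\<close>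

lemma U_mult_L:
  assumes C: "C \<subseteq> L_grp (S2 k)"
  shows "U_grp (S2 k) <#>\<^bsub>GL (S2 k)\<^esub> C = {g \<in> P_grp (S2 k). levi g \<in> (C :: 'a::field mat set)}"
proof (intro equalityI subsetI)
  fix g assume "g \<in> U_grp (S2 k) <#>\<^bsub>GL (S2 k)\<^esub> C"
  then obtain v l where "g = u_mat (S2 k) v * l" "v \<in> carrier_vec k" "l \<in> C"
    by (auto simp: set_mult_def U_grp_def)
  then show "g \<in> {g \<in> P_grp (S2 k). levi g \<in> C}" using u_mult_L[of v l] C by auto
next
  fix g assume g: "g \<in> {g \<in> P_grp (S2 k). levi g \<in> C}"
  then have "unip_vec g \<in> carrier_vec k" using P_carrier[OF odd_k, of g] by simp
  then show "g \<in> U_grp (S2 k) <#>\<^bsub>GL (S2 k)\<^esub> C"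
    using g P_decomp[of g] by (auto simp: set_mult_def U_grp_def)
qed

text \<open>The definite description in \<open>infl\<close> has a unique solution because
  \<open>levi\<close> recovers the second factor of a product \<open>u * l\<close>.\<close>

lemma infl_U_L:
  assumes C: "C \<subseteq> L_grp (S2 k)"
  shows "infl (GL (S2 k)) (U_grp (S2 k)) C \<theta> =
    (\<lambda>g :: 'a::field mat. if g \<in> P_grp (S2 k) \<and> levi g \<in> C then \<theta> (levi g) else 0)"
proof -
  have "(THE l. l \<in> C \<and> (\<exists>u\<in>U_grp (S2 k). g = u * l)) = levi g"
    if g: "g \<in> P_grp (S2 k)" "levi g \<in> C" for g
  proof (rule the_equality)
    have "unip_vec g \<in> carrier_vec k" using P_carrier[OF odd_k g(1)] by simp
    then show "levi g \<in> C \<and> (\<exists>u\<in>U_grp (S2 k). g = u * levi g)"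
      using g P_decomp[of g] by (auto simp: U_grp_def)
    fix l assume "l \<in> C \<and> (\<exists>u\<in>U_grp (S2 k). g = u * l)"
    then obtain v where "l \<in> C" "v \<in> carrier_vec k" "g = u_mat (S2 k) v * l" by (auto simp: U_grp_def)
    then show "l = levi g" using u_mult_L(2)[of v l] C by auto
  qed
  then show ?thesis unfolding infl_def U_mult_L[OF C] by (auto simp: fun_eq_iff)
qed

lemma ext_char_U_L:
  assumes C: "C \<subseteq> L_grp (S2 k)"
  shows "ext_char (GL (S2 k)) (U_grp (S2 k)) C (U_char (S2 k) f) =
    (\<lambda>g :: 'a::field mat. if g \<in> P_grp (S2 k) \<and> levi g \<in> C then f (unip_vec g) else 0)"
proof -
  have inj: "inj_on (u_mat (S2 k)) (carrier_vec k :: 'a vec set)"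
    by (rule inj_on_inverseI[where g = unip_vec]) simp
  have "(THE u. u \<in> U_grp (S2 k) \<and> (\<exists>l\<in>C. g = u * l)) = u_mat (S2 k) (unip_vec g)"
    if g: "g \<in> P_grp (S2 k)" "levi g \<in> C" for g
  proof (rule the_equality)
    have "unip_vec g \<in> carrier_vec k" using P_carrier[OF odd_k g(1)] by simp
    then show "u_mat (S2 k) (unip_vec g) \<in> U_grp (S2 k) \<and>
        (\<exists>l\<in>C. g = u_mat (S2 k) (unip_vec g) * l)"
      using g P_decomp[of g] by (auto simp: U_grp_def)
    fix u assume "u \<in> U_grp (S2 k) \<and> (\<exists>l\<in>C. g = u * l)"
    then obtain v l where "l \<in> C" "v \<in> carrier_vec k" "g = u_mat (S2 k) v * l" "u = u_mat (S2 k) v"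
      by (auto simp: U_grp_def)
    then show "u = u_mat (S2 k) (unip_vec g)" using u_mult_L(3)[of v l] C by auto
  qed
  moreover have "U_char (S2 k) f (u_mat (S2 k) v) = f v" if "v \<in> carrier_vec k" for v
    using that by (auto simp: U_char_def U_grp_def the_inv_into_f_f[OF inj])
  moreover have "unip_vec g \<in> carrier_vec k" if "g \<in> P_grp (S2 k)" for g :: "'a mat"
    using P_carrier[OF odd_k that] by simp
  ultimately show ?thesis unfolding ext_char_def U_mult_L[OF C] by (auto simp: fun_eq_iff)
qed

end

section \<open>Finiteness and orders\<close>

lemma finite_carrier_mat [simp]: "finite (carrier_mat n m :: 'a::{zero,finite} mat set)"
proof -
  have "carrier_mat n m \<subseteq> (\<lambda>f. mat n m f) ` (({..<n} \<times> {..<m}) \<rightarrow>\<^sub>E (UNIV :: 'a set))"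
  proof
    fix A :: "'a mat" assume A: "A \<in> carrier_mat n m"
    let ?f = "restrict (\<lambda>ij. A $$ ij) ({..<n} \<times> {..<m})"
    show "A \<in> (\<lambda>f. mat n m f) ` (({..<n} \<times> {..<m}) \<rightarrow>\<^sub>E (UNIV :: 'a set))"
    proof (rule image_eqI)
      show "A = mat n m ?f" using A by (intro eq_matI) auto
    qed simp
  qed
  then show ?thesis by (rule finite_subset) (intro finite_imageI finite_PiE, auto)
qed

lemma card_carrier_vec: "card (carrier_vec n :: 'a::{zero,finite} vec set) = card (UNIV :: 'a set) ^ n"
proof -
  have "bij_betw (\<lambda>f. vec n f) ({..<n} \<rightarrow>\<^sub>E (UNIV :: 'a set)) (carrier_vec n)"
    by (rule bij_betwI[where g = "\<lambda>v. restrict (\<lambda>i. v $ i) {..<n}"])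
       (auto intro!: eq_vecI simp: fun_eq_iff PiE_def extensional_def)
  then have "card (carrier_vec n :: 'a vec set) = card ({..<n} \<rightarrow>\<^sub>E (UNIV :: 'a set))"
    using bij_betw_same_card by metis
  then show ?thesis by (simp add: card_PiE)
qed

lemma card_U_mult_L:
  assumes k: "odd k" and C: "C \<subseteq> L_grp (S2 k)"
  shows "card {g \<in> P_grp (S2 k). levi g \<in> (C :: 'a::{field,finite} mat set)} = card (UNIV :: 'a set) ^ k * card C"
proof -
  have "bij_betw (\<lambda>(v, l). u_mat (S2 k) v * l) (carrier_vec k \<times> C) {g \<in> P_grp (S2 k). levi g \<in> C}"
  proof (rule bij_betwI[where g = "\<lambda>g. (unip_vec g, levi g)"])
    show "(\<lambda>(v, l). u_mat (S2 k) v * l) \<in> carrier_vec k \<times> C \<rightarrow> {g \<in> P_grp (S2 k). levi g \<in> C}"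
      using C by (auto simp: u_mult_L(1,2)[OF k _ subsetD[OF C]])
    show "(\<lambda>g. (unip_vec g, levi g)) \<in> {g \<in> P_grp (S2 k). levi g \<in> C} \<rightarrow> carrier_vec k \<times> C"
      by (auto intro!: unip_vec_carrier P_carrier[OF k])
    show "(unip_vec ((\<lambda>(v, l). u_mat (S2 k) v * l) x), levi ((\<lambda>(v, l). u_mat (S2 k) v * l) x)) = x"
      if "x \<in> carrier_vec k \<times> C" for x
      using that by (auto simp: u_mult_L(2,3)[OF k _ subsetD[OF C]])
  qed (auto simp: P_decomp[OF k, symmetric])
  then have "card ((carrier_vec k :: 'a vec set) \<times> C) = card {g \<in> P_grp (S2 k). levi g \<in> C}"
    by (rule bij_betw_same_card)
  then show ?thesis by (simp add: card_carrier_vec card_cartesian_product)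
qed

section \<open>The group \<open>R Q\<^sub>K\<close>\<close>

definition swap4 :: "nat \<Rightarrow> nat \<Rightarrow> nat" where
  "swap4 n i = (if i = 0 then 1 else if i = 1 then 0
     else if i = n - 2 then n - 1 else if i = n - 1 then n - 2 else i)"

lemma diag_block_mat3:
  assumes "A \<in> carrier_mat a a" "B \<in> carrier_mat b b" "C \<in> carrier_mat c c"
  shows "diag_block_mat [A, B, C] = mat (a + b + c) (a + b + c) (\<lambda>(i, j).
    if i < a then (if j < a then A $$ (i, j) else 0)
    else if i < a + b then (if a \<le> j \<and> j < a + b then B $$ (i - a, j - a) else 0)
    else if a + b \<le> j then C $$ (i - a - b, j - a - b) else 0)"
  using assms by (intro eq_matI) (auto simp: Let_def)

lemma J2_entry [simp]: "i < 2 \<Longrightarrow> j < 2 \<Longrightarrow> J2 $$ (i, j) = (if i \<noteq> j then 1 else 0)"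
  "dim_row J2 = 2" "dim_col J2 = 2" "J2 \<in> carrier_mat 2 2"
  by (simp_all add: J2_def)

lemma s_elt_entry:
  assumes k: "k > 0" and ij: "i < (S4 k)" "j < (S4 k)"
  shows "s_elt (S4 k) $$ (i, j) = (if j = swap4 (S4 k) i then 1 else (0::'a::field))"
proof -
  have e: "s_elt (S4 k) $$ (i, j) =
    (if i < 2 then (if j < 2 then J2 $$ (i, j) else 0)
    else if i < 2 + k then (if 2 \<le> j \<and> j < 2 + k then 1\<^sub>m k $$ (i - 2, j - 2) else 0)
    else if 2 + k \<le> j then J2 $$ (i - 2 - k, j - 2 - k) else (0::'a))"
  proof -
    have "s_elt (S4 k) = diag_block_mat [J2, 1\<^sub>m k, J2 :: 'a mat]" by (simp add: s_elt_def)
    also note diag_block_mat3[OF J2_entry(4) one_carrier_mat J2_entry(4)]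
    finally have "s_elt (S4 k) $$ (i, j) = mat (2 + k + 2) (2 + k + 2) (\<lambda>(i, j).
      if i < 2 then (if j < 2 then J2 $$ (i, j) else 0)
      else if i < 2 + k then (if 2 \<le> j \<and> j < 2 + k then 1\<^sub>m k $$ (i - 2, j - 2) else 0)
      else if 2 + k \<le> j then J2 $$ (i - 2 - k, j - 2 - k) else (0::'a)) $$ (i, j)" by (rule arg_cong)
    moreover have "i < 2 + k + 2" "j < 2 + k + 2" using ij by linarith+
    ultimately show ?thesis by (simp only: index_mat split)
  qed
  consider "i = 0" | "i = 1" | "2 \<le> i" "i < 2 + k" | "i = 2 + k" | "i = 3 + k" using ij by linarith
  then show ?thesis
  proof cases
    case 1
    have "s_elt (S4 k) $$ (i, j) = (if j < 2 then J2 $$ (i, j) else (0::'a))" unfolding e using 1 by simp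
    moreover have "swap4 (S4 k) i = 1" using 1 by (simp add: swap4_def)
    ultimately show ?thesis using 1 by (auto simp: less_2_cases_iff)
  next
    case 2
    have "s_elt (S4 k) $$ (i, j) = (if j < 2 then J2 $$ (i, j) else (0::'a))" unfolding e using 2 by simp
    moreover have "swap4 (S4 k) i = 0" using 2 by (simp add: swap4_def)
    ultimately show ?thesis using 2 by (auto simp: less_2_cases_iff)
  next
    case 3
    have "s_elt (S4 k) $$ (i, j) = (if 2 \<le> j \<and> j < 2 + k then 1\<^sub>m k $$ (i - 2, j - 2) else (0::'a))"
      unfolding e using 3 by simp
    moreover have "swap4 (S4 k) i = i" using 3 by (simp add: swap4_def)
    moreover have "i - 2 < k" "j < 2 + k \<Longrightarrow> 2 \<le> j \<Longrightarrow> j - 2 < k" "2 \<le> j \<Longrightarrow> (i - 2 = j - 2) = (j = i)"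
      using 3 by linarith+
    ultimately show ?thesis using 3 by auto
  next
    case 4
    have "s_elt (S4 k) $$ (i, j) = (if 2 + k \<le> j then J2 $$ (i - 2 - k, j - 2 - k) else (0::'a))"
      unfolding e using 4 by simp
    moreover have "swap4 (S4 k) i = 3 + k" using 4 k by (simp add: swap4_def)
    moreover have "j < 2 + k \<or> j = 2 + k \<or> j = 3 + k" using ij by linarith
    ultimately show ?thesis using 4 by auto
  next
    case 5
    have "s_elt (S4 k) $$ (i, j) = (if 2 + k \<le> j then J2 $$ (i - 2 - k, j - 2 - k) else (0::'a))"
      unfolding e using 5 by simp
    moreover have "swap4 (S4 k) i = 2 + k" using 5 k by (simp add: swap4_def)
    moreover have "j < 2 + k \<or> j = 2 + k \<or> j = 3 + k" using ij by linarith
    ultimately show ?thesis using 5 by auto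
  qed
qed

lemma s_elt_carrier [simp]: "(s_elt (S4 k) :: 'a::field mat) \<in> carrier_mat (S4 k) (S4 k)"
proof -
  have "s_elt (S4 k) = diag_block_mat [J2, 1\<^sub>m k, J2 :: 'a::field mat]" by (simp add: s_elt_def)
  also note diag_block_mat3[OF J2_entry(4) one_carrier_mat J2_entry(4)]
  finally show ?thesis by simp
qed

lemma swap4_simps [simp]:
  "swap4 (S4 k) 0 = Suc 0" "swap4 (S4 k) (Suc 0) = 0"
  "k > 0 \<Longrightarrow> swap4 (S4 k) (S2 k) = Suc (S2 k)" "k > 0 \<Longrightarrow> swap4 (S4 k) (Suc (S2 k)) = (S2 k)"
  "i < k \<Longrightarrow> swap4 (S4 k) (Suc (Suc i)) = Suc (Suc i)"
  by (simp_all add: swap4_def)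

lemma swap4_less: "k > 0 \<Longrightarrow> i < (S4 k) \<Longrightarrow> swap4 (S4 k) i < (S4 k)"
  by (simp add: swap4_def)

lemma swap4_swap4: "k > 0 \<Longrightarrow> i < (S4 k) \<Longrightarrow> swap4 (S4 k) (swap4 (S4 k) i) = i"
  by (simp add: swap4_def)

lemma swap4_eq_iff: "k > 0 \<Longrightarrow> i < (S4 k) \<Longrightarrow> j < (S4 k) \<Longrightarrow> j = swap4 (S4 k) i \<longleftrightarrow> i = swap4 (S4 k) j"
  using swap4_swap4 by metis

lemma s_elt_mult:
  fixes g :: "'a::field mat"
  assumes k: "k > 0" and g: "g \<in> carrier_mat (S4 k) (S4 k)" and ij: "i < (S4 k)" "j < (S4 k)"
  shows "(s_elt (S4 k) * g) $$ (i, j) = g $$ (swap4 (S4 k) i, j)"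
    and "(g * s_elt (S4 k)) $$ (i, j) = g $$ (i, swap4 (S4 k) j)"
proof -
  have "(s_elt (S4 k) * g) $$ (i, j) = (\<Sum>l<(S4 k). if l = swap4 (S4 k) i then g $$ (l, j) else 0)"
    unfolding mult_mat_entry[OF s_elt_carrier g ij]
    by (rule sum.cong) (use ij in \<open>auto simp: s_elt_entry[OF k]\<close>)
  also have "\<dots> = g $$ (swap4 (S4 k) i, j)" using swap4_less[OF k ij(1)] by (subst sum.delta) auto
  finally show "(s_elt (S4 k) * g) $$ (i, j) = g $$ (swap4 (S4 k) i, j)" .
  have "(g * s_elt (S4 k)) $$ (i, j) = (\<Sum>l<(S4 k). if l = swap4 (S4 k) j then g $$ (i, l) else 0)"
    unfolding mult_mat_entry[OF g s_elt_carrier ij]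
    by (rule sum.cong) (use ij in \<open>auto simp: s_elt_entry[OF k] swap4_eq_iff[OF k _ ij(2)]\<close>)
  also have "\<dots> = g $$ (i, swap4 (S4 k) j)" using swap4_less[OF k ij(2)] by (subst sum.delta) auto
  finally show "(g * s_elt (S4 k)) $$ (i, j) = g $$ (i, swap4 (S4 k) j)" .
qed

lemma s_elt_conj:
  fixes g :: "'a::field mat"
  assumes k: "k > 0" and g: "g \<in> carrier_mat (S4 k) (S4 k)" and ij: "i < (S4 k)" "j < (S4 k)"
  shows "(s_elt (S4 k) * g * s_elt (S4 k)) $$ (i, j) = g $$ (swap4 (S4 k) i, swap4 (S4 k) j)"
proof -
  have sg: "s_elt (S4 k) * g \<in> carrier_mat (S4 k) (S4 k)" using g s_elt_carrier by (rule mult_carrier_mat[rotated])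
  show ?thesis unfolding s_elt_mult(2)[OF k sg ij] by (rule s_elt_mult(1)[OF k g ij(1) swap4_less[OF k ij(2)]])
qed

lemma s_elt_square:
  assumes k: "k > 0"
  shows "s_elt (S4 k) * s_elt (S4 k) = (1\<^sub>m (S4 k) :: 'a::field mat)"
proof (rule eq_matI)
  fix i j assume "i < dim_row (1\<^sub>m (S4 k) :: 'a mat)" "j < dim_col (1\<^sub>m (S4 k) :: 'a mat)"
  then have ij: "i < (S4 k)" "j < (S4 k)" by auto
  show "(s_elt (S4 k) * s_elt (S4 k)) $$ (i, j) = (1\<^sub>m (S4 k) :: 'a mat) $$ (i, j)"
    unfolding s_elt_mult(1)[OF k s_elt_carrier ij] s_elt_entry[OF k swap4_less[OF k ij(1)] ij(2)]
    using ij swap4_swap4[OF k ij(1)] by auto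
qed (use carrier_matD[OF s_elt_carrier[of k, where 'a = 'a]] in simp_all)

lemma s_elt_GL:
  assumes k: "k > 0"
  shows "s_elt (S4 k) \<in> carrier (GL (S4 k) :: 'a::field mat monoid)"
    "inv\<^bsub>GL (S4 k)\<^esub> s_elt (S4 k) = (s_elt (S4 k) :: 'a mat)"
proof -
  interpret group "GL (S4 k) :: 'a mat monoid" by simp
  have "det (s_elt (S4 k) * s_elt (S4 k) :: 'a mat) = 1" using s_elt_square[OF k, where 'a = 'a] by simp
  then have "det (s_elt (S4 k) :: 'a mat) * det (s_elt (S4 k)) = 1" using det_mult[OF s_elt_carrier s_elt_carrier] by metis
  then have "det (s_elt (S4 k) :: 'a mat) \<noteq> 0" by auto
  then show 1: "s_elt (S4 k) \<in> carrier (GL (S4 k) :: 'a mat monoid)" by (simp only: GL_carrier s_elt_carrier simp_thms not_False_eq_True)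
  show "inv\<^bsub>GL (S4 k)\<^esub> s_elt (S4 k) = (s_elt (S4 k) :: 'a mat)"
    by (rule inv_equality) (simp_all add: s_elt_square[OF k] 1)
qed

text \<open>Two applications of \<open>Q_odd_border\<close> split off two hyperbolic planes, and
  \<open>s_elt\<close> interchanges them.\<close>

lemma s_elt_GO:
  assumes k: "odd k"
  shows "s_elt (S4 k) \<in> (isometries (S4 k) Q_odd :: 'a::field mat set)"
proof -
  have k0: "k > 0" using k by (rule odd_pos)
  have "Q_odd (s_elt (S4 k) *\<^sub>v v) = Q_odd v" if v: "v \<in> carrier_vec (S4 k)" for v :: "'a vec"
  proof -
    have sv: "s_elt (S4 k) *\<^sub>v v \<in> carrier_vec (S4 k)" using s_elt_carrier v by (rule mult_mat_vec_carrier)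
    have e: "(s_elt (S4 k) *\<^sub>v v) $ i = v $ swap4 (S4 k) i" if i: "i < (S4 k)" for i
    proof -
      have "(s_elt (S4 k) *\<^sub>v v) $ i = (\<Sum>l<(S4 k). if l = swap4 (S4 k) i then v $ l else 0)"
        unfolding mult_mat_vec_entry[OF s_elt_carrier v i]
        by (rule sum.cong) (use i in \<open>auto simp: s_elt_entry[OF k0]\<close>)
      also have "\<dots> = v $ swap4 (S4 k) i" using swap4_less[OF k0 i] by (subst sum.delta) auto
      finally show ?thesis .
    qed
    have m: "midv (midv (s_elt (S4 k) *\<^sub>v v)) = midv (midv v)"
      using carrier_vecD[OF v] carrier_vecD[OF sv] by (intro eq_vecI) (simp_all add: e del: index_mult_mat_vec dim_mult_mat_vec)
    have k2: "odd (S2 k)" using k by simp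
    have mm: "midv (s_elt (S4 k) *\<^sub>v v) $ i = (s_elt (S4 k) *\<^sub>v v) $ Suc i" "midv v $ i = v $ Suc i" if "i < (S2 k)" for i
      using that carrier_vecD[OF v] carrier_vecD[OF sv] by simp_all
    show ?thesis
      unfolding Q_odd_border[OF sv k2] Q_odd_border[OF midv_carrier[OF sv] k] Q_odd_border[OF v k2] Q_odd_border[OF midv_carrier[OF v] k] m
      using k0 by (simp add: mm e del: index_mult_mat_vec)
  qed
  then show ?thesis using s_elt_GL(1)[OF k0, where 'a = 'a] by (auto simp: isometries_def)
qed

lemma s_conj_SO:
  assumes k: "odd k" and g: "g \<in> carrier_mat (S4 k) (S4 k)"
  shows "s_elt (S4 k) * g * s_elt (S4 k) \<in> SO (S4 k) \<longleftrightarrow> (g :: 'a::field mat) \<in> SO (S4 k)"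
proof -
  have k0: "k > 0" using k by (rule odd_pos)
  let ?s = "s_elt (S4 k) :: 'a mat"
  interpret group "GL (S4 k) :: 'a mat monoid" by simp
  note sc = s_elt_carrier[of k, where 'a = 'a]
  have *: "?s * h * ?s \<in> SO (S4 k)" if h: "h \<in> SO (S4 k)" for h
  proof -
    have hc: "h \<in> carrier_mat (S4 k) (S4 k)" using h by (simp only: SO_iff)
    have "?s \<otimes>\<^bsub>GL (S4 k)\<^esub> h \<otimes>\<^bsub>GL (S4 k)\<^esub> ?s \<in> isometries (S4 k) Q_odd"
      using subgroup.m_closed[OF subgroup_isometries] s_elt_GO[OF k, where 'a = 'a] SO_isometry[OF h] by blast
    moreover have "det (?s * h * ?s) = det h"
    proof -
      have "det (?s * h * ?s) = det ?s * det ?s * det h"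
        using det_mult[OF mult_carrier_mat[OF sc hc] sc] det_mult[OF sc hc] by (simp only: ac_simps)
      also have "det ?s * det ?s = 1"
        using det_mult[OF sc sc] s_elt_square[OF k0, where 'a = 'a] by (metis det_one)
      finally show ?thesis by simp
    qed
    ultimately show ?thesis using h by (simp add: SO_def GO_def)
  qed
  have "?s * (?s * g * ?s) * ?s = g"
  proof -
    have "?s * (?s * g * ?s) * ?s = (?s * ?s) * g * (?s * ?s)"
      using sc g by (simp only: assoc_mult_mat[of _ "(S4 k)" "(S4 k)" _ "(S4 k)" _ "(S4 k)"] mult_carrier_mat[of _ "(S4 k)" "(S4 k)" _ "(S4 k)"])
    then show ?thesis using g by (simp add: s_elt_square[OF k0])
  qed
  then show ?thesis using * by metis
qed

text \<open>The group \<open>R Q_K\<close> in coordinates, as \<open>RQK_eq\<close> shows. Index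
  \<open>n - 3\<close> is the last coordinate of a vector of dimension \<open>n - 2\<close>, the one
  that vanishes on \<open>R\<close>.\<close>

definition K_grp :: "nat \<Rightarrow> 'a::field mat set" where
  "K_grp n = {g \<in> P_grp n. mid g \<in> P_grp (n - 2) \<and> unip_vec g $ (n - 3) = 0}"

context
  fixes k :: nat
  assumes odd_k: "odd k"
begin

private lemma k0: "k > 0" using odd_k by (rule odd_pos)

text \<open>By \<open>P_first_row\<close> this entry pairs the image of \<open>e_{m-1}\<close>, here
  a multiple of \<open>e_{m-1}\<close>, with the unipotent vector. Hence the condition that defines
  \<open>R\<close> says that \<open>g\<close> also fixes the line of \<open>e_{m-1}\<close>.\<close>

lemma P_row_0_1:
  fixes g :: "'a::field mat"
  assumes g: "g \<in> P_grp (S4 k)" and m: "mid g \<in> P_grp (S2 k)"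
  shows "g $$ (0, Suc 0) = - (mid g $$ (0, 0) * unip_vec g $ Suc k)"
proof -
  note c = P_carrier[OF odd_k m]
  have u: "unip_vec g \<in> carrier_vec (S2 k)" using P_carrier[OF odd2[OF odd_k] g] by (rule unip_vec_carrier)
  have e: "mid g *\<^sub>v unit_vec (S2 k) 0 = mid g $$ (0, 0) \<cdot>\<^sub>v unit_vec (S2 k) 0"
    by (intro eq_vecI) (use c par_col[OF P_par(1)[OF odd_k m]] in \<open>auto simp: mult_mat_vec_unit[OF c] simp del: index_mult_mat_vec\<close>)
  show ?thesis using P_first_row(1)[OF odd2[OF odd_k] g, of 0]
    by (simp add: e polar_smult_left[OF unit_vec_carrier u odd2[OF odd_k]] polar_unit_0[OF odd_k u])
qed

text \<open>The group is the joint stabilizer of the lines of \<open>e_m\<close> and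
  \<open>e_{m-1}\<close>. As \<open>s_elt\<close> interchanges these two vectors, invariance under
  conjugation by \<open>s_elt\<close> becomes visible.\<close>

lemma K_grp_iff:
  fixes g :: "'a::field mat"
  shows "g \<in> K_grp (S4 k) \<longleftrightarrow> g \<in> SO (S4 k) \<and> (\<forall>i<(S4 k). i \<noteq> 0 \<longrightarrow> g $$ (i, 0) = 0) \<and> (\<forall>i<(S4 k). i \<noteq> Suc 0 \<longrightarrow> g $$ (i, Suc 0) = 0)"
proof (cases "g \<in> P_grp (S4 k)")
  case True
  note c = P_carrier[OF odd2[OF odd_k] True] and p = P_par[OF odd2[OF odd_k] True]
  have SO: "g \<in> SO (S4 k)" "\<forall>i<(S4 k). i \<noteq> 0 \<longrightarrow> g $$ (i, 0) = 0" using True by (auto simp: P_grp_iff)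
  have "mid g \<in> P_grp (S2 k) \<longleftrightarrow> (\<forall>i. 0 < i \<longrightarrow> i < (S2 k) \<longrightarrow> g $$ (Suc i, Suc 0) = 0)"
    using p(4) c by (auto simp: P_grp_iff)
  also have "\<dots> \<longleftrightarrow> (\<forall>i<(S4 k). i \<noteq> Suc 0 \<and> i \<noteq> 0 \<longrightarrow> g $$ (i, Suc 0) = 0)"
  proof (intro iffI allI impI)
    fix i assume H: "\<forall>i. 0 < i \<longrightarrow> i < (S2 k) \<longrightarrow> g $$ (Suc i, Suc 0) = 0" and i: "i < (S4 k)" "i \<noteq> Suc 0 \<and> i \<noteq> 0"
    show "g $$ (i, Suc 0) = 0"
    proof (cases "i = Suc (S2 k)")
      case True
      then show ?thesis using par_row[OF p(1), of 1] by simp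
    next
      case False
      then show ?thesis using H[rule_format, of "i - 1"] i by simp
    qed
  next
    fix i assume "\<forall>i<(S4 k). i \<noteq> Suc 0 \<and> i \<noteq> 0 \<longrightarrow> g $$ (i, Suc 0) = 0" "0 < i" "i < (S2 k)"
    then show "g $$ (Suc i, Suc 0) = 0" by simp
  qed
  finally have 1: "mid g \<in> P_grp (S2 k) \<longleftrightarrow> (\<forall>i<(S4 k). i \<noteq> Suc 0 \<and> i \<noteq> 0 \<longrightarrow> g $$ (i, Suc 0) = 0)" .
  have 2: "g $$ (0, Suc 0) = 0 \<longleftrightarrow> unip_vec g $ Suc k = 0" if "mid g \<in> P_grp (S2 k)"
    using P_row_0_1[OF True that] P_par(2)[OF odd_k that] by simp
  have 3: "(\<forall>i<(S4 k). i \<noteq> Suc 0 \<longrightarrow> g $$ (i, Suc 0) = 0) \<longleftrightarrow>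
    (\<forall>i<(S4 k). i \<noteq> Suc 0 \<and> i \<noteq> 0 \<longrightarrow> g $$ (i, Suc 0) = 0) \<and> g $$ (0, Suc 0) = 0"
    by (metis zero_less_Suc n_not_Suc_n)
  have 4: "g \<in> K_grp (S4 k) \<longleftrightarrow> mid g \<in> P_grp (S2 k) \<and> unip_vec g $ Suc k = 0" using True by (simp add: K_grp_def)
  show ?thesis unfolding 3 4 using SO 1 2 by blast
next
  case False
  then show ?thesis by (auto simp: K_grp_def P_grp_iff)
qed

lemma s_conj_K:
  fixes g :: "'a::field mat"
  assumes g: "g \<in> carrier_mat (S4 k) (S4 k)"
  shows "s_elt (S4 k) * g * s_elt (S4 k) \<in> K_grp (S4 k) \<longleftrightarrow> g \<in> K_grp (S4 k)"
proof -
  have b: "(\<forall>i<(S4 k). P i) \<longleftrightarrow> (\<forall>i<(S4 k). P (swap4 (S4 k) i))" for P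
    using swap4_less[OF k0] swap4_swap4[OF k0] by metis
  have sw: "0 < swap4 (S4 k) i \<longleftrightarrow> i \<noteq> Suc 0" "swap4 (S4 k) i \<noteq> Suc 0 \<longleftrightarrow> i \<noteq> 0" if "i < (S4 k)" for i
    using that k0 by (auto simp: swap4_def)
  have "(\<forall>i<(S4 k). i \<noteq> 0 \<longrightarrow> g $$ (i, 0) = 0) \<longleftrightarrow> (\<forall>i<(S4 k). i \<noteq> Suc 0 \<longrightarrow> (s_elt (S4 k) * g * s_elt (S4 k)) $$ (i, Suc 0) = 0)"
    by (subst b) (simp add: s_elt_conj[OF k0 g] sw del: index_mult_mat(1))
  moreover have "(\<forall>i<(S4 k). i \<noteq> Suc 0 \<longrightarrow> g $$ (i, Suc 0) = 0) \<longleftrightarrow> (\<forall>i<(S4 k). i \<noteq> 0 \<longrightarrow> (s_elt (S4 k) * g * s_elt (S4 k)) $$ (i, 0) = 0)"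
    by (subst b) (simp add: s_elt_conj[OF k0 g] sw del: index_mult_mat(1))
  ultimately show ?thesis unfolding K_grp_iff s_conj_SO[OF odd_k g] by blast
qed

text \<open>Conjugation by \<open>s_elt\<close> exchanges the two torus entries and keeps the
  central block. It turns the inner part of the outer unipotent vector into the inner unipotent
  vector, so a twisted character of \<open>P_{n-2}\<close> is evaluated at
  \<open>midv (unip_vec g)\<close>.\<close>

lemma K_conj_simps:
  fixes g :: "'a::field mat"
  assumes g: "g \<in> K_grp (S4 k)"
  defines "h \<equiv> s_elt (S4 k) * g * s_elt (S4 k)"
  shows "h \<in> K_grp (S4 k)" "mid h $$ (0, 0) = g $$ (0, 0)" "h $$ (0, 0) = mid g $$ (0, 0)"
    "mid (mid h) = mid (mid g)" "unip_vec (mid h) = midv (unip_vec g)"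
proof -
  have P: "g \<in> P_grp (S4 k)" "mid g \<in> P_grp (S2 k)" using g by (auto simp: K_grp_def)
  note c = P_carrier[OF odd2[OF odd_k] P(1)]
  show hK: "h \<in> K_grp (S4 k)" unfolding h_def using s_conj_K[OF c] g by blast
  then have hc: "h \<in> carrier_mat (S4 k) (S4 k)" using P_carrier[OF odd2[OF odd_k]] by (auto simp: K_grp_def)
  have e: "h $$ (i, j) = g $$ (swap4 (S4 k) i, swap4 (S4 k) j)" if "i < (S4 k)" "j < (S4 k)" for i j
    unfolding h_def by (rule s_elt_conj[OF k0 c that])
  show 1: "mid h $$ (0, 0) = g $$ (0, 0)" "h $$ (0, 0) = mid g $$ (0, 0)" using hc c by (simp_all add: e)
  show "mid (mid h) = mid (mid g)" using hc c by (intro eq_matI) (simp_all add: e)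
  show "unip_vec (mid h) = midv (unip_vec g)" using hc c k0 1 by (intro eq_vecI) (simp_all add: e)
qed

end

section \<open>Induction from U_n C for a subgroup C of L_n\<close>

context
  fixes k :: nat
  assumes odd_k: "odd k"
begin

lemma levi_hom: "levi \<in> hom ((GL (S2 k))\<lparr>carrier := P_grp (S2 k)\<rparr>) (GL (S2 k) :: 'a::field mat monoid)"
  using subgroup.subset[OF subgroup_P[OF odd_k, where 'a = 'a]] levi_simps(1)[OF odd_k]
  by (auto simp: hom_def levi_mult[OF odd_k])

lemma subgroup_L: "subgroup (L_grp (S2 k) :: 'a::field mat set) (GL (S2 k))"
proof -
  interpret group "GL (S2 k) :: 'a mat monoid" by simp
  note P = subgroup_P[OF odd_k, where 'a = 'a]
  show ?thesis
  proof (rule subgroupI)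
    show "(L_grp (S2 k) :: 'a mat set) \<subseteq> carrier (GL (S2 k))" using subgroup.subset[OF P] by (auto simp: L_grp_iff[OF odd_k])
    have "levi (1\<^sub>m (S2 k)) = levi (1\<^sub>m (S2 k) :: 'a mat)" ..
    show "(L_grp (S2 k) :: 'a mat set) \<noteq> {}"
      using levi_simps(6)[OF odd_k subgroup.one_closed[OF P]] by blast
    show "a \<otimes>\<^bsub>GL (S2 k)\<^esub> b \<in> L_grp (S2 k)" if "a \<in> L_grp (S2 k)" "b \<in> L_grp (S2 k)" for a b :: "'a mat"
      using that subgroup.m_closed[OF P, of a b] by (auto simp: L_grp_iff[OF odd_k] levi_mult[OF odd_k])
    show "inv\<^bsub>GL (S2 k)\<^esub> a \<in> L_grp (S2 k)" if a: "a \<in> L_grp (S2 k)" for a :: "'a mat"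
    proof -
      have aP: "a \<in> P_grp (S2 k)" "levi a = a" using a by (auto simp: L_grp_iff[OF odd_k])
      have "levi (inv\<^bsub>GL (S2 k)\<^esub> a) = inv\<^bsub>GL (S2 k)\<^esub> levi a"
        by (rule restricted_hom_inv[OF P group_GL levi_hom aP(1)])
      then show ?thesis using aP subgroup.m_inv_closed[OF P aP(1)] by (simp add: L_grp_iff[OF odd_k])
    qed
  qed
qed

lemma s_mat_mult:
  fixes x y :: "'a::field mat"
  assumes "x \<in> SO k" "a \<noteq> 0" "y \<in> SO k" "b \<noteq> 0"
  shows "s_mat x a * s_mat y b = s_mat (x * y) (a * b)"
proof -
  have c: "x \<in> carrier_mat k k" "y \<in> carrier_mat k k" using assms by (auto simp: SO_iff)
  note P = s_mat_in_P[OF odd_k assms(1,2)] s_mat_in_P[OF odd_k assms(3,4)]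
  have "levi (s_mat x a * s_mat y b) = s_mat x a * s_mat y b"
    unfolding levi_mult[OF odd_k P] using c by simp
  then show ?thesis
    unfolding levi_def P_mult(2,3)[OF odd_k P] using c by simp
qed

lemma L_grpD:
  fixes g :: "'a::field mat"
  assumes "g \<in> L_grp (S2 k)"
  shows "s_mat (mid g) (g $$ (0, 0)) = g" "mid g \<in> SO k" "g $$ (0, 0) \<noteq> 0" "g \<in> P_grp (S2 k)"
    "unip_vec g = 0\<^sub>v k" "levi g = g"
proof -
  have g: "g \<in> P_grp (S2 k)" "levi g = g" using assms by (simp_all add: L_grp_iff[OF odd_k])
  then show "g \<in> P_grp (S2 k)" "levi g = g" "mid g \<in> SO k" "g $$ (0, 0) \<noteq> 0" using P_par[OF odd_k g(1)] by simp_all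
  show "s_mat (mid g) (g $$ (0, 0)) = g" using g(2) by (simp only: levi_def)
  show "unip_vec g = 0\<^sub>v k" using levi_simps(4)[OF odd_k g(1)] g(2) by simp
qed

lemma finite_P [simp]: "finite (P_grp (S2 k) :: 'a::{field,finite} mat set)"
  by (rule finite_subset[OF _ finite_carrier_mat[of "(S2 k)" "(S2 k)"]]) (use P_carrier[OF odd_k] in blast)

text \<open>The Levi factor acts on the unipotent coordinate through \<open>a\<close> times
  \<open>x\<close>. The equation is solved for \<open>unip_vec g\<close>, so that no inverse matrix
  occurs in it.\<close>

lemma unip_vec_conj_L:
  fixes g c :: "'a::field mat"
  assumes c: "c \<in> L_grp (S2 k)" and g: "g \<in> P_grp (S2 k)"
  defines "h \<equiv> inv\<^bsub>GL (S2 k)\<^esub> c \<otimes>\<^bsub>GL (S2 k)\<^esub> g \<otimes>\<^bsub>GL (S2 k)\<^esub> c"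
  shows "h \<in> P_grp (S2 k)" "c $$ (0, 0) \<cdot>\<^sub>v (mid c *\<^sub>v unip_vec h) = unip_vec g"
proof -
  interpret group "GL (S2 k) :: 'a mat monoid" by simp
  note P = subgroup_P[OF odd_k, where 'a = 'a]
  have cP: "c \<in> P_grp (S2 k)" "unip_vec c = 0\<^sub>v k" using L_grpD[OF c] by simp_all
  have cc: "c \<in> carrier (GL (S2 k))" "g \<in> carrier (GL (S2 k))" using cP g subgroup.subset[OF P] by auto
  show h: "h \<in> P_grp (S2 k)" unfolding h_def
    by (intro subgroup.m_closed[OF P] subgroup.m_inv_closed[OF P] cP g)
  have "c \<otimes>\<^bsub>GL (S2 k)\<^esub> h = g \<otimes>\<^bsub>GL (S2 k)\<^esub> c" unfolding h_def using cc by (simp only: m_assoc inv_cancel_left m_closed inv_closed)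
  then have "unip_vec (c * h) = unip_vec (g * c)" by simp
  moreover have "unip_vec g + g $$ (0, 0) \<cdot>\<^sub>v (mid g *\<^sub>v 0\<^sub>v k) = unip_vec g"
    unfolding mult_mat_zero_vec[OF P_mid_carrier[OF odd_k g]]
    using P_carrier[OF odd_k g] by (intro eq_vecI) auto
  moreover have "0\<^sub>v k + c $$ (0, 0) \<cdot>\<^sub>v (mid c *\<^sub>v unip_vec h) = c $$ (0, 0) \<cdot>\<^sub>v (mid c *\<^sub>v unip_vec h)"
    by (intro left_zero_vec smult_carrier_vec[THEN iffD2] mult_mat_vec_carrier[OF P_mid_carrier[OF odd_k cP(1)]]
      unip_vec_carrier P_carrier[OF odd_k h])
  ultimately show "c $$ (0, 0) \<cdot>\<^sub>v (mid c *\<^sub>v unip_vec h) = unip_vec g"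
    unfolding P_mult(4)[OF odd_k cP(1) h] P_mult(4)[OF odd_k g cP(1)] cP(2) by simp
qed

text \<open>The common shape of \<open>psi_zero\<close>, \<open>psi_plus\<close> and
  \<open>psi_minus\<close>: the integrand is a function of \<open>unip_vec g\<close> times a
  function of \<open>levi g\<close>.\<close>

lemma ind_U_L:
  fixes g :: "'a::{field,finite} mat"
  assumes C: "C \<subseteq> L_grp (S2 k)" and g: "g \<in> P_grp (S2 k)"
  shows "ind (GL (S2 k)) (U_grp (S2 k) <#>\<^bsub>GL (S2 k)\<^esub> C) (P_grp (S2 k))
     (\<lambda>g. ext_char (GL (S2 k)) (U_grp (S2 k)) C (U_char (S2 k) f) g * infl (GL (S2 k)) (U_grp (S2 k)) C \<theta> g) g
   = cavg (GL (S2 k)) (P_grp (S2 k)) (\<lambda>g. if levi g \<in> C then f (unip_vec g) * \<theta> (levi g) else 0) g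
     / of_nat (card (UNIV :: 'a set) ^ k * card C)"
proof -
  interpret group "GL (S2 k) :: 'a mat monoid" by simp
  have "cavg (GL (S2 k)) (P_grp (S2 k)) (\<lambda>h. if h \<in> U_grp (S2 k) <#>\<^bsub>GL (S2 k)\<^esub> C then
       ext_char (GL (S2 k)) (U_grp (S2 k)) C (U_char (S2 k) f) h * infl (GL (S2 k)) (U_grp (S2 k)) C \<theta> h else 0) g
     = cavg (GL (S2 k)) (P_grp (S2 k)) (\<lambda>g. if levi g \<in> C then f (unip_vec g) * \<theta> (levi g) else 0) g"
    by (rule cavg_cong[OF subgroup_P[OF odd_k] g])
       (simp add: U_mult_L[OF odd_k C] ext_char_U_L[OF odd_k C] infl_U_L[OF odd_k C])
  then show ?thesis
    unfolding ind_eq_cavg using g by (simp add: U_mult_L[OF odd_k C] card_U_mult_L[OF odd_k C])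
qed

text \<open>Invariance of \<open>f\<close> under \<open>C\<close> makes it an admissible factor in
  \<open>cavg_infl_ind\<close>. The order of \<open>C\<close> then cancels, and only
  \<open>C0\<close> remains.\<close>

lemma ind_U_L_ind:
  fixes g :: "'a::{field,finite} mat"
  assumes C: "C \<subseteq> L_grp (S2 k)" "subgroup C (GL (S2 k))" and C0: "C0 \<subseteq> C" and g: "g \<in> P_grp (S2 k)"
    and f: "\<And>c v. c \<in> C \<Longrightarrow> v \<in> carrier_vec k \<Longrightarrow> f (c $$ (0, 0) \<cdot>\<^sub>v (mid c *\<^sub>v v)) = f v"
  shows "ind (GL (S2 k)) (U_grp (S2 k) <#>\<^bsub>GL (S2 k)\<^esub> C) (P_grp (S2 k))
     (\<lambda>g. ext_char (GL (S2 k)) (U_grp (S2 k)) C (U_char (S2 k) f) g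
       * infl (GL (S2 k)) (U_grp (S2 k)) C (ind (GL (S2 k)) C0 C \<tau>) g) g
   = cavg (GL (S2 k)) (P_grp (S2 k)) (\<lambda>g. if levi g \<in> C0 then f (unip_vec g) * \<tau> (levi g) else 0) g
     / of_nat (card (UNIV :: 'a set) ^ k * card C0)"
proof -
  interpret group "GL (S2 k) :: 'a mat monoid" by simp
  have CP: "C \<subseteq> P_grp (S2 k)" "\<And>c. c \<in> C \<Longrightarrow> levi c = c" using C(1) by (auto simp: L_grp_iff[OF odd_k])
  have fin: "finite C" using CP(1) finite_P finite_subset by blast
  have "card C \<noteq> 0" using subgroup.one_closed[OF C(2)] fin by auto
  moreover have "f (unip_vec (inv\<^bsub>GL (S2 k)\<^esub> c \<otimes>\<^bsub>GL (S2 k)\<^esub> h \<otimes>\<^bsub>GL (S2 k)\<^esub> c)) = f (unip_vec h)" if "c \<in> C" "h \<in> P_grp (S2 k)" for c h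
  proof -
    have cL: "c \<in> L_grp (S2 k)" using that C(1) by auto
    note u = unip_vec_conj_L[OF cL that(2)]
    show ?thesis using f[OF that(1) unip_vec_carrier[OF P_carrier[OF odd_k u(1)]]] unfolding u(2) by simp
  qed
  note c = cavg_infl_ind[OF subgroup_P[OF odd_k] g C(2) CP(1) C0 levi_hom CP(2) this]
  show ?thesis unfolding ind_U_L[OF C(1) g] using calculation by (simp add: c)
qed

end

text \<open>The multiples of \<open>z\<close> form a complement of the kernel.\<close>

lemma card_kernel:
  fixes \<phi> :: "'a::{field,finite} vec \<Rightarrow> 'a"
  assumes add: "\<And>v w. v \<in> carrier_vec n \<Longrightarrow> w \<in> carrier_vec n \<Longrightarrow> \<phi> (v + w) = \<phi> v + \<phi> w"
    and smult: "\<And>c v. v \<in> carrier_vec n \<Longrightarrow> \<phi> (c \<cdot>\<^sub>v v) = c * \<phi> v"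
    and z: "z \<in> carrier_vec n" "\<phi> z = 1"
  shows "card (UNIV :: 'a set) * card {v \<in> carrier_vec n. \<phi> v = 0} = card (UNIV :: 'a set) ^ n"
proof -
  let ?K = "{v \<in> carrier_vec n. \<phi> v = 0}"
  have "bij_betw (\<lambda>(t, v). v + t \<cdot>\<^sub>v z) (UNIV \<times> ?K) (carrier_vec n)"
    by (rule bij_betwI[where g = "\<lambda>v. (\<phi> v, v + (- \<phi> v) \<cdot>\<^sub>v z)"])
       (use z in \<open>auto simp: add smult intro!: eq_vecI\<close>)
  then have "card ((UNIV :: 'a set) \<times> ?K) = card (carrier_vec n :: 'a vec set)" by (rule bij_betw_same_card)
  then show ?thesis by (simp add: card_cartesian_product card_carrier_vec)
qed

section \<open>R Q_K: coordinates, group property, inflation and order\<close>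

context
  fixes k :: nat
  assumes odd_k: "odd k"
begin

lemma last_coord:
  assumes "v \<in> carrier_vec (S2 k)"
  shows "cf' v (Suc (k div 2)) = v $ Suc k"
proof -
  obtain l where "k = 2 * l + 1" using odd_k by (elim oddE)
  then show ?thesis using carrier_vecD[OF assms] by (simp add: cf'_def mult_2)
qed

lemma one_SO: "1\<^sub>m n \<in> SO n"
  by (auto simp: SO_iff)

lemma P_in_SO: "x \<in> P_grp n \<Longrightarrow> x \<in> SO n"
  by (simp add: P_grp_def)

lemma QK_eq: "QK_grp (S4 k) = {g \<in> L_grp (S4 k). mid g \<in> (P_grp (S2 k) :: 'a::field mat set)}"
proof (intro equalityI subsetI)
  fix g :: "'a mat" assume "g \<in> QK_grp (S4 k)"
  then obtain a x where ax: "a \<noteq> 0" "x \<in> P_grp (S2 k)" "g = s_mat (1\<^sub>m (S2 k)) a * s_mat x 1"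
    by (auto simp: QK_grp_def set_mult_def A_grp_def P_emb_def emb_def)
  have xc: "x \<in> carrier_mat (S2 k) (S2 k)" by (rule P_carrier[OF odd_k ax(2)])
  have "g = s_mat x a" unfolding ax(3) using s_mat_mult[OF odd2[OF odd_k] one_SO ax(1) P_in_SO[OF ax(2)] one_neq_zero] xc by simp
  then show "g \<in> {g \<in> L_grp (S4 k). mid g \<in> P_grp (S2 k)}"
    using ax xc P_in_SO[OF ax(2)] by (auto simp: L_grp_def)
next
  fix g :: "'a mat" assume g: "g \<in> {g \<in> L_grp (S4 k). mid g \<in> P_grp (S2 k)}"
  then obtain x a where xa: "g = s_mat x a" "x \<in> SO (S2 k)" "a \<noteq> 0" by (auto simp: L_grp_def)
  have xc: "x \<in> carrier_mat (S2 k) (S2 k)" using xa(2) by (simp add: SO_iff)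
  then have xP: "x \<in> P_grp (S2 k)" using g xa by simp
  have "g = s_mat (1\<^sub>m (S2 k)) a * s_mat x 1"
    using s_mat_mult[OF odd2[OF odd_k] one_SO xa(3) xa(2) one_neq_zero] xc xa(1) by simp
  then show "g \<in> QK_grp (S4 k)" using xa(3) xP
    by (auto simp: QK_grp_def set_mult_def A_grp_def P_emb_def emb_def)
qed

lemma RQK_eq: "RQK_grp (S4 k) = (K_grp (S4 k) :: 'a::field mat set)"
proof (intro equalityI subsetI)
  fix g :: "'a mat" assume "g \<in> RQK_grp (S4 k)"
  then obtain v l where vl: "v \<in> carrier_vec (S2 k)" "v $ Suc k = 0" "l \<in> QK_grp (S4 k)" "g = u_mat (S4 k) v * l"
    by (auto simp: RQK_grp_def set_mult_def R_grp_def last_coord)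
  have l: "l \<in> L_grp (S4 k)" "mid l \<in> P_grp (S2 k)" using vl(3) by (auto simp: QK_eq)
  note u = u_mult_L[OF odd2[OF odd_k] vl(1) l(1)]
  have "mid g = mid (levi g)" using levi_simps(3)[OF odd2[OF odd_k] u(1)] vl(4) by simp
  then show "g \<in> K_grp (S4 k)" using u vl l by (simp add: K_grp_def)
next
  fix g :: "'a mat" assume "g \<in> K_grp (S4 k)"
  then have g: "g \<in> P_grp (S4 k)" "mid g \<in> P_grp (S2 k)" "unip_vec g $ Suc k = 0" by (auto simp: K_grp_def)
  note l = levi_simps[OF odd2[OF odd_k] g(1)]
  have "unip_vec g \<in> carrier_vec (S2 k)" using P_carrier[OF odd2[OF odd_k] g(1)] by (rule unip_vec_carrier)
  moreover have "levi g \<in> QK_grp (S4 k)" using l g by (simp add: QK_eq)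
  moreover have "u_mat (S4 k) (unip_vec g) \<in> R_grp (S4 k)"
    unfolding R_grp_def using g(3) calculation(1) last_coord[OF calculation(1)] by auto
  ultimately have "u_mat (S4 k) (unip_vec g) * levi g \<in> RQK_grp (S4 k)"
    by (auto simp: RQK_grp_def set_mult_def)
  then show "g \<in> RQK_grp (S4 k)" using P_decomp[OF odd2[OF odd_k] g(1)] by simp
qed

text \<open>The set is rewritten as the intersection of \<open>P_grp\<close> with its conjugate by
  the involution \<open>s_elt\<close>; closure is then inherited from \<open>P_grp\<close>.\<close>

lemma subgroup_K: "subgroup (K_grp (S4 k) :: 'a::field mat set) (GL (S4 k))"
proof -
  interpret group "GL (S4 k) :: 'a mat monoid" by simp
  note P = subgroup_P[OF odd2[OF odd_k], where 'a = 'a]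
  have k0: "k > 0" using odd_k by (rule odd_pos)
  let ?s = "s_elt (S4 k) :: 'a mat"
  note s = s_elt_GL[OF k0, where 'a = 'a]
  have eq: "K_grp (S4 k) = {g \<in> P_grp (S4 k). ?s \<otimes>\<^bsub>GL (S4 k)\<^esub> g \<otimes>\<^bsub>GL (S4 k)\<^esub> ?s \<in> P_grp (S4 k)}"
  proof (intro equalityI subsetI)
    fix g :: "'a mat" assume "g \<in> K_grp (S4 k)"
    then show "g \<in> {g \<in> P_grp (S4 k). ?s \<otimes>\<^bsub>GL (S4 k)\<^esub> g \<otimes>\<^bsub>GL (S4 k)\<^esub> ?s \<in> P_grp (S4 k)}"
      using K_conj_simps(1)[OF odd_k, of g] by (auto simp: K_grp_def)
  next
    fix g :: "'a mat" assume g: "g \<in> {g \<in> P_grp (S4 k). ?s \<otimes>\<^bsub>GL (S4 k)\<^esub> g \<otimes>\<^bsub>GL (S4 k)\<^esub> ?s \<in> P_grp (S4 k)}"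
    then have gc: "g \<in> carrier_mat (S4 k) (S4 k)" using P_carrier[OF odd2[OF odd_k]] by auto
    have "g $$ (i, Suc 0) = 0" if i: "i < (S4 k)" "i \<noteq> Suc 0" for i
    proof -
      have "0 < swap4 (S4 k) i" "swap4 (S4 k) i < (S4 k)" using i swap4_less[OF k0] by (auto simp: swap4_def)
      moreover have "(?s * g * ?s) $$ (swap4 (S4 k) i, 0) = g $$ (i, Suc 0)"
        using s_elt_conj[OF k0 gc, of "swap4 (S4 k) i" 0] swap4_less[OF k0 i(1)] swap4_swap4[OF k0 i(1)] by simp
      ultimately show ?thesis using g by (simp add: P_grp_iff)
    qed
    then show "g \<in> K_grp (S4 k)" using g by (auto simp: K_grp_iff[OF odd_k] P_grp_iff)
  qed
  have inv_s: "inv\<^bsub>GL (S4 k)\<^esub> ?s = ?s" by (rule s)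
  have ss: "?s \<otimes>\<^bsub>GL (S4 k)\<^esub> ?s = \<one>\<^bsub>GL (S4 k)\<^esub>" using s_elt_square[OF k0] by simp
  have sg: "?s \<otimes>\<^bsub>GL (S4 k)\<^esub> (g \<otimes>\<^bsub>GL (S4 k)\<^esub> h) \<otimes>\<^bsub>GL (S4 k)\<^esub> ?s = (?s \<otimes>\<^bsub>GL (S4 k)\<^esub> g \<otimes>\<^bsub>GL (S4 k)\<^esub> ?s) \<otimes>\<^bsub>GL (S4 k)\<^esub> (?s \<otimes>\<^bsub>GL (S4 k)\<^esub> h \<otimes>\<^bsub>GL (S4 k)\<^esub> ?s)"
    if "g \<in> carrier (GL (S4 k))" "h \<in> carrier (GL (S4 k))" for g h
    using that s(1) inv_cancel_left[OF s(1)] by (simp only: inv_s m_assoc m_closed)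
  show ?thesis
  proof (rule subgroupI)
    have PG: "x \<in> carrier (GL (S4 k))" if "x \<in> P_grp (S4 k)" for x :: "'a mat" using that subgroup.subset[OF P] by auto
    show "(K_grp (S4 k) :: 'a mat set) \<subseteq> carrier (GL (S4 k))" using PG by (auto simp: K_grp_def)
    have "\<one>\<^bsub>GL (S4 k)\<^esub> \<in> (K_grp (S4 k) :: 'a mat set)" unfolding eq
      using subgroup.one_closed[OF P] ss r_one[OF s(1)] by simp
    then show "(K_grp (S4 k) :: 'a mat set) \<noteq> {}" by blast
    show "a \<otimes>\<^bsub>GL (S4 k)\<^esub> b \<in> K_grp (S4 k)" if "a \<in> K_grp (S4 k)" "b \<in> K_grp (S4 k)" for a b :: "'a mat"
      using that subgroup.m_closed[OF P] PG unfolding eq by (simp add: sg del: GL_simps)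
    show "inv\<^bsub>GL (S4 k)\<^esub> a \<in> K_grp (S4 k)" if a: "a \<in> K_grp (S4 k)" for a :: "'a mat"
    proof -
      have aP: "a \<in> P_grp (S4 k)" "?s \<otimes>\<^bsub>GL (S4 k)\<^esub> a \<otimes>\<^bsub>GL (S4 k)\<^esub> ?s \<in> P_grp (S4 k)" using a unfolding eq by auto
      have "inv\<^bsub>GL (S4 k)\<^esub> (?s \<otimes>\<^bsub>GL (S4 k)\<^esub> a \<otimes>\<^bsub>GL (S4 k)\<^esub> ?s) = ?s \<otimes>\<^bsub>GL (S4 k)\<^esub> inv\<^bsub>GL (S4 k)\<^esub> a \<otimes>\<^bsub>GL (S4 k)\<^esub> ?s"
        using s(1) PG[OF aP(1)] by (simp add: inv_mult_group inv_s m_assoc del: GL_simps)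
      then show ?thesis using subgroup.m_inv_closed[OF P] aP unfolding eq by (metis (mono_tags, lifting) mem_Collect_eq)
    qed
  qed
qed

text \<open>Factors from \<open>R\<close> and \<open>A\<close> have the identity as middle block, so
  \<open>mid\<close> recovers the factor in \<open>P_emb\<close> that the definite description in
  \<open>infl\<close> selects.\<close>

lemma infl_RQK_eq:
  "infl_RQK (S4 k) \<chi> = (\<lambda>g. if g \<in> (K_grp (S4 k) :: 'a::field mat set) then \<chi> (mid g) else 0)"
proof -
  interpret group "GL (S4 k) :: 'a mat monoid" by simp
  note P = subgroup_P[OF odd2[OF odd_k], where 'a = 'a]
  have R: "(R_grp (S4 k) :: 'a mat set) \<subseteq> carrier (GL (S4 k))" "(A_grp (S4 k) :: 'a mat set) \<subseteq> carrier (GL (S4 k))"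
      "(P_emb (S4 k) :: 'a mat set) \<subseteq> carrier (GL (S4 k))"
    by (auto simp: R_grp_def A_grp_def P_emb_def emb_def
        intro!: subsetD[OF subgroup.subset[OF P]] u_mat_in_P[OF odd2[OF odd_k]] s_mat_in_P[OF odd2[OF odd_k]] one_SO P_in_SO)
  have eq: "(R_grp (S4 k) <#>\<^bsub>GL (S4 k)\<^esub> A_grp (S4 k)) <#>\<^bsub>GL (S4 k)\<^esub> P_emb (S4 k) = (K_grp (S4 k) :: 'a mat set)"
    unfolding set_mult_assoc[OF R] RQK_eq[symmetric] RQK_grp_def QK_grp_def ..
  have u: "kk = emb (mid g) \<and> mid g \<in> P_grp (S2 k)" if th: "kk \<in> P_emb (S4 k)" "u \<in> R_grp (S4 k) <#>\<^bsub>GL (S4 k)\<^esub> A_grp (S4 k)" "g = u * kk" for u kk g :: "'a mat"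
  proof -
    obtain v a where v: "v \<in> carrier_vec (S2 k)" "a \<noteq> 0" "u = u_mat (S4 k) v * s_mat (1\<^sub>m (S2 k)) a"
      using th(2) by (auto simp: set_mult_def R_grp_def A_grp_def)
    obtain x where x: "kk = s_mat x 1" "x \<in> P_grp (S2 k)" using th(1) by (auto simp: P_emb_def emb_def)
    note xc = P_carrier[OF odd_k x(2)]
    note uP = u_mat_in_P[OF odd2[OF odd_k] v(1)] and aP = s_mat_in_P[OF odd2[OF odd_k] one_SO v(2)]
      and kP = s_mat_in_P[OF odd2[OF odd_k] P_in_SO[OF x(2)] one_neq_zero]
    have "mid g = x" unfolding th(3) v(3) x(1) P_mult(3)[OF odd2[OF odd_k] P_mult(1)[OF odd2[OF odd_k] uP aP] kP] P_mult(3)[OF odd2[OF odd_k] uP aP]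
        u_mat_simps(4)[OF odd2[OF odd_k] v(1)] s_mat_simps(4)[OF one_carrier_mat] s_mat_simps(4)[OF xc]
        left_mult_one_mat[OF one_carrier_mat] left_mult_one_mat[OF xc] ..
    then show ?thesis using x by (simp add: emb_def)
  qed
  have "infl_RQK (S4 k) \<chi> g = (if g \<in> K_grp (S4 k) then \<chi> (mid g) else 0)" for g :: "'a mat"
  proof (cases "g \<in> K_grp (S4 k)")
    case True
    then obtain u kk where uk: "kk \<in> P_emb (S4 k)" "u \<in> R_grp (S4 k) <#>\<^bsub>GL (S4 k)\<^esub> A_grp (S4 k)" "g = u * kk"
      unfolding eq[symmetric] by (auto simp: set_mult_def)
    have "(THE kk. kk \<in> P_emb (S4 k) \<and> (\<exists>u\<in>R_grp (S4 k) <#>\<^bsub>GL (S4 k)\<^esub> A_grp (S4 k). g = u * kk)) = emb (mid g)"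
    proof (rule the_equality)
      have "kk = emb (mid g)" using u[OF uk] ..
      then show "emb (mid g) \<in> P_emb (S4 k) \<and> (\<exists>u\<in>R_grp (S4 k) <#>\<^bsub>GL (S4 k)\<^esub> A_grp (S4 k). g = u * emb (mid g))"
        using uk by auto
      fix k' assume "k' \<in> P_emb (S4 k) \<and> (\<exists>u\<in>R_grp (S4 k) <#>\<^bsub>GL (S4 k)\<^esub> A_grp (S4 k). g = u * k')"
      then obtain u' where "k' \<in> P_emb (S4 k)" "u' \<in> R_grp (S4 k) <#>\<^bsub>GL (S4 k)\<^esub> A_grp (S4 k)" "g = u' * k'" by blast
      from u[OF this] show "k' = emb (mid g)" ..
    qed
    moreover have "mid (emb (mid g)) = mid g" using u[OF uk] P_carrier[OF odd_k, of "mid g"] by (simp add: emb_def)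
    ultimately show ?thesis using True u[OF uk] uk(1) by (simp add: infl_RQK_def infl_def eq char_emb_def)
  next
    case False
    then show ?thesis by (simp add: infl_RQK_def infl_def eq)
  qed
  then show ?thesis by (simp add: fun_eq_iff)
qed

text \<open>The coordinates \<open>v\<close>, \<open>a\<close>, \<open>x\<close> range
  independently, with one linear condition on \<open>v\<close>.\<close>

lemma card_K:
  "card (K_grp (S4 k) :: 'a::{field,finite} mat set) = card (UNIV :: 'a set) ^ Suc k * (card (UNIV :: 'a set) - 1) * card (P_grp (S2 k) :: 'a mat set)"
proof -
  let ?q = "card (UNIV :: 'a set)"
  let ?H = "{v \<in> carrier_vec (S2 k). v $ Suc k = (0 :: 'a)}"
  have H: "card ?H = ?q ^ Suc k"
  proof -
    have "?q * card ?H = ?q ^ (S2 k)"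
      by (rule card_kernel[where z = "unit_vec (S2 k) (Suc k)"]) auto
    then show ?thesis using finite_UNIV_card_ge_0[where 'a = 'a] by simp
  qed
  have "bij_betw (\<lambda>(v, a, x). u_mat (S4 k) v * s_mat x a) (?H \<times> ({a. a \<noteq> 0} \<times> P_grp (S2 k))) (K_grp (S4 k))"
  proof (rule bij_betwI[where g = "\<lambda>g. (unip_vec g, g $$ (0, 0), mid g)"])
    show "(\<lambda>g. (unip_vec g, g $$ (0, 0), mid g)) \<in> K_grp (S4 k) \<rightarrow> ?H \<times> ({a. a \<noteq> 0} \<times> P_grp (S2 k))"
      using P_carrier[OF odd2[OF odd_k], where 'a = 'a] P_par(2)[OF odd2[OF odd_k], where 'a = 'a] by (auto simp: K_grp_def intro!: unip_vec_carrier)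
    have *: "(case (v, a, x) of (v, a, x) \<Rightarrow> u_mat (S4 k) v * s_mat x a) \<in> K_grp (S4 k) \<and>
       unip_vec (u_mat (S4 k) v * s_mat x a) = v \<and> (u_mat (S4 k) v * s_mat x a) $$ (0, 0) = a \<and> mid (u_mat (S4 k) v * s_mat x a) = x"
      if "v \<in> carrier_vec (S2 k)" "v $ Suc k = 0" "a \<noteq> 0" "x \<in> P_grp (S2 k)" for v :: "'a vec" and a x
    proof -
      have l: "s_mat x a \<in> L_grp (S4 k)" using that P_in_SO by (auto simp: L_grp_def)
      note xc = P_carrier[OF odd_k that(4)]
      note u = u_mult_L[OF odd2[OF odd_k] that(1) l]
      note p = P_mult(2,3)[OF odd2[OF odd_k] u_mat_in_P[OF odd2[OF odd_k] that(1)] s_mat_in_P[OF odd2[OF odd_k] P_in_SO[OF that(4)] that(3)]]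
      show ?thesis using u p u_mat_simps[OF odd2[OF odd_k] that(1)] xc that by (simp add: K_grp_def del: index_mult_mat(1))
    qed
    show "(\<lambda>(v, a, x). u_mat (S4 k) v * s_mat x a) \<in> ?H \<times> ({a. a \<noteq> 0} \<times> P_grp (S2 k)) \<rightarrow> K_grp (S4 k)"
      using * by auto
    show "(unip_vec ((\<lambda>(v, a, x). u_mat (S4 k) v * s_mat x a) y), (\<lambda>(v, a, x). u_mat (S4 k) v * s_mat x a) y $$ (0, 0),
        mid ((\<lambda>(v, a, x). u_mat (S4 k) v * s_mat x a) y)) = y" if "y \<in> ?H \<times> ({a. a \<noteq> 0} \<times> P_grp (S2 k))" for y
      using * that by (auto simp del: index_mult_mat(1))
    show "(\<lambda>(v, a, x). u_mat (S4 k) v * s_mat x a) (unip_vec y, y $$ (0, 0), mid y) = y" if "y \<in> K_grp (S4 k)" for y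
      using P_decomp[OF odd2[OF odd_k], of y] that by (simp add: K_grp_def levi_def)
  qed
  then have "card (?H \<times> ({a :: 'a. a \<noteq> 0} \<times> (P_grp (S2 k) :: 'a mat set))) = card (K_grp (S4 k) :: 'a mat set)"
    by (rule bij_betw_same_card)
  moreover have "card {a :: 'a. a \<noteq> 0} = ?q - 1"
    using card_Diff_singleton[of 0 "UNIV :: 'a set"] by (simp add: Compl_eq_Diff_UNIV[symmetric] Collect_neg_eq)
  ultimately show ?thesis by (simp add: card_cartesian_product H)
qed

end

section \<open>Exchanging root subgroups\<close>

definition additive_char :: "('a::field \<Rightarrow> complex) \<Rightarrow> bool" where
  "additive_char \<xi> \<longleftrightarrow> (\<forall>x y. \<xi> (x + y) = \<xi> x * \<xi> y) \<and> \<xi> 0 = 1 \<and> (\<exists>x. \<xi> x \<noteq> 1)"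

lemma additive_charD:
  assumes "additive_char \<xi>"
  shows "\<xi> (x + y) = \<xi> x * \<xi> y" "\<xi> 0 = 1"
  using assms by (auto simp: additive_char_def)

text \<open>If \<open>\<xi> x \<noteq> 1\<close>, translating \<open>t\<close> by
  \<open>x / c\<close> multiplies the sum by \<open>\<xi> x\<close>, so it vanishes.\<close>

lemma additive_char_sum:
  fixes \<xi> :: "'a::{field,finite} \<Rightarrow> complex"
  assumes \<xi>: "additive_char \<xi>"
  shows "(\<Sum>t\<in>UNIV. \<xi> (t * c)) = (if c = 0 then of_nat (card (UNIV :: 'a set)) else 0)"
proof (cases "c = 0")
  case False
  obtain x where x: "\<xi> x \<noteq> 1" using \<xi> by (auto simp: additive_char_def)
  have "(\<Sum>t\<in>UNIV. \<xi> (t * c)) = (\<Sum>t\<in>UNIV. \<xi> ((t + x / c) * c))"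
    by (rule sum.reindex_bij_witness[where i = "\<lambda>t. t + x / c" and j = "\<lambda>t. t - x / c"]) auto
  also have "\<dots> = (\<Sum>t\<in>UNIV. \<xi> x * \<xi> (t * c))"
    using False by (intro sum.cong) (auto simp: distrib_right additive_charD[OF \<xi>])
  also have "\<dots> = \<xi> x * (\<Sum>t\<in>UNIV. \<xi> (t * c))" by (simp add: sum_distrib_left)
  finally have "(1 - \<xi> x) * (\<Sum>t\<in>UNIV. \<xi> (t * c)) = 0" by (simp add: algebra_simps)
  then show ?thesis using x False by simp
qed (simp add: additive_charD[OF \<xi>])

text \<open>Both sides are the same average over a Heisenberg group: \<open>w\<close> and \<open>v\<close> are the coordinates in
  two root subgroups, and each side averages over the one which the other side requires to vanish.\<close>

lemma additive_char_swap:
  fixes \<xi> :: "'a::{field,finite} \<Rightarrow> complex"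
  assumes \<xi>: "additive_char \<xi>" and a: "a \<noteq> 0" and b: "b \<noteq> 0"
  shows "(\<Sum>t\<in>UNIV. if v + t * (1 - a / b) = 0 then \<xi> (p - a / b * t * w) else 0)
    = (\<Sum>t\<in>UNIV. if w + t * (1 - b / a) = 0 then \<xi> (p + t * v) else 0)"
proof (cases "a = b")
  case True
  have "(\<Sum>t\<in>UNIV. \<xi> (p - t * w)) = \<xi> p * (\<Sum>t\<in>UNIV. \<xi> (t * (- w)))"
    unfolding sum_distrib_left by (intro sum.cong) (auto simp: additive_charD(1)[OF \<xi>, symmetric])
  moreover have "(\<Sum>t\<in>UNIV. \<xi> (p + t * v)) = \<xi> p * (\<Sum>t\<in>UNIV. \<xi> (t * v))"
    unfolding sum_distrib_left by (intro sum.cong) (auto simp: additive_charD(1)[OF \<xi>])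
  ultimately show ?thesis unfolding additive_char_sum[OF \<xi>] using True b
    by (cases "v = 0"; cases "w = 0") simp_all
next
  case False
  have ab: "b - a \<noteq> 0" "a - b \<noteq> 0" using False by auto
  have "v + t * (1 - a / b) = 0 \<longleftrightarrow> t = - (v * b / (b - a))" for t using ab b by (simp add: field_simps) algebra
  then have "(\<Sum>t\<in>UNIV. if v + t * (1 - a / b) = 0 then \<xi> (p - a / b * t * w) else 0)
     = \<xi> (p + a / b * (v * b / (b - a)) * w)" by simp
  moreover have "w + t * (1 - b / a) = 0 \<longleftrightarrow> t = - (w * a / (a - b))" for t using ab a by (simp add: field_simps) algebra
  then have "(\<Sum>t\<in>UNIV. if w + t * (1 - b / a) = 0 then \<xi> (p + t * v) else 0)
     = \<xi> (p + - (w * a / (a - b)) * v)" by simp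
  moreover have "a / b * (v * b / (b - a)) * w = - (w * a / (a - b)) * v"
    using ab a b by (simp add: field_simps)
  ultimately show ?thesis by simp
qed

text \<open>The Levi element of size \<open>n - 2\<close> that keeps the outer torus entry and
  forgets the inner one. By \<open>levi_mid_s_conj\<close> it is the Levi part of the middle block
  after conjugation by \<open>s_elt\<close>.\<close>

definition core :: "'a::field mat \<Rightarrow> 'a mat" where
  "core g = s_mat (mid (mid g)) (g $$ (0, 0))"

definition linear_on :: "nat \<Rightarrow> ('a::field vec \<Rightarrow> 'a) \<Rightarrow> bool" where
  "linear_on n \<phi> \<longleftrightarrow> (\<forall>v\<in>carrier_vec n. \<forall>w\<in>carrier_vec n. \<phi> (v + w) = \<phi> v + \<phi> w) \<and>
     (\<forall>c. \<forall>v\<in>carrier_vec n. \<phi> (c \<cdot>\<^sub>v v) = c * \<phi> v)"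

lemma linear_onD:
  assumes "linear_on n \<phi>"
  shows "v \<in> carrier_vec n \<Longrightarrow> w \<in> carrier_vec n \<Longrightarrow> \<phi> (v + w) = \<phi> v + \<phi> w"
    "v \<in> carrier_vec n \<Longrightarrow> \<phi> (c \<cdot>\<^sub>v v) = c * \<phi> v" "\<phi> (0\<^sub>v n) = 0"
proof -
  show 1: "v \<in> carrier_vec n \<Longrightarrow> w \<in> carrier_vec n \<Longrightarrow> \<phi> (v + w) = \<phi> v + \<phi> w"
    "v \<in> carrier_vec n \<Longrightarrow> \<phi> (c \<cdot>\<^sub>v v) = c * \<phi> v" for v w c using assms by (auto simp: linear_on_def)
  have "0\<^sub>v n = (0 :: 'a) \<cdot>\<^sub>v 0\<^sub>v n" by (intro eq_vecI) auto
  then have "\<phi> (0\<^sub>v n) = 0 * \<phi> (0\<^sub>v n)" using 1(2)[of "0\<^sub>v n" 0] by simp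
  then show "\<phi> (0\<^sub>v n) = 0" by simp
qed

lemma linear_on_diff:
  assumes \<phi>: "linear_on n \<phi>" and c: "u \<in> carrier_vec n" "v \<in> carrier_vec n" "w \<in> carrier_vec n"
    and e: "u + v = w"
  shows "\<phi> u = \<phi> w - \<phi> v"
  using linear_onD(1)[OF \<phi> c(1,2)] e by simp

section \<open>Conjugation in coordinates\<close>

context
  fixes k :: nat
  assumes odd_k: "odd k"
begin

text \<open>The last claim is an equation between sums: it comes from comparing
  \<open>g' * h\<close> with \<open>h * g\<close>, which avoids coordinates of the inverse of
  \<open>h\<close>.\<close>

lemma conj_by_u:
  fixes g :: "'a::field mat"
  assumes g: "g \<in> P_grp (S2 k)" and z: "z \<in> carrier_vec k"
  defines "h \<equiv> u_mat (S2 k) z" 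
  defines "g' \<equiv> h \<otimes>\<^bsub>GL (S2 k)\<^esub> g \<otimes>\<^bsub>GL (S2 k)\<^esub> inv\<^bsub>GL (S2 k)\<^esub> h"
  shows "g' \<in> P_grp (S2 k)" "g' $$ (0, 0) = g $$ (0, 0)" "mid g' = mid g"
    "unip_vec g' + g $$ (0, 0) \<cdot>\<^sub>v (mid g *\<^sub>v z) = z + unip_vec g"
proof -
  interpret group "GL (S2 k) :: 'a mat monoid" by simp
  note P = subgroup_P[OF odd_k, where 'a = 'a]
  note PG = subsetD[OF subgroup.subset[OF P]]
  have h: "h \<in> P_grp (S2 k)" unfolding h_def by (rule u_mat_in_P[OF odd_k z])
  show g': "g' \<in> P_grp (S2 k)" unfolding g'_def
    by (intro subgroup.m_closed[OF P] subgroup.m_inv_closed[OF P] g h)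
  have "g' \<otimes>\<^bsub>GL (S2 k)\<^esub> h = h \<otimes>\<^bsub>GL (S2 k)\<^esub> g" unfolding g'_def
    using PG[OF g] PG[OF h] by (simp only: m_assoc m_closed inv_closed l_inv r_one)
  then have e: "g' * h = h * g" by simp
  note m = P_mult[OF odd_k g' h] P_mult[OF odd_k h g]
  note u = u_mat_simps[OF odd_k z, folded h_def]
  show "g' $$ (0, 0) = g $$ (0, 0)" using arg_cong[OF e, of "\<lambda>x. x $$ (0, 0)"] unfolding m u by simp
  moreover show mid: "mid g' = mid g"
    using arg_cong[OF e, of mid] right_mult_one_mat[OF P_mid_carrier[OF odd_k g']] left_mult_one_mat[OF P_mid_carrier[OF odd_k g]]
    unfolding m u by simp
  ultimately show "unip_vec g' + g $$ (0, 0) \<cdot>\<^sub>v (mid g *\<^sub>v z) = z + unip_vec g"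
    using arg_cong[OF e, of unip_vec] unip_vec_carrier[OF P_carrier[OF odd_k g]]
    unfolding m(4,8) u by simp
qed

lemma emb_props:
  fixes x :: "'a::field mat"
  assumes x: "x \<in> SO k"
  shows "emb x \<in> P_grp (S2 k)" "mid (emb x) = x" "emb x $$ (0, 0) = 1" "unip_vec (emb x) = 0\<^sub>v k" "emb x \<in> L_grp (S2 k)"
proof -
  have c: "x \<in> carrier_mat k k" using x by (simp add: SO_iff)
  show "emb x \<in> P_grp (S2 k)" "mid (emb x) = x" "emb x $$ (0, 0) = 1" "unip_vec (emb x) = 0\<^sub>v k"
    using s_mat_in_P[OF odd_k x one_neq_zero] c by (simp_all add: emb_def)
  then show "emb x \<in> L_grp (S2 k)" using c by (simp add: L_grp_iff[OF odd_k] emb_def)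
qed

lemma mid_hom: "mid \<in> hom ((GL (S2 k))\<lparr>carrier := P_grp (S2 k)\<rparr>) (GL k :: 'a::field mat monoid)"
  using subgroup.subset[OF subgroup_SO[of k, where 'a = 'a]] P_par(4)[OF odd_k, where 'a = 'a]
  by (auto simp: hom_def P_mult(3)[OF odd_k])

lemma conj_by_emb:
  fixes g :: "'a::field mat"
  assumes g: "g \<in> P_grp (S2 k)" and x: "x \<in> SO k"
  defines "g' \<equiv> emb x \<otimes>\<^bsub>GL (S2 k)\<^esub> g \<otimes>\<^bsub>GL (S2 k)\<^esub> inv\<^bsub>GL (S2 k)\<^esub> (emb x)"
  shows "g' \<in> P_grp (S2 k)" "g' $$ (0, 0) = g $$ (0, 0)" 
    "mid g' = x \<otimes>\<^bsub>GL k\<^esub> mid g \<otimes>\<^bsub>GL k\<^esub> inv\<^bsub>GL k\<^esub> x"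
    "unip_vec g' = x *\<^sub>v unip_vec g"
proof -
  interpret group "GL (S2 k) :: 'a mat monoid" by simp
  note P = subgroup_P[OF odd_k, where 'a = 'a]
  note PG = subsetD[OF subgroup.subset[OF P]]
  note h = emb_props[OF x]
  have xc: "x \<in> carrier_mat k k" using x by (simp add: SO_iff)
  have ih: "inv\<^bsub>GL (S2 k)\<^esub> (emb x) \<in> P_grp (S2 k)" by (rule subgroup.m_inv_closed[OF P h(1)])
  have hg: "emb x * g \<in> P_grp (S2 k)" by (rule P_mult(1)[OF odd_k h(1) g])
  show g': "g' \<in> P_grp (S2 k)" unfolding g'_def
    by (intro subgroup.m_closed[OF P] ih g h)
  have "g' \<otimes>\<^bsub>GL (S2 k)\<^esub> emb x = emb x \<otimes>\<^bsub>GL (S2 k)\<^esub> g" unfolding g'_def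
    using PG[OF g] PG[OF h(1)] by (simp only: m_assoc m_closed inv_closed l_inv r_one)
  then have e: "g' * emb x = emb x * g" by simp
  note m = P_mult[OF odd_k g' h(1)] P_mult[OF odd_k h(1) g]
  show 00: "g' $$ (0, 0) = g $$ (0, 0)" using arg_cong[OF e, of "\<lambda>x. x $$ (0, 0)"] unfolding m h by simp
  show "mid g' = x \<otimes>\<^bsub>GL k\<^esub> mid g \<otimes>\<^bsub>GL k\<^esub> inv\<^bsub>GL k\<^esub> x"
    using P_mult(3)[OF odd_k hg ih] P_mult(3)[OF odd_k h(1) g] restricted_hom_inv[OF P group_GL mid_hom h(1)]
    unfolding g'_def by (simp add: h)
  have "unip_vec g' + g' $$ (0, 0) \<cdot>\<^sub>v (mid g' *\<^sub>v 0\<^sub>v k) = unip_vec g'"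
    unfolding mult_mat_zero_vec[OF P_mid_carrier[OF odd_k g']]
    using P_carrier[OF odd_k g'] by (intro eq_vecI) auto
  moreover have "0\<^sub>v k + 1 \<cdot>\<^sub>v (x *\<^sub>v unip_vec g) = x *\<^sub>v unip_vec g"
    using xc P_carrier[OF odd_k g] by (intro eq_vecI) auto
  ultimately show "unip_vec g' = x *\<^sub>v unip_vec g"
    using arg_cong[OF e, of unip_vec] unfolding m(4,8) h by simp
qed

end

section \<open>Averaging over two root subgroups\<close>

context
  fixes k :: nat and \<xi> :: "'a::{field,finite} \<Rightarrow> complex" and \<phi> :: "'a vec \<Rightarrow> 'a"
    and C' :: "'a mat set" and \<theta> :: "'a mat \<Rightarrow> complex"
  assumes odd_k: "odd k" and \<xi>: "additive_char \<xi>" and \<phi>: "linear_on k \<phi>"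
begin

lemma P_vec_carriers:
  fixes g :: "'a mat"
  assumes "g \<in> P_grp (S4 k)"
  shows "unip_vec g \<in> carrier_vec (S2 k)" "midv (unip_vec g) \<in> carrier_vec k"
    "mid g \<in> P_grp (S2 k) \<Longrightarrow> unip_vec (mid g) \<in> carrier_vec k"
    "mid g \<in> P_grp (S2 k) \<Longrightarrow> mid (mid g) \<in> carrier_mat k k"
  using P_carrier[OF odd2[OF odd_k] assms] P_carrier[OF odd_k, of "mid g"]
  by (auto intro!: unip_vec_carrier midv_carrier mid_carrier)

text \<open>The conjugators form the root subgroup of \<open>U_n\<close> that belongs to the last
  coordinate. The functional is arbitrary here and may be zero, which is the case used for Type
  \<open>1\<close>.\<close>

lemma avg_left:
  assumes g: "g \<in> P_grp (S4 k)"
  shows "cavg (GL (S4 k)) (P_grp (S4 k)) (\<lambda>g. if mid g \<in> P_grp (S2 k) \<and> core g \<in> C' then \<theta> (core g) *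
      (\<Sum>t\<in>UNIV. if unip_vec g $ Suc k + t * (1 - g $$ (0, 0) / mid g $$ (0, 0)) = 0
        then \<xi> (\<phi> (midv (unip_vec g)) - g $$ (0, 0) / mid g $$ (0, 0) * t * \<phi> (unip_vec (mid g))) else 0) else 0) g
   = of_nat (card (UNIV :: 'a set)) * cavg (GL (S4 k)) (P_grp (S4 k))
      (\<lambda>g. if mid g \<in> P_grp (S2 k) \<and> core g \<in> C' \<and> unip_vec g $ Suc k = 0
        then \<xi> (\<phi> (midv (unip_vec g))) * \<theta> (core g) else 0) g"
proof -
  interpret group "GL (S4 k) :: 'a mat monoid" by simp
  let ?e = "\<lambda>t :: 'a. t \<cdot>\<^sub>v unit_vec (S2 k) (Suc k)"
  have e: "?e t \<in> carrier_vec (S2 k)" for t by simp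
  show ?thesis
  proof (rule cavg_average[where k = "\<lambda>t. u_mat (S4 k) (?e t)", OF subgroup_P[OF odd2[OF odd_k]] g])
    show "u_mat (S4 k) (?e t) \<in> P_grp (S4 k)" for t by (rule u_mat_in_P[OF odd2[OF odd_k] e])
    fix h :: "'a mat" assume h: "h \<in> P_grp (S4 k)"
    let ?a = "h $$ (0, 0)" and ?b = "mid h $$ (0, 0)" and ?v = "unip_vec h" and ?w = "unip_vec (mid h)"
    let ?h' = "\<lambda>t. u_mat (S4 k) (?e t) \<otimes>\<^bsub>GL (S4 k)\<^esub> h \<otimes>\<^bsub>GL (S4 k)\<^esub> inv\<^bsub>GL (S4 k)\<^esub> u_mat (S4 k) (?e t)"
    note c = conj_by_u[OF odd2[OF odd_k] h e]
    have core: "core (?h' t) = core h" for t unfolding core_def c(2,3) ..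
    have v': "unip_vec (?h' t) $ Suc k = ?v $ Suc k + t * (1 - ?a / ?b)"
      "\<phi> (midv (unip_vec (?h' t))) = \<phi> (midv ?v) - ?a / ?b * t * \<phi> ?w" if m: "mid h \<in> P_grp (S2 k)" for t
    proof -
      note mc = P_carrier[OF odd_k m] and mp = P_par[OF odd_k m]
      \<comment> \<open>The last column of \<open>mid h\<close> has inner part
        \<open>inverse ?b\<close> times \<open>?w\<close> and last entry \<open>inverse ?b\<close>.
        This is the origin of the quotient \<open>?a / ?b\<close>.\<close>
      have me: "(mid h *\<^sub>v ?e t) $ i = t * mid h $$ (i, Suc k)" if "i < (S2 k)" for i
        using mult_mat_vec[OF mc unit_vec_carrier] mult_mat_vec_unit[OF mc _ that, of "Suc k"]
          carrier_matD[OF P_carrier[OF odd2[OF odd_k] h]] that by (simp del: index_mult_mat_vec)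
      note uc = P_vec_carriers[OF c(1)] and vc = P_vec_carriers[OF h]
      have i: "unip_vec (?h' t) $ i + ?a * (t * mid h $$ (i, Suc k)) = ?e t $ i + ?v $ i" if "i < (S2 k)" for i
        using arg_cong[OF c(4)[of t], of "\<lambda>v. v $ i"] that uc(1) vc(1) carrier_matD[OF P_carrier[OF odd2[OF odd_k] h]] me[OF that]
        by (simp del: index_mult_mat_vec)
      show "unip_vec (?h' t) $ Suc k = ?v $ Suc k + t * (1 - ?a / ?b)"
        using i[of "Suc k"] mp(2,3) by (simp add: field_simps)
      have "midv (unip_vec (?h' t)) + (?a / ?b * t) \<cdot>\<^sub>v ?w = midv ?v"
      proof (rule eq_vecI)
        fix j assume "j < dim_vec (midv ?v)"
        then have j: "j < k" using carrier_vecD[OF vc(2)] by simp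
        then show "(midv (unip_vec (?h' t)) + (?a / ?b * t) \<cdot>\<^sub>v ?w) $ j = midv ?v $ j"
          using i[of "Suc j"] mp(2) carrier_vecD[OF vc(1)] carrier_vecD[OF uc(1)] carrier_matD[OF P_carrier[OF odd2[OF odd_k] h]] by simp
      qed (use carrier_matD[OF P_carrier[OF odd2[OF odd_k] h]] carrier_vecD[OF vc(1)] in simp)
      from linear_on_diff[OF \<phi> uc(2) _ vc(2) this] linear_onD(2)[OF \<phi> vc(3)[OF m]] vc(3)[OF m]
      show "\<phi> (midv (unip_vec (?h' t))) = \<phi> (midv ?v) - ?a / ?b * t * \<phi> ?w" by simp
    qed
    show "(\<Sum>t\<in>UNIV. if mid (?h' t) \<in> P_grp (S2 k) \<and> core (?h' t) \<in> C' \<and> unip_vec (?h' t) $ Suc k = 0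
        then \<xi> (\<phi> (midv (unip_vec (?h' t)))) * \<theta> (core (?h' t)) else 0)
      = (if mid h \<in> P_grp (S2 k) \<and> core h \<in> C' then \<theta> (core h) *
      (\<Sum>t\<in>UNIV. if ?v $ Suc k + t * (1 - ?a / ?b) = 0
        then \<xi> (\<phi> (midv ?v) - ?a / ?b * t * \<phi> ?w) else 0) else 0)"
    proof (cases "mid h \<in> P_grp (S2 k) \<and> core h \<in> C'")
      case True
      then show ?thesis unfolding core c(3) sum_distrib_left
        by (auto simp: v' simp del: GL_simps intro!: sum.cong)
    next
      case False
      then show ?thesis unfolding core c(3) by auto
    qed
  qed
qed

text \<open>The conjugators come from \<open>U_{n-2}\<close>, at multiples of a vector
  \<open>z\<close> normalized by \<open>\<phi> z = 1\<close>. Elements of \<open>C'\<close> fix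
  \<open>\<phi>\<close> up to the scalar \<open>a\<close>, so the central block sends
  \<open>z\<close> to a vector of value \<open>inverse a\<close>; this produces the quotient of
  \<open>b\<close> by \<open>a\<close>.\<close>

lemma avg_right:
  assumes g: "g \<in> P_grp (S4 k)" and z: "z \<in> carrier_vec k" "\<phi> z = 1"
    and C': "\<And>y a v. s_mat y a \<in> C' \<Longrightarrow> y \<in> SO k \<Longrightarrow> a \<noteq> 0 \<Longrightarrow> v \<in> carrier_vec k \<Longrightarrow> a * \<phi> (y *\<^sub>v v) = \<phi> v"
  shows "cavg (GL (S4 k)) (P_grp (S4 k)) (\<lambda>g. if mid g \<in> P_grp (S2 k) \<and> core g \<in> C' then \<theta> (core g) *
      (\<Sum>t\<in>UNIV. if \<phi> (unip_vec (mid g)) + t * (1 - mid g $$ (0, 0) / g $$ (0, 0)) = 0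
        then \<xi> (\<phi> (midv (unip_vec g)) + t * unip_vec g $ Suc k) else 0) else 0) g
   = of_nat (card (UNIV :: 'a set)) * cavg (GL (S4 k)) (P_grp (S4 k))
      (\<lambda>g. if mid g \<in> P_grp (S2 k) \<and> core g \<in> C' \<and> \<phi> (unip_vec (mid g)) = 0
        then \<xi> (\<phi> (midv (unip_vec g))) * \<theta> (core g) else 0) g"
proof -
  interpret group "GL (S4 k) :: 'a mat monoid" by simp
  interpret G2: group "GL (S2 k) :: 'a mat monoid" by simp
  let ?u = "\<lambda>t :: 'a. u_mat (S2 k) (t \<cdot>\<^sub>v z)"
  have tz: "t \<cdot>\<^sub>v z \<in> carrier_vec k" for t using z by simp
  note uP = u_mat_in_P[OF odd_k tz]
  note uSO = P_in_SO[OF odd_k uP]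
  show ?thesis
  proof (rule cavg_average[where k = "\<lambda>t. emb (?u t)", OF subgroup_P[OF odd2[OF odd_k]] g])
    show "emb (?u t) \<in> P_grp (S4 k)" for t by (rule emb_props(1)[OF odd2[OF odd_k] uSO])
    fix h :: "'a mat" assume h: "h \<in> P_grp (S4 k)"
    let ?a = "h $$ (0, 0)" and ?b = "mid h $$ (0, 0)" and ?v = "unip_vec h" and ?w = "unip_vec (mid h)"
    let ?h' = "\<lambda>t. emb (?u t) \<otimes>\<^bsub>GL (S4 k)\<^esub> h \<otimes>\<^bsub>GL (S4 k)\<^esub> inv\<^bsub>GL (S4 k)\<^esub> emb (?u t)"
    note c = conj_by_emb[OF odd2[OF odd_k] h uSO]
    note P2 = subgroup_P[OF odd_k, where 'a = 'a]
    have iff: "mid (?h' t) \<in> P_grp (S2 k) \<longleftrightarrow> mid h \<in> P_grp (S2 k)" for t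
    proof
      assume "mid h \<in> P_grp (S2 k)"
      then show "mid (?h' t) \<in> P_grp (S2 k)" unfolding c(3)
        by (intro subgroup.m_closed[OF P2] subgroup.m_inv_closed[OF P2] uP)
    next
      assume *: "mid (?h' t) \<in> P_grp (S2 k)"
      have mc: "mid h \<in> carrier (GL (S2 k))" "?u t \<in> carrier (GL (S2 k))"
        using P_par(4)[OF odd2[OF odd_k] h] subgroup.subset[OF subgroup_SO[of "(S2 k)", where 'a = 'a]] uSO[of t] by auto
      have "inv\<^bsub>GL (S2 k)\<^esub> ?u t \<otimes>\<^bsub>GL (S2 k)\<^esub> mid (?h' t) \<otimes>\<^bsub>GL (S2 k)\<^esub> ?u t = mid h" unfolding c(3)
        using mc by (simp only: G2.m_assoc G2.inv_cancel_left G2.m_closed G2.inv_closed G2.l_inv G2.r_one)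
      moreover have "inv\<^bsub>GL (S2 k)\<^esub> ?u t \<otimes>\<^bsub>GL (S2 k)\<^esub> mid (?h' t) \<otimes>\<^bsub>GL (S2 k)\<^esub> ?u t \<in> P_grp (S2 k)"
        by (intro subgroup.m_closed[OF P2] subgroup.m_inv_closed[OF P2] uP *)
      ultimately show "mid h \<in> P_grp (S2 k)" by simp
    qed
    note vc = P_vec_carriers[OF h]
    have v': "\<phi> (midv (unip_vec (?h' t))) = \<phi> (midv ?v) + t * ?v $ Suc k" for t
    proof -
      note us = u_mat_simps[OF odd_k tz[of t]]
      have "vec k (\<lambda>i. ?v $ Suc k * ?u t $$ (Suc i, Suc k)) = (?v $ Suc k * t) \<cdot>\<^sub>v z"
        using us(9) z carrier_vecD[OF z(1)] by (intro eq_vecI) auto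
      then have "midv (unip_vec (?h' t)) = midv ?v + (?v $ Suc k * t) \<cdot>\<^sub>v z"
        unfolding c(4) par_mult_vec(3)[OF us(6) vc(1)] us(4) using vc(2) by simp
      then show ?thesis using linear_onD(1)[OF \<phi> vc(2), of "(?v $ Suc k * t) \<cdot>\<^sub>v z"] linear_onD(2)[OF \<phi> z(1)] z by simp
    qed
    have m': "core (?h' t) = core h"
      "core h \<in> C' \<Longrightarrow> \<phi> (unip_vec (mid (?h' t))) = \<phi> ?w + t * (1 - ?b / ?a)" if m: "mid h \<in> P_grp (S2 k)" for t
    proof -
      note d = conj_by_u[OF odd_k m tz[of t], folded c(3)]
      show "core (?h' t) = core h" unfolding core_def c(2) d(3) ..
      assume C: "core h \<in> C'"
      have ab: "?a \<noteq> 0" "?b \<noteq> 0" using P_par(2)[OF odd2[OF odd_k] h] P_par(2)[OF odd_k m] .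
      have mz: "mid (mid h) *\<^sub>v (t \<cdot>\<^sub>v z) \<in> carrier_vec k" by (rule mult_mat_vec_carrier[OF vc(4)[OF m] tz])
      have uc: "unip_vec (mid (?h' t)) \<in> carrier_vec k" by (rule unip_vec_carrier[OF P_carrier[OF odd_k d(1)]])
      have "?a * \<phi> (mid (mid h) *\<^sub>v (t \<cdot>\<^sub>v z)) = \<phi> (t \<cdot>\<^sub>v z)"
        using C' C[unfolded core_def] P_par(4)[OF odd_k m] ab(1) tz by blast
      then have "\<phi> (mid (mid h) *\<^sub>v (t \<cdot>\<^sub>v z)) = t / ?a"
        using linear_onD(2)[OF \<phi> z(1)] z(2) ab by (simp add: field_simps)
      moreover have "\<phi> (unip_vec (mid (?h' t))) + \<phi> (?b \<cdot>\<^sub>v (mid (mid h) *\<^sub>v (t \<cdot>\<^sub>v z))) = \<phi> (t \<cdot>\<^sub>v z) + \<phi> ?w"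
        using arg_cong[OF d(4), of \<phi>] linear_onD(1)[OF \<phi> uc smult_carrier_vec[THEN iffD2, OF mz]]
          linear_onD(1)[OF \<phi> tz vc(3)[OF m]] by simp
      ultimately show "\<phi> (unip_vec (mid (?h' t))) = \<phi> ?w + t * (1 - ?b / ?a)"
        using linear_onD(2)[OF \<phi> mz] linear_onD(2)[OF \<phi> z(1)] z(2) by (simp add: algebra_simps)
    qed
    show "(\<Sum>t\<in>UNIV. if mid (?h' t) \<in> P_grp (S2 k) \<and> core (?h' t) \<in> C' \<and> \<phi> (unip_vec (mid (?h' t))) = 0
        then \<xi> (\<phi> (midv (unip_vec (?h' t)))) * \<theta> (core (?h' t)) else 0)
      = (if mid h \<in> P_grp (S2 k) \<and> core h \<in> C' then \<theta> (core h) *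
      (\<Sum>t\<in>UNIV. if \<phi> ?w + t * (1 - ?b / ?a) = 0
        then \<xi> (\<phi> (midv ?v) + t * ?v $ Suc k) else 0) else 0)"
    proof (cases "mid h \<in> P_grp (S2 k) \<and> core h \<in> C'")
      case True
      then show ?thesis unfolding iff v' sum_distrib_left
        by (auto simp: m' simp del: GL_simps intro!: sum.cong)
    next
      case False
      then show ?thesis unfolding iff by (cases "mid h \<in> P_grp (S2 k)") (simp_all add: m'(1) del: GL_simps)
    qed
  qed
qed

text \<open>Neither integrand is transformed directly into the other. Each is smoothed over its own
  root subgroup, and \<open>additive_char_swap\<close> compares the smoothed integrands pointwise;
  the two factors \<open>q\<close> cancel.\<close>

lemma cavg_swap:
  assumes g: "g \<in> P_grp (S4 k)" and z: "z \<in> carrier_vec k" "\<phi> z = 1"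
    and C': "\<And>y a v. s_mat y a \<in> C' \<Longrightarrow> y \<in> SO k \<Longrightarrow> a \<noteq> 0 \<Longrightarrow> v \<in> carrier_vec k \<Longrightarrow> a * \<phi> (y *\<^sub>v v) = \<phi> v"
  shows "cavg (GL (S4 k)) (P_grp (S4 k))
      (\<lambda>g. if mid g \<in> P_grp (S2 k) \<and> core g \<in> C' \<and> unip_vec g $ Suc k = 0
        then \<xi> (\<phi> (midv (unip_vec g))) * \<theta> (core g) else 0) g
    = cavg (GL (S4 k)) (P_grp (S4 k))
      (\<lambda>g. if mid g \<in> P_grp (S2 k) \<and> core g \<in> C' \<and> \<phi> (unip_vec (mid g)) = 0
        then \<xi> (\<phi> (midv (unip_vec g))) * \<theta> (core g) else 0) g" (is "cavg _ _ ?l g = cavg _ _ ?r g")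
proof -
  interpret group "GL (S4 k) :: 'a mat monoid" by simp
  let ?F1 = "\<lambda>h. if mid h \<in> P_grp (S2 k) \<and> core h \<in> C' then \<theta> (core h) *
      (\<Sum>t\<in>UNIV. if unip_vec h $ Suc k + t * (1 - h $$ (0, 0) / mid h $$ (0, 0)) = 0
        then \<xi> (\<phi> (midv (unip_vec h)) - h $$ (0, 0) / mid h $$ (0, 0) * t * \<phi> (unip_vec (mid h))) else 0) else 0"
  let ?F2 = "\<lambda>h. if mid h \<in> P_grp (S2 k) \<and> core h \<in> C' then \<theta> (core h) *
      (\<Sum>t\<in>UNIV. if \<phi> (unip_vec (mid h)) + t * (1 - mid h $$ (0, 0) / h $$ (0, 0)) = 0
        then \<xi> (\<phi> (midv (unip_vec h)) + t * unip_vec h $ Suc k) else 0) else 0"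
  have "of_nat (card (UNIV :: 'a set)) * cavg (GL (S4 k)) (P_grp (S4 k)) ?l g = cavg (GL (S4 k)) (P_grp (S4 k)) ?F1 g"
    by (rule avg_left[OF g, symmetric])
  also have "\<dots> = cavg (GL (S4 k)) (P_grp (S4 k)) ?F2 g"
  proof (rule cavg_cong[OF subgroup_P[OF odd2[OF odd_k]] g])
    fix h :: "'a mat" assume h: "h \<in> P_grp (S4 k)"
    show "?F1 h = ?F2 h"
    proof (cases "mid h \<in> P_grp (S2 k)")
      case True
      show ?thesis unfolding additive_char_swap[OF \<xi> P_par(2)[OF odd2[OF odd_k] h] P_par(2)[OF odd_k True]] ..
    qed simp
  qed
  also have "\<dots> = of_nat (card (UNIV :: 'a set)) * cavg (GL (S4 k)) (P_grp (S4 k)) ?r g"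
    by (rule avg_right[OF g z], rule C')
  finally show ?thesis by simp
qed

end

section \<open>Induction from R Q_K\<close>

context
  fixes k :: nat
  assumes odd_k: "odd k"
begin

lemma K_grp_D:
  fixes g :: "'a::field mat"
  assumes "g \<in> K_grp (S4 k)"
  shows "g \<in> P_grp (S4 k)" "mid g \<in> P_grp (S2 k)" "unip_vec g $ Suc k = 0"
  using assms by (auto simp: K_grp_def)

lemma K_grp_I:
  fixes g :: "'a::field mat"
  assumes "g \<in> P_grp (S4 k)"
  shows "g \<in> K_grp (S4 k) \<longleftrightarrow> mid g \<in> P_grp (S2 k) \<and> unip_vec g $ Suc k = 0"
  using assms by (auto simp: K_grp_def)

lemma s_conj_GL:
  fixes g :: "'a::field mat"
  shows "inv\<^bsub>GL (S4 k)\<^esub> s_elt (S4 k) \<otimes>\<^bsub>GL (S4 k)\<^esub> g \<otimes>\<^bsub>GL (S4 k)\<^esub> s_elt (S4 k) = s_elt (S4 k) * g * s_elt (S4 k)"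
  using s_elt_GL(2)[OF odd_pos[OF odd_k], where 'a = 'a] by simp

lemma levi_mid_s_conj:
  fixes g :: "'a::field mat"
  assumes g: "g \<in> K_grp (S4 k)"
  shows "mid (s_elt (S4 k) * g * s_elt (S4 k)) \<in> P_grp (S2 k)"
    "levi (mid (s_elt (S4 k) * g * s_elt (S4 k))) = core g"
    "unip_vec (mid (s_elt (S4 k) * g * s_elt (S4 k))) = midv (unip_vec g)"
  using K_conj_simps[OF odd_k g] K_grp_D(2) by (auto simp: levi_def core_def)

lemma ind_RQK:
  fixes g :: "'a::{field,finite} mat"
  assumes g: "g \<in> P_grp (S4 k)"
  shows "ind (GL (S4 k)) (RQK_grp (S4 k)) (P_grp (S4 k)) (conj_char (GL (S4 k)) (s_elt (S4 k)) (infl_RQK (S4 k) \<chi>)) g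
    = cavg (GL (S4 k)) (P_grp (S4 k)) (\<lambda>g. if g \<in> K_grp (S4 k)
        then \<chi> (mid (inv\<^bsub>GL (S4 k)\<^esub> s_elt (S4 k) \<otimes>\<^bsub>GL (S4 k)\<^esub> g \<otimes>\<^bsub>GL (S4 k)\<^esub> s_elt (S4 k))) else 0) g
      / of_nat (card (K_grp (S4 k) :: 'a mat set))"
proof -
  interpret group "GL (S4 k) :: 'a mat monoid" by simp
  note K = subgroup_K[OF odd_k, where 'a = 'a]
  have "cavg (GL (S4 k)) (P_grp (S4 k)) (\<lambda>h. if h \<in> K_grp (S4 k)
      then conj_char (GL (S4 k)) (s_elt (S4 k)) (infl_RQK (S4 k) \<chi>) h else 0) g =
    cavg (GL (S4 k)) (P_grp (S4 k)) (\<lambda>g. if g \<in> K_grp (S4 k)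
        then \<chi> (mid (inv\<^bsub>GL (S4 k)\<^esub> s_elt (S4 k) \<otimes>\<^bsub>GL (S4 k)\<^esub> g \<otimes>\<^bsub>GL (S4 k)\<^esub> s_elt (S4 k))) else 0) g"
  proof (rule cavg_cong[OF subgroup_P[OF odd2[OF odd_k]] g])
    fix h :: "'a mat"
    show "(if h \<in> K_grp (S4 k) then conj_char (GL (S4 k)) (s_elt (S4 k)) (infl_RQK (S4 k) \<chi>) h else 0) =
      (if h \<in> K_grp (S4 k) then \<chi> (mid (inv\<^bsub>GL (S4 k)\<^esub> s_elt (S4 k) \<otimes>\<^bsub>GL (S4 k)\<^esub> h \<otimes>\<^bsub>GL (S4 k)\<^esub> s_elt (S4 k))) else 0)"
    proof (cases "h \<in> K_grp (S4 k)")
      case True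
      then have "h \<in> carrier (GL (S4 k))" using subgroup.subset[OF K] by auto
      then show ?thesis using True K_conj_simps(1)[OF odd_k True]
        unfolding conj_char_def infl_RQK_eq[OF odd_k] s_conj_GL by simp
    qed simp
  qed
  then show ?thesis unfolding ind_eq_cavg RQK_eq[OF odd_k] using g by simp
qed

lemma card_P_pos: "card (P_grp (S2 k) :: 'a::{field,finite} mat set) > 0"
  using subgroup.one_closed[OF subgroup_P[OF odd_k, where 'a = 'a]] finite_P[OF odd_k, where 'a = 'a]
  by (auto simp: card_gt_0_iff)

lemma card_field: "card (UNIV :: 'a::{field,finite} set) > 1"
proof -
  have "card {0, 1 :: 'a} \<le> card (UNIV :: 'a set)" by (rule card_mono) auto
  then show ?thesis by simp
qed

text \<open>The inner induction from the inertia group of \<open>P_{n-2}\<close> is absorbed by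
  means of the section \<open>emb\<close>. After conjugation by \<open>s_elt\<close> the remaining
  integrand depends on \<open>core g\<close> and \<open>midv (unip_vec g)\<close>, with the last
  coordinate of \<open>unip_vec g\<close> required to vanish. The exchange replaces that requirement
  by a condition on the Levi factor, as needed for comparison with a character of
  \<open>P_n\<close>.\<close>

lemma ind_RQK_psi:
  fixes g :: "'a::{field,finite} mat" and \<xi> :: "'a \<Rightarrow> complex"
  assumes \<xi>: "additive_char \<xi>" and \<phi>: "linear_on k \<phi>"
    and g: "g \<in> P_grp (S4 k)" and z: "z \<in> carrier_vec k" "\<phi> z = 1"
    and C'L: "C' \<subseteq> L_grp (S2 k)"
    and C': "\<And>y a v. s_mat y a \<in> C' \<Longrightarrow> y \<in> SO k \<Longrightarrow> a \<noteq> 0 \<Longrightarrow> v \<in> carrier_vec k \<Longrightarrow> a * \<phi> (y *\<^sub>v v) = \<phi> v"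
    and \<chi>: "\<chi> = ind (GL (S2 k)) (U_grp (S2 k) <#>\<^bsub>GL (S2 k)\<^esub> C') (P_grp (S2 k))
     (\<lambda>g. ext_char (GL (S2 k)) (U_grp (S2 k)) C' (U_char (S2 k) (\<lambda>v. \<xi> (\<phi> v))) g * infl (GL (S2 k)) (U_grp (S2 k)) C' \<theta> g)"
  shows "ind (GL (S4 k)) (RQK_grp (S4 k)) (P_grp (S4 k)) (conj_char (GL (S4 k)) (s_elt (S4 k)) (infl_RQK (S4 k) \<chi>)) g
    = cavg (GL (S4 k)) (P_grp (S4 k))
      (\<lambda>g. if mid g \<in> P_grp (S2 k) \<and> core g \<in> C' \<and> \<phi> (unip_vec (mid g)) = 0
        then \<xi> (\<phi> (midv (unip_vec g))) * \<theta> (core g) else 0) g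
      / of_nat (card (UNIV :: 'a set) ^ (k + Suc k) * (card (UNIV :: 'a set) - 1) * card C')"
proof -
  interpret group "GL (S4 k) :: 'a mat monoid" by simp
  let ?I = "U_grp (S2 k) <#>\<^bsub>GL (S2 k)\<^esub> C'"
  let ?\<eta> = "\<lambda>g. ext_char (GL (S2 k)) (U_grp (S2 k)) C' (U_char (S2 k) (\<lambda>v. \<xi> (\<phi> v))) g * infl (GL (S2 k)) (U_grp (S2 k)) C' \<theta> g"
  let ?s = "s_elt (S4 k) :: 'a mat"
  note K = subgroup_K[OF odd_k, where 'a = 'a]
  note KG = subsetD[OF subgroup.subset[OF K]]
  have "cavg (GL (S4 k)) (P_grp (S4 k)) (\<lambda>g. if g \<in> K_grp (S4 k) then \<chi> (mid (inv\<^bsub>GL (S4 k)\<^esub> ?s \<otimes>\<^bsub>GL (S4 k)\<^esub> g \<otimes>\<^bsub>GL (S4 k)\<^esub> ?s)) else 0) g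
    = of_nat (card (P_grp (S2 k) :: 'a mat set)) / of_nat (card ?I) *
      cavg (GL (S4 k)) (P_grp (S4 k)) (\<lambda>g. if g \<in> K_grp (S4 k) \<and> mid (inv\<^bsub>GL (S4 k)\<^esub> ?s \<otimes>\<^bsub>GL (S4 k)\<^esub> g \<otimes>\<^bsub>GL (S4 k)\<^esub> ?s) \<in> ?I
        then ?\<eta> (mid (inv\<^bsub>GL (S4 k)\<^esub> ?s \<otimes>\<^bsub>GL (S4 k)\<^esub> g \<otimes>\<^bsub>GL (S4 k)\<^esub> ?s)) else 0) g"
    unfolding \<chi>
  proof (rule cavg_conj_infl_ind[where e = emb, OF subgroup_P[OF odd2[OF odd_k]] g K _ _ _ group_GL subgroup_P[OF odd_k]])
    show "K_grp (S4 k) \<subseteq> (P_grp (S4 k) :: 'a mat set)" using K_grp_D(1) by blast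
    show "?s \<in> carrier (GL (S4 k))" by (rule s_elt_GL[OF odd_pos[OF odd_k]])
    show "(inv\<^bsub>GL (S4 k)\<^esub> ?s \<otimes>\<^bsub>GL (S4 k)\<^esub> h \<otimes>\<^bsub>GL (S4 k)\<^esub> ?s \<in> K_grp (S4 k)) = (h \<in> K_grp (S4 k))" if "h \<in> carrier (GL (S4 k))" for h
      unfolding s_conj_GL by (rule s_conj_K[OF odd_k]) (use that in \<open>simp add: GL_carrier\<close>)
    show "mid \<in> hom (GL (S4 k)\<lparr>carrier := K_grp (S4 k)\<rparr>) (GL (S2 k) :: 'a mat monoid)"
      using hom_in_carrier[OF mid_hom[OF odd2[OF odd_k], where 'a = 'a]] K_grp_D(1)
      by (auto simp: hom_def P_mult(3)[OF odd2[OF odd_k]])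
    show "mid h \<in> P_grp (S2 k)" if "h \<in> K_grp (S4 k)" for h :: "'a mat" using K_grp_D(2)[OF that] .
    show "emb x \<in> K_grp (S4 k)" "mid (emb x) = x" if "x \<in> P_grp (S2 k)" for x :: "'a mat"
      using emb_props[OF odd2[OF odd_k] P_in_SO[OF odd_k that]] that by (auto simp: K_grp_I)
  qed
  also have "cavg (GL (S4 k)) (P_grp (S4 k)) (\<lambda>g. if g \<in> K_grp (S4 k) \<and> mid (inv\<^bsub>GL (S4 k)\<^esub> ?s \<otimes>\<^bsub>GL (S4 k)\<^esub> g \<otimes>\<^bsub>GL (S4 k)\<^esub> ?s) \<in> ?I
        then ?\<eta> (mid (inv\<^bsub>GL (S4 k)\<^esub> ?s \<otimes>\<^bsub>GL (S4 k)\<^esub> g \<otimes>\<^bsub>GL (S4 k)\<^esub> ?s)) else 0) g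
    = cavg (GL (S4 k)) (P_grp (S4 k))
      (\<lambda>g. if mid g \<in> P_grp (S2 k) \<and> core g \<in> C' \<and> unip_vec g $ Suc k = 0
        then \<xi> (\<phi> (midv (unip_vec g))) * \<theta> (core g) else 0) g"
  proof (rule cavg_cong[OF subgroup_P[OF odd2[OF odd_k]] g])
    fix h :: "'a mat" assume h: "h \<in> P_grp (S4 k)"
    show "(if h \<in> K_grp (S4 k) \<and> mid (inv\<^bsub>GL (S4 k)\<^esub> ?s \<otimes>\<^bsub>GL (S4 k)\<^esub> h \<otimes>\<^bsub>GL (S4 k)\<^esub> ?s) \<in> ?I
        then ?\<eta> (mid (inv\<^bsub>GL (S4 k)\<^esub> ?s \<otimes>\<^bsub>GL (S4 k)\<^esub> h \<otimes>\<^bsub>GL (S4 k)\<^esub> ?s)) else 0)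
      = (if mid h \<in> P_grp (S2 k) \<and> core h \<in> C' \<and> unip_vec h $ Suc k = 0
        then \<xi> (\<phi> (midv (unip_vec h))) * \<theta> (core h) else 0)"
    proof (cases "h \<in> K_grp (S4 k)")
      case True
      then show ?thesis using K_grp_D[OF True] levi_mid_s_conj[OF True]
        unfolding s_conj_GL U_mult_L[OF odd_k C'L] ext_char_U_L[OF odd_k C'L] infl_U_L[OF odd_k C'L]
        by simp
    next
      case False
      then show ?thesis using K_grp_I[OF h] by auto
    qed
  qed
  also have "\<dots> = cavg (GL (S4 k)) (P_grp (S4 k))
      (\<lambda>g. if mid g \<in> P_grp (S2 k) \<and> core g \<in> C' \<and> \<phi> (unip_vec (mid g)) = 0
        then \<xi> (\<phi> (midv (unip_vec g))) * \<theta> (core g) else 0) g" (is "_ = ?R")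
    by (rule cavg_swap[OF odd_k \<xi> \<phi> g z], rule C')
  finally have 1: "ind (GL (S4 k)) (RQK_grp (S4 k)) (P_grp (S4 k)) (conj_char (GL (S4 k)) (s_elt (S4 k)) (infl_RQK (S4 k) \<chi>)) g
     = of_nat (card (P_grp (S2 k) :: 'a mat set)) / of_nat (card ?I) * ?R / of_nat (card (K_grp (S4 k) :: 'a mat set))"
    unfolding ind_RQK[OF g] by simp
  have "of_nat (card (P_grp (S2 k) :: 'a mat set)) \<noteq> (0 :: complex)" using card_P_pos[where 'a = 'a] by simp
  then show ?thesis
    unfolding 1 card_K[OF odd_k] U_mult_L[OF odd_k C'L] card_U_mult_L[OF odd_k C'L]
    by (simp add: power_add)
qed

text \<open>Rebuilds an element of \<open>L_n\<close> from the coordinates \<open>w\<close>,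
  \<open>y\<close>, \<open>b\<close>, \<open>a\<close>. It is the witness in the count of
  \<open>card_parabolic_levi\<close> and for surjectivity in \<open>core_hom\<close>.\<close>

lemma s_mat_s_mat_in_L:
  fixes y :: "'a::field mat"
  assumes w: "w \<in> carrier_vec k" and y: "y \<in> SO k" and b: "b \<noteq> 0" and a: "a \<noteq> 0"
  defines "x \<equiv> u_mat (S2 k) w * s_mat y b"
  shows "s_mat x a \<in> L_grp (S4 k)" "x \<in> P_grp (S2 k)" "mid (s_mat x a) = x" "mid x = y" "unip_vec x = w" "x $$ (0, 0) = b"
    "s_mat x a $$ (0, 0) = a" "core (s_mat x a) = s_mat y a"
proof -
  have yc: "y \<in> carrier_mat k k" using y by (simp add: SO_iff)
  have l: "s_mat y b \<in> L_grp (S2 k)" using y b by (auto simp: L_grp_def)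
  note u = u_mult_L[OF odd_k w l, folded x_def]
  show xP: "x \<in> P_grp (S2 k)" by (rule u)
  then have xc: "x \<in> carrier_mat (S2 k) (S2 k)" by (rule P_carrier[OF odd_k])
  show "s_mat x a \<in> L_grp (S4 k)" using P_in_SO[OF odd_k xP] a by (auto simp: L_grp_def)
  show 1: "mid (s_mat x a) = x" "s_mat x a $$ (0, 0) = a" using xc by simp_all
  show "unip_vec x = w" by (rule u)
  have "levi x $$ (0, 0) = b" "mid (levi x) = y" unfolding u(2) using yc by simp_all
  then show "mid x = y" "x $$ (0, 0) = b" using levi_simps[OF odd_k xP] by auto
  then show "core (s_mat x a) = s_mat y a" unfolding core_def 1 by simp
qed

text \<open>Over each element of \<open>C'\<close> lie a vector in the kernel of
  \<open>\<phi>\<close> and a free inner torus entry. The factor \<open>q\<close> on the left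
  compensates the index of the kernel, so no division occurs.\<close>

lemma card_parabolic_levi:
  fixes C' :: "'a::{field,finite} mat set"
  assumes \<phi>: "linear_on k \<phi>" and z: "z \<in> carrier_vec k" "\<phi> z = 1"
    and C'L: "C' \<subseteq> L_grp (S2 k)"
  shows "card (UNIV :: 'a set) * card {c \<in> L_grp (S4 k). mid c \<in> P_grp (S2 k) \<and> core c \<in> C' \<and> \<phi> (unip_vec (mid c)) = 0}
    = card (UNIV :: 'a set) ^ k * (card (UNIV :: 'a set) - 1) * card C'"
proof -
  let ?K = "{v \<in> carrier_vec k. \<phi> v = 0}" and ?q = "card (UNIV :: 'a set)"
  let ?C0 = "{c \<in> L_grp (S4 k). mid c \<in> P_grp (S2 k) \<and> core c \<in> C' \<and> \<phi> (unip_vec (mid c)) = 0}"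
  let ?f = "\<lambda>(w, b, l). s_mat (u_mat (S2 k) w * s_mat (mid l) b) (l $$ (0, 0))"
  have K: "?q * card ?K = ?q ^ k"
    by (rule card_kernel[where \<phi> = \<phi> and z = z]) (use linear_onD[OF \<phi>] z in auto)
  have f: "?f (w, b, l) \<in> ?C0 \<and> unip_vec (mid (?f (w, b, l))) = w \<and> mid (?f (w, b, l)) $$ (0, 0) = b \<and> core (?f (w, b, l)) = l"
    if "w \<in> ?K" "b \<noteq> 0" "l \<in> C'" for w b l
  proof -
    have l: "l = s_mat (mid l) (l $$ (0, 0))" "mid l \<in> SO k" "l $$ (0, 0) \<noteq> 0"
      using L_grpD[OF odd_k subsetD[OF C'L that(3)]] by auto
    from s_mat_s_mat_in_L[OF _ l(2) that(2) l(3), of w] that l(1) show ?thesis by auto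
  qed
  have "bij_betw ?f (?K \<times> ({b. b \<noteq> 0} \<times> C')) ?C0"
  proof (rule bij_betwI[where g = "\<lambda>c. (unip_vec (mid c), mid c $$ (0, 0), core c)"])
    show "?f \<in> ?K \<times> ({b. b \<noteq> 0} \<times> C') \<rightarrow> ?C0" using f by auto
    show "(\<lambda>c. (unip_vec (mid c), mid c $$ (0, 0), core c)) \<in> ?C0 \<rightarrow> ?K \<times> ({b. b \<noteq> 0} \<times> C')"
      using P_par(2)[OF odd_k, where 'a = 'a] unip_vec_carrier[OF P_carrier[OF odd_k, where 'a = 'a]] by auto
    show "(unip_vec (mid (?f y)), mid (?f y) $$ (0, 0), core (?f y)) = y" if y': "y \<in> ?K \<times> ({b. b \<noteq> 0} \<times> C')" for y
    proof -
      obtain w b l where y: "y = (w, b, l)" "w \<in> ?K" "b \<noteq> 0" "l \<in> C'" using y' by auto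
      show ?thesis unfolding y(1) using f[OF y(2-4)] by blast
    qed
    show "?f (unip_vec (mid c), mid c $$ (0, 0), core c) = c" if c: "c \<in> ?C0" for c
    proof -
      have cL: "c \<in> L_grp (S4 k)" "mid c \<in> P_grp (S2 k)" using c by auto
      have "mid (core c) = mid (mid c)" "core c $$ (0, 0) = c $$ (0, 0)"
        unfolding core_def using P_mid_carrier[OF odd_k cL(2)] by simp_all
      then have "?f (unip_vec (mid c), mid c $$ (0, 0), core c) = s_mat (u_mat (S2 k) (unip_vec (mid c)) * levi (mid c)) (c $$ (0, 0))"
        by (simp add: levi_def)
      also have "\<dots> = s_mat (mid c) (c $$ (0, 0))" using P_decomp[OF odd_k cL(2)] by simp
      also have "\<dots> = c" by (rule L_grpD(1)[OF odd2[OF odd_k] cL(1)])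
      finally show ?thesis .
    qed
  qed
  then have "card (?K \<times> ({b :: 'a. b \<noteq> 0} \<times> C')) = card ?C0" by (rule bij_betw_same_card)
  moreover have "card {b :: 'a. b \<noteq> 0} = ?q - 1"
    using card_Diff_singleton[of 0 "UNIV :: 'a set"] by (simp add: Compl_eq_Diff_UNIV[symmetric] Collect_neg_eq)
  ultimately have "card ?C0 = card ?K * ((?q - 1) * card C')" by (simp add: card_cartesian_product)
  then have "?q * card ?C0 = (?q * card ?K) * ((?q - 1) * card C')" by simp
  then show ?thesis unfolding K by simp
qed

text \<open>Types \<open>0\<close>, \<open>+\<close> and \<open>-\<close> in one statement: \<open>C\<close> is the complement in an inertia group of
  \<open>P\<^sub>n\<close>, \<open>C'\<close> the corresponding one in \<open>P\<^sub>n\<^sub>-\<^sub>2\<close>, and \<open>C0\<close> the parabolic subgroup of \<open>C\<close>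
  from which one induces.\<close>

lemma ind_RQK_inertia:
  fixes g :: "'a::{field,finite} mat" and \<xi> :: "'a \<Rightarrow> complex"
  assumes \<xi>: "additive_char \<xi>" and \<phi>: "linear_on k \<phi>"
    and g: "g \<in> P_grp (S4 k)" and z: "z \<in> carrier_vec k" "\<phi> z = 1"
    and C'L: "C' \<subseteq> L_grp (S2 k)"
    and C': "\<And>y a v. s_mat y a \<in> C' \<Longrightarrow> y \<in> SO k \<Longrightarrow> a \<noteq> 0 \<Longrightarrow> v \<in> carrier_vec k \<Longrightarrow> a * \<phi> (y *\<^sub>v v) = \<phi> v"
    and \<chi>: "\<chi> = ind (GL (S2 k)) (U_grp (S2 k) <#>\<^bsub>GL (S2 k)\<^esub> C') (P_grp (S2 k))
     (\<lambda>g. ext_char (GL (S2 k)) (U_grp (S2 k)) C' (U_char (S2 k) (\<lambda>v. \<xi> (\<phi> v))) g * infl (GL (S2 k)) (U_grp (S2 k)) C' \<theta> g)"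
    and C: "C \<subseteq> L_grp (S4 k)" "subgroup C (GL (S4 k))" and C0C: "C0 \<subseteq> C"
    and C0: "\<And>c. c \<in> L_grp (S4 k) \<Longrightarrow> c \<in> C0 \<longleftrightarrow> mid c \<in> P_grp (S2 k) \<and> core c \<in> C' \<and> \<phi> (unip_vec (mid c)) = 0"
    and \<tau>: "\<And>c. c \<in> C0 \<Longrightarrow> \<tau> c = \<theta> (core c)"
    and f: "\<And>v. v \<in> carrier_vec (S2 k) \<Longrightarrow> f v = \<xi> (\<phi> (midv v))"
    and f_inv: "\<And>c v. c \<in> C \<Longrightarrow> v \<in> carrier_vec (S2 k) \<Longrightarrow> f (c $$ (0, 0) \<cdot>\<^sub>v (mid c *\<^sub>v v)) = f v"
  shows "ind (GL (S4 k)) (RQK_grp (S4 k)) (P_grp (S4 k)) (conj_char (GL (S4 k)) (s_elt (S4 k)) (infl_RQK (S4 k) \<chi>)) g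
    = ind (GL (S4 k)) (U_grp (S4 k) <#>\<^bsub>GL (S4 k)\<^esub> C) (P_grp (S4 k))
     (\<lambda>g. ext_char (GL (S4 k)) (U_grp (S4 k)) C (U_char (S4 k) f) g
       * infl (GL (S4 k)) (U_grp (S4 k)) C (ind (GL (S4 k)) C0 C \<tau>) g) g"
proof -
  interpret group "GL (S4 k) :: 'a mat monoid" by simp
  let ?q = "card (UNIV :: 'a set)"
  have "C0 = {c \<in> L_grp (S4 k). mid c \<in> P_grp (S2 k) \<and> core c \<in> C' \<and> \<phi> (unip_vec (mid c)) = 0}"
    using C0 C0C C(1) by blast
  then have card: "?q * card C0 = ?q ^ k * (?q - 1) * card C'"
    using card_parabolic_levi[OF \<phi> z C'L] by simp
  \<comment> \<open>The normalizing constants of the two inductions coincide: both are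
    \<open>q ^ (k + Suc k) * (q - 1) * card C'\<close>.\<close>
  have "?q ^ (S2 k) * card C0 = ?q ^ Suc k * (?q * card C0)" by simp
  also have "\<dots> = ?q ^ (k + Suc k) * (?q - 1) * card C'" unfolding card by (simp add: power_add)
  finally have card': "?q ^ (S2 k) * card C0 = ?q ^ (k + Suc k) * (?q - 1) * card C'" .
  have "cavg (GL (S4 k)) (P_grp (S4 k))
      (\<lambda>g. if mid g \<in> P_grp (S2 k) \<and> core g \<in> C' \<and> \<phi> (unip_vec (mid g)) = 0
        then \<xi> (\<phi> (midv (unip_vec g))) * \<theta> (core g) else 0) g
    = cavg (GL (S4 k)) (P_grp (S4 k)) (\<lambda>g. if levi g \<in> C0 then f (unip_vec g) * \<tau> (levi g) else 0) g"
  proof (rule cavg_cong[OF subgroup_P[OF odd2[OF odd_k]] g])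
    fix h :: "'a mat" assume h: "h \<in> P_grp (S4 k)"
    note l = levi_simps[OF odd2[OF odd_k] h]
    have "core (levi h) = core h" unfolding core_def l ..
    moreover have "f (unip_vec h) = \<xi> (\<phi> (midv (unip_vec h)))"
      by (rule f) (rule unip_vec_carrier[OF P_carrier[OF odd2[OF odd_k] h]])
    ultimately show "(if mid h \<in> P_grp (S2 k) \<and> core h \<in> C' \<and> \<phi> (unip_vec (mid h)) = 0
        then \<xi> (\<phi> (midv (unip_vec h))) * \<theta> (core h) else 0)
      = (if levi h \<in> C0 then f (unip_vec h) * \<tau> (levi h) else 0)"
      using C0[OF l(6)] \<tau>[of "levi h"] unfolding l by auto
  qed
  then have "cavg (GL (S4 k)) (P_grp (S4 k))
      (\<lambda>g. if mid g \<in> P_grp (S2 k) \<and> core g \<in> C' \<and> \<phi> (unip_vec (mid g)) = 0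
        then \<xi> (\<phi> (midv (unip_vec g))) * \<theta> (core g) else 0) g
      / of_nat (?q ^ (k + Suc k) * (?q - 1) * card C')
    = cavg (GL (S4 k)) (P_grp (S4 k)) (\<lambda>g. if levi g \<in> C0 then f (unip_vec g) * \<tau> (levi g) else 0) g
      / of_nat (?q ^ (S2 k) * card C0)" unfolding card' by simp
  also have "\<dots> = ind (GL (S4 k)) (U_grp (S4 k) <#>\<^bsub>GL (S4 k)\<^esub> C) (P_grp (S4 k))
     (\<lambda>g. ext_char (GL (S4 k)) (U_grp (S4 k)) C (U_char (S4 k) f) g
       * infl (GL (S4 k)) (U_grp (S4 k)) C (ind (GL (S4 k)) C0 C \<tau>) g) g"
    by (rule ind_U_L_ind[OF odd2[OF odd_k] C C0C g, symmetric]) (rule f_inv)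
  finally show ?thesis
    by (subst ind_RQK_psi[OF \<xi> \<phi> g z C'L _ \<chi>]) (rule C')
qed

end

section \<open>Type 1\<close>

lemma s_mat_in_L: "x \<in> SO k \<Longrightarrow> a \<noteq> 0 \<Longrightarrow> s_mat x a \<in> L_grp (S2 k)"
  unfolding L_grp_def by auto

context
  fixes k :: nat
  assumes odd_k: "odd k"
begin

text \<open>The fibres of \<open>levi\<close> on \<open>P_n\<close> are cosets of
  \<open>U_n\<close>.\<close>

lemma sum_levi:
  fixes F :: "'a::{field,finite} mat \<Rightarrow> complex"
  shows "(\<Sum>x\<in>P_grp (S2 k). F (levi x)) = of_nat (card (UNIV :: 'a set) ^ k) * (\<Sum>l\<in>L_grp (S2 k). F l)"
proof -
  note u = u_mult_L[OF odd_k, where 'a = 'a]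
  have "(\<Sum>x\<in>P_grp (S2 k). F (levi x)) = (\<Sum>(v, l)\<in>(carrier_vec k :: 'a vec set) \<times> L_grp (S2 k). F l)"
    by (rule sum.reindex_bij_witness[where i = "\<lambda>(v, l). u_mat (S2 k) v * l" and j = "\<lambda>x. (unip_vec x, levi x)"])
       (auto simp: u P_decomp[OF odd_k, symmetric] levi_simps(6)[OF odd_k]
         intro: unip_vec_carrier[OF P_carrier[OF odd_k]])
  also have "\<dots> = of_nat (card (UNIV :: 'a set) ^ k) * (\<Sum>l\<in>L_grp (S2 k). F l)"
    by (simp add: sum.cartesian_product[symmetric] card_carrier_vec)
  finally show ?thesis .
qed

text \<open>A character inflated from \<open>L_n\<close> depends only on \<open>levi\<close>, so the
  sum over \<open>L_n\<close> in the inner induction can be spread evenly over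
  \<open>P_n\<close>.\<close>

lemma psi_one_ind:
  fixes g :: "'a::{field,finite} mat"
  assumes g: "g \<in> P_grp (S2 k)" and C0: "C0 \<subseteq> L_grp (S2 k)"
  shows "psi_one (S2 k) (ind (GL (S2 k)) C0 (L_grp (S2 k)) \<tau>) g
    = cavg (GL (S2 k)) (P_grp (S2 k)) (\<lambda>g. if levi g \<in> C0 then \<tau> (levi g) else 0) g
      / of_nat (card (UNIV :: 'a set) ^ k * card C0)"
proof -
  interpret group "GL (S2 k) :: 'a mat monoid" by simp
  note P = subgroup_P[OF odd_k, where 'a = 'a]
  let ?F = "\<lambda>y. if inv\<^bsub>GL (S2 k)\<^esub> y \<otimes>\<^bsub>GL (S2 k)\<^esub> levi g \<otimes>\<^bsub>GL (S2 k)\<^esub> y \<in> C0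
    then \<tau> (inv\<^bsub>GL (S2 k)\<^esub> y \<otimes>\<^bsub>GL (S2 k)\<^esub> levi g \<otimes>\<^bsub>GL (S2 k)\<^esub> y) else 0"
  have lc: "levi (inv\<^bsub>GL (S2 k)\<^esub> x \<otimes>\<^bsub>GL (S2 k)\<^esub> g \<otimes>\<^bsub>GL (S2 k)\<^esub> x) = inv\<^bsub>GL (S2 k)\<^esub> levi x \<otimes>\<^bsub>GL (S2 k)\<^esub> levi g \<otimes>\<^bsub>GL (S2 k)\<^esub> levi x"
    if x: "x \<in> P_grp (S2 k)" for x
  proof -
    have ix: "inv\<^bsub>GL (S2 k)\<^esub> x \<in> P_grp (S2 k)" by (rule subgroup.m_inv_closed[OF P x])
    show ?thesis using restricted_hom_inv[OF P group_GL levi_hom[OF odd_k] x]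
      by (simp add: levi_mult[OF odd_k] P_mult(1)[OF odd_k] ix g x)
  qed
  have "cavg (GL (S2 k)) (P_grp (S2 k)) (\<lambda>g. if levi g \<in> C0 then \<tau> (levi g) else 0) g = (\<Sum>x\<in>P_grp (S2 k). ?F (levi x))"
    unfolding cavg_def by (rule sum.cong) (simp_all only: lc)
  also have "\<dots> = of_nat (card (UNIV :: 'a set) ^ k) * (\<Sum>y\<in>L_grp (S2 k). ?F y)" by (rule sum_levi)
  finally have 1: "cavg (GL (S2 k)) (P_grp (S2 k)) (\<lambda>g. if levi g \<in> C0 then \<tau> (levi g) else 0) g
    = of_nat (card (UNIV :: 'a set) ^ k) * (\<Sum>y\<in>L_grp (S2 k). ?F y)" .
  have "of_nat (card (UNIV :: 'a set)) \<noteq> (0 :: complex)" using card_field[OF odd_k, where 'a = 'a] by simp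
  then show ?thesis unfolding 1
    using levi_simps(6)[OF odd_k g] g by (simp add: psi_one_def infl_U_L[OF odd_k subset_refl] ind_def)
qed

end

section \<open>The groups P_tilde, L_K and Q_K, and characters of Type 1\<close>

context
  fixes k :: nat
  assumes odd_k: "odd k"
begin

lemma P_tilde_iff:
  fixes c :: "'a::field mat"
  shows "c \<in> P_tilde (S4 k) \<longleftrightarrow> c \<in> L_grp (S4 k) \<and> mid c \<in> P_grp (S2 k) \<and> mid c $$ (0, 0) = c $$ (0, 0)"
proof -
  have e: "x *\<^sub>v unit_vec (S2 k) 0 = a \<cdot>\<^sub>v unit_vec (S2 k) 0 \<longleftrightarrow> x $$ (0, 0) = a" if x: "x \<in> P_grp (S2 k)" for x and a :: 'a
  proof -
    note xc = P_carrier[OF odd_k x]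
    have "x *\<^sub>v unit_vec (S2 k) 0 = x $$ (0, 0) \<cdot>\<^sub>v unit_vec (S2 k) 0"
      by (intro eq_vecI) (use xc par_col[OF P_par(1)[OF odd_k x]] in \<open>auto simp: mult_mat_vec_unit[OF xc] simp del: index_mult_mat_vec\<close>)
    then show ?thesis by (auto dest!: arg_cong[where f = "\<lambda>v. v $ 0"])
  qed
  show ?thesis
  proof
    assume "c \<in> P_tilde (S4 k)"
    then obtain x a where xa: "c = s_mat x a" "x \<in> P_grp (S2 k)" "a \<noteq> 0" "x *\<^sub>v unit_vec (S2 k) 0 = a \<cdot>\<^sub>v unit_vec (S2 k) 0"
      by (auto simp: P_tilde_def)
    have "c \<in> L_grp (S4 k)" using xa P_in_SO[OF odd_k xa(2)] by (auto simp: L_grp_def)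
    then show "c \<in> L_grp (S4 k) \<and> mid c \<in> P_grp (S2 k) \<and> mid c $$ (0, 0) = c $$ (0, 0)"
      using xa(1,2) P_carrier[OF odd_k xa(2)] xa(4)[unfolded e[OF xa(2)]] by simp
  next
    assume c: "c \<in> L_grp (S4 k) \<and> mid c \<in> P_grp (S2 k) \<and> mid c $$ (0, 0) = c $$ (0, 0)"
    then have "c = s_mat (mid c) (c $$ (0, 0))" "c $$ (0, 0) \<noteq> 0" using L_grpD(1,3)[OF odd2[OF odd_k], of c] by auto
    moreover have "mid c *\<^sub>v unit_vec (S2 k) 0 = c $$ (0, 0) \<cdot>\<^sub>v unit_vec (S2 k) 0" using c e by metis
    ultimately show "c \<in> P_tilde (S4 k)" using c by (auto simp: P_tilde_def)
  qed
qed

lemma P_tilde_L: "P_tilde (S4 k) \<subseteq> L_grp (S4 k)"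
  using P_tilde_iff by blast

text \<open>On \<open>P_tilde\<close> the corner entry is forced to equal the first entry of the
  middle block, so the middle block alone is a coordinate.\<close>

lemma bij_mid_P_tilde: "bij_betw mid (P_tilde (S4 k)) (P_grp (S2 k) :: 'a::field mat set)"
proof (rule bij_betwI[where g = "\<lambda>x. s_mat x (x $$ (0, 0))"])
  show "mid \<in> P_tilde (S4 k) \<rightarrow> (P_grp (S2 k) :: 'a mat set)" by (simp add: P_tilde_iff)
  have x: "s_mat x (x $$ (0, 0)) \<in> P_tilde (S4 k) \<and> mid (s_mat x (x $$ (0, 0))) = x" if "x \<in> P_grp (S2 k)" for x :: "'a mat"
    using that P_carrier[OF odd_k that] P_in_SO[OF odd_k that] P_par(2)[OF odd_k that]
    by (auto simp: P_tilde_iff L_grp_def)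
  show "(\<lambda>x. s_mat x (x $$ (0, 0))) \<in> P_grp (S2 k) \<rightarrow> (P_tilde (S4 k) :: 'a mat set)" using x by auto
  show "mid (s_mat y (y $$ (0, 0))) = y" if "y \<in> P_grp (S2 k)" for y :: "'a mat" using x[OF that] ..
  show "s_mat (mid c) (mid c $$ (0, 0)) = c" if "c \<in> P_tilde (S4 k)" for c :: "'a mat"
    using that L_grpD(1)[OF odd2[OF odd_k], of c] by (simp add: P_tilde_iff)
qed

lemma LK_eq: "LK_grp (S4 k) = {c \<in> L_grp (S4 k). mid c \<in> (L_grp (S2 k) :: 'a::field mat set)}"
proof (intro equalityI subsetI)
  fix g :: "'a mat" assume "g \<in> LK_grp (S4 k)"
  then obtain a x where ax: "a \<noteq> 0" "x \<in> L_grp (S2 k)" "g = s_mat (1\<^sub>m (S2 k)) a * s_mat x 1"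
    by (auto simp: LK_grp_def set_mult_def A_grp_def L_emb_def emb_def)
  have x: "x \<in> P_grp (S2 k)" using ax(2) by (simp add: L_grp_iff[OF odd_k])
  have xc: "x \<in> carrier_mat (S2 k) (S2 k)" by (rule P_carrier[OF odd_k x])
  have "g = s_mat x a" unfolding ax(3) using s_mat_mult[OF odd2[OF odd_k] one_SO[OF odd_k] ax(1) P_in_SO[OF odd_k x] one_neq_zero] xc by simp
  then show "g \<in> {c \<in> L_grp (S4 k). mid c \<in> L_grp (S2 k)}"
    using ax xc P_in_SO[OF odd_k x] by (auto simp: L_grp_def[of "(S4 k)"])
next
  fix g :: "'a mat" assume g: "g \<in> {c \<in> L_grp (S4 k). mid c \<in> L_grp (S2 k)}"
  then obtain x a where xa: "g = s_mat x a" "x \<in> SO (S2 k)" "a \<noteq> 0" by (auto simp: L_grp_def[of "(S4 k)"])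
  have xc: "x \<in> carrier_mat (S2 k) (S2 k)" using xa(2) by (simp add: SO_iff)
  then have xL: "x \<in> L_grp (S2 k)" using g xa by simp
  have "g = s_mat (1\<^sub>m (S2 k)) a * s_mat x 1"
    using s_mat_mult[OF odd2[OF odd_k] one_SO[OF odd_k] xa(3) xa(2) one_neq_zero] xc xa(1) by simp
  then show "g \<in> LK_grp (S4 k)" using xa(3) xL
    by (auto simp: LK_grp_def set_mult_def A_grp_def L_emb_def emb_def)
qed

lemma char_LK_eq:
  fixes g :: "'a::field mat"
  shows "char_LK (S4 k) \<chi> g = (if g \<in> LK_grp (S4 k) then \<chi> (mid g) else 0)"
proof (cases "g \<in> LK_grp (S4 k)")
  case True
  have u: "l = emb (mid g) \<and> mid g \<in> L_grp (S2 k)" if th: "l \<in> L_emb (S4 k)" "u \<in> A_grp (S4 k)" "g = u * l" for u l :: "'a mat"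
  proof -
    obtain a where a: "a \<noteq> 0" "u = s_mat (1\<^sub>m (S2 k)) a" using th(2) by (auto simp: A_grp_def)
    obtain x where x: "l = s_mat x 1" "x \<in> L_grp (S2 k)" using th(1) by (auto simp: L_emb_def emb_def)
    have xP: "x \<in> P_grp (S2 k)" using x by (simp add: L_grp_iff[OF odd_k])
    have xc: "x \<in> carrier_mat (S2 k) (S2 k)" by (rule P_carrier[OF odd_k xP])
    have "g = s_mat x a" unfolding th(3) a x
      using s_mat_mult[OF odd2[OF odd_k] one_SO[OF odd_k] a(1) P_in_SO[OF odd_k xP] one_neq_zero] xc by simp
    then show ?thesis using x xc by (simp add: emb_def)
  qed
  obtain u l where ul: "l \<in> L_emb (S4 k)" "u \<in> A_grp (S4 k)" "g = u * l"
    using True by (auto simp: LK_grp_def set_mult_def)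
  have "(THE l. l \<in> L_emb (S4 k) \<and> (\<exists>u\<in>A_grp (S4 k). g = u * l)) = emb (mid g)"
  proof (rule the_equality)
    have "l = emb (mid g)" using u[OF ul] ..
    then show "emb (mid g) \<in> L_emb (S4 k) \<and> (\<exists>u\<in>A_grp (S4 k). g = u * emb (mid g))" using ul by auto
    fix l' assume "l' \<in> L_emb (S4 k) \<and> (\<exists>u\<in>A_grp (S4 k). g = u * l')"
    then obtain u' where "l' \<in> L_emb (S4 k)" "u' \<in> A_grp (S4 k)" "g = u' * l'" by blast
    from u[OF this] show "l' = emb (mid g)" ..
  qed
  moreover have m: "mid g \<in> L_grp (S2 k)" using u[OF ul] ..
  then have mP: "mid g \<in> P_grp (S2 k)" by (simp add: L_grp_iff[OF odd_k])
  moreover have "mid (emb (mid g)) = mid g" using P_carrier[OF odd_k mP] by (simp add: emb_def)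
  ultimately show ?thesis using True m
    by (auto simp: char_LK_def infl_def LK_grp_def restr_def char_emb_def L_emb_def P_emb_def)
next
  case False
  then show ?thesis by (simp add: char_LK_def infl_def LK_grp_def)
qed

text \<open>The Levi decomposition of \<open>mid c\<close>, one size down, with the outer torus
  entry carried along.\<close>

lemma
  fixes c :: "'a::field mat"
  shows U_emb_LK: "U_emb (S4 k) <#>\<^bsub>GL (S4 k)\<^esub> LK_grp (S4 k) = (QK_grp (S4 k) :: 'a mat set)"
    and infl_U_emb_LK: "c \<in> QK_grp (S4 k) \<Longrightarrow> infl (GL (S4 k)) (U_emb (S4 k)) (LK_grp (S4 k)) \<chi> c = \<chi> (s_mat (levi (mid c)) (c $$ (0, 0)))"
proof -
  have u: "l = s_mat (levi (mid c)) (c $$ (0, 0)) \<and> c \<in> QK_grp (S4 k)"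
    if th: "l \<in> LK_grp (S4 k)" "u \<in> U_emb (S4 k)" "c = u * l" for u l c :: "'a mat"
  proof -
    obtain w where w: "w \<in> carrier_vec k" "u = emb (u_mat (S2 k) w)" using th(2) by (auto simp: U_emb_def U_grp_def)
    have l: "l \<in> L_grp (S4 k)" "mid l \<in> L_grp (S2 k)" using th(1) by (auto simp: LK_eq)
    note uP = u_mat_in_P[OF odd_k w(1)]
    note e = emb_props[OF odd2[OF odd_k] P_in_SO[OF odd_k uP]]
    have lP: "l \<in> P_grp (S4 k)" "l = s_mat (mid l) (l $$ (0, 0))" using L_grpD(1,4)[OF odd2[OF odd_k] l(1)] by simp_all
    note p = P_mult[OF odd2[OF odd_k] e(1) lP(1), folded w(2), folded th(3)]
    note m = u_mult_L[OF odd_k w(1) l(2)]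
    have mc: "mid c = u_mat (S2 k) w * mid l" "c $$ (0, 0) = l $$ (0, 0)" using p(2,3) by (simp_all add: w(2) e)
    have "levi (mid c) = mid l" unfolding mc m ..
    moreover have "c \<in> L_grp (S4 k)"
      using subgroup.m_closed[OF subgroup_L[OF odd2[OF odd_k]] e(5) l(1)] th(3) w(2) by simp
    moreover have "mid c \<in> P_grp (S2 k)" unfolding mc by (rule m)
    ultimately show ?thesis using lP(2)[symmetric] mc by (simp add: QK_eq[OF odd_k])
  qed
  have ex: "s_mat (levi (mid c)) (c $$ (0, 0)) \<in> LK_grp (S4 k) \<and> emb (u_mat (S2 k) (unip_vec (mid c))) \<in> U_emb (S4 k) \<and>
      c = emb (u_mat (S2 k) (unip_vec (mid c))) * s_mat (levi (mid c)) (c $$ (0, 0))" if c: "c \<in> QK_grp (S4 k)" for c :: "'a mat"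
  proof -
    have cL: "c \<in> L_grp (S4 k)" "mid c \<in> P_grp (S2 k)" using c by (auto simp: QK_eq[OF odd_k])
    have cc: "c = s_mat (mid c) (c $$ (0, 0))" "c $$ (0, 0) \<noteq> 0" using L_grpD(1,3)[OF odd2[OF odd_k] cL(1)] by simp_all
    note w = unip_vec_carrier[OF P_carrier[OF odd_k cL(2)]]
    note l = levi_simps[OF odd_k cL(2)]
    have "s_mat (levi (mid c)) (c $$ (0, 0)) \<in> L_grp (S4 k)"
      using P_in_SO[OF odd_k l(1)] cc(2) by (auto simp: L_grp_def)
    then have "s_mat (levi (mid c)) (c $$ (0, 0)) \<in> LK_grp (S4 k)"
      using l P_carrier[OF odd_k l(1)] by (simp add: LK_eq)
    moreover have "emb (u_mat (S2 k) (unip_vec (mid c))) \<in> U_emb (S4 k)" using w by (auto simp: U_emb_def U_grp_def)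
    moreover have "emb (u_mat (S2 k) (unip_vec (mid c))) * s_mat (levi (mid c)) (c $$ (0, 0)) = c"
    proof -
      have "emb (u_mat (S2 k) (unip_vec (mid c))) * s_mat (levi (mid c)) (c $$ (0, 0))
        = s_mat (u_mat (S2 k) (unip_vec (mid c)) * levi (mid c)) (1 * c $$ (0, 0))" unfolding emb_def
        by (rule s_mat_mult[OF odd2[OF odd_k] P_in_SO[OF odd_k u_mat_in_P[OF odd_k w]] one_neq_zero P_in_SO[OF odd_k l(1)] cc(2)])
      then show ?thesis using P_decomp[OF odd_k cL(2), symmetric] cc(1)[symmetric] by simp
    qed
    ultimately show ?thesis by metis
  qed
  show 1: "U_emb (S4 k) <#>\<^bsub>GL (S4 k)\<^esub> LK_grp (S4 k) = (QK_grp (S4 k) :: 'a mat set)"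
  proof (intro equalityI subsetI)
    fix c :: "'a mat" assume "c \<in> U_emb (S4 k) <#>\<^bsub>GL (S4 k)\<^esub> LK_grp (S4 k)"
    then obtain u' l where "l \<in> LK_grp (S4 k)" "u' \<in> U_emb (S4 k)" "c = u' * l" by (auto simp: set_mult_def)
    from u[OF this] show "c \<in> QK_grp (S4 k)" ..
  next
    fix c :: "'a mat" assume "c \<in> QK_grp (S4 k)"
    from ex[OF this] show "c \<in> U_emb (S4 k) <#>\<^bsub>GL (S4 k)\<^esub> LK_grp (S4 k)" unfolding set_mult_def by auto
  qed
  assume c: "c \<in> QK_grp (S4 k)"
  have "(THE l. l \<in> LK_grp (S4 k) \<and> (\<exists>u\<in>U_emb (S4 k). c = u * l)) = s_mat (levi (mid c)) (c $$ (0, 0))"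
  proof (rule the_equality)
    show "s_mat (levi (mid c)) (c $$ (0, 0)) \<in> LK_grp (S4 k) \<and> (\<exists>u\<in>U_emb (S4 k). c = u * s_mat (levi (mid c)) (c $$ (0, 0)))"
      using ex[OF c] by blast
    fix l assume "l \<in> LK_grp (S4 k) \<and> (\<exists>u\<in>U_emb (S4 k). c = u * l)"
    then obtain u' where "l \<in> LK_grp (S4 k)" "u' \<in> U_emb (S4 k)" "c = u' * l" by blast
    from u[OF this] show "l = s_mat (levi (mid c)) (c $$ (0, 0))" ..
  qed
  then show "infl (GL (S4 k)) (U_emb (S4 k)) (LK_grp (S4 k)) \<chi> c = \<chi> (s_mat (levi (mid c)) (c $$ (0, 0)))"
    unfolding infl_def 1 using c by simp
qed

text \<open>\<open>s_elt\<close> interchanges the torus factors \<open>A\<close> and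
  \<open>A_{n-2}\<close> of \<open>L_K\<close>. Beyond \<open>K_conj_simps\<close> one has to see
  that no outer unipotent part appears, and this is checked entry by entry in the last
  column.\<close>

lemma s_conj_LK:
  fixes c :: "'a::field mat"
  assumes c: "c \<in> LK_grp (S4 k)"
  shows "s_elt (S4 k) * c * s_elt (S4 k) \<in> LK_grp (S4 k)" "mid (s_elt (S4 k) * c * s_elt (S4 k)) = core c"
proof -
  have cL: "c \<in> L_grp (S4 k)" "mid c \<in> L_grp (S2 k)" using c by (auto simp: LK_eq)
  have cP: "c \<in> P_grp (S4 k)" "unip_vec c = 0\<^sub>v (S2 k)" "c = s_mat (mid c) (c $$ (0, 0))"
    using L_grpD(1,4,5)[OF odd2[OF odd_k] cL(1)] by simp_all
  have mP: "mid c \<in> P_grp (S2 k)" "unip_vec (mid c) = 0\<^sub>v k" using L_grpD(4,5)[OF odd_k cL(2)] by simp_all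
  have cK: "c \<in> K_grp (S4 k)" using cP mP by (simp add: K_grp_I[OF odd_k])
  let ?h = "s_elt (S4 k) * c * s_elt (S4 k)"
  note h = K_conj_simps[OF odd_k cK] and hK = K_conj_simps(1)[OF odd_k cK]
  note hP = K_grp_D[OF odd_k hK]
  note hl = levi_mid_s_conj[OF odd_k cK]
  have "unip_vec (mid ?h) = 0\<^sub>v k" unfolding hl(3) cP(2) by (intro eq_vecI) auto
  then have lm: "levi (mid ?h) = mid ?h"
    by (intro P_eqI[OF odd_k levi_simps(1)[OF odd_k hP(2)] hP(2) levi_simps(2,3)[OF odd_k hP(2)]])
       (simp only: levi_simps(4)[OF odd_k hP(2)])
  then show mh: "mid ?h = core c" using hl(2) by (rule trans[OF sym])
  have mL: "mid ?h \<in> L_grp (S2 k)" unfolding L_grp_iff[OF odd_k] using lm hP(2) by (rule conjI[rotated])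
  have "unip_vec ?h = 0\<^sub>v (S2 k)"
  proof (rule eq_vecI)
    have hc: "?h \<in> carrier_mat (S4 k) (S4 k)" by (rule P_carrier[OF odd2[OF odd_k] hP(1)])
    have mc: "mid c \<in> carrier_mat (S2 k) (S2 k)" by (rule P_carrier[OF odd_k mP(1)])
    fix i assume "i < dim_vec (0\<^sub>v (S2 k) :: 'a vec)"
    then have i: "i < (S2 k)" by simp
    have e: "?h $$ (Suc i, Suc (S2 k)) = c $$ (swap4 (S4 k) (Suc i), (S2 k))"
      using s_elt_conj[OF odd_pos[OF odd_k] P_carrier[OF odd2[OF odd_k] cP(1)], of "Suc i" "Suc (S2 k)"] i odd_pos[OF odd_k] by simp
    have "c $$ (swap4 (S4 k) (Suc i), (S2 k)) = 0"
    proof (cases "i = 0")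
      case True
      have "s_mat (mid c) (c $$ (0, 0)) $$ (0, Suc (Suc k)) = 0" using s_mat_simps(7)[OF mc, of "Suc k"] by simp
      then show ?thesis using True cP(3)[symmetric] by simp
    next
      case False
      then obtain j where j: "i = Suc j" by (cases i) auto
      show ?thesis
      proof (cases "j < k")
        case True
        have "mid c $$ (Suc j, Suc k) = 0"
          using arg_cong[OF mP(2), of "\<lambda>v. v $ j"] True P_par(2)[OF odd_k mP(1)] carrier_matD[OF P_carrier[OF odd2[OF odd_k] cP(1)]] by simp
        then show ?thesis using True j carrier_matD[OF P_carrier[OF odd2[OF odd_k] cP(1)]] by simp
      next
        case False
        then have "swap4 (S4 k) (Suc i) = Suc (S2 k)" using i j odd_pos[OF odd_k] by (simp add: less_Suc_eq)
        then show ?thesis using par_row[OF P_par(1)[OF odd2[OF odd_k] cP(1)], of "(S2 k)"] by simp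
      qed
    qed
    moreover have "unip_vec ?h $ i = ?h $$ (0, 0) * ?h $$ (Suc i, dim_row ?h - 1)"
      by (rule unip_vec_entry) (simp only: carrier_matD(1)[OF hc], use i in simp)
    ultimately show "unip_vec ?h $ i = 0\<^sub>v (S2 k) $ i" using i e by (simp only: carrier_matD(1)[OF hc]) simp
  qed (use carrier_vecD[OF unip_vec_carrier[OF P_carrier[OF odd2[OF odd_k] hP(1)]]] in \<open>simp only: index_zero_vec\<close>)
  then have "levi ?h = ?h"
    by (intro P_eqI[OF odd2[OF odd_k] levi_simps(1)[OF odd2[OF odd_k] hP(1)] hP(1) levi_simps(2,3)[OF odd2[OF odd_k] hP(1)]])
       (simp only: levi_simps(4)[OF odd2[OF odd_k] hP(1)])
  then have "?h \<in> L_grp (S4 k)" using hP(1) L_grp_iff[OF odd2[OF odd_k]] by blast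
  then show "?h \<in> LK_grp (S4 k)" using mL LK_eq by blast
qed

text \<open>The integrand of Harish-Chandra induction is again the pullback along
  \<open>core\<close>, the function that conjugation by \<open>s_elt\<close> produces in the
  induction from \<open>R Q_K\<close>.\<close>

lemma HC_integrand:
  fixes c :: "'a::field mat"
  assumes c: "c \<in> QK_grp (S4 k)"
  shows "infl (GL (S4 k)) (U_emb (S4 k)) (LK_grp (S4 k)) (conj_char (GL (S4 k)) (s_elt (S4 k)) (char_LK (S4 k) \<chi>)) c = \<chi> (core c)"
proof -
  have cL: "c \<in> L_grp (S4 k)" "mid c \<in> P_grp (S2 k)" using c by (auto simp: QK_eq[OF odd_k])
  have c0: "c $$ (0, 0) \<noteq> 0" using L_grpD(1,3)[OF odd2[OF odd_k] cL(1)] by simp_all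
  note l = levi_simps[OF odd_k cL(2)]
  let ?l = "s_mat (levi (mid c)) (c $$ (0, 0))"
  have lL: "?l \<in> L_grp (S4 k)" using P_in_SO[OF odd_k l(1)] c0 by (auto simp: L_grp_def)
  have lK: "?l \<in> LK_grp (S4 k)" using lL l P_carrier[OF odd_k l(1)] by (simp add: LK_eq)
  have "?l \<in> carrier (GL (S4 k))" using lL subgroup.subset[OF subgroup_L[OF odd2[OF odd_k], where 'a = 'a]] by auto
  moreover have "core ?l = core c" unfolding core_def using P_carrier[OF odd_k l(1)] l by simp
  ultimately show ?thesis
    unfolding infl_U_emb_LK[OF c] conj_char_def s_conj_GL[OF odd_k] char_LK_eq
    using s_conj_LK[OF lK] by simp
qed

lemma card_QK: "card (QK_grp (S4 k) :: 'a::{field,finite} mat set) = (card (UNIV :: 'a set) - 1) * card (P_grp (S2 k) :: 'a mat set)"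
proof -
  have "bij_betw (\<lambda>(a, x). s_mat x a) ({a. a \<noteq> 0} \<times> P_grp (S2 k)) (QK_grp (S4 k) :: 'a mat set)"
  proof (rule bij_betwI[where g = "\<lambda>c. (c $$ (0, 0), mid c)"])
    have f: "s_mat x a \<in> QK_grp (S4 k) \<and> mid (s_mat x a) = x \<and> s_mat x a $$ (0, 0) = a" if "a \<noteq> 0" "x \<in> P_grp (S2 k)" for x and a :: 'a
      using that P_in_SO[OF odd_k that(2)] P_carrier[OF odd_k that(2)] by (auto simp: QK_eq[OF odd_k] L_grp_def)
    show "(\<lambda>(a, x). s_mat x a) \<in> {a. a \<noteq> 0} \<times> P_grp (S2 k) \<rightarrow> (QK_grp (S4 k) :: 'a mat set)" using f by auto
    show "(\<lambda>c. (c $$ (0, 0), mid c)) \<in> QK_grp (S4 k) \<rightarrow> {a. a \<noteq> 0} \<times> (P_grp (S2 k) :: 'a mat set)"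
      by (auto simp: QK_eq[OF odd_k] L_grpD(3)[OF odd2[OF odd_k]])
    show "((\<lambda>(a, x). s_mat x a) y $$ (0, 0), mid ((\<lambda>(a, x). s_mat x a) y)) = y"
      if "y \<in> {a. a \<noteq> 0} \<times> (P_grp (S2 k) :: 'a mat set)" for y using that f by auto
    show "(\<lambda>(a, x). s_mat x a) (y $$ (0, 0), mid y) = y" if "y \<in> QK_grp (S4 k)" for y :: "'a mat"
      using that by (simp add: QK_eq[OF odd_k] L_grpD(1)[OF odd2[OF odd_k]])
  qed
  then have "card ({a :: 'a. a \<noteq> 0} \<times> (P_grp (S2 k) :: 'a mat set)) = card (QK_grp (S4 k) :: 'a mat set)" by (rule bij_betw_same_card)
  moreover have "card {b :: 'a. b \<noteq> 0} = card (UNIV :: 'a set) - 1"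
    using card_Diff_singleton[of 0 "UNIV :: 'a set"] by (simp add: Compl_eq_Diff_UNIV[symmetric] Collect_neg_eq)
  ultimately show ?thesis by (simp add: card_cartesian_product)
qed

lemma ind_RQK_type_one:
  fixes g :: "'a::{field,finite} mat" and \<xi> :: "'a \<Rightarrow> complex"
  assumes \<xi>: "additive_char \<xi>" and g: "g \<in> P_grp (S4 k)"
    and \<chi>: "\<And>x. x \<in> P_grp (S2 k) \<Longrightarrow> \<chi> x = \<chi> (levi x)"
  shows "ind (GL (S4 k)) (RQK_grp (S4 k)) (P_grp (S4 k)) (conj_char (GL (S4 k)) (s_elt (S4 k)) (infl_RQK (S4 k) \<chi>)) g
    = psi_zero \<xi> (S4 k) \<chi> g + psi_one (S4 k) (HC_LK (S4 k) (conj_char (GL (S4 k)) (s_elt (S4 k)) (char_LK (S4 k) \<chi>))) g"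
proof -
  interpret group "GL (S4 k) :: 'a mat monoid" by simp
  note P = subgroup_P[OF odd2[OF odd_k], where 'a = 'a]
  let ?q = "card (UNIV :: 'a set)" and ?p = "card (P_grp (S2 k) :: 'a mat set)"
  let ?avg = "cavg (GL (S4 k)) (P_grp (S4 k))"
  let ?a = "\<lambda>g :: 'a mat. g $$ (0, 0)" and ?b = "\<lambda>g :: 'a mat. mid g $$ (0, 0)" and ?v = "\<lambda>g :: 'a mat. unip_vec g $ Suc k"
  \<comment> \<open>\<open>?F\<close> is the integrand for \<open>R Q_K\<close>, averaged over the
    root subgroup. \<open>?Fo\<close> is the Harish-Chandra integrand, and \<open>?Fz\<close> is the
    Type \<open>0\<close> integrand averaged over the torus \<open>A\<close>.\<close>
  let ?F = "\<lambda>g. if mid g \<in> P_grp (S2 k) then \<chi> (core g) * (\<Sum>t\<in>UNIV. if ?v g + t * (1 - ?a g / ?b g) = 0 then 1 else 0) else 0"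
  let ?Fz = "\<lambda>g. if mid g \<in> P_grp (S2 k) \<and> ?a g = ?b g then \<chi> (mid g) * (if ?v g = 0 then of_nat ?q - 1 else - 1) else 0"
  let ?Fo = "\<lambda>g. if mid g \<in> P_grp (S2 k) then \<chi> (core g) else 0"
  have chi_mid: "\<chi> (mid h) = \<chi> (core h)" if "mid h \<in> P_grp (S2 k)" "?a h = ?b h" for h
    using \<chi>[OF that(1)] that(2) by (simp add: levi_def core_def)
  have F: "?avg ?F g = ?avg (\<lambda>g. ?Fz g + ?Fo g) g"
  proof (rule cavg_cong[OF P g])
    fix h :: "'a mat" assume h: "h \<in> P_grp (S4 k)"
    show "?F h = ?Fz h + ?Fo h"
    proof (cases "mid h \<in> P_grp (S2 k)")
      case True
      have b: "?b h \<noteq> 0" by (rule P_par(2)[OF odd_k True])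
      show ?thesis
      proof (cases "?a h = ?b h")
        case ab: True
        have "1 - ?a h / ?b h = 0" using ab b by simp
        then have "?F h = \<chi> (core h) * (if ?v h = 0 then of_nat ?q else 0)" using True by simp
        moreover have "?Fz h = \<chi> (core h) * (if ?v h = 0 then of_nat ?q - 1 else - 1)" using True ab chi_mid[OF True ab] by simp
        moreover have "?Fo h = \<chi> (core h)" using True by simp
        ultimately show ?thesis by (simp only:) (simp add: algebra_simps)
      next
        case ab: False
        then have nz: "1 - ?a h / ?b h \<noteq> 0" using b by (simp add: field_simps)
        have "?v h + t * (1 - ?a h / ?b h) = 0 \<longleftrightarrow> t = - ?v h / (1 - ?a h / ?b h)" for t
          by (simp only: nonzero_eq_divide_eq[OF nz] eq_neg_iff_add_eq_0 add.commute)
        then have "(\<Sum>t\<in>UNIV. if ?v h + t * (1 - ?a h / ?b h) = 0 then 1 else 0) = (1 :: complex)" by simp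
        then show ?thesis using True ab by simp
      qed
    qed simp
  qed
  \<comment> \<open>Type \<open>1\<close> is treated as the case of the zero functional, so that
    \<open>avg_left\<close> applies with \<open>C' = UNIV\<close>.\<close>
  have lin0: "linear_on k (\<lambda>_. 0 :: 'a)" by (simp add: linear_on_def)
  have q: "of_nat ?q \<noteq> (0 :: complex)" "of_nat ?p \<noteq> (0 :: complex)"
    using card_field[OF odd_k, where 'a = 'a] card_P_pos[OF odd_k, where 'a = 'a] by simp_all
  have L: "ind (GL (S4 k)) (RQK_grp (S4 k)) (P_grp (S4 k)) (conj_char (GL (S4 k)) (s_elt (S4 k)) (infl_RQK (S4 k) \<chi>)) g
    = ?avg ?F g / of_nat (?q ^ (S2 k) * (?q - 1) * ?p)"
  proof -
    have "?avg (\<lambda>g. if g \<in> K_grp (S4 k)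
        then \<chi> (mid (inv\<^bsub>GL (S4 k)\<^esub> s_elt (S4 k) \<otimes>\<^bsub>GL (S4 k)\<^esub> g \<otimes>\<^bsub>GL (S4 k)\<^esub> s_elt (S4 k))) else 0) g
      = ?avg (\<lambda>g. if mid g \<in> P_grp (S2 k) \<and> core g \<in> UNIV \<and> ?v g = 0 then \<xi> ((\<lambda>_. 0) (midv (unip_vec g))) * \<chi> (core g) else 0) g"
    proof (rule cavg_cong[OF P g])
      fix h :: "'a mat" assume h: "h \<in> P_grp (S4 k)"
      show "(if h \<in> K_grp (S4 k) then \<chi> (mid (inv\<^bsub>GL (S4 k)\<^esub> s_elt (S4 k) \<otimes>\<^bsub>GL (S4 k)\<^esub> h \<otimes>\<^bsub>GL (S4 k)\<^esub> s_elt (S4 k))) else 0)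
        = (if mid h \<in> P_grp (S2 k) \<and> core h \<in> UNIV \<and> ?v h = 0 then \<xi> ((\<lambda>_. 0) (midv (unip_vec h))) * \<chi> (core h) else 0)"
      proof (cases "h \<in> K_grp (S4 k)")
        case True
        then show ?thesis unfolding s_conj_GL[OF odd_k]
          using levi_mid_s_conj[OF odd_k True] K_grp_D[OF odd_k True] \<chi>[of "mid (s_elt (S4 k) * h * s_elt (S4 k))"]
          by (simp add: additive_charD[OF \<xi>])
      next
        case False
        then show ?thesis using K_grp_I[OF odd_k h] by auto
      qed
    qed
    also have "of_nat ?q * \<dots> = ?avg ?F g"
      unfolding avg_left[OF odd_k \<xi> lin0 g, where C' = UNIV and \<theta> = \<chi>, symmetric]
      unfolding mult_zero_right diff_self additive_charD(2)[OF \<xi>] by simp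
    finally have E: "of_nat ?q * ?avg (\<lambda>g. if g \<in> K_grp (S4 k)
        then \<chi> (mid (inv\<^bsub>GL (S4 k)\<^esub> s_elt (S4 k) \<otimes>\<^bsub>GL (S4 k)\<^esub> g \<otimes>\<^bsub>GL (S4 k)\<^esub> s_elt (S4 k))) else 0) g = ?avg ?F g" .
    show ?thesis unfolding E[symmetric] ind_RQK[OF odd_k g] card_K[OF odd_k] using q(1) by simp
  qed
  have Z: "psi_zero \<xi> (S4 k) \<chi> g = ?avg ?Fz g / of_nat (?q ^ (S2 k) * (?q - 1) * ?p)"
  proof -
    let ?fz = "\<lambda>g. if levi g \<in> P_tilde (S4 k) then \<xi> (cf' (unip_vec g) ((S2 k) div 2)) * (if levi g \<in> P_tilde (S4 k) then \<chi> (mid (levi g)) else 0) else 0"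
    have Y: "card {c :: 'a. c \<noteq> 0} = ?q - 1"
      using card_Diff_singleton[of 0 "UNIV :: 'a set"] by (simp add: Compl_eq_Diff_UNIV[symmetric] Collect_neg_eq)
    have cp: "card (P_tilde (S4 k) :: 'a mat set) = ?p" by (rule bij_betw_same_card[OF bij_mid_P_tilde])
    \<comment> \<open>Conjugation by the torus multiplies the last coordinate by \<open>c\<close>.
      Averaging over all \<open>c \<noteq> 0\<close> replaces \<open>\<xi>\<close> by the sum of the
      non-trivial additive characters.\<close>
    have "?avg ?Fz g = of_nat (card {c :: 'a. c \<noteq> 0}) * ?avg ?fz g"
    proof (rule cavg_average[where k = "\<lambda>c. inv\<^bsub>GL (S4 k)\<^esub> s_mat (1\<^sub>m (S2 k)) (inverse c)", OF P g])
      have t: "s_mat (1\<^sub>m (S2 k)) (inverse c) \<in> L_grp (S4 k)" if "c \<noteq> 0" for c :: 'a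
        using that one_SO[OF odd_k] by (intro s_mat_in_L) auto
      have tP: "s_mat (1\<^sub>m (S2 k)) (inverse c) \<in> P_grp (S4 k)" if "c \<noteq> 0" for c :: 'a
        using t[OF that] by (simp add: L_grp_iff[OF odd2[OF odd_k]])
      show "inv\<^bsub>GL (S4 k)\<^esub> s_mat (1\<^sub>m (S2 k)) (inverse c) \<in> P_grp (S4 k)" if "c \<in> {c. c \<noteq> 0}" for c :: 'a
        using tP that by (intro subgroup.m_inv_closed[OF P]) auto
      fix h :: "'a mat" assume h: "h \<in> P_grp (S4 k)"
      note lh = levi_simps[OF odd2[OF odd_k] h]
      have *: "?fz (inv\<^bsub>GL (S4 k)\<^esub> s_mat (1\<^sub>m (S2 k)) (inverse c) \<otimes>\<^bsub>GL (S4 k)\<^esub> h \<otimes>\<^bsub>GL (S4 k)\<^esub> inv\<^bsub>GL (S4 k)\<^esub> (inv\<^bsub>GL (S4 k)\<^esub> s_mat (1\<^sub>m (S2 k)) (inverse c)))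
        = (if mid h \<in> P_grp (S2 k) \<and> ?a h = ?b h then \<chi> (mid h) * \<xi> (c * ?v h) else 0)" if c: "c \<noteq> 0" for c
      proof -
        let ?t = "s_mat (1\<^sub>m (S2 k)) (inverse c)"
        let ?h = "inv\<^bsub>GL (S4 k)\<^esub> ?t \<otimes>\<^bsub>GL (S4 k)\<^esub> h \<otimes>\<^bsub>GL (S4 k)\<^esub> ?t"
        have tc: "?t \<in> carrier (GL (S4 k))" "h \<in> carrier (GL (S4 k))" using tP[OF c] h subgroup.subset[OF P] by auto
        note u = unip_vec_conj_L[OF odd2[OF odd_k] t[OF c] h]
        have "?t \<otimes>\<^bsub>GL (S4 k)\<^esub> ?h = h \<otimes>\<^bsub>GL (S4 k)\<^esub> ?t" using tc by (simp only: m_assoc inv_cancel_left m_closed inv_closed)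
        then have e: "?t * ?h = h * ?t" by simp
        note p = P_mult[OF odd2[OF odd_k] tP[OF c] u(1)] P_mult[OF odd2[OF odd_k] h tP[OF c]]
        have t1: "?t $$ (0, 0) = inverse c" "mid ?t = 1\<^sub>m (S2 k)" by (rule s_mat_simps(2,4)[OF one_carrier_mat])+
        have a: "?a ?h = ?a h" using arg_cong[OF e, of ?a] c unfolding p t1 by simp
        have m: "mid ?h = mid h" using arg_cong[OF e, of mid]
          unfolding p t1 left_mult_one_mat[OF P_mid_carrier[OF odd2[OF odd_k] u(1)]] right_mult_one_mat[OF P_mid_carrier[OF odd2[OF odd_k] h]] .
        note lh' = levi_simps[OF odd2[OF odd_k] u(1)]
        note uc = unip_vec_carrier[OF P_carrier[OF odd2[OF odd_k] u(1)]]
        have "inverse c \<cdot>\<^sub>v unip_vec ?h = unip_vec h" using u(2) one_mult_mat_vec[OF uc] unfolding t1 by simp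
        from arg_cong[OF this, of "\<lambda>v. v $ Suc k"] have v: "?v ?h = c * ?v h"
          using c carrier_vecD[OF uc] by (simp add: field_simps)
        have "levi ?h \<in> P_tilde (S4 k) \<longleftrightarrow> mid h \<in> P_grp (S2 k) \<and> ?a h = ?b h"
          unfolding P_tilde_iff lh' a m using lh'(6) by auto
        then show ?thesis unfolding inv_inv[OF tc(1)] using v last_coord[OF odd_k uc] lh'(3) m
          by (simp del: GL_simps)
      qed
      have S: "(\<Sum>c\<in>{c. c \<noteq> 0}. \<xi> (c * ?v h)) = (if ?v h = 0 then of_nat ?q - 1 else - 1)"
      proof -
        have "(\<Sum>c\<in>UNIV. \<xi> (c * ?v h)) = \<xi> (0 * ?v h) + (\<Sum>c\<in>UNIV - {0}. \<xi> (c * ?v h))"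
          by (rule sum.remove) auto
        moreover have "UNIV - {0 :: 'a} = {c. c \<noteq> 0}" by auto
        ultimately have "(if ?v h = 0 then of_nat ?q else 0) = 1 + (\<Sum>c\<in>{c. c \<noteq> 0}. \<xi> (c * ?v h))"
          unfolding additive_char_sum[OF \<xi>] mult_zero_left additive_charD(2)[OF \<xi>] by simp
        then have "(\<Sum>c\<in>{c. c \<noteq> 0}. \<xi> (c * ?v h)) = (if ?v h = 0 then of_nat ?q else 0) - 1"
          by (simp only: add_diff_cancel_left')
        then show ?thesis by simp
      qed
      have "(\<Sum>c\<in>{c. c \<noteq> 0}. ?fz (inv\<^bsub>GL (S4 k)\<^esub> s_mat (1\<^sub>m (S2 k)) (inverse c) \<otimes>\<^bsub>GL (S4 k)\<^esub> h \<otimes>\<^bsub>GL (S4 k)\<^esub>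
          inv\<^bsub>GL (S4 k)\<^esub> (inv\<^bsub>GL (S4 k)\<^esub> s_mat (1\<^sub>m (S2 k)) (inverse c))))
        = (\<Sum>c\<in>{c. c \<noteq> 0}. if mid h \<in> P_grp (S2 k) \<and> ?a h = ?b h then \<chi> (mid h) * \<xi> (c * ?v h) else 0)"
        by (rule sum.cong[OF refl], rule *) simp
      also have "\<dots> = ?Fz h"
      proof (cases "mid h \<in> P_grp (S2 k) \<and> ?a h = ?b h")
        case True
        show ?thesis unfolding if_P[OF True] S[symmetric] sum_distrib_left ..
      next
        case False
        show ?thesis unfolding if_not_P[OF False] by simp
      qed
      finally show "(\<Sum>c\<in>{c. c \<noteq> 0}. ?fz (inv\<^bsub>GL (S4 k)\<^esub> s_mat (1\<^sub>m (S2 k)) (inverse c) \<otimes>\<^bsub>GL (S4 k)\<^esub> h \<otimes>\<^bsub>GL (S4 k)\<^esub>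
          inv\<^bsub>GL (S4 k)\<^esub> (inv\<^bsub>GL (S4 k)\<^esub> s_mat (1\<^sub>m (S2 k)) (inverse c)))) = ?Fz h" .
    qed
    then have "?avg ?Fz g = of_nat (?q - 1) * ?avg ?fz g" unfolding Y .
    moreover have "psi_zero \<xi> (S4 k) \<chi> g = ?avg ?fz g / of_nat (?q ^ (S2 k) * ?p)"
      unfolding psi_zero_def lam_zero_def I_zero_def cp[symmetric]
      using ind_U_L[OF odd2[OF odd_k] P_tilde_L g, where \<theta> = "\<lambda>h. if h \<in> P_tilde (S4 k) then \<chi> (mid h) else 0"
          and f = "\<lambda>v. \<xi> (cf' v ((S2 k) div 2))"] by simp
    moreover have "of_nat (?q - 1) \<noteq> (0 :: complex)" using card_field[OF odd_k, where 'a = 'a] by simp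
    ultimately show ?thesis by simp
  qed
  have O: "psi_one (S4 k) (HC_LK (S4 k) (conj_char (GL (S4 k)) (s_elt (S4 k)) (char_LK (S4 k) \<chi>))) g = ?avg ?Fo g / of_nat (?q ^ (S2 k) * (?q - 1) * ?p)"
  proof -
    let ?\<tau> = "infl (GL (S4 k)) (U_emb (S4 k)) (LK_grp (S4 k)) (conj_char (GL (S4 k)) (s_elt (S4 k)) (char_LK (S4 k) \<chi>))"
    have "?avg (\<lambda>g. if levi g \<in> QK_grp (S4 k) then ?\<tau> (levi g) else 0) g = ?avg ?Fo g"
    proof (rule cavg_cong[OF P g])
      fix h :: "'a mat" assume h: "h \<in> P_grp (S4 k)"
      note l = levi_simps[OF odd2[OF odd_k] h]
      have "levi h \<in> QK_grp (S4 k) \<longleftrightarrow> mid h \<in> P_grp (S2 k)" using l by (simp add: QK_eq[OF odd_k])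
      moreover have "core (levi h) = core h" unfolding core_def l ..
      ultimately show "(if levi h \<in> QK_grp (S4 k) then ?\<tau> (levi h) else 0) = ?Fo h"
        using HC_integrand[of "levi h" \<chi>] by simp
    qed
    moreover have sub: "QK_grp (S4 k) \<subseteq> (L_grp (S4 k) :: 'a mat set)" by (auto simp: QK_eq[OF odd_k])
    ultimately show ?thesis unfolding HC_LK_def psi_one_ind[OF odd2[OF odd_k] g sub] card_QK
      by (simp only: mult.assoc)
  qed
  show ?thesis unfolding L Z O F cavg_add by (simp add: add_divide_distrib)
qed

end

section \<open>Isometries fixing a functional\<close>

text \<open>Projection along \<open>e_0\<close> to even dimension; \<open>insv\<close> is its
  section with middle coordinate \<open>0\<close>.\<close>

definition rmv :: "'a vec \<Rightarrow> 'a vec" where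
  "rmv v = vec (dim_vec v - 1) (\<lambda>i. v $ (if i < dim_vec v div 2 then i else i + 1))"

definition insv :: "nat \<Rightarrow> 'a::zero vec \<Rightarrow> 'a vec" where
  "insv p u = vec (2 * p + 1) (\<lambda>i. if i < p then u $ i else if i = p then 0 else u $ (i - 1))"

text \<open>One family for both signs: the parameters \<open>0\<close>, \<open>0\<close> give
  \<open>Q_plus\<close>, and \<open>1\<close>, \<open>\<nu>\<close> give \<open>Q_minus\<close>. In
  dimension \<open>0\<close> the coordinates of index \<open>1\<close> do not exist, which is why
  the assumptions below then ask for zero parameters.\<close>

definition R_form :: "'a::field \<Rightarrow> 'a \<Rightarrow> 'a vec \<Rightarrow> 'a" where
  "R_form \<alpha> \<beta> w = Q_plus w + \<alpha> * (cf w 1)\<^sup>2 + \<beta> * (cf' w 1)\<^sup>2"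

lemma Q_plus_R_form: "Q_plus = R_form 0 0"
  by (simp add: R_form_def fun_eq_iff)

lemma Q_minus_R_form:
  assumes "w \<in> carrier_vec (2 * p)" "p > 0"
  shows "Q_minus \<nu> w = R_form 1 \<nu> w"
proof -
  have "dim_vec w div 2 = p" using assms by simp
  moreover have "{1..p} = insert 1 {2..p}" using assms by auto
  ultimately show ?thesis by (simp add: Q_minus_def R_form_def Q_plus_def algebra_simps)
qed

lemma rmv_carrier [simp]: "v \<in> carrier_vec (Suc (2 * p)) \<Longrightarrow> rmv v \<in> carrier_vec (2 * p)"
  by (intro carrier_vecI) (simp add: rmv_def)

lemma insv_carrier [simp]: "insv p u \<in> carrier_vec (Suc (2 * p))"
  by (simp add: insv_def)

lemma rmv_insv: "u \<in> carrier_vec (2 * p) \<Longrightarrow> rmv (insv p u) = u"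
  by (intro eq_vecI) (auto simp: rmv_def insv_def)

lemma insv_mid: "insv p u $ p = 0"
  by (simp add: insv_def)

lemma cf_rmv:
  assumes "v \<in> carrier_vec (Suc (2 * p))" "1 \<le> j" "j \<le> p"
  shows "cf (rmv v) j = cf v j" "cf' (rmv v) j = cf' v j"
proof -
  have d: "dim_vec v = Suc (2 * p)" "dim_vec (rmv v) = 2 * p" using assms by (auto simp: rmv_def)
  show "cf (rmv v) j = cf v j" using assms(2,3) unfolding cf_def d by (simp add: rmv_def d)
  have "(2 * p - 1) div 2 + j = p + j - 1" "\<not> p + j - 1 < p" using assms(2,3) by linarith+
  then show "cf' (rmv v) j = cf' v j" using assms(2,3) unfolding cf'_def d by (simp add: rmv_def d)
qed

lemma Q_odd_rmv:
  assumes v: "v \<in> carrier_vec (Suc (2 * p))"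
  shows "Q_odd v = (v $ p)\<^sup>2 + R_form 0 0 (rmv v)"
proof -
  have d: "dim_vec v = Suc (2 * p)" "dim_vec (rmv v) = 2 * p" using v by (auto simp: rmv_def)
  show ?thesis by (simp add: R_form_def Q_odd_def Q_plus_def d cf_rmv[OF v]) (simp add: cf_def d)
qed

lemma Q_odd'_rmv:
  assumes v: "v \<in> carrier_vec (Suc (2 * p))" and p: "p > 0"
  shows "Q_odd' \<nu> v = (v $ p)\<^sup>2 + R_form 1 \<nu> (rmv v)"
proof -
  have d: "dim_vec v = Suc (2 * p)" "dim_vec (rmv v) = 2 * p" using v by (auto simp: rmv_def)
  have "cf v 0 = v $ p" by (simp add: cf_def d)
  then show ?thesis using p cf_rmv[OF v, of 1]
    unfolding Q_minus_R_form[OF rmv_carrier[OF v] p, symmetric]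
    by (simp add: Q_minus_def Q_odd'_def d cf_rmv[OF v])
qed

section \<open>The forms \<open>R_form\<close> in dimension 2 p and their isometries\<close>

context
  fixes p :: nat and \<alpha> \<beta> :: "'a::field"
  assumes nondeg: "p > 0 \<Longrightarrow> 4 * \<alpha> * \<beta> \<noteq> 1" "p = 0 \<Longrightarrow> \<alpha> = 0 \<and> \<beta> = 0"
begin

lemma cf_add:
  assumes "v \<in> carrier_vec (2 * p)" "w \<in> carrier_vec (2 * p)" "1 \<le> j" "j \<le> p"
  shows "cf (v + w) j = cf v j + (cf w j :: 'a)" "cf' (v + w) j = cf' v j + (cf' w j :: 'a)"
  using assms by (auto simp: cf_def cf'_def)

lemma cf_smult:
  assumes "v \<in> carrier_vec (2 * p)" "1 \<le> j" "j \<le> p"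
  shows "cf (c \<cdot>\<^sub>v v) j = c * (cf v j :: 'a)" "cf' (c \<cdot>\<^sub>v v) j = c * (cf' v j :: 'a)"
  using assms by (auto simp: cf_def cf'_def)

lemma polar_R_form:
  assumes v: "v \<in> carrier_vec (2 * p)" and w: "w \<in> carrier_vec (2 * p)"
  shows "polar (R_form \<alpha> \<beta>) v w = (\<Sum>j=1..p. cf v j * cf' w j + cf w j * cf' v j)
    + 2 * \<alpha> * cf v 1 * cf w 1 + 2 * \<beta> * cf' v 1 * cf' w 1"
proof -
  have d: "dim_vec v div 2 = p" "dim_vec w div 2 = p" "dim_vec (v + w) div 2 = p" using v w by auto
  have "(\<Sum>j=1..p. cf (v + w) j * cf' (v + w) j) =
     (\<Sum>j=1..p. cf v j * cf' v j) + (\<Sum>j=1..p. cf w j * cf' w j) + (\<Sum>j=1..p. cf v j * cf' w j + cf w j * cf' v j)"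
    unfolding sum.distrib[symmetric] by (intro sum.cong) (simp_all add: cf_add[OF v w] algebra_simps)
  then have Q: "Q_plus (v + w) = Q_plus v + Q_plus w + (\<Sum>j=1..p. cf v j * cf' w j + cf w j * cf' v j)"
    unfolding Q_plus_def d .
  show ?thesis
  proof (cases "p = 0")
    case True
    then show ?thesis using nondeg(2) Q by (simp add: polar_def R_form_def)
  next
    case False
    then have "cf (v + w) 1 = cf v 1 + cf w 1" "cf' (v + w) 1 = cf' v 1 + cf' w 1"
      using cf_add[OF v w, of 1] by auto
    then show ?thesis using Q by (simp add: polar_def R_form_def power2_eq_square algebra_simps)
  qed
qed

lemma polar_R_linear:
  assumes w: "w \<in> carrier_vec (2 * p)"
  shows "linear_on (2 * p) (\<lambda>v. polar (R_form \<alpha> \<beta>) v w)"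
  unfolding linear_on_def
proof (intro conjI ballI allI)
  fix u v :: "'a vec" assume u: "u \<in> carrier_vec (2 * p)" and v: "v \<in> carrier_vec (2 * p)"
  have "(\<Sum>j=1..p. cf (u + v) j * cf' w j + cf w j * cf' (u + v) j) =
     (\<Sum>j=1..p. cf u j * cf' w j + cf w j * cf' u j) + (\<Sum>j=1..p. cf v j * cf' w j + cf w j * cf' v j)"
    unfolding sum.distrib[symmetric] by (intro sum.cong) (simp_all add: cf_add[OF u v] algebra_simps)
  moreover have "2 * \<alpha> * cf (u + v) 1 * cf w 1 = 2 * \<alpha> * cf u 1 * cf w 1 + 2 * \<alpha> * cf v 1 * cf w 1"
    "2 * \<beta> * cf' (u + v) 1 * cf' w 1 = 2 * \<beta> * cf' u 1 * cf' w 1 + 2 * \<beta> * cf' v 1 * cf' w 1"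
    using cf_add[OF u v, of 1] nondeg(2) by (cases "p = 0"; simp add: algebra_simps)+
  ultimately show "polar (R_form \<alpha> \<beta>) (u + v) w = polar (R_form \<alpha> \<beta>) u w + polar (R_form \<alpha> \<beta>) v w"
    unfolding polar_R_form[OF add_carrier_vec[OF u v] w] polar_R_form[OF u w] polar_R_form[OF v w] by (simp only: ac_simps)
next
  fix c and v :: "'a vec" assume v: "v \<in> carrier_vec (2 * p)"
  have "(\<Sum>j=1..p. cf (c \<cdot>\<^sub>v v) j * cf' w j + cf w j * cf' (c \<cdot>\<^sub>v v) j) =
     c * (\<Sum>j=1..p. cf v j * cf' w j + cf w j * cf' v j)"
    unfolding sum_distrib_left by (intro sum.cong) (simp_all add: cf_smult[OF v] algebra_simps)
  moreover have "2 * \<alpha> * cf (c \<cdot>\<^sub>v v) 1 * cf w 1 = c * (2 * \<alpha> * cf v 1 * cf w 1)"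
    "2 * \<beta> * cf' (c \<cdot>\<^sub>v v) 1 * cf' w 1 = c * (2 * \<beta> * cf' v 1 * cf' w 1)"
    using cf_smult[OF v, of 1] nondeg(2) by (cases "p = 0"; simp)+
  ultimately show "polar (R_form \<alpha> \<beta>) (c \<cdot>\<^sub>v v) w = c * polar (R_form \<alpha> \<beta>) v w"
    unfolding polar_R_form[OF smult_carrier_vec[THEN iffD2, OF v] w] polar_R_form[OF v w] by (simp only: distrib_left)
qed

lemma polar_R_unit:
  assumes z: "z \<in> carrier_vec (2 * p)" and j: "1 \<le> j" "j \<le> p"
  shows "polar (R_form \<alpha> \<beta>) z (unit_vec (2 * p) (p - j)) = cf' z j + (if j = 1 then 2 * \<alpha> * cf z 1 else 0)"
    and "polar (R_form \<alpha> \<beta>) z (unit_vec (2 * p) (p - 1 + j)) = cf z j + (if j = 1 then 2 * \<beta> * cf' z 1 else 0)"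
proof -
  have c: "cf (unit_vec (2 * p) i) l = (if i = p - l then 1 else (0::'a))"
    "cf' (unit_vec (2 * p) i) l = (if i = p - 1 + l then 1 else (0::'a))" if "1 \<le> l" "l \<le> p" for i l
  proof -
    have "(2 * p - 1) div 2 + l = p - 1 + l" "p - l < 2 * p" "p - 1 + l < 2 * p" using that by linarith+
    then show "cf (unit_vec (2 * p) i) l = (if i = p - l then 1 else (0::'a))"
      "cf' (unit_vec (2 * p) i) l = (if i = p - 1 + l then 1 else (0::'a))"
      by (auto simp: cf_def cf'_def unit_vec_def)
  qed
  have p: "1 \<le> p" using j by simp
  have "(\<Sum>l=1..p. cf z l * cf' (unit_vec (2 * p) (p - j)) l + cf (unit_vec (2 * p) (p - j)) l * cf' z l)
     = (\<Sum>l=1..p. if l = j then cf' z l else 0)"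
    by (rule sum.cong) (use j in \<open>auto simp: c\<close>)
  then have 1: "(\<Sum>l=1..p. cf z l * cf' (unit_vec (2 * p) (p - j)) l + cf (unit_vec (2 * p) (p - j)) l * cf' z l) = cf' z j"
    using j by simp
  show "polar (R_form \<alpha> \<beta>) z (unit_vec (2 * p) (p - j)) = cf' z j + (if j = 1 then 2 * \<alpha> * cf z 1 else 0)"
    unfolding polar_R_form[OF z unit_vec_carrier] 1 using j p by (auto simp: c)
  have "(\<Sum>l=1..p. cf z l * cf' (unit_vec (2 * p) (p - 1 + j)) l + cf (unit_vec (2 * p) (p - 1 + j)) l * cf' z l)
     = (\<Sum>l=1..p. if l = j then cf z l else 0)"
    by (rule sum.cong) (use j in \<open>auto simp: c\<close>)
  then have 2: "(\<Sum>l=1..p. cf z l * cf' (unit_vec (2 * p) (p - 1 + j)) l + cf (unit_vec (2 * p) (p - 1 + j)) l * cf' z l) = cf z j"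
    using j by simp
  show "polar (R_form \<alpha> \<beta>) z (unit_vec (2 * p) (p - 1 + j)) = cf z j + (if j = 1 then 2 * \<beta> * cf' z 1 else 0)"
    unfolding polar_R_form[OF z unit_vec_carrier] 2 using j p by (auto simp: c)
qed

text \<open>Away from index \<open>1\<close>, pairing with a basis vector isolates a single
  coordinate of \<open>z\<close>. At index \<open>1\<close> two equations remain whose determinant
  is \<open>1 - 4 * \<alpha> * \<beta>\<close> up to sign.\<close>

lemma polar_R_nondegenerate:
  assumes z: "z \<in> carrier_vec (2 * p)" and 0: "\<And>w. w \<in> carrier_vec (2 * p) \<Longrightarrow> polar (R_form \<alpha> \<beta>) z w = 0"
  shows "z = 0\<^sub>v (2 * p)"
proof (rule eq_vecI)
  have cz: "cf z j = 0 \<and> cf' z j = 0" if j: "1 \<le> j" "j \<le> p" for j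
  proof -
    have e: "cf' z j + (if j = 1 then 2 * \<alpha> * cf z 1 else 0) = 0" "cf z j + (if j = 1 then 2 * \<beta> * cf' z 1 else 0) = 0"
      using polar_R_unit[OF z j] 0[OF unit_vec_carrier] by simp_all
    show ?thesis
    proof (cases "j = 1")
      case True
      have 1: "cf' z 1 = - (2 * \<alpha> * cf z 1)" "cf z 1 + 2 * \<beta> * cf' z 1 = 0"
        using e True by (simp_all add: eq_neg_iff_add_eq_0)
      have "(1 - 4 * \<alpha> * \<beta>) * cf z 1 = 0" using 1(2) unfolding 1(1) by (simp add: algebra_simps)
      then have "cf z 1 = 0" using nondeg(1) j by auto
      then show ?thesis using 1(1) True by simp
    qed (use e in simp)
  qed
  have d: "dim_vec z = 2 * p" using z by simp
  fix i assume "i < dim_vec (0\<^sub>v (2 * p) :: 'a vec)"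
  then have i: "i < 2 * p" by simp
  show "z $ i = 0\<^sub>v (2 * p) $ i"
  proof (cases "i < p")
    case True
    then show ?thesis using cz[of "p - i"] i by (simp add: cf_def d)
  next
    case False
    have "(2 * p - 1) div 2 + (i - p + 1) = i" using False i by linarith
    then show ?thesis using cz[of "i - p + 1"] i False by (simp add: cf'_def d)
  qed
qed (use z in simp)

text \<open>With the Gram matrix \<open>B\<close> of the polar form, an isometry \<open>g\<close> satisfies \<open>g\<^sup>T B g = B\<close>.\<close>

lemma det_R_isometry:
  assumes g: "g \<in> isometries (2 * p) (R_form \<alpha> \<beta>)"
  shows "det g * det g = 1"
proof -
  let ?n = "2 * p" and ?P = "polar (R_form \<alpha> \<beta>)"
  have gc: "g \<in> carrier_mat ?n ?n" using g by (auto simp: isometries_def GL_carrier)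
  define B where "B = mat ?n ?n (\<lambda>(i, j). ?P (unit_vec ?n i) (unit_vec ?n j))"
  have Bc: "B \<in> carrier_mat ?n ?n" by (simp add: B_def)
  have B1: "(B *\<^sub>v w) $ i = ?P w (unit_vec ?n i)" if w: "w \<in> carrier_vec ?n" and i: "i < ?n" for w i
  proof -
    have "?P w (unit_vec ?n i) = (\<Sum>j<?n. w $ j * ?P (unit_vec ?n j) (unit_vec ?n i))"
      by (rule linear_functional[where f = "\<lambda>v. ?P v (unit_vec ?n i)"])
         (use linear_onD[OF polar_R_linear[OF unit_vec_carrier]] w in auto)
    also have "\<dots> = (B *\<^sub>v w) $ i"
      unfolding mult_mat_vec_entry[OF Bc w i]
      by (rule sum.cong) (use i in \<open>auto simp: B_def mult.commute polar_sym[OF unit_vec_carrier unit_vec_carrier]\<close>)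
    finally show ?thesis ..
  qed
  have B2: "v \<bullet> (B *\<^sub>v w) = ?P v w" if v: "v \<in> carrier_vec ?n" and w: "w \<in> carrier_vec ?n" for v w
  proof -
    have Bw: "B *\<^sub>v w \<in> carrier_vec ?n" using Bc w by simp
    have "?P v w = (\<Sum>j<?n. v $ j * ?P (unit_vec ?n j) w)"
      by (rule linear_functional[where f = "\<lambda>v. ?P v w"])
         (use linear_onD[OF polar_R_linear[OF w]] v in auto)
    also have "\<dots> = (\<Sum>j<?n. v $ j * (B *\<^sub>v w) $ j)"
      by (rule sum.cong) (auto simp: B1[OF w] polar_sym[OF unit_vec_carrier w] simp del: index_mult_mat_vec)
    also have "\<dots> = v \<bullet> (B *\<^sub>v w)" using carrier_vecD[OF Bw] by (simp add: scalar_prod_def lessThan_atLeast0 del: index_mult_mat_vec)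
    finally show ?thesis ..
  qed
  have gB: "transpose_mat g * (B * g) = B"
  proof (rule eq_matI)
    fix i j assume "i < dim_row B" "j < dim_col B"
    then have ij: "i < ?n" "j < ?n" using Bc by auto
    note cc = col_carrier_vec[OF ij(1) gc] col_carrier_vec[OF ij(2) gc]
    have ge: "col g l = g *\<^sub>v unit_vec ?n l" if "l < ?n" for l
      using gc that by (intro eq_vecI) auto
    have "(transpose_mat g * (B * g)) $$ (i, j) = col g i \<bullet> (B *\<^sub>v col g j)"
      using ij gc Bc col_mult2[OF Bc gc ij(2)] by simp
    also have "\<dots> = ?P (g *\<^sub>v unit_vec ?n i) (g *\<^sub>v unit_vec ?n j)"
      using B2[OF cc] ge ij by simp
    also have "\<dots> = B $$ (i, j)" using polar_isometry[OF g] ij by (simp add: B_def)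
    finally show "(transpose_mat g * (B * g)) $$ (i, j) = B $$ (i, j)" .
  qed (use gc Bc in auto)
  have "det B \<noteq> 0"
  proof
    assume "det B = 0"
    then obtain z where z: "z \<in> carrier_vec ?n" "z \<noteq> 0\<^sub>v ?n" "B *\<^sub>v z = 0\<^sub>v ?n"
      using det_0_iff_vec_prod_zero[OF Bc] by auto
    have "?P z w = 0" if w: "w \<in> carrier_vec ?n" for w
      using B2[OF w z(1)] w polar_sym[OF z(1) w, of "R_form \<alpha> \<beta>"] by (simp add: z(3))
    then show False using polar_R_nondegenerate[OF z(1)] z(2) by blast
  qed
  moreover have "det g * (det B * det g) = det B"
    using arg_cong[OF gB, of det] det_mult[of "transpose_mat g" ?n "B * g"] det_mult[OF Bc gc] det_transpose[OF gc] gc Bc by simp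
  ultimately show ?thesis by (simp add: algebra_simps)
qed

lemma cross_simps:
  fixes g :: "'a mat"
  assumes g: "g \<in> carrier_mat (2 * p) (2 * p)"
  shows "cross g a \<in> carrier_mat (Suc (2 * p)) (Suc (2 * p))"
    and "v \<in> carrier_vec (Suc (2 * p)) \<Longrightarrow> (cross g a *\<^sub>v v) $ p = a * v $ p"
    and "v \<in> carrier_vec (Suc (2 * p)) \<Longrightarrow> rmv (cross g a *\<^sub>v v) = g *\<^sub>v rmv v"
    and "det (cross g a) = a * det g"
proof -
  let ?k = "Suc (2 * p)"
  let ?h = "\<lambda>i. if i < p then i else i - 1"
  have c: "cross g a = mat ?k ?k (\<lambda>(i, j). if i = p \<and> j = p then a else if i = p \<or> j = p then 0 else g $$ (?h i, ?h j))"
    using g by (simp add: cross_def Let_def)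
  show cc: "cross g a \<in> carrier_mat ?k ?k" by (simp add: c)
  have split: "(\<Sum>l<?k. f l) = (\<Sum>l<p. f l) + f p + (\<Sum>l\<in>{p..<2 * p}. f (Suc l))" for f :: "nat \<Rightarrow> 'a"
  proof -
    have "{..<?k} = {..<p} \<union> ({p} \<union> Suc ` {p..<2 * p})" by (auto simp: image_Suc_atLeastLessThan)
    then have "(\<Sum>l<?k. f l) = sum f ({..<p} \<union> ({p} \<union> Suc ` {p..<2 * p}))" by simp
    also have "\<dots> = sum f {..<p} + sum f ({p} \<union> Suc ` {p..<2 * p})"
      by (rule sum.union_disjoint) auto
    also have "sum f ({p} \<union> Suc ` {p..<2 * p}) = sum f {p} + sum f (Suc ` {p..<2 * p})"
      by (rule sum.union_disjoint) auto
    also have "sum f (Suc ` {p..<2 * p}) = (\<Sum>l\<in>{p..<2 * p}. f (Suc l))" by (simp only: sum.reindex inj_Suc o_def)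
    finally show ?thesis by (simp only: sum.insert finite.emptyI empty_iff not_False_eq_True sum.empty add_0_right add.assoc)
  qed
  have pk: "p < ?k" by simp
  show "(cross g a *\<^sub>v v) $ p = a * v $ p" if v: "v \<in> carrier_vec ?k"
  proof -
    have "(cross g a *\<^sub>v v) $ p = (\<Sum>l<?k. if l = p then a * v $ l else 0)"
      unfolding mult_mat_vec_entry[OF cc v pk] by (rule sum.cong) (auto simp: c)
    also have "\<dots> = a * v $ p" by (subst sum.delta) (use pk in auto)
    finally show ?thesis .
  qed
  show "rmv (cross g a *\<^sub>v v) = g *\<^sub>v rmv v" if v: "v \<in> carrier_vec ?k"
  proof (rule eq_vecI)
    have cv: "cross g a *\<^sub>v v \<in> carrier_vec ?k" using cc v by simp
    note dv = carrier_vecD[OF v] carrier_vecD[OF cv]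
    fix i assume "i < dim_vec (g *\<^sub>v rmv v)"
    then have i: "i < 2 * p" using g by simp
    let ?i = "if i < p then i else Suc i"
    have i': "?i < ?k" "?i \<noteq> p" "?h ?i = i" using i by auto
    have "rmv (cross g a *\<^sub>v v) $ i = (cross g a *\<^sub>v v) $ ?i" using i dv by (simp add: rmv_def del: index_mult_mat_vec)
    also have "\<dots> = (\<Sum>l<?k. cross g a $$ (?i, l) * v $ l)" by (rule mult_mat_vec_entry[OF cc v i'(1)])
    also have "\<dots> = (\<Sum>l<p. g $$ (i, l) * v $ l) + (\<Sum>l\<in>{p..<2 * p}. g $$ (i, l) * v $ Suc l)"
      unfolding split using i' by (intro arg_cong2[where f = "(+)"] sum.cong) (auto simp: c)
    also have "\<dots> = (\<Sum>l<p. g $$ (i, l) * rmv v $ l) + (\<Sum>l\<in>{p..<2 * p}. g $$ (i, l) * rmv v $ l)"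
      using dv by (intro arg_cong2[where f = "(+)"] sum.cong) (auto simp: rmv_def)
    also have "\<dots> = (\<Sum>l<2 * p. g $$ (i, l) * rmv v $ l)"
    proof -
      have "{..<2 * p} = {..<p} \<union> {p..<2 * p}" by auto
      show ?thesis unfolding \<open>{..<2 * p} = {..<p} \<union> {p..<2 * p}\<close>
        by (rule sum.union_disjoint[symmetric]) auto
    qed
    also have "\<dots> = (g *\<^sub>v rmv v) $ i" by (rule mult_mat_vec_entry[OF g rmv_carrier[OF v] i, symmetric])
    finally show "rmv (cross g a *\<^sub>v v) $ i = (g *\<^sub>v rmv v) $ i" .
  qed (use g cc v in \<open>simp add: rmv_def\<close>)
  have "det (cross g a) = (\<Sum>j<?k. cross g a $$ (p, j) * cofactor (cross g a) p j)"
    by (rule laplace_expansion_row[OF cc]) simp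
  also have "\<dots> = (\<Sum>j<?k. if j = p then a * cofactor (cross g a) p j else 0)"
    by (rule sum.cong) (auto simp: c)
  also have "\<dots> = a * cofactor (cross g a) p p" by (subst sum.delta) (use pk in auto)
  also have "mat_delete (cross g a) p p = g"
    using g by (intro eq_matI) (auto simp: mat_delete_def c)
  then have "cofactor (cross g a) p p = det g" by (simp add: cofactor_def)
  finally show "det (cross g a) = a * det g" .
qed

text \<open>For the converse, let \<open>z\<close> be the image of \<open>e_0\<close>. The scaling
  condition says that \<open>x\<close> preserves the hyperplane of vanishing middle coordinate, and
  \<open>e_0\<close> is orthogonal to it in every characteristic. So \<open>rmv z\<close> is
  orthogonal to everything and vanishes by nondegeneracy. This fixes the middle column, the scaling
  condition fixes the middle row, and \<open>x\<close> has the shape of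
  \<open>cross\<close>.\<close>

lemma cross_iff:
  fixes x :: "'a mat"
  assumes x: "x \<in> carrier_mat (Suc (2 * p)) (Suc (2 * p))" and a: "a \<noteq> 0"
    and Q: "\<And>v. v \<in> carrier_vec (Suc (2 * p)) \<Longrightarrow> Q v = (v $ p)\<^sup>2 + R_form \<alpha> \<beta> (rmv v)"
  shows "(\<exists>g\<in>isometries (2 * p) (R_form \<alpha> \<beta>). a = det g \<and> x = cross g a) \<longleftrightarrow>
    det x = 1 \<and> (\<forall>v\<in>carrier_vec (Suc (2 * p)). Q (x *\<^sub>v v) = Q v) \<and> (\<forall>v\<in>carrier_vec (Suc (2 * p)). a * (x *\<^sub>v v) $ p = v $ p)"
proof
  assume "\<exists>g\<in>isometries (2 * p) (R_form \<alpha> \<beta>). a = det g \<and> x = cross g a"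
  then obtain g where g: "g \<in> isometries (2 * p) (R_form \<alpha> \<beta>)" "a = det g" "x = cross g a" by blast
  have gc: "g \<in> carrier_mat (2 * p) (2 * p)" using g(1) by (auto simp: isometries_def GL_carrier)
  note c = cross_simps[OF gc]
  have aa: "a * a = 1" using det_R_isometry[OF g(1)] g(2) by simp
  have "Q (x *\<^sub>v v) = Q v" if v: "v \<in> carrier_vec (Suc (2 * p))" for v
  proof -
    have xv: "x *\<^sub>v v \<in> carrier_vec (Suc (2 * p))" using x v by simp
    have "R_form \<alpha> \<beta> (g *\<^sub>v rmv v) = R_form \<alpha> \<beta> (rmv v)" using g(1) rmv_carrier[OF v] by (auto simp: isometries_def)
    moreover have "(a * v $ p)\<^sup>2 = (v $ p)\<^sup>2" using aa by (simp add: power_mult_distrib power2_eq_square)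
    ultimately show ?thesis unfolding Q[OF xv] Q[OF v] unfolding g(3) c(2)[OF v] c(3)[OF v] by simp
  qed
  moreover have "a * (x *\<^sub>v v) $ p = v $ p" if v: "v \<in> carrier_vec (Suc (2 * p))" for v
    unfolding g(3) c(2)[OF v] using aa by (simp add: mult.assoc[symmetric])
  moreover have "det x = 1" unfolding g(3) c(4) using aa g(2) by simp
  ultimately show "det x = 1 \<and> (\<forall>v\<in>carrier_vec (Suc (2 * p)). Q (x *\<^sub>v v) = Q v) \<and> (\<forall>v\<in>carrier_vec (Suc (2 * p)). a * (x *\<^sub>v v) $ p = v $ p)"
    by blast
next
  let ?k = "Suc (2 * p)"
  assume "det x = 1 \<and> (\<forall>v\<in>carrier_vec ?k. Q (x *\<^sub>v v) = Q v) \<and> (\<forall>v\<in>carrier_vec ?k. a * (x *\<^sub>v v) $ p = v $ p)"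
  then have det: "det x = 1" and Qx: "\<And>v. v \<in> carrier_vec ?k \<Longrightarrow> Q (x *\<^sub>v v) = Q v"
    and row: "\<And>v. v \<in> carrier_vec ?k \<Longrightarrow> a * (x *\<^sub>v v) $ p = v $ p" by auto
  have iso: "x \<in> isometries ?k Q" by (rule isometriesI[OF x]) (use det Qx in auto)
  interpret group "GL ?k :: 'a mat monoid" by simp
  have xG: "x \<in> carrier (GL ?k)" using x det by (simp add: GL_carrier)
  let ?e = "unit_vec ?k p :: 'a vec" and ?y = "inv\<^bsub>GL ?k\<^esub> x"
  have y: "?y \<in> carrier_mat ?k ?k" using inv_closed[OF xG] by (simp add: GL_carrier)
  have xy: "x * ?y = 1\<^sub>m ?k" using r_inv[OF xG] by simp
  define z where "z = x *\<^sub>v ?e"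
  have z: "z \<in> carrier_vec ?k" using x by (simp add: z_def)
  have polarQ: "polar Q v w = 2 * v $ p * w $ p + polar (R_form \<alpha> \<beta>) (rmv v) (rmv w)"
    if v: "v \<in> carrier_vec ?k" and w: "w \<in> carrier_vec ?k" for v w
  proof -
    have "rmv (v + w) = rmv v + rmv w"
      using carrier_vecD[OF v] carrier_vecD[OF w] by (intro eq_vecI) (auto simp: rmv_def)
    then show ?thesis using v w by (simp add: polar_def Q power2_eq_square algebra_simps)
  qed
  have rz: "rmv z = 0\<^sub>v (2 * p)"
  proof (rule polar_R_nondegenerate[OF rmv_carrier[OF z]])
    fix u :: "'a vec" assume u: "u \<in> carrier_vec (2 * p)"
    \<comment> \<open>The preimage of \<open>insv p u\<close> under \<open>x\<close>. Its middle
      coordinate is \<open>0\<close> by the scaling condition, so it is orthogonal to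
      \<open>e_0\<close>.\<close>
    define w where "w = ?y *\<^sub>v insv p u"
    have w: "w \<in> carrier_vec ?k" using y by (simp add: w_def)
    have xw: "x *\<^sub>v w = insv p u" unfolding w_def using assoc_mult_mat_vec[OF x y insv_carrier, symmetric] xy by simp
    have wp: "w $ p = 0" using row[OF w] unfolding xw insv_mid by simp
    have "rmv ?e = 0 \<cdot>\<^sub>v rmv w" using carrier_vecD[OF w] by (intro eq_vecI) (auto simp: rmv_def unit_vec_def)
    then have "polar (R_form \<alpha> \<beta>) (rmv ?e) (rmv w) = 0"
      using linear_onD(2)[OF polar_R_linear[OF rmv_carrier[OF w]] rmv_carrier[OF w], of 0] by simp
    then have "polar Q ?e w = 0" unfolding polarQ[OF unit_vec_carrier w] wp by simp
    then have "polar Q z (insv p u) = 0" using polar_isometry[OF iso unit_vec_carrier w, of p] by (simp only: z_def xw)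
    then show "polar (R_form \<alpha> \<beta>) (rmv z) u = 0"
      unfolding polarQ[OF z insv_carrier] insv_mid rmv_insv[OF u] by simp
  qed
  have zp: "a * z $ p = 1" using row[OF unit_vec_carrier, of p] by (simp add: z_def del: index_mult_mat_vec)
  have R0: "R_form \<alpha> \<beta> (0\<^sub>v (2 * p)) = 0"
  proof -
    have "(\<Sum>j=1..p. cf (0\<^sub>v (2 * p)) j * cf' (0\<^sub>v (2 * p)) j) = (0::'a)"
      by (rule sum.neutral) (auto simp: cf_def)
    moreover have "\<alpha> * (cf (0\<^sub>v (2 * p)) 1)\<^sup>2 = 0" "\<beta> * (cf' (0\<^sub>v (2 * p)) 1)\<^sup>2 = 0"
      using nondeg(2) by (cases "p = 0"; simp add: cf_def cf'_def)+
    ultimately show ?thesis by (simp add: R_form_def Q_plus_def) auto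
  qed
  have "rmv ?e = 0\<^sub>v (2 * p)" by (intro eq_vecI) (auto simp: rmv_def unit_vec_def)
  then have "Q ?e = 1" using Q[OF unit_vec_carrier, of p] R0 by simp
  then have "Q z = 1" using Qx[OF unit_vec_carrier, of p] by (simp add: z_def)
  then have zz: "z $ p * z $ p = 1" using Q[OF z] R0 by (simp add: rz power2_eq_square)
  \<comment> \<open>\<open>a * z $ p = 1\<close> together with \<open>z $ p * z $ p = 1\<close>
    identifies \<open>z $ p\<close> with \<open>a\<close>, and no sign has to be chosen.\<close>
  have za: "z $ p = a" using zp zz a by (metis mult_right_cancel mult_zero_right one_neq_zero)
  then have aa: "a * a = 1" using zz by simp
  have col: "x $$ (i, p) = (if i = p then a else 0)" if i: "i < ?k" for i
  proof -
    have xi: "x $$ (i, p) = z $ i" unfolding z_def using mult_mat_vec_unit[OF x _ i, of p] by simp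
    consider "i < p" | "i = p" | j where "i = Suc j" "p \<le> j" "j < 2 * p"
      using i by (metis Suc_less_eq less_Suc_eq_le linorder_neqE_nat not_less_eq Suc_pred' gr_implies_not0 not_gr_zero)
    then show ?thesis
    proof cases
      case 1
      then have "rmv z $ i = z $ i" using carrier_vecD[OF z] by (simp add: rmv_def)
      then show ?thesis using 1 xi by (simp add: rz)
    next
      case 3
      then have "rmv z $ j = z $ i" using carrier_vecD[OF z] by (simp add: rmv_def)
      then show ?thesis using 3 xi by (simp add: rz)
    qed (use xi za in simp)
  qed
  have rowp: "x $$ (p, j) = (if j = p then a else 0)" if j: "j < ?k" for j
  proof -
    have "a * x $$ (p, j) = (if j = p then 1 else 0)"
      using row[OF unit_vec_carrier, of j] mult_mat_vec_unit[OF x j, of p] j by (simp add: unit_vec_def del: index_mult_mat_vec)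
    then have "a * (a * x $$ (p, j)) = (if j = p then a else 0)" by simp
    then show ?thesis using aa by (simp add: mult.assoc[symmetric])
  qed
  define g where "g = mat_delete x p p"
  have gc: "g \<in> carrier_mat (2 * p) (2 * p)" using x by (auto simp: g_def mat_delete_def)
  have xg: "x = cross g a"
  proof (rule eq_matI)
    show "dim_row x = dim_row (cross g a)" "dim_col x = dim_col (cross g a)"
      using x carrier_matD[OF cross_simps(1)[OF gc, of a]] by auto
    fix i j assume "i < dim_row (cross g a)" "j < dim_col (cross g a)"
    then have ij: "i < ?k" "j < ?k" using carrier_matD[OF cross_simps(1)[OF gc, of a]] by auto
    have e: "cross g a $$ (i, j) = (if i = p \<and> j = p then a else if i = p \<or> j = p then 0
        else g $$ (if i < p then i else i - 1, if j < p then j else j - 1))"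
      using gc ij by (simp add: cross_def Let_def)
    show "x $$ (i, j) = cross g a $$ (i, j)"
      unfolding e using ij x col[of i] rowp[of j] by (auto simp: g_def mat_delete_def)
  qed
  have dg: "a * det g = 1" using det unfolding xg cross_simps(4)[OF gc] .
  then have ad: "a = det g" using aa a by (metis mult_left_cancel)
  have "g \<in> isometries (2 * p) (R_form \<alpha> \<beta>)"
  proof (rule isometriesI[OF gc])
    show "det g \<noteq> 0" using dg by auto
    fix u :: "'a vec" assume u: "u \<in> carrier_vec (2 * p)"
    have xi: "x *\<^sub>v insv p u \<in> carrier_vec ?k" using x insv_carrier[of p u] by simp
    have "Q (x *\<^sub>v insv p u) = Q (insv p u)" by (rule Qx[OF insv_carrier])
    then show "R_form \<alpha> \<beta> (g *\<^sub>v u) = R_form \<alpha> \<beta> u"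
      unfolding Q[OF xi] Q[OF insv_carrier] unfolding xg cross_simps(2,3)[OF gc insv_carrier] insv_mid rmv_insv[OF u] by simp
  qed
  then show "\<exists>g\<in>isometries (2 * p) (R_form \<alpha> \<beta>). a = det g \<and> x = cross g a" using ad xg by blast
qed

end

text \<open>The stabilizer of \<open>\<phi>\<close> in \<open>L_n\<close>, which acts on the
  coordinate of \<open>U_n\<close> through \<open>a\<close> times \<open>x\<close>. Describing the
  complements of the inertia groups by functionals instead of matrix shapes allows both signs to be
  treated at once.\<close>

definition inertia :: "nat \<Rightarrow> ('a::field vec \<Rightarrow> 'a) \<Rightarrow> 'a mat set" where
  "inertia n \<phi> = {c \<in> L_grp n. \<forall>v\<in>carrier_vec (n - 2). c $$ (0, 0) * \<phi> (mid c *\<^sub>v v) = \<phi> v}"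

lemma isometries_cong:
  assumes "\<And>v. v \<in> carrier_vec n \<Longrightarrow> Q v = Q' v"
  shows "isometries n Q = isometries n Q'"
proof -
  have "Q (g *\<^sub>v v) = Q' (g *\<^sub>v v)" if "g \<in> carrier (GL n)" "v \<in> carrier_vec n" for g v
    using that by (intro assms mult_mat_vec_carrier) (auto simp: GL_carrier)
  then show ?thesis using assms by (auto simp: isometries_def)
qed

lemma mid_one: "mid (1\<^sub>m (S2 k)) = (1\<^sub>m k :: 'a::field mat)"
  by (intro eq_matI) auto

context
  fixes k :: nat
  assumes odd_k: "odd k"
begin

lemma inertia_iff:
  "c \<in> inertia (S2 k) \<phi> \<longleftrightarrow> c \<in> L_grp (S2 k) \<and> (\<forall>v\<in>carrier_vec k. c $$ (0, 0) * \<phi> (mid c *\<^sub>v v) = \<phi> v)"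
  by (simp add: inertia_def)

lemma inertia_L: "inertia (S2 k) \<phi> \<subseteq> L_grp (S2 k)"
  by (auto simp: inertia_iff)

lemma subgroup_inertia: "subgroup (inertia (S2 k) \<phi> :: 'a::field mat set) (GL (S2 k))"
proof -
  interpret group "GL (S2 k) :: 'a mat monoid" by simp
  note L = subgroup_L[OF odd_k, where 'a = 'a]
  show ?thesis
  proof (rule subgroupI)
    show "(inertia (S2 k) \<phi> :: 'a mat set) \<subseteq> carrier (GL (S2 k))" using inertia_L subgroup.subset[OF L] by blast
    have "(1\<^sub>m (S2 k) :: 'a mat) \<in> L_grp (S2 k)" using subgroup.one_closed[OF L] by simp
    moreover note mid_one[of k, where 'a = 'a]
    ultimately have "(1\<^sub>m (S2 k) :: 'a mat) \<in> inertia (S2 k) \<phi>" by (simp add: inertia_iff)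
    then show "inertia (S2 k) \<phi> \<noteq> {}" by blast
    show "c \<otimes>\<^bsub>GL (S2 k)\<^esub> d \<in> inertia (S2 k) \<phi>" if c: "c \<in> inertia (S2 k) \<phi>" and d: "d \<in> inertia (S2 k) \<phi>" for c d
    proof -
      have cd: "c \<in> L_grp (S2 k)" "d \<in> L_grp (S2 k)" using c d by (auto simp: inertia_iff)
      note P = L_grpD(4)[OF odd_k cd(1)] L_grpD(4)[OF odd_k cd(2)]
      have "(c * d) $$ (0, 0) * \<phi> (mid (c * d) *\<^sub>v v) = \<phi> v" if v: "v \<in> carrier_vec k" for v
      proof -
        have dv: "mid d *\<^sub>v v \<in> carrier_vec k" by (rule mult_mat_vec_carrier[OF P_mid_carrier[OF odd_k P(2)] v])
        have "(c * d) $$ (0, 0) * \<phi> (mid (c * d) *\<^sub>v v) = d $$ (0, 0) * (c $$ (0, 0) * \<phi> (mid c *\<^sub>v (mid d *\<^sub>v v)))"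
          unfolding P_mult(2,3)[OF odd_k P] assoc_mult_mat_vec[OF P_mid_carrier[OF odd_k P(1)] P_mid_carrier[OF odd_k P(2)] v] by simp
        also have "c $$ (0, 0) * \<phi> (mid c *\<^sub>v (mid d *\<^sub>v v)) = \<phi> (mid d *\<^sub>v v)" using c dv by (simp add: inertia_iff)
        finally show ?thesis using d v by (simp add: inertia_iff)
      qed
      then show ?thesis using subgroup.m_closed[OF L cd] by (simp add: inertia_iff del: index_mult_mat(1))
    qed
    show "inv\<^bsub>GL (S2 k)\<^esub> c \<in> inertia (S2 k) \<phi>" if c: "c \<in> inertia (S2 k) \<phi>" for c
    proof -
      have cL: "c \<in> L_grp (S2 k)" using c by (auto simp: inertia_iff)
      let ?d = "inv\<^bsub>GL (S2 k)\<^esub> c"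
      have dL: "?d \<in> L_grp (S2 k)" by (rule subgroup.m_inv_closed[OF L cL])
      note P = L_grpD(4)[OF odd_k cL] L_grpD(4)[OF odd_k dL]
      note cP = P_mid_carrier[OF odd_k P(1)] P_mid_carrier[OF odd_k P(2)]
      have "c * ?d = 1\<^sub>m (S2 k)" using r_inv[of c] cL subgroup.subset[OF L] by auto
      then have e: "c $$ (0, 0) * ?d $$ (0, 0) = 1" "mid c * mid ?d = 1\<^sub>m k"
        using P_mult(2,3)[OF odd_k P] mid_one[of k, where 'a = 'a] by auto
      have "?d $$ (0, 0) * \<phi> (mid ?d *\<^sub>v v) = \<phi> v" if v: "v \<in> carrier_vec k" for v
      proof -
        have dv: "mid ?d *\<^sub>v v \<in> carrier_vec k" by (rule mult_mat_vec_carrier[OF cP(2) v])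
        have "mid c *\<^sub>v (mid ?d *\<^sub>v v) = v" using assoc_mult_mat_vec[OF cP v] v unfolding e(2) by simp
        then have "\<phi> (mid ?d *\<^sub>v v) = c $$ (0, 0) * \<phi> v" using c dv by (metis inertia_iff)
        then show ?thesis using e(1) by (metis mult.assoc mult.commute mult.left_neutral)
      qed
      then show ?thesis using dL by (simp add: inertia_iff)
    qed
  qed
qed

end

context
  fixes k :: nat
  assumes odd_k: "odd k"
begin

lemma core_in_L:
  assumes c: "c \<in> P_grp (S4 k)" and m: "mid c \<in> P_grp (S2 k)"
  shows "core (c :: 'a::field mat) \<in> L_grp (S2 k)"
  unfolding core_def by (rule s_mat_in_L[OF P_par(4)[OF odd_k m] P_par(2)[OF odd2[OF odd_k] c]])

lemma core_simps:
  assumes m: "mid c \<in> P_grp (S2 k)"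
  shows "mid (core c) = mid (mid c)" "core c $$ (0, 0) = (c :: 'a::field mat) $$ (0, 0)"
  unfolding core_def using P_mid_carrier[OF odd_k m] by simp_all

text \<open>Applied to \<open>mid c\<close>, the functional splits: the inner coordinates of
  \<open>v\<close> meet only the central block, while the last coordinate contributes a multiple of
  \<open>\<phi> (unip_vec (mid c))\<close>. Vectors padded by zeros and the last basis vector test
  the two parts separately.\<close>

lemma inertia_border:
  fixes c :: "'a::field mat"
  assumes \<phi>: "linear_on k \<phi>" and c: "c \<in> L_grp (S4 k)" and m: "mid c \<in> P_grp (S2 k)"
  shows "c \<in> inertia (S4 k) (\<lambda>v. \<phi> (midv v)) \<longleftrightarrow> core c \<in> inertia (S2 k) \<phi> \<and> \<phi> (unip_vec (mid c)) = 0"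
proof -
  let ?a = "c $$ (0, 0)" and ?b = "mid c $$ (0, 0)" and ?w = "unip_vec (mid c)"
  note cP = L_grpD(4)[OF odd2[OF odd_k] c]
  have a: "?a \<noteq> 0" by (rule L_grpD(3)[OF odd2[OF odd_k] c])
  note p = P_par[OF odd_k m] and mc = P_carrier[OF odd_k m]
  have w: "?w \<in> carrier_vec k" using mc by (rule unip_vec_carrier)
  have e: "?a * \<phi> (midv (mid c *\<^sub>v v)) = ?a * \<phi> (mid (mid c) *\<^sub>v midv v) + ?a * inverse ?b * v $ Suc k * \<phi> ?w"
    if v: "v \<in> carrier_vec (S2 k)" for v
  proof -
    have "mid c $$ (Suc i, Suc k) = inverse ?b * ?w $ i" if "i < k" for i
      using carrier_matD[OF P_carrier[OF odd2[OF odd_k] cP]] that p(2) by simp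
    then have "vec k (\<lambda>i. v $ Suc k * mid c $$ (Suc i, Suc k)) = (v $ Suc k * inverse ?b) \<cdot>\<^sub>v ?w"
      using carrier_vecD[OF w] by (intro eq_vecI) auto
    then have "midv (mid c *\<^sub>v v) = mid (mid c) *\<^sub>v midv v + (v $ Suc k * inverse ?b) \<cdot>\<^sub>v ?w"
      using par_mult_vec(3)[OF p(1) v] by simp
    then show ?thesis
      using linear_onD(1)[OF \<phi> mult_mat_vec_carrier[OF mid_carrier[OF mc] midv_carrier[OF v]] smult_carrier_vec[THEN iffD2, OF w]]
        linear_onD(2)[OF \<phi> w] by (simp add: algebra_simps)
  qed
  have i4: "c \<in> inertia (S4 k) (\<lambda>v. \<phi> (midv v)) \<longleftrightarrow> (\<forall>v\<in>carrier_vec (S2 k). ?a * \<phi> (midv (mid c *\<^sub>v v)) = \<phi> (midv v))"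
    using c by (simp add: inertia_def)
  have i2: "core c \<in> inertia (S2 k) \<phi> \<longleftrightarrow> (\<forall>u\<in>carrier_vec k. ?a * \<phi> (mid (mid c) *\<^sub>v u) = \<phi> u)"
    using core_in_L[OF cP m] core_simps[OF m] by (simp add: inertia_iff[OF odd_k])
  show ?thesis
  proof
    assume L: "c \<in> inertia (S4 k) (\<lambda>v. \<phi> (midv v))"
    have "?a * \<phi> (mid (mid c) *\<^sub>v u) = \<phi> u" if u: "u \<in> carrier_vec k" for u
    proof -
      let ?v = "vec (S2 k) (\<lambda>i. if i = 0 \<or> i = Suc k then 0 else u $ (i - 1))"
      have "midv ?v = u" using u by (intro eq_vecI) auto
      then show ?thesis using L[unfolded i4, rule_format, of ?v] e[of ?v] by simp
    qed
    moreover have "\<phi> ?w = 0"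
    proof -
      let ?v = "unit_vec (S2 k) (Suc k) :: 'a vec"
      have mv: "midv ?v = 0\<^sub>v k" by (intro eq_vecI) auto
      have "?a * inverse ?b * \<phi> ?w = 0"
        using L[unfolded i4, rule_format, of ?v] e[of ?v] linear_onD(3)[OF \<phi>]
        unfolding mv mult_mat_zero_vec[OF mid_carrier[OF mc]] by simp
      then show ?thesis using a p(2) by simp
    qed
    ultimately show "core c \<in> inertia (S2 k) \<phi> \<and> \<phi> ?w = 0" using i2 by blast
  next
    assume "core c \<in> inertia (S2 k) \<phi> \<and> \<phi> ?w = 0"
    then show "c \<in> inertia (S4 k) (\<lambda>v. \<phi> (midv v))"
      unfolding i4 i2 using e midv_carrier by simp
  qed
qed

text \<open>The instance of \<open>ind_RQK_inertia\<close> in which the complements are stabilizers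
  of functionals and \<open>C0\<close> is the part of \<open>C\<close> whose middle block is
  parabolic. Types \<open>+\<close> and \<open>-\<close> then differ only in
  \<open>\<phi>\<close>.\<close>

lemma ind_RQK_inertia_functional:
  fixes g :: "'a::{field,finite} mat" and \<xi> :: "'a \<Rightarrow> complex"
  assumes \<xi>: "additive_char \<xi>" and \<phi>: "linear_on k \<phi>"
    and g: "g \<in> P_grp (S4 k)" and z: "z \<in> carrier_vec k" "\<phi> z = 1"
    and C': "C' = inertia (S2 k) \<phi>" and C: "C = inertia (S4 k) \<phi>'" and C0: "C0 = {c \<in> C. mid c \<in> P_grp (S2 k)}"
    and \<phi>': "\<And>v. v \<in> carrier_vec (S2 k) \<Longrightarrow> \<phi>' v = \<phi> (midv v)"
    and \<chi>: "\<chi> = ind (GL (S2 k)) (U_grp (S2 k) <#>\<^bsub>GL (S2 k)\<^esub> C') (P_grp (S2 k))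
     (\<lambda>g. ext_char (GL (S2 k)) (U_grp (S2 k)) C' (U_char (S2 k) (\<lambda>v. \<xi> (\<phi> v))) g * infl (GL (S2 k)) (U_grp (S2 k)) C' \<theta> g)"
    and \<tau>: "\<And>c. c \<in> C0 \<Longrightarrow> \<tau> c = \<theta> (core c)"
  shows "ind (GL (S4 k)) (RQK_grp (S4 k)) (P_grp (S4 k)) (conj_char (GL (S4 k)) (s_elt (S4 k)) (infl_RQK (S4 k) \<chi>)) g
    = ind (GL (S4 k)) (U_grp (S4 k) <#>\<^bsub>GL (S4 k)\<^esub> C) (P_grp (S4 k))
     (\<lambda>g. ext_char (GL (S4 k)) (U_grp (S4 k)) C (U_char (S4 k) (\<lambda>v. \<xi> (\<phi>' v))) g
       * infl (GL (S4 k)) (U_grp (S4 k)) C (ind (GL (S4 k)) C0 C \<tau>) g) g"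
proof -
  have C2: "inertia (S4 k) \<phi>' = inertia (S4 k) (\<lambda>v. \<phi> (midv v))"
  proof -
    have "\<phi>' (mid c *\<^sub>v v) = \<phi> (midv (mid c *\<^sub>v v))" if "c \<in> L_grp (S4 k)" "v \<in> carrier_vec (S2 k)" for c v
      by (rule \<phi>', rule mult_mat_vec_carrier[OF P_mid_carrier[OF odd2[OF odd_k] L_grpD(4)[OF odd2[OF odd_k] that(1)]] that(2)])
    then show ?thesis using \<phi>' by (auto simp: inertia_def)
  qed
  show ?thesis
  proof (rule ind_RQK_inertia[OF odd_k \<xi> \<phi> g z _ _ \<chi>])
    show "C' \<subseteq> L_grp (S2 k)" unfolding C' by (rule inertia_L[OF odd_k])
    show "a * \<phi> (y *\<^sub>v v) = \<phi> v" if "s_mat y a \<in> C'" "y \<in> SO k" "a \<noteq> 0" "v \<in> carrier_vec k" for y a v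
    proof -
      have "y \<in> carrier_mat k k" using that(2) by (simp add: SO_iff)
      then show ?thesis using that(1,4) unfolding C' inertia_iff[OF odd_k] by simp
    qed
    show "C \<subseteq> L_grp (S4 k)" unfolding C by (auto simp: inertia_def)
    show "C0 \<subseteq> C" unfolding C0 by blast
    show "c \<in> C0 \<longleftrightarrow> mid c \<in> P_grp (S2 k) \<and> core c \<in> C' \<and> \<phi> (unip_vec (mid c)) = 0" if "c \<in> L_grp (S4 k)" for c
      unfolding C0 C C2 C' using inertia_border[OF \<phi> that] by blast
    show "\<xi> (\<phi>' v) = \<xi> (\<phi> (midv v))" if "v \<in> carrier_vec (S2 k)" for v using \<phi>'[OF that] by simp
    show "\<xi> (\<phi>' (c $$ (0, 0) \<cdot>\<^sub>v (mid c *\<^sub>v v))) = \<xi> (\<phi>' v)" if c: "c \<in> C" and v: "v \<in> carrier_vec (S2 k)" for c v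
    proof -
      have cL: "c \<in> L_grp (S4 k)" using c unfolding C by (simp add: inertia_def)
      have mv: "mid c *\<^sub>v v \<in> carrier_vec (S2 k)" by (rule mult_mat_vec_carrier[OF P_mid_carrier[OF odd2[OF odd_k] L_grpD(4)[OF odd2[OF odd_k] cL]] v])
      have "midv (c $$ (0, 0) \<cdot>\<^sub>v (mid c *\<^sub>v v)) = c $$ (0, 0) \<cdot>\<^sub>v midv (mid c *\<^sub>v v)"
        using carrier_vecD[OF mv] by (intro eq_vecI) (auto simp del: index_mult_mat_vec dim_mult_mat_vec)
      then have "\<phi>' (c $$ (0, 0) \<cdot>\<^sub>v (mid c *\<^sub>v v)) = c $$ (0, 0) * \<phi>' (mid c *\<^sub>v v)"
        using \<phi>'[OF mv] \<phi>'[OF smult_carrier_vec[THEN iffD2, OF mv]] linear_onD(2)[OF \<phi> midv_carrier[OF mv]] by simp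
      also have "\<dots> = \<phi>' v" using c v unfolding C by (simp add: inertia_def)
      finally show ?thesis by simp
    qed
  qed (use subgroup_inertia[OF odd2[OF odd_k]] \<tau> C in auto)
qed

end

section \<open>The groups \<open>L_plus\<close> and \<open>P_plus\<close>\<close>

lemma inertia_I:
  fixes x :: "'a::field mat"
  assumes "x \<in> SO k" "a \<noteq> 0" "\<And>v. v \<in> carrier_vec k \<Longrightarrow> a * \<phi> (x *\<^sub>v v) = \<phi> v"
  shows "s_mat x a \<in> inertia (S2 k) \<phi>"
proof -
  have "x \<in> carrier_mat k k" using assms(1) by (simp add: SO_iff)
  then show ?thesis using assms s_mat_in_L[OF assms(1,2)] by (simp add: inertia_def)
qed

lemma inertiaD:
  fixes c :: "'a::field mat"
  assumes k: "odd k" and "c \<in> inertia (S2 k) \<phi>"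
  shows "s_mat (mid c) (c $$ (0, 0)) = c" "mid c \<in> SO k" "c $$ (0, 0) \<noteq> 0"
    "v \<in> carrier_vec k \<Longrightarrow> c $$ (0, 0) * \<phi> (mid c *\<^sub>v v) = \<phi> v"
  using assms L_grpD[OF k, of c] by (auto simp: inertia_def)

lemma cf_mid: "v \<in> carrier_vec (Suc (2 * p)) \<Longrightarrow> cf v 0 = v $ p"
  by (simp add: cf_def)

text \<open>This is \<open>cross_iff\<close> for the parameters \<open>0\<close>, \<open>0\<close>,
  with the middle coordinate as functional.\<close>

lemma L_plus_eq:
  assumes k: "odd k"
  shows "L_plus (S2 k) = inertia (S2 k) (\<lambda>v :: 'a::field vec. cf v 0)"
proof -
  obtain p where p: "k = Suc (2 * p)" using k by (auto elim: oddE)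
  have nd: "0 < p \<Longrightarrow> 4 * 0 * 0 \<noteq> (1 :: 'a)" "p = 0 \<Longrightarrow> (0 :: 'a) = 0 \<and> (0 :: 'a) = 0" by auto
  have GO: "GO_plus (k - 1) = isometries (2 * p) (R_form 0 0 :: 'a vec \<Rightarrow> 'a)"
    by (simp add: GO_plus_def p Q_plus_R_form)
  have iff: "(\<exists>g\<in>isometries (2 * p) (R_form 0 0). a = det g \<and> x = cross g a) \<longleftrightarrow>
      det x = 1 \<and> (\<forall>v\<in>carrier_vec k. Q_odd (x *\<^sub>v v) = Q_odd v) \<and> (\<forall>v\<in>carrier_vec k. a * (x *\<^sub>v v) $ p = v $ p)"
    if "x \<in> carrier_mat k k" "a \<noteq> 0" for x and a :: 'a
    using that unfolding p by (intro cross_iff nd Q_odd_rmv)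
  show ?thesis
  proof (intro equalityI subsetI)
    fix c :: "'a mat" assume "c \<in> L_plus (S2 k)"
    then obtain g where g: "g \<in> GO_plus (k - 1)" "c = s_mat (cross g (det g)) (det g)" by (auto simp: L_plus_def)
    have gc: "g \<in> carrier_mat (2 * p) (2 * p)" "det g \<noteq> 0" using g(1) unfolding GO by (auto simp: isometries_def GL_carrier)
    have x: "cross g (det g) \<in> carrier_mat k k" using cross_simps(1)[OF nd gc(1), of "det g"] by (simp add: p)
    from iff[OF x gc(2)] g(1) have *: "det (cross g (det g)) = 1" "\<And>v. v \<in> carrier_vec k \<Longrightarrow> Q_odd (cross g (det g) *\<^sub>v v) = Q_odd v"
      "\<And>v. v \<in> carrier_vec k \<Longrightarrow> det g * (cross g (det g) *\<^sub>v v) $ p = v $ p" unfolding GO by blast+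
    show "c \<in> inertia (S2 k) (\<lambda>v. cf v 0)" unfolding g(2)
    proof (rule inertia_I)
      show "cross g (det g) \<in> SO k" using x * by (simp add: SO_iff)
      show "det g * cf (cross g (det g) *\<^sub>v v) 0 = cf v 0" if v: "v \<in> carrier_vec k" for v
        using *(3)[OF v] mult_mat_vec_carrier[OF x v] v unfolding p by (simp only: cf_mid)
    qed (rule gc)
  next
    fix c :: "'a mat" assume "c \<in> inertia (S2 k) (\<lambda>v. cf v 0)"
    note c = inertiaD[OF k this]
    have x: "mid c \<in> carrier_mat k k" using c(2) by (simp add: SO_iff)
    have "\<exists>g\<in>isometries (2 * p) (R_form 0 0). c $$ (0, 0) = det g \<and> mid c = cross g (c $$ (0, 0))"
      unfolding iff[OF x c(3)]
    proof (intro conjI ballI)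
      show "det (mid c) = 1" using c(2) by (simp add: SO_iff)
      show "Q_odd (mid c *\<^sub>v v) = Q_odd v" if "v \<in> carrier_vec k" for v using c(2) that by (simp add: SO_iff)
      show "c $$ (0, 0) * (mid c *\<^sub>v v) $ p = v $ p" if v: "v \<in> carrier_vec k" for v
        using c(4)[OF v] mult_mat_vec_carrier[OF x v] v unfolding p by (simp only: cf_mid)
    qed
    then obtain g where "g \<in> GO_plus (k - 1)" "c $$ (0, 0) = det g" "mid c = cross g (c $$ (0, 0))" unfolding GO by blast
    then have "\<exists>g a. s_mat (mid c) (c $$ (0, 0)) = s_mat (cross g a) a \<and> g \<in> GO_plus (k - 1) \<and> a = det g"
      by (intro exI[of _ g] exI[of _ "c $$ (0, 0)"]) simp
    then show "c \<in> L_plus (S2 k)" unfolding c(1) by (simp add: L_plus_def)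
  qed
qed

text \<open>Only the first column is a genuine condition. The last row and the corner entries are
  supplied through \<open>par\<close>, and the two zeros in the middle row and column come from
  \<open>cross\<close>; for these \<open>k \<ge> 3\<close> keeps the middle index away from the
  border.\<close>

lemma parabolic_shape_iff:
  fixes x :: "'a::field mat"
  assumes k: "odd k" "k \<ge> 3" and x: "x \<in> carrier_mat (S2 k) (S2 k)"
    and cr: "x = cross g' a" "g' \<in> carrier_mat (k + 1) (k + 1)" and a: "a \<noteq> 0"
    and par: "(\<forall>i. 0 < i \<longrightarrow> i < (S2 k) \<longrightarrow> x $$ (i, 0) = 0) \<Longrightarrow> par (S2 k) x \<and> x $$ (0, 0) \<noteq> 0 \<and> x $$ (Suc k, Suc k) = inverse (x $$ (0, 0))
      \<and> (\<exists>g\<in>X. a = det g \<and> mid x = cross g a)"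
  shows "x \<in> parabolic_shape (S2 k) X a \<longleftrightarrow> (\<forall>i. 0 < i \<longrightarrow> i < (S2 k) \<longrightarrow> x $$ (i, 0) = 0)"
proof
  assume "x \<in> parabolic_shape (S2 k) X a"
  then show "\<forall>i. 0 < i \<longrightarrow> i < (S2 k) \<longrightarrow> x $$ (i, 0) = 0" by (auto simp: parabolic_shape_def)
next
  assume *: "\<forall>i. 0 < i \<longrightarrow> i < (S2 k) \<longrightarrow> x $$ (i, 0) = 0"
  obtain p where p: "k = Suc (2 * p)" using k(1) by (auto elim: oddE)
  have e: "cross g' a $$ (i, j) = (if i = Suc p \<and> j = Suc p then a else if i = Suc p \<or> j = Suc p then 0
      else g' $$ (if i < Suc p then i else i - 1, if j < Suc p then j else j - 1))" if "i < (S2 k)" "j < (S2 k)" for i j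
    using cr(2) that p by (simp add: cross_def Let_def)
  have z: "x $$ (0, (S2 k) div 2) = 0" "x $$ ((S2 k) div 2, Suc k) = 0"
    using p k(2) unfolding cr(1) by (simp_all add: e)
  from par[OF *] obtain g where "g \<in> X" "a = det g" "mid x = cross g a" and
    p: "par (S2 k) x" "x $$ (0, 0) \<noteq> 0" "x $$ (Suc k, Suc k) = inverse (x $$ (0, 0))" by blast
  then show "x \<in> parabolic_shape (S2 k) X a"
    unfolding parabolic_shape_def using x * z par_row[OF p(1)] by (auto intro!: exI[of _ g])
qed

lemma P_plus_eq:
  assumes k: "odd k"
  shows "P_plus (S4 k) = {c \<in> L_plus (S4 k). mid c \<in> (P_grp (S2 k) :: 'a::field mat set)}"
proof (cases "k = 1")
  case False
  then have k3: "k \<ge> 3" using k by presburger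
  have shape: "mid c \<in> parabolic_shape (S2 k) (GO_plus (k - 1)) (c $$ (0, 0)) \<longleftrightarrow> mid c \<in> P_grp (S2 k)" if c: "c \<in> L_plus (S4 k)" for c :: "'a mat"
  proof -
    obtain g' where g': "g' \<in> GO_plus (k + 1)" "c = s_mat (cross g' (det g')) (det g')"
      using c by (auto simp: L_plus_def)
    have gc: "g' \<in> carrier_mat (k + 1) (k + 1)" using g'(1) by (auto simp: GO_plus_def isometries_def GL_carrier)
    note I = c[unfolded L_plus_eq[OF odd2[OF k]]]
    note cD = inertiaD[OF odd2[OF k] I]
    have mc: "mid c \<in> carrier_mat (S2 k) (S2 k)" using cD(2) by (simp add: SO_iff)
    have cL: "c \<in> L_grp (S4 k)" using I by (simp add: inertia_def)
    note cP = L_grpD(4)[OF odd2[OF k] cL]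
    have crc: "cross g' (det g') \<in> carrier_mat (S2 k) (S2 k)"
      using gc k by (auto simp: cross_def Let_def elim!: oddE)
    have c0: "c $$ (0, 0) = det g'" "mid c = cross g' (c $$ (0, 0))" using g'(2) crc by simp_all
    have iffP: "mid c \<in> P_grp (S2 k) \<longleftrightarrow> (\<forall>i. 0 < i \<longrightarrow> i < (S2 k) \<longrightarrow> mid c $$ (i, 0) = 0)"
      using cD(2) P_grp_iff[of "(S2 k)" "mid c"] by simp
    show ?thesis unfolding iffP
    proof (rule parabolic_shape_iff[OF k k3 mc c0(2) gc cD(3)])
      assume "\<forall>i. 0 < i \<longrightarrow> i < (S2 k) \<longrightarrow> mid c $$ (i, 0) = 0"
      then have mP: "mid c \<in> P_grp (S2 k)" using iffP by simp
      have "linear_on k (\<lambda>v :: 'a vec. cf v 0)" using odd_pos[OF k] by (auto simp: linear_on_def cf_def)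
      moreover have "c \<in> inertia (S4 k) (\<lambda>v. cf (midv v) 0)"
      proof -
        have "cf (midv v) 0 = cf v 0" if "v \<in> carrier_vec (S2 k)" for v :: "'a vec"
          using carrier_vecD[OF that] odd_pos[OF k] by (simp add: cf_def)
        then show ?thesis using I mult_mat_vec_carrier[OF mc] by (auto simp: inertia_def)
      qed
      ultimately have "core c \<in> inertia (S2 k) (\<lambda>v. cf v 0)" using inertia_border[OF k _ cL mP] by blast
      then have "core c \<in> L_plus (S2 k)" by (simp add: L_plus_eq[OF k])
      then obtain g where g: "g \<in> GO_plus (k - 1)" "core c = s_mat (cross g (det g)) (det g)" by (auto simp: L_plus_def)
      have gc': "cross g (det g) \<in> carrier_mat k k"
        using g(1) k by (auto simp: GO_plus_def isometries_def GL_carrier cross_def Let_def elim!: oddE)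
      have "mid (mid c) = cross g (det g)" "c $$ (0, 0) = det g"
        using core_simps[OF k mP] g(2) gc' by auto
      then show "par (S2 k) (mid c) \<and> mid c $$ (0, 0) \<noteq> 0 \<and> mid c $$ (Suc k, Suc k) = inverse (mid c $$ (0, 0))
        \<and> (\<exists>g\<in>GO_plus (k - 1). c $$ (0, 0) = det g \<and> mid (mid c) = cross g (c $$ (0, 0)))"
        using P_par[OF k mP] g(1) by auto
    qed
  qed
  have n5: "(S4 k) \<noteq> 5" "(S4 k) - 2 = (S2 k)" "(S4 k) - 5 = k - 1" using False by auto
  show ?thesis
  proof (intro equalityI subsetI)
    fix c :: "'a mat" assume "c \<in> P_plus (S4 k)"
    then obtain y a where ya: "c = s_mat y a" "s_mat y a \<in> L_plus (S4 k)" "y \<in> parabolic_shape (S2 k) (GO_plus (k - 1)) a"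
      unfolding P_plus_def n5 using n5(1) by (auto simp only: if_False mem_Collect_eq)
    have yc: "y \<in> carrier_mat (S2 k) (S2 k)" using ya(3) by (simp add: parabolic_shape_def)
    have m: "mid c = y" "c $$ (0, 0) = a" unfolding ya(1) using yc by simp_all
    show "c \<in> {c \<in> L_plus (S4 k). mid c \<in> P_grp (S2 k)}" using shape[of c] ya m by simp
  next
    fix c :: "'a mat" assume c: "c \<in> {c \<in> L_plus (S4 k). mid c \<in> P_grp (S2 k)}"
    then have "c \<in> inertia (S4 k) (\<lambda>v. cf v 0)" using L_plus_eq[OF odd2[OF k], where 'a = 'a] by auto
    note s = inertiaD(1)[OF odd2[OF k] this]
    have "s_mat (mid c) (c $$ (0, 0)) \<in> L_plus (S4 k) \<and> mid c \<in> parabolic_shape (S2 k) (GO_plus (k - 1)) (c $$ (0, 0))"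
      unfolding s using shape[of c] c by simp
    then show "c \<in> P_plus (S4 k)" unfolding P_plus_def n5 using n5(1) s
      by (simp only: if_False mem_Collect_eq) (metis s)
  qed
next
  \<comment> \<open>For \<open>n = 5\<close> the group \<open>SO 1\<close> of central blocks is
    trivial, and \<open>P_plus\<close> is given outright as a torus of diagonal matrices.\<close>
  case True
  have d: "mat_diag 5 (\<lambda>i. [1, b, 1, inverse b, 1] ! i) = s_mat (s_mat (1\<^sub>m 1) b) (1 :: 'a)" for b
  proof -
    have s1: "s_mat (1\<^sub>m (Suc 0)) b \<in> carrier_mat 3 3" using s_mat_simps(1)[of "1\<^sub>m 1" 1 b] by (simp add: numeral_3_eq_3)
    have "s_mat (1\<^sub>m (Suc 0)) b = mat (Suc (Suc 1)) (Suc (Suc 1)) (\<lambda>(i, j).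
      if i = 0 then (if j = 0 then b else 0) else if i = Suc 1 then (if j = Suc 1 then inverse b else 0)
      else if j = 0 \<or> j = Suc 1 then 0 else 1\<^sub>m (Suc 0) $$ (i - 1, j - 1))" by (rule s_mat_eq) simp
    then have s2: "s_mat (1\<^sub>m (Suc 0)) b $$ (i, j) = (if i \<noteq> j then 0 else if i = 0 then b else if i = Suc 0 then 1 else inverse b)" if "i < 3" "j < 3" for i j
      using that by (auto simp: less_Suc_eq numeral_3_eq_3)
    show ?thesis unfolding One_nat_def s_mat_eq[OF s1]
      by (intro eq_matI) (auto simp: mat_diag_def s2 less_Suc_eq numeral_eq_Suc nth_Cons')
  qed
  have L3: "L_grp 5 = {s_mat x a |x a. x \<in> SO 3 \<and> a \<noteq> (0::'a)}" by (simp add: L_grp_def)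
  have SO1: "SO (Suc 0) = {1\<^sub>m (Suc 0) :: 'a mat}"
  proof (intro equalityI subsetI)
    fix x :: "'a mat" assume "x \<in> SO (Suc 0)"
    then have x: "x \<in> carrier_mat 1 1" "det x = 1" by (auto simp: SO_iff)
    have "x = 1\<^sub>m 1" using x det_single[OF x(1)] by (intro eq_matI) auto
    then show "x \<in> {1\<^sub>m (Suc 0)}" by simp
  qed (simp add: SO_iff)
  have *: "mid c \<in> P_grp (S2 k) \<and> c \<in> L_plus (S4 k) \<longleftrightarrow> (\<exists>b. b \<noteq> 0 \<and> c = s_mat (s_mat (1\<^sub>m 1) b) 1)" for c :: "'a mat"
  proof
    assume c: "mid c \<in> P_grp (S2 k) \<and> c \<in> L_plus (S4 k)"
    note I = c[THEN conjunct2, unfolded L_plus_eq[OF odd2[OF k]]]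
    have cL: "c \<in> L_grp (S4 k)" using I by (simp add: inertia_def)
    have "linear_on k (\<lambda>v :: 'a vec. cf v 0)" using odd_pos[OF k] by (auto simp: linear_on_def cf_def)
    moreover have "c \<in> inertia (S4 k) (\<lambda>v. cf (midv v) 0)"
    proof -
      have mc: "mid c \<in> carrier_mat (S2 k) (S2 k)" using P_carrier[OF k] c by auto
      have "cf (midv v) 0 = cf v 0" if "v \<in> carrier_vec (S2 k)" for v :: "'a vec"
        using carrier_vecD[OF that] odd_pos[OF k] by (simp add: cf_def)
      then show ?thesis using I mult_mat_vec_carrier[OF mc] by (auto simp: inertia_def)
    qed
    ultimately have u: "core c \<in> inertia (S2 k) (\<lambda>v. cf v 0)" "cf (unip_vec (mid c)) 0 = 0"
      using inertia_border[OF k _ cL] c by auto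
    have mP: "mid c \<in> P_grp (S2 k)" using c by simp
    have m1: "mid (mid c) = 1\<^sub>m 1" using P_par(4)[OF k mP] SO1 True by auto
    \<comment> \<open>Evaluating the preserved functional at the only basis vector forces the corner
      entry to be \<open>1\<close>.\<close>
    have "c $$ (0, 0) * cf (mid (mid c) *\<^sub>v unit_vec k 0) 0 = cf (unit_vec k 0) 0"
      using inertiaD(4)[OF k u(1), of "unit_vec k 0"] core_simps[OF k mP] by simp
    then have c1: "c $$ (0, 0) = 1" unfolding m1 using True by (simp add: cf_def)
    have "unip_vec (mid c) = 0\<^sub>v k"
      using u(2) True carrier_vecD[OF unip_vec_carrier[OF P_carrier[OF k mP]]] by (intro eq_vecI) (auto simp: cf_def)
    then have "levi (mid c) = mid c"
      by (intro P_eqI[OF k levi_simps(1)[OF k mP] mP levi_simps(2,3)[OF k mP]]) (simp only: levi_simps(4)[OF k mP])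
    then have "mid c = s_mat (1\<^sub>m 1) (mid c $$ (0, 0))" unfolding levi_def m1 by simp
    moreover have "c = s_mat (mid c) 1" using L_grpD(1)[OF odd2[OF k] cL] c1 by simp
    ultimately have "c = s_mat (s_mat (1\<^sub>m 1) (mid c $$ (0, 0))) 1" by simp
    then show "\<exists>b. b \<noteq> 0 \<and> c = s_mat (s_mat (1\<^sub>m 1) b) 1" using P_par(2)[OF k mP] by blast
  next
    assume "\<exists>b. b \<noteq> 0 \<and> c = s_mat (s_mat (1\<^sub>m 1) b) 1"
    then obtain b where b: "b \<noteq> 0" "c = s_mat (s_mat (1\<^sub>m k) b) 1" using True by auto
    have xP: "s_mat (1\<^sub>m k) b \<in> P_grp (S2 k)" by (rule s_mat_in_P[OF k one_SO[OF k] b(1)])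
    note xc = P_carrier[OF k xP]
    have "c \<in> inertia (S4 k) (\<lambda>v. cf v 0)" unfolding b(2)
    proof (rule inertia_I[OF P_in_SO[OF k xP] one_neq_zero])
      fix v :: "'a vec" assume v: "v \<in> carrier_vec (S2 k)"
      have "(s_mat (1\<^sub>m k) b *\<^sub>v v) $ Suc 0 = v $ Suc 0"
      proof -
        have z: "vec k (\<lambda>i. v $ Suc k * s_mat (1\<^sub>m k) b $$ (Suc i, Suc k)) = 0\<^sub>v k" by (intro eq_vecI) auto
        have "midv (s_mat (1\<^sub>m k) b *\<^sub>v v) = midv v"
          using par_mult_vec(3)[OF s_mat_simps(6)[OF one_carrier_mat, of k b] v] midv_carrier[OF v]
          unfolding z s_mat_simps(4)[OF one_carrier_mat] by simp
        from arg_cong[OF this, of "\<lambda>v. v $ 0"] show ?thesis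
          using True carrier_vecD[OF v] carrier_matD[OF xc] by (simp del: index_mult_mat_vec)
      qed
      then show "1 * cf (s_mat (1\<^sub>m k) b *\<^sub>v v) 0 = cf v 0"
        using True carrier_vecD[OF v] carrier_matD[OF xc] by (simp add: cf_def del: index_mult_mat_vec)
    qed
    then show "mid c \<in> P_grp (S2 k) \<and> c \<in> L_plus (S4 k)" using xP unfolding L_plus_eq[OF odd2[OF k]] b(2) s_mat_simps(4)[OF xc] by simp
  qed
  have n5: "((S4 k) = 5) = True" using True by simp
  show ?thesis unfolding P_plus_def n5 if_True d using * by blast
qed

section \<open>The similitude \<open>b_mat\<close>\<close>

lemma GL_inv:
  assumes "b \<in> carrier (GL n)"
  shows "inv\<^bsub>GL n\<^esub> b \<in> carrier_mat n n" "b * inv\<^bsub>GL n\<^esub> b = 1\<^sub>m n" "inv\<^bsub>GL n\<^esub> b * b = (1\<^sub>m n :: 'a::field mat)"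
proof -
  interpret group "GL n :: 'a mat monoid" by simp
  show "inv\<^bsub>GL n\<^esub> b \<in> carrier_mat n n" using inv_closed[OF assms] by (simp add: GL_carrier)
  show "b * inv\<^bsub>GL n\<^esub> b = 1\<^sub>m n" "inv\<^bsub>GL n\<^esub> b * b = 1\<^sub>m n"
    using r_inv[OF assms] l_inv[OF assms] by simp_all
qed

lemma GL_inv_unique:
  assumes "b \<in> carrier (GL n)" "c \<in> carrier_mat n n" "b * c = (1\<^sub>m n :: 'a::field mat)"
  shows "inv\<^bsub>GL n\<^esub> b = c"
proof -
  have "b \<in> carrier_mat n n" using assms(1) by (simp add: GL_carrier)
  then have "c = (inv\<^bsub>GL n\<^esub> b * b) * c" using GL_inv(3)[OF assms(1)] assms(2) by simp
  also have "\<dots> = inv\<^bsub>GL n\<^esub> b * (b * c)"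
    by (rule assoc_mult_mat[OF GL_inv(1)[OF assms(1)] \<open>b \<in> carrier_mat n n\<close> assms(2)])
  finally show ?thesis using GL_inv(1)[OF assms(1)] unfolding assms(3) by simp
qed

lemma conj_cancel:
  fixes b c x :: "'a::field mat"
  assumes "b \<in> carrier_mat n n" "c \<in> carrier_mat n n" "c * b = 1\<^sub>m n" "x \<in> carrier_mat n n"
  shows "c * (b * x * c) * b = x"
proof -
  have "c * (b * x * c) = (c * b) * x * c"
    using assms(1,2,4) by (simp add: assoc_mult_mat[of _ n n _ n _ n])
  then have "c * (b * x * c) * b = (x * c) * b" using assms(3,4) by simp
  also have "\<dots> = x * (c * b)" by (rule assoc_mult_mat[OF assms(4,2,1)])
  finally show ?thesis using assms(3,4) by simp
qed

text \<open>The first column is read off from \<open>h * g\<close> and the last row from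
  \<open>g * h\<close>. No orthogonality is involved, since the matrix to be inverted is
  \<open>b_mat\<close>.\<close>

lemma par_inverse:
  fixes g h :: "'a::field mat"
  assumes g: "par (S2 k) g" and h: "h \<in> carrier_mat (S2 k) (S2 k)" and gh: "g * h = 1\<^sub>m (S2 k)" "h * g = 1\<^sub>m (S2 k)"
  shows "par (S2 k) h"
proof -
  note gc = par_carrier[OF g]
  have "(h * g) $$ (i, 0) = h $$ (i, 0) * g $$ (0, 0)" if "i < (S2 k)" for i
  proof -
    have "(h * g) $$ (i, 0) = (\<Sum>l<(S2 k). if l = 0 then h $$ (i, l) * g $$ (l, 0) else 0)"
      unfolding mult_mat_entry[OF h gc that zero_less_Suc]
      by (rule sum.cong) (use g in \<open>auto simp: par_def\<close>)
    also have "\<dots> = h $$ (i, 0) * g $$ (0, 0)" by (subst sum.delta) auto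
    finally show ?thesis .
  qed
  then have 1: "h $$ (i, 0) * g $$ (0, 0) = (if i = 0 then 1 else 0)" if "i < (S2 k)" for i
    using that unfolding gh(2) by simp
  have e: "(g * h) $$ (Suc k, j) = g $$ (Suc k, Suc k) * h $$ (Suc k, j)" if "j < (S2 k)" for j
  proof -
    have "(g * h) $$ (Suc k, j) = (\<Sum>l<(S2 k). if l = Suc k then g $$ (Suc k, l) * h $$ (l, j) else 0)"
      unfolding mult_mat_entry[OF gc h lessI that]
      by (rule sum.cong) (use g in \<open>auto simp: par_def\<close>)
    also have "\<dots> = g $$ (Suc k, Suc k) * h $$ (Suc k, j)" by (subst sum.delta) auto
    finally show ?thesis .
  qed
  have 2: "g $$ (Suc k, Suc k) * h $$ (Suc k, j) = (if j = Suc k then 1 else 0)" if "j < (S2 k)" for j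
    unfolding e[OF that, symmetric] gh(1) using that by simp
  from 1[of 0] 2[of "Suc k"] have nz: "g $$ (0, 0) \<noteq> 0" "g $$ (Suc k, Suc k) \<noteq> 0" by auto
  show ?thesis unfolding par_def
  proof (intro conjI allI impI)
    show "h $$ (i, 0) = 0" if "0 < i" "i < (S2 k)" for i using 1[OF that(2)] nz that by simp
    show "h $$ ((S2 k) - 1, j) = 0" if "j < (S2 k) - 1" for j using 2[of j] nz that by simp
  qed (rule h)
qed

lemma first_col_mult:
  fixes g h :: "'a::field mat"
  assumes "g \<in> carrier_mat n n" "h \<in> carrier_mat n n"
    and g: "\<And>i. 0 < i \<Longrightarrow> i < n \<Longrightarrow> g $$ (i, 0) = 0" and h: "\<And>i. 0 < i \<Longrightarrow> i < n \<Longrightarrow> h $$ (i, 0) = 0"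
    and i: "0 < i" "i < n"
  shows "(g * h) $$ (i, 0) = 0"
proof -
  have "0 < n" using i by simp
  have "(\<Sum>l<n. g $$ (i, l) * h $$ (l, 0)) = 0"
    by (rule sum.neutral) (use g[OF i] h in \<open>metis lessThan_iff mult_zero_left mult_zero_right neq0_conv\<close>)
  then show ?thesis using mult_mat_entry[OF assms(1,2) i(2) \<open>0 < n\<close>] by simp
qed

text \<open>If \<open>4 * \<nu> = 1\<close>, then \<open>2\<close> is invertible and the polynomial
  is the square of \<open>X + 1/2\<close>. The unsimplified product has the form required of the
  parameters \<open>1\<close>, \<open>\<nu>\<close> of \<open>R_form\<close>.\<close>

lemma irreducible_disc:
  fixes \<nu> :: "'a::field"
  assumes "irreducible [:\<nu>, 1, 1:]"
  shows "4 * 1 * \<nu> \<noteq> 1"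
proof
  assume *: "4 * 1 * \<nu> = 1"
  then have t: "(2::'a) \<noteq> 0" by (metis mult_2 mult_zero_left numeral_Bit0 add_0 one_neq_zero mult_1_right)
  define c :: 'a where "c = inverse 2"
  have c: "c + c = 1" "c * c = \<nu>"
  proof -
    show "c + c = 1" using t by (simp add: c_def mult_2[symmetric] right_inverse)
    have "4 * (c * c) = 1" using \<open>c + c = 1\<close> by (metis (no_types, opaque_lifting) distrib_left distrib_right mult_1 mult_2 mult_numeral_left_semiring_numeral num_double numeral_Bit0)
    moreover have "(4::'a) \<noteq> 0" using * by auto
    ultimately show "c * c = \<nu>" using * by (metis mult_1_right mult_left_cancel)
  qed
  have "[:\<nu>, 1, 1:] = [:c, 1:] * [:c, 1:]" by (simp add: c)
  from irreducibleD[OF assms this] show False by (auto simp: is_unit_pCons_iff)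
qed

lemma b_mat_entry:
  assumes "b3 \<in> carrier_mat 3 3" "p > 0"
  shows "b_mat \<nu>' b3 (Suc (2 * p)) = mat (Suc (2 * p)) (Suc (2 * p)) (\<lambda>(i, j).
    if i < p - 1 then (if i = j then \<nu>' else 0)
    else if i < p + 2 then (if p - 1 \<le> j \<and> j < p + 2 then b3 $$ (i - (p - 1), j - (p - 1)) else 0)
    else if i = j then 1 else (0 :: 'a::field))"
proof -
  have l: "Suc (2 * p) div 2 - 1 = p - 1" by simp
  have c: "\<nu>' \<cdot>\<^sub>m 1\<^sub>m (p - 1) \<in> carrier_mat (p - 1) (p - 1)" by simp
  have d: "p - 1 + 3 + (p - 1) = Suc (2 * p)" "p - 1 + 3 = p + 2" using assms(2) by auto
  show ?thesis unfolding b_mat_def l diag_block_mat3[OF c assms(1) one_carrier_mat] d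
    using assms(2) by (intro cong_mat) auto
qed

text \<open>Enlarging \<open>b_mat\<close> by one step borders it with the diagonal entries
  \<open>\<nu>'\<close> and \<open>1\<close>. It resembles a Levi element whose corner entries need
  not be inverse to each other.\<close>

lemma b_mat_border:
  fixes b3 :: "'a::field mat"
  assumes b3: "b3 \<in> carrier_mat 3 3" and k: "odd k" "k \<ge> 3"
  shows "b_mat \<nu>' b3 (S2 k) \<in> carrier_mat (S2 k) (S2 k)" "par (S2 k) (b_mat \<nu>' b3 (S2 k))" "mid (b_mat \<nu>' b3 (S2 k)) = b_mat \<nu>' b3 k"
    "b_mat \<nu>' b3 (S2 k) $$ (0, 0) = \<nu>'" "b_mat \<nu>' b3 (S2 k) $$ (Suc k, Suc k) = 1"
    "i < k \<Longrightarrow> b_mat \<nu>' b3 (S2 k) $$ (Suc i, Suc k) = 0"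
proof -
  obtain p where p: "k = Suc (2 * p)" using k by (auto elim: oddE)
  have p0: "p > 0" using p k(2) by simp
  have s: "(S2 k) = Suc (2 * Suc p)" using p by simp
  note e = b_mat_entry[OF b3 zero_less_Suc[of p], of \<nu>', folded s]
  note e' = b_mat_entry[OF b3 p0, of \<nu>', folded p]
  show "b_mat \<nu>' b3 (S2 k) \<in> carrier_mat (S2 k) (S2 k)" unfolding e by simp
  show "par (S2 k) (b_mat \<nu>' b3 (S2 k))" unfolding par_def e using p p0 by auto
  show "b_mat \<nu>' b3 (S2 k) $$ (0, 0) = \<nu>'" "b_mat \<nu>' b3 (S2 k) $$ (Suc k, Suc k) = 1"
    "i < k \<Longrightarrow> b_mat \<nu>' b3 (S2 k) $$ (Suc i, Suc k) = 0" unfolding e using p p0 by auto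
  show "mid (b_mat \<nu>' b3 (S2 k)) = b_mat \<nu>' b3 k"
  proof (rule eq_matI)
    show "dim_row (mid (b_mat \<nu>' b3 (S2 k))) = dim_row (b_mat \<nu>' b3 k)" "dim_col (mid (b_mat \<nu>' b3 (S2 k))) = dim_col (b_mat \<nu>' b3 k)"
      unfolding e e' by (simp_all add: mid_def)
    fix i j assume "i < dim_row (b_mat \<nu>' b3 k)" "j < dim_col (b_mat \<nu>' b3 k)"
    then have ij: "i < k" "j < k" unfolding e' by auto
    have "mid (b_mat \<nu>' b3 (S2 k)) $$ (i, j) = b_mat \<nu>' b3 (S2 k) $$ (Suc i, Suc j)" using ij unfolding mid_def e by simp
    also have "\<dots> = b_mat \<nu>' b3 k $$ (i, j)"
    proof -
      obtain q where q: "p = Suc q" using p0 gr0_conv_Suc by blast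
      show ?thesis unfolding e e' q using ij by simp
    qed
    finally show "mid (b_mat \<nu>' b3 (S2 k)) $$ (i, j) = b_mat \<nu>' b3 k $$ (i, j)" .
  qed
qed

text \<open>Induction on the size through the bordering; in size \<open>3\<close> the matrix is
  \<open>b3\<close> itself.\<close>

lemma b_mat_GL:
  fixes b3 :: "'a::field mat"
  assumes b3: "b3 \<in> carrier (GL 3)" and \<nu>': "\<nu>' \<noteq> 0" and k: "odd k" "k \<ge> 3"
  shows "b_mat \<nu>' b3 k \<in> carrier (GL k)"
proof -
  have c3: "b3 \<in> carrier_mat 3 3" "det b3 \<noteq> 0" using b3 by (auto simp: GL_carrier)
  have "b_mat \<nu>' b3 (Suc (2 * Suc q)) \<in> carrier (GL (Suc (2 * Suc q)))" for q
  proof (induction q)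
    case 0
    have "b_mat \<nu>' b3 (Suc (2 * Suc 0)) = b3"
      unfolding b_mat_entry[OF c3(1) zero_less_Suc] using c3(1) by (intro eq_matI) (auto simp: numeral_3_eq_3)
    then show ?case using b3 by (simp add: numeral_3_eq_3)
  next
    case (Suc q)
    let ?k = "Suc (2 * Suc q)"
    have "odd ?k" "?k \<ge> 3" by auto
    note b = b_mat_border[OF c3(1) this, where \<nu>' = \<nu>']
    have "det (b_mat \<nu>' b3 (Suc (Suc ?k))) \<noteq> 0"
      using det_par[OF b(2)] Suc.IH \<nu>' unfolding b(3-5) by (simp add: GL_carrier)
    then show ?case using b(1) by (simp add: GL_carrier)
  qed
  moreover obtain q where "k = Suc (2 * Suc q)"
  proof -
    obtain p where "k = Suc (2 * p)" using k by (auto elim: oddE)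
    moreover have "p = Suc (p - 1)" using calculation k(2) by simp
    ultimately show ?thesis using that[of "p - 1"] by metis
  qed
  ultimately show ?thesis by simp
qed

section \<open>The groups \<open>L_minus\<close> and \<open>P_minus\<close>\<close>

context
  fixes \<nu> \<nu>' :: "'a::field" and b3 :: "'a mat" and k :: nat
  assumes irr: "irreducible [:\<nu>, 1, 1:]" and nu': "\<nu>' \<noteq> 0" and b3: "b3 \<in> carrier (GL 3)"
    and b_mat: "\<forall>l\<ge>1. \<forall>v\<in>carrier_vec (2 * l + 1).
      Q_odd' \<nu> (b_mat \<nu>' b3 (2 * l + 1) *\<^sub>v v) = \<nu>' * Q_odd v"
    and k: "odd k" "k \<ge> 3"
begin

text \<open>\<open>b_mat\<close> carries \<open>Q_odd\<close> to \<open>Q_odd'\<close> up to the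
  scalar \<open>\<nu>'\<close>, which cancels from the isometry condition. After conjugation the
  claim is \<open>cross_iff\<close> for \<open>Q_odd'\<close>, that is, for the parameters
  \<open>1\<close>, \<open>\<nu>\<close>.\<close>

lemma L_minus_eq: "L_minus \<nu> \<nu>' b3 (S2 k) = inertia (S2 k) (\<lambda>v. cf (b_mat \<nu>' b3 k *\<^sub>v v) 0)"
proof -
  obtain p where p: "k = Suc (2 * p)" using k by (auto elim: oddE)
  have p0: "p > 0" using p k(2) by simp
  define b where "b = b_mat \<nu>' b3 k"
  define c where "c = inv\<^bsub>GL k\<^esub> b"
  have bG: "b \<in> carrier (GL k)" unfolding b_def by (rule b_mat_GL[OF b3 nu' k])
  have bc: "b \<in> carrier_mat k k" using bG by (simp add: GL_carrier)
  note c = GL_inv[OF bG, folded c_def]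
  have H: "Q_odd' \<nu> (b *\<^sub>v v) = \<nu>' * Q_odd v" if "v \<in> carrier_vec k" for v
    using b_mat[rule_format, of p v] p0 that p by (simp add: b_def)
  have nd: "0 < p \<Longrightarrow> 4 * 1 * \<nu> \<noteq> 1" "p = 0 \<Longrightarrow> (1 :: 'a) = 0 \<and> \<nu> = 0"
    using irreducible_disc[OF irr] p0 by auto
  have GO: "GO_minus \<nu> (k - 1) = isometries (2 * p) (R_form 1 \<nu>)"
    using isometries_cong[OF Q_minus_R_form[OF _ p0]] p by (simp add: GO_minus_def)
  have iff: "(\<exists>g\<in>isometries (2 * p) (R_form 1 \<nu>). a = det g \<and> y = cross g a) \<longleftrightarrow>
      det y = 1 \<and> (\<forall>v\<in>carrier_vec k. Q_odd' \<nu> (y *\<^sub>v v) = Q_odd' \<nu> v) \<and> (\<forall>v\<in>carrier_vec k. a * (y *\<^sub>v v) $ p = v $ p)"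
    if "y \<in> carrier_mat k k" "a \<noteq> 0" for y a
    using that unfolding p by (intro cross_iff nd Q_odd'_rmv p0)
  have key: "(\<exists>g\<in>GO_minus \<nu> (k - 1). a = det g \<and> b * x * c = cross g a) \<longleftrightarrow>
      x \<in> SO k \<and> (\<forall>v\<in>carrier_vec k. a * cf (b *\<^sub>v (x *\<^sub>v v)) 0 = cf (b *\<^sub>v v) 0)"
    if x: "x \<in> carrier_mat k k" and a: "a \<noteq> 0" for x a
  proof -
    let ?y = "b * x * c"
    have y: "?y \<in> carrier_mat k k" using bc x c(1) by simp
    have "det c * det b = 1" using c(3) det_mult[OF c(1) bc] by simp
    then have dety: "det ?y = det x"
      using det_mult[OF mult_carrier_mat[OF bc x] c(1)] det_mult[OF bc x] by (simp add: algebra_simps)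
    have yb: "?y *\<^sub>v (b *\<^sub>v v) = b *\<^sub>v (x *\<^sub>v v)" if v: "v \<in> carrier_vec k" for v
    proof -
      have "?y *\<^sub>v (b *\<^sub>v v) = (?y * b) *\<^sub>v v" by (rule assoc_mult_mat_vec[OF y bc v, symmetric])
      also have "?y * b = (b * x) * (c * b)" by (rule assoc_mult_mat[OF mult_carrier_mat[OF bc x] c(1) bc])
      also have "\<dots> = b * x" using bc x unfolding c(3) by simp
      also have "(b * x) *\<^sub>v v = b *\<^sub>v (x *\<^sub>v v)" by (rule assoc_mult_mat_vec[OF bc x v])
      finally show ?thesis .
    qed
    \<comment> \<open>\<open>b\<close> is bijective on vectors, so the conditions on
      \<open>?y\<close> may be tested on images under \<open>b\<close>, where they become conditions
      on \<open>x\<close>.\<close>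
    have sur: "(\<forall>v\<in>carrier_vec k. R v) \<longleftrightarrow> (\<forall>v\<in>carrier_vec k. R (b *\<^sub>v v))" for R
    proof
      assume R: "\<forall>v\<in>carrier_vec k. R (b *\<^sub>v v)"
      show "\<forall>v\<in>carrier_vec k. R v"
      proof
        fix v :: "'a vec" assume v: "v \<in> carrier_vec k"
        have "b *\<^sub>v (c *\<^sub>v v) = v" using assoc_mult_mat_vec[OF bc c(1) v] v unfolding c(2) by simp
        then show "R v" using R mult_mat_vec_carrier[OF c(1) v] by metis
      qed
    qed (use bc in auto)
    have xv: "x *\<^sub>v v \<in> carrier_vec k" if "v \<in> carrier_vec k" for v using x that by (rule mult_mat_vec_carrier)
    have bv: "b *\<^sub>v v \<in> carrier_vec (Suc (2 * p))" if "v \<in> carrier_vec k" for v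
      using mult_mat_vec_carrier[OF bc that] p by simp
    have Qb: "Q_odd' \<nu> (b *\<^sub>v (x *\<^sub>v v)) = Q_odd' \<nu> (b *\<^sub>v v) \<longleftrightarrow> Q_odd (x *\<^sub>v v) = Q_odd v" if "v \<in> carrier_vec k" for v
      using H[OF that] H[OF xv[OF that]] nu' by simp
    show ?thesis
      unfolding GO iff[OF y a] dety SO_iff
      unfolding sur[of "\<lambda>v. Q_odd' \<nu> (?y *\<^sub>v v) = Q_odd' \<nu> v"] sur[of "\<lambda>v. a * (?y *\<^sub>v v) $ p = v $ p"]
      using x by (simp add: yb Qb cf_mid[OF bv] cf_mid[OF bv[OF xv]] cong: ball_cong del: index_mult_mat_vec)
  qed
  have bk: "b_mat \<nu>' b3 ((S2 k) - 2) = b" "inv\<^bsub>GL ((S2 k) - 2)\<^esub> b = c" "(S2 k) - 3 = k - 1" by (simp_all add: b_def c_def)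
  show ?thesis unfolding L_minus_def Let_def bk
  proof (intro equalityI subsetI)
    fix d :: "'a mat" assume "d \<in> {s_mat (c * cross g a * b) a |g a. g \<in> GO_minus \<nu> (k - 1) \<and> a = det g}"
    then obtain g where g: "g \<in> GO_minus \<nu> (k - 1)" "d = s_mat (c * cross g (det g) * b) (det g)" by blast
    have gc: "g \<in> carrier_mat (2 * p) (2 * p)" "det g \<noteq> 0" using g(1) unfolding GO by (auto simp: isometries_def GL_carrier)
    have y: "cross g (det g) \<in> carrier_mat k k" using cross_simps(1)[OF nd gc(1), of "det g"] by (simp add: p)
    have x: "c * cross g (det g) * b \<in> carrier_mat k k" using y c(1) bc by simp
    have "b * (c * cross g (det g) * b) * c = cross g (det g)" by (rule conj_cancel[OF c(1) bc c(2) y])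
    then have "c * cross g (det g) * b \<in> SO k \<and> (\<forall>v\<in>carrier_vec k. det g * cf (b *\<^sub>v (c * cross g (det g) * b *\<^sub>v v)) 0 = cf (b *\<^sub>v v) 0)"
      using key[OF x gc(2)] g(1) by blast
    then show "d \<in> inertia (S2 k) (\<lambda>v. cf (b_mat \<nu>' b3 k *\<^sub>v v) 0)" unfolding g(2) b_def[symmetric]
      using gc(2) by (intro inertia_I) blast+
  next
    fix d :: "'a mat" assume "d \<in> inertia (S2 k) (\<lambda>v. cf (b_mat \<nu>' b3 k *\<^sub>v v) 0)"
    note d = inertiaD[OF k(1) this, folded b_def]
    have x: "mid d \<in> carrier_mat k k" using d(2) by (simp add: SO_iff)
    obtain g where g: "g \<in> GO_minus \<nu> (k - 1)" "d $$ (0, 0) = det g" "b * mid d * c = cross g (d $$ (0, 0))"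
      using key[OF x d(3)] d(2,4) by blast
    have "c * cross g (d $$ (0, 0)) * b = mid d" unfolding g(3)[symmetric] by (rule conj_cancel[OF bc c(1) c(3) x])
    then have "d = s_mat (c * cross g (d $$ (0, 0)) * b) (d $$ (0, 0))" using d(1) by simp
    then show "d \<in> {s_mat (c * cross g a * b) a |g a. g \<in> GO_minus \<nu> (k - 1) \<and> a = det g}"
      using g(1,2) by blast
  qed
qed

lemma linear_b: "linear_on k (\<lambda>v. cf (b_mat \<nu>' b3 k *\<^sub>v v) 0)"
proof -
  have bc: "b_mat \<nu>' b3 k \<in> carrier_mat k k" using b_mat_GL[OF b3 nu' k] by (simp add: GL_carrier)
  show ?thesis unfolding linear_on_def
  proof (intro conjI ballI allI)
    fix u v :: "'a vec" assume u: "u \<in> carrier_vec k" and v: "v \<in> carrier_vec k"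
    note uv = mult_mat_vec_carrier[OF bc u] mult_mat_vec_carrier[OF bc v]
    show "cf (b_mat \<nu>' b3 k *\<^sub>v (u + v)) 0 = cf (b_mat \<nu>' b3 k *\<^sub>v u) 0 + cf (b_mat \<nu>' b3 k *\<^sub>v v) 0"
      unfolding mult_add_distrib_mat_vec[OF bc u v] using carrier_vecD[OF uv(1)] carrier_vecD[OF uv(2)] k(2) by (simp add: cf_def del: index_mult_mat_vec dim_mult_mat_vec)
  next
    fix c and v :: "'a vec" assume v: "v \<in> carrier_vec k"
    show "cf (b_mat \<nu>' b3 k *\<^sub>v (c \<cdot>\<^sub>v v)) 0 = c * cf (b_mat \<nu>' b3 k *\<^sub>v v) 0"
      unfolding mult_mat_vec[OF bc v] using carrier_vecD[OF mult_mat_vec_carrier[OF bc v]] k(2) by (simp add: cf_def del: index_mult_mat_vec dim_mult_mat_vec)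
  qed
qed

text \<open>The middle coordinate after applying \<open>b_mat\<close> does not involve the outermost
  coordinates. The functionals of consecutive sizes are therefore related by \<open>midv\<close>,
  exactly as for Type \<open>+\<close>.\<close>

lemma cf_b_border:
  assumes v: "v \<in> carrier_vec (S2 k)"
  shows "cf (b_mat \<nu>' b3 (S2 k) *\<^sub>v v) 0 = cf (b_mat \<nu>' b3 k *\<^sub>v midv v) 0"
proof -
  have "b3 \<in> carrier_mat 3 3" using b3 by (simp add: GL_carrier)
  note b = b_mat_border[OF this k, where \<nu>' = \<nu>']
  have bc: "b_mat \<nu>' b3 k \<in> carrier_mat k k" using b_mat_GL[OF b3 nu' k] by (simp add: GL_carrier)
  have w: "b_mat \<nu>' b3 (S2 k) *\<^sub>v v \<in> carrier_vec (S2 k)" by (rule mult_mat_vec_carrier[OF b(1) v])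
  have "vec k (\<lambda>i. v $ Suc k * b_mat \<nu>' b3 (S2 k) $$ (Suc i, Suc k)) = 0\<^sub>v k" using b(6) by (intro eq_vecI) auto
  then have "midv (b_mat \<nu>' b3 (S2 k) *\<^sub>v v) = b_mat \<nu>' b3 k *\<^sub>v midv v"
    using par_mult_vec(3)[OF b(2) v] mult_mat_vec_carrier[OF bc midv_carrier[OF v]] unfolding b(3) by simp
  moreover have "cf (midv (b_mat \<nu>' b3 (S2 k) *\<^sub>v v)) 0 = cf (b_mat \<nu>' b3 (S2 k) *\<^sub>v v) 0"
    using carrier_vecD[OF w] k(2) by (simp add: cf_def del: index_mult_mat_vec dim_mult_mat_vec)
  ultimately show ?thesis by simp
qed

end

context
  fixes \<nu> \<nu>' :: "'a::field" and b3 :: "'a mat" and k :: nat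
  assumes irr: "irreducible [:\<nu>, 1, 1:]" and nu': "\<nu>' \<noteq> 0" and b3: "b3 \<in> carrier (GL 3)"
    and b_mat: "\<forall>l\<ge>1. \<forall>v\<in>carrier_vec (2 * l + 1).
      Q_odd' \<nu> (b_mat \<nu>' b3 (2 * l + 1) *\<^sub>v v) = \<nu>' * Q_odd v"
    and k: "odd k" "k \<ge> 3"
begin

text \<open>Both \<open>b_mat\<close> and its inverse are block upper triangular. The shape required
  in \<open>P_minus\<close>, which is stated for a conjugate by \<open>b_mat\<close>, can therefore
  be tested on the matrix itself.\<close>

lemma b_conj_parabolic:
  fixes x :: "'a mat"
  assumes x: "x \<in> carrier_mat (S2 k) (S2 k)" and y: "y = b_mat \<nu>' b3 (S2 k) * x * inv\<^bsub>GL (S2 k)\<^esub> (b_mat \<nu>' b3 (S2 k))"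
  shows "(\<forall>i. 0 < i \<longrightarrow> i < (S2 k) \<longrightarrow> y $$ (i, 0) = 0) \<longleftrightarrow> (\<forall>i. 0 < i \<longrightarrow> i < (S2 k) \<longrightarrow> x $$ (i, 0) = 0)"
    and "par (S2 k) x \<Longrightarrow> par (S2 k) y" and "par (S2 k) x \<Longrightarrow> y $$ (0, 0) = x $$ (0, 0)"
    and "par (S2 k) x \<Longrightarrow> y $$ (Suc k, Suc k) = x $$ (Suc k, Suc k)"
    and "par (S2 k) x \<Longrightarrow> mid y = b_mat \<nu>' b3 k * mid x * inv\<^bsub>GL k\<^esub> (b_mat \<nu>' b3 k)"
proof -
  define B where "B = b_mat \<nu>' b3 (S2 k)"
  define C where "C = inv\<^bsub>GL (S2 k)\<^esub> B"
  have BG: "B \<in> carrier (GL (S2 k))" unfolding B_def using k by (intro b_mat_GL[OF b3 nu']) auto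
  have b3c: "b3 \<in> carrier_mat 3 3" using b3 by (simp add: GL_carrier)
  note b = b_mat_border[OF b3c k, where \<nu>' = \<nu>', folded B_def]
  note C = GL_inv[OF BG, folded C_def]
  have pC: "par (S2 k) C" by (rule par_inverse[OF b(2) C])
  have y': "y = B * x * C" unfolding y B_def C_def ..
  have yc: "y \<in> carrier_mat (S2 k) (S2 k)" unfolding y' using b(1) x C(1) by simp
  have x': "x = C * y * B" unfolding y' by (rule conj_cancel[OF b(1) C(1,3) x, symmetric])
  show "(\<forall>i. 0 < i \<longrightarrow> i < (S2 k) \<longrightarrow> y $$ (i, 0) = 0) \<longleftrightarrow> (\<forall>i. 0 < i \<longrightarrow> i < (S2 k) \<longrightarrow> x $$ (i, 0) = 0)"
  proof (intro iffI allI impI)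
    fix i assume y0: "\<forall>i. 0 < i \<longrightarrow> i < (S2 k) \<longrightarrow> y $$ (i, 0) = 0" and i: "0 < i" "i < (S2 k)"
    show "x $$ (i, 0) = 0" unfolding x'
      by (rule first_col_mult[OF mult_carrier_mat[OF C(1) yc] b(1) first_col_mult[OF C(1) yc] _ i])
        (use y0 pC b(2) in \<open>auto simp: par_def\<close>)
  next
    fix i assume x0: "\<forall>i. 0 < i \<longrightarrow> i < (S2 k) \<longrightarrow> x $$ (i, 0) = 0" and i: "0 < i" "i < (S2 k)"
    show "y $$ (i, 0) = 0" unfolding y'
      by (rule first_col_mult[OF mult_carrier_mat[OF b(1) x] C(1) first_col_mult[OF b(1) x] _ i])
        (use x0 pC b(2) in \<open>auto simp: par_def\<close>)
  qed
  assume px: "par (S2 k) x"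
  note Bx = par_mult[OF b(2) px] and BC = par_mult[OF b(2) pC, unfolded C(2)]
  note BxC = par_mult[OF Bx(1) pC]
  show "par (S2 k) y" unfolding y' by (rule BxC(1))
  have 1: "B $$ (0, 0) * C $$ (0, 0) = 1" "B $$ (Suc k, Suc k) * C $$ (Suc k, Suc k) = 1" using BC(2,3) by simp_all
  show "y $$ (0, 0) = x $$ (0, 0)" "y $$ (Suc k, Suc k) = x $$ (Suc k, Suc k)"
    unfolding y' BxC(2,3) Bx(2,3) using 1 by (metis mult.assoc mult.commute mult_1_right)+
  have "b_mat \<nu>' b3 k * mid C = 1\<^sub>m k" using BC(4) unfolding b(3) mid_one by simp
  then have "inv\<^bsub>GL k\<^esub> (b_mat \<nu>' b3 k) = mid C"
    by (rule GL_inv_unique[OF b_mat_GL[OF b3 nu' k] mid_carrier[OF C(1)]])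
  then show "mid y = b_mat \<nu>' b3 k * mid x * inv\<^bsub>GL k\<^esub> (b_mat \<nu>' b3 k)"
    unfolding y' BxC(4) Bx(4) b(3) by simp
qed

lemma inertia_border_b:
  assumes "c \<in> inertia (S4 k) (\<lambda>v. cf (b_mat \<nu>' b3 (S2 k) *\<^sub>v v) 0)"
  shows "c \<in> inertia (S4 k) (\<lambda>v. cf (b_mat \<nu>' b3 k *\<^sub>v midv v) 0)"
proof -
  have "mid c \<in> carrier_mat (S2 k) (S2 k)" using inertiaD(2)[OF odd2[OF k(1)] assms] by (simp add: SO_iff)
  then have "mid c *\<^sub>v v \<in> carrier_vec (S2 k)" if "v \<in> carrier_vec (S2 k)" for v using that by (rule mult_mat_vec_carrier)
  then show ?thesis using assms cf_b_border[OF irr nu' b3 b_mat k] by (simp add: inertia_def)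
qed

lemma L_minus_eq2: "L_minus \<nu> \<nu>' b3 (S4 k) = inertia (S4 k) (\<lambda>v. cf (b_mat \<nu>' b3 (S2 k) *\<^sub>v v) 0)"
  by (rule L_minus_eq[OF irr nu' b3 b_mat odd2[OF k(1)]]) (use k in simp)

lemma core_L_minus:
  assumes c: "c \<in> L_minus \<nu> \<nu>' b3 (S4 k)" "mid c \<in> P_grp (S2 k)"
  shows "core c \<in> L_minus \<nu> \<nu>' b3 (S2 k)"
proof -
  note I = c(1)[unfolded L_minus_eq2]
  have "c \<in> L_grp (S4 k)" using I by (simp add: inertia_def)
  then show ?thesis using inertia_border[OF k(1) linear_b[OF irr nu' b3 b_mat k] _ c(2)] inertia_border_b[OF I]
    unfolding L_minus_eq[OF irr nu' b3 b_mat k] by blast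
qed

lemma parabolic_shape_minus_iff:
  assumes c: "c \<in> L_minus \<nu> \<nu>' b3 (S4 k)"
  shows "b_mat \<nu>' b3 (S2 k) * mid c * inv\<^bsub>GL (S2 k)\<^esub> (b_mat \<nu>' b3 (S2 k)) \<in> parabolic_shape (S2 k) (GO_minus \<nu> (k - 1)) (c $$ (0, 0))
    \<longleftrightarrow> mid c \<in> P_grp (S2 k)" (is "?y \<in> _ \<longleftrightarrow> _")
proof -
  define B where "B = b_mat \<nu>' b3 (S2 k)"
  define C where "C = inv\<^bsub>GL (S2 k)\<^esub> B"
  have BG: "B \<in> carrier (GL (S2 k))" unfolding B_def using k by (intro b_mat_GL[OF b3 nu']) auto
  then have Bc: "B \<in> carrier_mat (S2 k) (S2 k)" by (simp add: GL_carrier)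
  note C = GL_inv[OF BG, folded C_def]
  have bk: "b_mat \<nu>' b3 ((S4 k) - 2) = B" "inv\<^bsub>GL ((S4 k) - 2)\<^esub> B = C" "(S4 k) - 3 = k + 1" by (simp_all add: B_def C_def)
  obtain g' where g': "g' \<in> GO_minus \<nu> (k + 1)" "c = s_mat (C * cross g' (det g') * B) (det g')"
    using c unfolding L_minus_def Let_def bk by blast
  have gc: "g' \<in> carrier_mat (k + 1) (k + 1)" using g'(1) by (auto simp: GO_minus_def isometries_def GL_carrier)
  have crc: "cross g' (det g') \<in> carrier_mat (S2 k) (S2 k)"
    using gc k by (auto simp: cross_def Let_def elim!: oddE)
  have CB: "C * cross g' (det g') * B \<in> carrier_mat (S2 k) (S2 k)" using C(1) crc Bc by simp
  have c0: "c $$ (0, 0) = det g'" "mid c = C * cross g' (det g') * B"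
    unfolding g'(2) by (rule s_mat_simps[OF CB])+
  have y: "?y = cross g' (c $$ (0, 0))" unfolding c0 B_def[symmetric] C_def[symmetric]
    by (rule conj_cancel[OF C(1) Bc C(2) crc])
  note cD = inertiaD[OF odd2[OF k(1)] c[unfolded L_minus_eq2]]
  have mc: "mid c \<in> carrier_mat (S2 k) (S2 k)" using cD(2) by (simp add: SO_iff)
  note conj = b_conj_parabolic[OF mc refl]
  have iffP: "mid c \<in> P_grp (S2 k) \<longleftrightarrow> (\<forall>i. 0 < i \<longrightarrow> i < (S2 k) \<longrightarrow> ?y $$ (i, 0) = 0)"
    unfolding conj(1) using cD(2) P_grp_iff[of "(S2 k)" "mid c"] by simp
  have yc: "?y \<in> carrier_mat (S2 k) (S2 k)" unfolding y c0(1) by (rule crc)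
  show ?thesis unfolding iffP
  proof (rule parabolic_shape_iff[OF k yc y gc cD(3)])
    assume "\<forall>i. 0 < i \<longrightarrow> i < (S2 k) \<longrightarrow> ?y $$ (i, 0) = 0"
    then have mP: "mid c \<in> P_grp (S2 k)" using iffP by simp
    note pP = P_par[OF k(1) mP]
    define b where "b = b_mat \<nu>' b3 k"
    define d where "d = inv\<^bsub>GL k\<^esub> b"
    have bG: "b \<in> carrier (GL k)" unfolding b_def by (rule b_mat_GL[OF b3 nu' k])
    then have bc: "b \<in> carrier_mat k k" by (simp add: GL_carrier)
    note d = GL_inv[OF bG, folded d_def]
    have bk: "b_mat \<nu>' b3 ((S2 k) - 2) = b" "inv\<^bsub>GL ((S2 k) - 2)\<^esub> b = d" "(S2 k) - 3 = k - 1" by (simp_all add: b_def d_def)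
    obtain g where g: "g \<in> GO_minus \<nu> (k - 1)" "core c = s_mat (d * cross g (det g) * b) (det g)"
      using core_L_minus[OF c mP] unfolding L_minus_def Let_def bk by blast
    have "g \<in> carrier_mat (k - 1) (k - 1)" using g(1) by (auto simp: GO_minus_def isometries_def GL_carrier)
    then have crk: "cross g (det g) \<in> carrier_mat k k" using k by (auto simp: cross_def Let_def elim!: oddE)
    have db: "d * cross g (det g) * b \<in> carrier_mat k k" using d(1) crk bc by simp
    have e: "c $$ (0, 0) = det g" "mid (mid c) = d * cross g (det g) * b"
      using core_simps[OF k(1) mP] s_mat_simps(2,4)[OF db, of "det g"] unfolding g(2) by simp_all
    have "mid ?y = cross g (c $$ (0, 0))"
      unfolding conj(5)[OF pP(1)] e b_def[symmetric] d_def[symmetric] by (rule conj_cancel[OF d(1) bc d(2) crk])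
    then show "par (S2 k) ?y \<and> ?y $$ (0, 0) \<noteq> 0 \<and> ?y $$ (Suc k, Suc k) = inverse (?y $$ (0, 0))
      \<and> (\<exists>g\<in>GO_minus \<nu> (k - 1). c $$ (0, 0) = det g \<and> mid ?y = cross g (c $$ (0, 0)))"
      unfolding conj(3,4)[OF pP(1)] using conj(2)[OF pP(1)] pP(2,3) g(1) e(1) by blast
  qed
qed

lemma P_minus_eq: "P_minus \<nu> \<nu>' b3 (S4 k) = {c \<in> L_minus \<nu> \<nu>' b3 (S4 k). mid c \<in> P_grp (S2 k)}"
proof -
  define B where "B = b_mat \<nu>' b3 (S2 k)"
  define C where "C = inv\<^bsub>GL (S2 k)\<^esub> B"
  have BG: "B \<in> carrier (GL (S2 k))" unfolding B_def using k by (intro b_mat_GL[OF b3 nu']) auto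
  then have Bc: "B \<in> carrier_mat (S2 k) (S2 k)" by (simp add: GL_carrier)
  note C = GL_inv[OF BG, folded C_def]
  have bk: "(S4 k) - 2 = (S2 k)" "(S4 k) - 5 = k - 1" by simp_all
  note shape = parabolic_shape_minus_iff[folded B_def, folded C_def]
  show ?thesis unfolding P_minus_def Let_def bk B_def[symmetric] C_def[symmetric]
  proof (intro equalityI subsetI)
    fix c assume "c \<in> {s_mat (C * y * B) a |y a. s_mat (C * y * B) a \<in> L_minus \<nu> \<nu>' b3 (S4 k) \<and> y \<in> parabolic_shape (S2 k) (GO_minus \<nu> (k - 1)) a}"
    then obtain y a where ya: "c = s_mat (C * y * B) a" "c \<in> L_minus \<nu> \<nu>' b3 (S4 k)" "y \<in> parabolic_shape (S2 k) (GO_minus \<nu> (k - 1)) a" by blast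
    have yc: "y \<in> carrier_mat (S2 k) (S2 k)" using ya(3) by (simp add: parabolic_shape_def)
    have "C * y * B \<in> carrier_mat (S2 k) (S2 k)" using C(1) yc Bc by simp
    note m = s_mat_simps(2,4)[OF this, of a, folded ya(1)]
    have "B * mid c * C = y" unfolding m(2) by (rule conj_cancel[OF C(1) Bc C(2) yc])
    then show "c \<in> {c \<in> L_minus \<nu> \<nu>' b3 (S4 k). mid c \<in> P_grp (S2 k)}"
      using shape[OF ya(2)] ya(2,3) m(1) by simp
  next
    fix c assume c: "c \<in> {c \<in> L_minus \<nu> \<nu>' b3 (S4 k). mid c \<in> P_grp (S2 k)}"
    then have cL: "c \<in> L_minus \<nu> \<nu>' b3 (S4 k)" by simp
    note cD = inertiaD[OF odd2[OF k(1)] cL[unfolded L_minus_eq2]]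
    have mc: "mid c \<in> carrier_mat (S2 k) (S2 k)" using cD(2) by (simp add: SO_iff)
    have "C * (B * mid c * C) * B = mid c" by (rule conj_cancel[OF Bc C(1,3) mc])
    then have e: "s_mat (C * (B * mid c * C) * B) (c $$ (0, 0)) = c" using cD(1) by simp
    have "s_mat (C * (B * mid c * C) * B) (c $$ (0, 0)) \<in> L_minus \<nu> \<nu>' b3 (S4 k)" unfolding e by (rule cL)
    moreover have "B * mid c * C \<in> parabolic_shape (S2 k) (GO_minus \<nu> (k - 1)) (c $$ (0, 0))"
      using shape[OF cL] c by simp
    moreover note e[symmetric]
    ultimately show "c \<in> {s_mat (C * y * B) a |y a. s_mat (C * y * B) a \<in> L_minus \<nu> \<nu>' b3 (S4 k) \<and> y \<in> parabolic_shape (S2 k) (GO_minus \<nu> (k - 1)) a}"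
      by blast
  qed
qed

text \<open>The conjugations in sizes \<open>n - 2\<close> and \<open>n - 4\<close> cancel on the
  central block, because the middle block of the larger \<open>b_mat\<close> is the smaller
  one.\<close>

lemma infl_P_minus_core:
  assumes c: "c \<in> P_minus \<nu> \<nu>' b3 (S4 k)"
  shows "infl_P_minus \<nu> \<nu>' b3 (S4 k) \<theta> c = \<theta> (core c)"
proof -
  have cL: "c \<in> L_minus \<nu> \<nu>' b3 (S4 k)" and mP: "mid c \<in> P_grp (S2 k)" using c unfolding P_minus_eq by auto
  note pP = P_par[OF k(1) mP] and mc = P_carrier[OF k(1) mP]
  define b where "b = b_mat \<nu>' b3 k"
  have bG: "b \<in> carrier (GL k)" unfolding b_def by (rule b_mat_GL[OF b3 nu' k])
  then have bc: "b \<in> carrier_mat k k" by (simp add: GL_carrier)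
  note d = GL_inv[OF bG]
  have k4: "(S4 k) - 2 = (S2 k)" "(S4 k) - 4 = k" by simp_all
  have "inv\<^bsub>GL k\<^esub> b * mid (b_mat \<nu>' b3 (S2 k) * mid c * inv\<^bsub>GL (S2 k)\<^esub> (b_mat \<nu>' b3 (S2 k))) * b = mid (mid c)"
    unfolding b_conj_parabolic(5)[OF mc refl pP(1)] b_def[symmetric]
    by (rule conj_cancel[OF bc d(1,3) mid_carrier[OF mc]])
  then show ?thesis unfolding infl_P_minus_def k4 Let_def using c by (simp add: b_def core_def)
qed

end

section \<open>Type 0\<close>

lemma det_diag_block_mat3:
  fixes A :: "'a::field mat"
  assumes A: "A \<in> carrier_mat a a" and B: "B \<in> carrier_mat b b" and C: "C \<in> carrier_mat c c"
  shows "det (diag_block_mat [A, B, C]) = det A * det B * det C"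
proof -
  have d: "diag_block_mat [B, C] = four_block_mat B (0\<^sub>m b c) (0\<^sub>m c b) C"
    unfolding diag_block_mat.simps(2)[of B] diag_block_mat_singleton Let_def using B C by auto
  have dc: "diag_block_mat [B, C] \<in> carrier_mat (b + c) (b + c)" unfolding d by (rule four_block_carrier_mat[OF B C])
  have "diag_block_mat [A, B, C] = four_block_mat A (0\<^sub>m a (b + c)) (0\<^sub>m (b + c) a) (diag_block_mat [B, C])"
    unfolding diag_block_mat.simps(2)[of A] Let_def by (simp only: carrier_matD[OF A] carrier_matD[OF dc])
  then have "det (diag_block_mat [A, B, C]) = det A * det (diag_block_mat [B, C])"
    using det_four_block_mat_lower_left_zero[OF A zero_carrier_mat refl dc] by simp
  also have "det (diag_block_mat [B, C]) = det B * det C"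
    unfolding d by (rule det_four_block_mat_lower_left_zero[OF B zero_carrier_mat refl C])
  finally show ?thesis by simp
qed

text \<open>The two blocks contribute the square of \<open>det J2\<close>, which is \<open>1\<close>
  in every characteristic. Membership in \<open>SO\<close> matters because \<open>r_elt\<close> is
  the image of \<open>s_elt\<close> under \<open>emb\<close>.\<close>

lemma det_s_elt: "det (s_elt (S4 k) :: 'a::field mat) = 1"
proof -
  have "J2 * J2 = (1\<^sub>m 2 :: 'a mat)"
    by (intro eq_matI) (auto simp: J2_def scalar_prod_def less_2_cases_iff numeral_2_eq_2)
  then have "det (J2 :: 'a mat) * det (J2 :: 'a mat) = 1" using det_mult[of "J2 :: 'a mat" 2 J2] by simp
  then show ?thesis
    unfolding s_elt_def det_diag_block_mat3[OF J2_entry(4) one_carrier_mat J2_entry(4)] by simp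
qed

text \<open>Reduces \<open>r_elt\<close> to \<open>s_elt\<close> one size down, so that its
  properties are transported by the homomorphism \<open>emb\<close>.\<close>

lemma r_elt_eq: "r_elt (S6 k) = emb (s_elt (S4 k) :: 'a::field mat)"
proof -
  have k: "(S6 k) - 6 = k" "(S4 k) - 4 = k" by simp_all
  have "mat 1 1 (\<lambda>_. 1) = (1\<^sub>m 1 :: 'a mat)" by (intro eq_matI) auto
  then have "emb (s_elt (S4 k) :: 'a mat) = diag_block_mat [1\<^sub>m 1, s_elt (S4 k), 1\<^sub>m 1]"
    by (simp add: emb_def s_mat_def)
  moreover have "diag_block_mat ([J2, 1\<^sub>m k, J2] @ [1\<^sub>m 1 :: 'a mat]) = diag_block_mat [diag_block_mat [J2, 1\<^sub>m k, J2], 1\<^sub>m 1]"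
    unfolding diag_block_mat_last diag_block_mat.simps(2)[of "diag_block_mat [J2, 1\<^sub>m k, J2]"] diag_block_mat_singleton Let_def ..
  then have "diag_block_mat [J2, 1\<^sub>m k, J2, 1\<^sub>m 1 :: 'a mat] = diag_block_mat [s_elt (S4 k), 1\<^sub>m 1]"
    unfolding s_elt_def k by (simp only: append.simps)
  ultimately show ?thesis unfolding r_elt_def k diag_block_mat.simps(2)[of "1\<^sub>m 1"] by (simp only:)
qed

context
  fixes k :: nat
  assumes odd_k: "odd k"
begin

lemma emb_hom: "emb \<in> hom ((GL k)\<lparr>carrier := SO k\<rparr>) (GL (S2 k) :: 'a::field mat monoid)"
proof -
  have "emb x \<in> carrier (GL (S2 k))" if "x \<in> SO k" for x :: "'a mat"
    using emb_props(1)[OF odd_k that] subgroup.subset[OF subgroup_P[OF odd_k, where 'a = 'a]] by blast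
  moreover have "emb (x * y) = emb x * emb y" if "x \<in> SO k" "y \<in> SO k" for x y :: "'a mat"
    using s_mat_mult[OF odd_k that(1) one_neq_zero that(2) one_neq_zero] by (simp add: emb_def)
  ultimately show ?thesis by (auto simp: hom_def)
qed

lemma emb_inv:
  assumes "x \<in> SO k"
  shows "emb (inv\<^bsub>GL k\<^esub> x) = inv\<^bsub>GL (S2 k)\<^esub> (emb x :: 'a::field mat)"
proof -
  interpret group "GL k :: 'a mat monoid" by simp
  show ?thesis by (rule restricted_hom_inv[OF subgroup_SO group_GL emb_hom assms])
qed

lemma emb_conj:
  assumes x: "x \<in> SO k" and y: "(y :: 'a::field mat) \<in> SO k"
  shows "emb x \<otimes>\<^bsub>GL (S2 k)\<^esub> emb y \<otimes>\<^bsub>GL (S2 k)\<^esub> inv\<^bsub>GL (S2 k)\<^esub> (emb x) = emb (x \<otimes>\<^bsub>GL k\<^esub> y \<otimes>\<^bsub>GL k\<^esub> inv\<^bsub>GL k\<^esub> x)"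
proof -
  note S = subgroup_SO[of k, where 'a = 'a]
  note h = hom_mult[OF emb_hom[where 'a = 'a], simplified]
  show ?thesis unfolding emb_inv[OF x, symmetric]
    using h[OF x y] h[OF subgroup.m_closed[OF S x y] subgroup.m_inv_closed[OF S x]] by simp
qed

end

section \<open>P_{n-2} and its conjugate by r\<close>

context
  fixes k :: nat
  assumes odd_k: "odd k"
begin

lemma s_elt_SO: "s_elt (S4 k) \<in> (SO (S4 k) :: 'a::field mat set)"
  using s_elt_GO[OF odd_k, where 'a = 'a] det_s_elt[of k, where 'a = 'a] by (simp add: SO_def GO_def)

lemma s_elt_inv: "inv\<^bsub>GL (S4 k)\<^esub> s_elt (S4 k) = (s_elt (S4 k) :: 'a::field mat)"
  by (rule s_elt_GL(2)[OF odd_pos[OF odd_k]])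

lemma s_elt_involution:
  fixes x :: "'a::field mat"
  assumes "x \<in> carrier_mat (S4 k) (S4 k)"
  shows "s_elt (S4 k) * (s_elt (S4 k) * x * s_elt (S4 k)) * s_elt (S4 k) = x"
  by (rule conj_cancel[OF s_elt_carrier s_elt_carrier s_elt_square[OF odd_pos[OF odd_k]] assms])

text \<open>Transported by \<open>emb\<close> to the next size, this yields the intersection
  belonging to \<open>r_elt\<close> in \<open>r_conj_P_emb\<close>.\<close>

lemma K_grp_conj_iff:
  fixes x :: "'a::field mat"
  shows "x \<in> K_grp (S4 k) \<longleftrightarrow> x \<in> P_grp (S4 k) \<and> s_elt (S4 k) * x * s_elt (S4 k) \<in> P_grp (S4 k)"
proof
  assume "x \<in> K_grp (S4 k)"
  then show "x \<in> P_grp (S4 k) \<and> s_elt (S4 k) * x * s_elt (S4 k) \<in> P_grp (S4 k)"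
    using K_conj_simps(1)[OF odd_k] K_grp_D(1)[OF odd_k] by blast
next
  assume a: "x \<in> P_grp (S4 k) \<and> s_elt (S4 k) * x * s_elt (S4 k) \<in> P_grp (S4 k)"
  have xc: "x \<in> carrier_mat (S4 k) (S4 k)" using a P_carrier[OF odd2[OF odd_k]] by blast
  have "x $$ (i, Suc 0) = 0" if i: "i < (S4 k)" "i \<noteq> Suc 0" for i
  proof -
    have sw: "swap4 (S4 k) i < (S4 k)" "swap4 (S4 k) (swap4 (S4 k) i) = i" "swap4 (S4 k) i \<noteq> 0" "swap4 (S4 k) 0 = Suc 0"
      using i odd_pos[OF odd_k] by (auto simp: swap4_def)
    have "(s_elt (S4 k) * x * s_elt (S4 k)) $$ (swap4 (S4 k) i, 0) = x $$ (i, Suc 0)"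
      using s_elt_conj[OF odd_pos[OF odd_k] xc sw(1), of 0] sw by simp
    then show ?thesis using a sw by (auto simp: P_grp_iff)
  qed
  then show "x \<in> K_grp (S4 k)" using a by (auto simp: K_grp_iff[OF odd_k] P_grp_iff)
qed

lemma r_conj_emb:
  fixes y :: "'a::field mat"
  assumes "y \<in> SO (S4 k)"
  shows "r_elt (S6 k) \<otimes>\<^bsub>GL (S6 k)\<^esub> emb y \<otimes>\<^bsub>GL (S6 k)\<^esub> inv\<^bsub>GL (S6 k)\<^esub> (r_elt (S6 k)) = emb (s_elt (S4 k) * y * s_elt (S4 k))"
  unfolding r_elt_eq emb_conj[OF odd2[OF odd2[OF odd_k]] s_elt_SO assms] s_elt_inv by simp

lemma r_elt_inv: "inv\<^bsub>GL (S6 k)\<^esub> (r_elt (S6 k)) = (r_elt (S6 k) :: 'a::field mat)"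
  unfolding r_elt_eq emb_inv[OF odd2[OF odd2[OF odd_k]] s_elt_SO, symmetric] s_elt_inv ..

lemma r_conj_P_emb:
  "conj_set (GL (S6 k)) (r_elt (S6 k)) (P_emb (S6 k)) \<inter> P_emb (S6 k) = emb ` (K_grp (S4 k) :: 'a::field mat set)"
proof -
  have P: "P_emb (S6 k) = emb ` (P_grp (S4 k) :: 'a mat set)" by (simp add: P_emb_def)
  note SO = P_in_SO[OF odd2[OF odd_k], where 'a = 'a] and PC = P_carrier[OF odd2[OF odd_k], where 'a = 'a]
  have m: "mid (emb x) = x" if "x \<in> SO (S4 k)" for x :: "'a mat" by (rule emb_props(2)[OF odd2[OF odd2[OF odd_k]] that])
  show ?thesis
  proof (intro equalityI subsetI)
    fix h :: "'a mat" assume "h \<in> conj_set (GL (S6 k)) (r_elt (S6 k)) (P_emb (S6 k)) \<inter> P_emb (S6 k)"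
    then obtain y x where y: "y \<in> P_grp (S4 k)" "h = r_elt (S6 k) \<otimes>\<^bsub>GL (S6 k)\<^esub> emb y \<otimes>\<^bsub>GL (S6 k)\<^esub> inv\<^bsub>GL (S6 k)\<^esub> (r_elt (S6 k))"
      and x: "x \<in> P_grp (S4 k)" "h = emb x" unfolding conj_set_def P by blast
    have e: "emb x = emb (s_elt (S4 k) * y * s_elt (S4 k))" using x(2) y(2) unfolding r_conj_emb[OF SO[OF y(1)]] by simp
    have sy: "s_elt (S4 k) * y * s_elt (S4 k) \<in> SO (S4 k)" using s_conj_SO[OF odd_k PC[OF y(1)]] SO[OF y(1)] by simp
    have "x = s_elt (S4 k) * y * s_elt (S4 k)" using arg_cong[OF e, of mid] unfolding m[OF SO[OF x(1)]] m[OF sy] .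
    then have "s_elt (S4 k) * x * s_elt (S4 k) = y" using s_elt_involution[OF PC[OF y(1)]] by (simp only:)
    then have "x \<in> K_grp (S4 k)" unfolding K_grp_conj_iff using x(1) y(1) by (simp only: simp_thms)
    then show "h \<in> emb ` K_grp (S4 k)" using x(2) by (rule rev_image_eqI)
  next
    fix h :: "'a mat" assume "h \<in> emb ` K_grp (S4 k)"
    then obtain x where x: "h = emb x" "x \<in> P_grp (S4 k)" "s_elt (S4 k) * x * s_elt (S4 k) \<in> P_grp (S4 k)" by (auto simp: K_grp_conj_iff)
    have "h = r_elt (S6 k) \<otimes>\<^bsub>GL (S6 k)\<^esub> emb (s_elt (S4 k) * x * s_elt (S4 k)) \<otimes>\<^bsub>GL (S6 k)\<^esub> inv\<^bsub>GL (S6 k)\<^esub> (r_elt (S6 k))"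
      unfolding r_conj_emb[OF SO[OF x(3)]] s_elt_involution[OF PC[OF x(2)]] by (rule x(1))
    then show "h \<in> conj_set (GL (S6 k)) (r_elt (S6 k)) (P_emb (S6 k)) \<inter> P_emb (S6 k)"
      unfolding conj_set_def P using x by blast
  qed
qed

lemma subgroup_P_tilde: "subgroup (P_tilde (S4 k) :: 'a::field mat set) (GL (S4 k))"
proof -
  interpret group "GL (S4 k) :: 'a mat monoid" by simp
  note L = subgroup_L[OF odd2[OF odd_k], where 'a = 'a]
  note P = subgroup_P[OF odd_k, where 'a = 'a]
  note iff = P_tilde_iff[OF odd_k]
  show ?thesis
  proof (rule subgroupI)
    show "(P_tilde (S4 k) :: 'a mat set) \<subseteq> carrier (GL (S4 k))" using subgroup.subset[OF L] by (auto simp: iff)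
    have "(1\<^sub>m (S4 k) :: 'a mat) \<in> P_tilde (S4 k)"
      using subgroup.one_closed[OF L] subgroup.one_closed[OF P] by (simp add: iff mid_one)
    then show "P_tilde (S4 k) \<noteq> ({} :: 'a mat set)" by blast
    show "c \<otimes>\<^bsub>GL (S4 k)\<^esub> d \<in> P_tilde (S4 k)" if cd: "c \<in> P_tilde (S4 k)" "d \<in> P_tilde (S4 k)" for c d :: "'a mat"
    proof -
      have c: "c \<in> L_grp (S4 k)" "mid c \<in> P_grp (S2 k)" "mid c $$ (0, 0) = c $$ (0, 0)"
        and d: "d \<in> L_grp (S4 k)" "mid d \<in> P_grp (S2 k)" "mid d $$ (0, 0) = d $$ (0, 0)" using cd by (auto simp: iff)
      note m = P_mult(2,3)[OF odd2[OF odd_k] L_grpD(4)[OF odd2[OF odd_k] c(1)] L_grpD(4)[OF odd2[OF odd_k] d(1)]]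
      show ?thesis
        unfolding iff GL_simps m P_mult(2)[OF odd_k c(2) d(2)] c(3) d(3)
        using subgroup.m_closed[OF L c(1) d(1)] subgroup.m_closed[OF P c(2) d(2)] by simp
    qed
    show "inv\<^bsub>GL (S4 k)\<^esub> c \<in> P_tilde (S4 k)" if c': "c \<in> P_tilde (S4 k)" for c :: "'a mat"
    proof -
      let ?d = "inv\<^bsub>GL (S4 k)\<^esub> c"
      have c: "c \<in> L_grp (S4 k)" "mid c \<in> P_grp (S2 k)" "mid c $$ (0, 0) = c $$ (0, 0)" using c' by (auto simp: iff)
      have dL: "?d \<in> L_grp (S4 k)" by (rule subgroup.m_inv_closed[OF L c(1)])
      note m = P_mult(2,3)[OF odd2[OF odd_k] L_grpD(4)[OF odd2[OF odd_k] c(1)] L_grpD(4)[OF odd2[OF odd_k] dL]]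
      have "c * ?d = 1\<^sub>m (S4 k)" using r_inv[of c] c(1) subgroup.subset[OF L] by auto
      then have e: "mid c * mid ?d = 1\<^sub>m (S2 k)" "c $$ (0, 0) * ?d $$ (0, 0) = 1" using m mid_one[of "(S2 k)", where 'a = 'a] by auto
      have md: "mid ?d = inv\<^bsub>GL (S2 k)\<^esub> (mid c)"
        using GL_inv_unique[OF subsetD[OF subgroup.subset[OF P] c(2)] P_mid_carrier[OF odd2[OF odd_k] L_grpD(4)[OF odd2[OF odd_k] dL]] e(1)] ..
      have dP: "mid ?d \<in> P_grp (S2 k)" unfolding md by (rule subgroup.m_inv_closed[OF P c(2)])
      have "c $$ (0, 0) * mid ?d $$ (0, 0) = 1" using P_mult(2)[OF odd_k c(2) dP] unfolding e(1) c(3) by simp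
      then have "mid ?d $$ (0, 0) = ?d $$ (0, 0)" using e(2) by (metis mult_left_cancel mult_zero_left zero_neq_one)
      then show ?thesis using dL dP by (simp add: iff)
    qed
  qed
qed

lemma s_elt_vec:
  fixes v :: "'a::field vec"
  assumes v: "v \<in> carrier_vec (S4 k)"
  shows "(s_elt (S4 k) *\<^sub>v v) $ Suc (S2 k) = v $ Suc (Suc k)"
proof -
  have i: "Suc (S2 k) < (S4 k)" by simp
  have sw: "swap4 (S4 k) (Suc (S2 k)) = Suc (Suc k)" by (simp add: swap4_def)
  have "(s_elt (S4 k) *\<^sub>v v) $ Suc (S2 k) = (\<Sum>l<(S4 k). if l = Suc (Suc k) then v $ l else 0)"
    unfolding mult_mat_vec_entry[OF s_elt_carrier v i]
    by (rule sum.cong[OF refl]) (simp add: s_elt_entry[OF odd_pos[OF odd_k] i] sw)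
  also have "\<dots> = v $ Suc (Suc k)" by (subst sum.delta) auto
  finally show ?thesis .
qed

lemma P_last_coord:
  fixes x :: "'a::field mat"
  assumes x: "x \<in> P_grp (S2 k)" and v: "v \<in> carrier_vec (S2 k)"
  shows "(x *\<^sub>v v) $ Suc k = inverse (x $$ (0, 0)) * v $ Suc k"
  using par_mult_vec(2)[OF P_par(1)[OF odd_k x] v] P_par(3)[OF odd_k x] by simp

end

lemma U_char_cong:
  assumes k: "odd k" and f: "\<And>v. v \<in> carrier_vec k \<Longrightarrow> f v = f' v"
  shows "U_char (S2 k) f = U_char (S2 k) (f' :: 'a::field vec \<Rightarrow> complex)"
proof
  have inj: "inj_on (u_mat (S2 k)) (carrier_vec k :: 'a vec set)"
    by (rule inj_on_inverseI[where g = unip_vec]) (rule u_mat_simps(5)[OF k])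
  fix g :: "'a mat"
  have "the_inv_into (carrier_vec k) (u_mat (S2 k)) g \<in> carrier_vec k" if "g \<in> U_grp (S2 k)"
    using that the_inv_into_into[OF inj _ subset_refl] by (simp add: U_grp_def)
  then show "U_char (S2 k) f g = U_char (S2 k) f' g" using f by (simp add: U_char_def)
qed

section \<open>Induction of characters of Type 0\<close>

context
  fixes k :: nat
  assumes odd_k: "odd k"
begin

text \<open>The left side is \<open>ind_RQK_psi\<close> with the last coordinate as functional, the
  right side \<open>ind_U_L_ind\<close> for \<open>P_tilde\<close>. The resulting integrands
  \<open>f1\<close> and \<open>f2\<close> involve the coordinates \<open>v_{m-2}'\<close> and
  \<open>v_{m-1}'\<close> of the outer unipotent vector, which \<open>r_elt\<close>
  interchanges.\<close>

lemma ind_RQK_type_zero: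
  fixes g :: "'a::{field,finite} mat" and \<xi> :: "'a \<Rightarrow> complex"
  assumes \<xi>: "additive_char \<xi>" and g: "g \<in> P_grp (S6 k)" and \<chi>: "\<chi> = psi_zero \<xi> (S4 k) \<chi>\<^sub>0"
  shows "ind (GL (S6 k)) (RQK_grp (S6 k)) (P_grp (S6 k)) (conj_char (GL (S6 k)) (s_elt (S6 k)) (infl_RQK (S6 k) \<chi>)) g
    = psi_zero \<xi> (S6 k) (ind (GL (S6 k)) (emb ` K_grp (S4 k)) (P_emb (S6 k))
        (conj_char (GL (S6 k)) (r_elt (S6 k)) (infl_central (emb ` K_grp (S4 k)) \<chi>\<^sub>0)) \<circ> emb) g"
proof -
  interpret group "GL (S6 k) :: 'a mat monoid" by simp
  note odd4 = odd2[OF odd2[OF odd_k]] and k2 = odd2[OF odd_k]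
  note P6 = subgroup_P[OF odd4, where 'a = 'a]
  let ?q = "card (UNIV :: 'a set)" and ?s = "s_elt (S4 k) :: 'a mat" and ?r = "r_elt (S6 k) :: 'a mat"
  let ?\<phi> = "\<lambda>v :: 'a vec. v $ Suc k" and ?\<phi>' = "\<lambda>v :: 'a vec. v $ Suc (S2 k)"
  let ?H = "emb ` K_grp (S4 k) :: 'a mat set"
  define \<chi>' where "\<chi>' = conj_char (GL (S6 k)) ?r (infl_central ?H \<chi>\<^sub>0)"
  \<comment> \<open>\<open>P_tilde\<close> is a copy of \<open>P_{n-2}\<close>. Inside it,
    \<open>C0\<close> is the copy of the intersection of \<open>P_{n-2}\<close> with its conjugate
    by \<open>r_elt\<close>, and \<open>\<tau>\<close> is the copy of the twisted character.\<close>
  define C0 where "C0 = {c \<in> P_tilde (S6 k). mid c \<in> (K_grp (S4 k) :: 'a mat set)}"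
  define \<tau> where "\<tau> c = \<chi>' (emb (mid c))" for c
  define \<theta> where "\<theta> h = (if h \<in> P_tilde (S4 k) then \<chi>\<^sub>0 (mid h) else 0)" for h :: "'a mat"
  define f1 where "f1 g = (if mid g \<in> P_grp (S4 k) \<and> core g \<in> P_tilde (S4 k) \<and> ?\<phi> (unip_vec (mid g)) = 0
        then \<xi> (?\<phi> (midv (unip_vec g))) * \<theta> (core g) else 0)" for g
  define f2 where "f2 g = (if levi g \<in> C0 then \<xi> (?\<phi>' (unip_vec g)) * \<tau> (levi g) else 0)" for g
  have l4: "lam_zero \<xi> (S4 k) = U_char (S4 k) (\<lambda>v. \<xi> (?\<phi> v))" and l6: "lam_zero \<xi> (S6 k) = U_char (S6 k) (\<lambda>v. \<xi> (?\<phi>' v))"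
    using U_char_cong[OF k2, of "\<lambda>v. \<xi> (cf' v (Suc (k div 2)))" "\<lambda>v. \<xi> (?\<phi> v)"] last_coord[OF odd_k, where 'a = 'a]
      U_char_cong[OF odd4, of "\<lambda>v. \<xi> (cf' v (Suc ((S2 k) div 2)))" "\<lambda>v. \<xi> (?\<phi>' v)"] last_coord[OF k2, where 'a = 'a]
    by (simp_all add: lam_zero_def)
  have lin: "linear_on (S2 k) ?\<phi>" by (auto simp: linear_on_def)
  have z: "unit_vec (S2 k) (Suc k) \<in> carrier_vec (S2 k)" "?\<phi> (unit_vec (S2 k) (Suc k)) = 1" by simp_all
  have L: "ind (GL (S6 k)) (RQK_grp (S6 k)) (P_grp (S6 k)) (conj_char (GL (S6 k)) (s_elt (S6 k)) (infl_RQK (S6 k) \<chi>)) g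
    = cavg (GL (S6 k)) (P_grp (S6 k)) f1 g / of_nat (?q ^ ((S2 k) + Suc (S2 k)) * (?q - 1) * card (P_tilde (S4 k) :: 'a mat set))"
    unfolding f1_def
  proof (rule ind_RQK_psi[OF k2 \<xi> lin g z P_tilde_L[OF odd_k]])
    show "\<chi> = ind (GL (S4 k)) (U_grp (S4 k) <#>\<^bsub>GL (S4 k)\<^esub> P_tilde (S4 k)) (P_grp (S4 k))
     (\<lambda>g. ext_char (GL (S4 k)) (U_grp (S4 k)) (P_tilde (S4 k)) (U_char (S4 k) (\<lambda>v. \<xi> (v $ Suc k))) g * infl (GL (S4 k)) (U_grp (S4 k)) (P_tilde (S4 k)) \<theta> g)"
      unfolding \<chi> psi_zero_def I_zero_def l4 \<theta>_def ..
    fix y :: "'a mat" and a and v :: "'a vec"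
    assume y: "s_mat y a \<in> P_tilde (S4 k)" "y \<in> SO (S2 k)" "a \<noteq> 0" and v: "v \<in> carrier_vec (S2 k)"
    have yc: "y \<in> carrier_mat (S2 k) (S2 k)" using y(2) by (simp add: SO_iff)
    have yP: "y \<in> P_grp (S2 k)" "y $$ (0, 0) = a" using y(1) yc unfolding P_tilde_iff[OF odd_k] by simp_all
    show "a * (y *\<^sub>v v) $ Suc k = v $ Suc k" using P_last_coord[OF odd_k yP(1) v] y(3) unfolding yP(2) by simp
  qed
  have bij: "bij_betw mid (P_tilde (S6 k)) (P_grp (S4 k) :: 'a mat set)" by (rule bij_mid_P_tilde[OF k2])
  have KP: "(K_grp (S4 k) :: 'a mat set) \<subseteq> P_grp (S4 k)" using K_grp_D(1)[OF odd_k] by blast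
  have midC0: "mid ` C0 = K_grp (S4 k)"
  proof -
    have "mid ` C0 = mid ` P_tilde (S6 k) \<inter> K_grp (S4 k)" unfolding C0_def by blast
    then show ?thesis using bij_betw_imp_surj_on[OF bij] KP by blast
  qed
  have C0P: "C0 \<subseteq> P_tilde (S6 k)" unfolding C0_def by blast
  have SO4: "x \<in> SO (S4 k)" if "x \<in> P_grp (S4 k)" for x :: "'a mat" by (rule P_in_SO[OF k2 that])
  \<comment> \<open>\<open>\<Sigma>\<close> is induced inside \<open>P_emb\<close>. Carried back
    along \<open>emb \<circ> mid\<close>, it becomes an induction between subgroups of
    \<open>P_tilde\<close>, as \<open>ind_U_L_ind\<close> requires.\<close>
  have \<Sigma>: "(\<lambda>h. if h \<in> P_tilde (S6 k) then (ind (GL (S6 k)) ?H (P_emb (S6 k)) \<chi>' \<circ> emb) (mid h) else 0) = ind (GL (S6 k)) C0 (P_tilde (S6 k)) \<tau>"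
  proof
    fix h :: "'a mat"
    show "(if h \<in> P_tilde (S6 k) then (ind (GL (S6 k)) ?H (P_emb (S6 k)) \<chi>' \<circ> emb) (mid h) else 0) = ind (GL (S6 k)) C0 (P_tilde (S6 k)) \<tau> h"
    proof (cases "h \<in> P_tilde (S6 k)")
      case True
      let ?f = "\<lambda>c. emb (mid c) :: 'a mat"
      have "ind (GL (S6 k)) ?H (P_emb (S6 k)) \<chi>' (?f h) = ind (GL (S6 k)) C0 (P_tilde (S6 k)) (\<lambda>x. \<chi>' (?f x)) h"
      proof (rule ind_transport[OF subgroup_P_tilde[OF k2] group_GL _ _ C0P _ True])
        show "?f \<in> hom ((GL (S6 k))\<lparr>carrier := P_tilde (S6 k)\<rparr>) (GL (S6 k))"
        proof -
          have cP: "c \<in> P_grp (S6 k)" "mid c \<in> SO (S4 k)" if "c \<in> P_tilde (S6 k)" for c :: "'a mat"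
            using that SO4 L_grpD(4)[OF odd4, of c] by (auto simp: P_tilde_iff[OF k2])
          have "?f (c * d) = ?f c * ?f d" if "c \<in> P_tilde (S6 k)" "d \<in> P_tilde (S6 k)" for c d :: "'a mat"
            unfolding P_mult(3)[OF odd4 cP(1)[OF that(1)] cP(1)[OF that(2)]]
            using hom_mult[OF emb_hom[OF odd4], of "mid c" "mid d"] cP(2)[OF that(1)] cP(2)[OF that(2)] by simp
          moreover have "?f c \<in> carrier (GL (S6 k))" if "c \<in> P_tilde (S6 k)" for c :: "'a mat"
            using hom_in_carrier[OF emb_hom[OF odd4], of "mid c"] cP(2)[OF that] by simp
          ultimately show ?thesis by (auto simp: hom_def)
        qed
        have "inj_on emb (P_grp (S4 k) :: 'a mat set)"
          by (rule inj_on_inverseI[where g = mid]) (rule emb_props(2)[OF odd4 SO4])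
        then have "bij_betw emb (P_grp (S4 k)) (P_emb (S6 k) :: 'a mat set)" by (simp add: bij_betw_def P_emb_def)
        from bij_betw_trans[OF bij this] show "bij_betw ?f (P_tilde (S6 k)) (P_emb (S6 k))" by (simp add: o_def)
        show "?f ` C0 = ?H" using midC0 by (simp add: image_image[symmetric])
      qed
      then show ?thesis using True by (simp add: \<tau>_def[abs_def])
    qed (simp add: ind_def)
  qed
  have R: "psi_zero \<xi> (S6 k) (ind (GL (S6 k)) ?H (P_emb (S6 k)) \<chi>' \<circ> emb) g
    = cavg (GL (S6 k)) (P_grp (S6 k)) f2 g / of_nat (?q ^ (S4 k) * card C0)"
    unfolding psi_zero_def I_zero_def l6 \<Sigma> f2_def
  proof (rule ind_U_L_ind[OF odd4 P_tilde_L[OF k2] subgroup_P_tilde[OF k2] C0P g])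
    fix c :: "'a mat" and v :: "'a vec" assume c: "c \<in> P_tilde (S6 k)" and v: "v \<in> carrier_vec (S4 k)"
    have m: "c \<in> L_grp (S6 k)" "mid c \<in> P_grp (S4 k)" "mid c $$ (0, 0) = c $$ (0, 0)" using c by (auto simp: P_tilde_iff[OF k2])
    have mv: "mid c *\<^sub>v v \<in> carrier_vec (S4 k)" by (rule mult_mat_vec_carrier[OF P_carrier[OF k2 m(2)] v])
    have "(c $$ (0, 0) \<cdot>\<^sub>v (mid c *\<^sub>v v)) $ Suc (S2 k) = c $$ (0, 0) * (mid c *\<^sub>v v) $ Suc (S2 k)"
      using carrier_vecD[OF mv] by (intro index_smult_vec(1)) (simp del: dim_mult_mat_vec)
    also have "\<dots> = v $ Suc (S2 k)"
      using P_last_coord[OF k2 m(2) v] L_grpD(3)[OF odd4 m(1)] unfolding m(3) by simp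
    finally show "\<xi> ((c $$ (0, 0) \<cdot>\<^sub>v (mid c *\<^sub>v v)) $ Suc (S2 k)) = \<xi> (v $ Suc (S2 k))" by simp
  qed
  have rP: "?r \<in> P_grp (S6 k)" unfolding r_elt_eq by (rule emb_props(1)[OF odd4 s_elt_SO[OF odd_k]])
  have conj: "f2 (?r \<otimes>\<^bsub>GL (S6 k)\<^esub> h \<otimes>\<^bsub>GL (S6 k)\<^esub> inv\<^bsub>GL (S6 k)\<^esub> ?r) = f1 h" if h: "h \<in> P_grp (S6 k)" for h
  proof -
    define h' where "h' = ?r \<otimes>\<^bsub>GL (S6 k)\<^esub> h \<otimes>\<^bsub>GL (S6 k)\<^esub> inv\<^bsub>GL (S6 k)\<^esub> ?r"
    define x where "x = mid h"
    note hh = conj_by_emb[OF odd4 h s_elt_SO[OF odd_k], folded r_elt_eq, folded h'_def]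
    have xc: "x \<in> carrier_mat (S4 k) (S4 k)" unfolding x_def by (rule P_mid_carrier[OF odd4 h])
    have m: "mid h' = ?s * x * ?s" using hh(3) unfolding s_elt_inv[OF odd_k] GL_simps x_def .
    have uc: "unip_vec h \<in> carrier_vec (S4 k)" by (rule unip_vec_carrier[OF P_carrier[OF odd4 h]])
    have "?\<phi>' (unip_vec h') = unip_vec h $ Suc (Suc k)" unfolding hh(4) by (rule s_elt_vec[OF odd_k uc])
    also have "\<dots> = ?\<phi> (midv (unip_vec h))" using carrier_vecD[OF uc] by (simp add: midv_def)
    finally have v: "?\<phi>' (unip_vec h') = ?\<phi> (midv (unip_vec h))" .
    note lh = levi_simps[OF odd4 hh(1)]
    show ?thesis
    proof (cases "x \<in> K_grp (S4 k)")
      case False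
      then have "levi h' \<notin> C0" unfolding C0_def lh m using s_conj_K[OF odd_k xc] lh(3) m by auto
      moreover have "\<not> (x \<in> P_grp (S4 k) \<and> core h \<in> P_tilde (S4 k) \<and> ?\<phi> (unip_vec x) = 0)"
      proof
        assume a: "x \<in> P_grp (S4 k) \<and> core h \<in> P_tilde (S4 k) \<and> ?\<phi> (unip_vec x) = 0"
        then have "mid (core h) \<in> P_grp (S2 k)" by (simp add: P_tilde_iff[OF odd_k])
        then have "mid x \<in> P_grp (S2 k)" using core_simps(1)[OF k2, of h] a by (simp add: x_def)
        then show False using K_grp_I[OF odd_k, of x] a False by blast
      qed
      ultimately show ?thesis unfolding f1_def f2_def h'_def[symmetric] x_def[symmetric] by auto
    next
      \<comment> \<open>On \<open>K_grp\<close> both support conditions reduce to the same equality,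
        between the corner entries of \<open>mid x\<close> and \<open>h\<close>.\<close>
      case True
      note Kx = K_grp_D[OF odd_k True] and Ks = K_conj_simps[OF odd_k True]
      have cs: "mid (core h) = mid x" "core h $$ (0, 0) = h $$ (0, 0)"
        using core_simps[OF k2, of h] Kx(1) by (simp_all add: x_def)
      have cL: "core h \<in> L_grp (S4 k)" using core_in_L[OF k2 h] Kx(1) by (simp add: x_def)
      have c1: "core h \<in> P_tilde (S4 k) \<longleftrightarrow> mid x $$ (0, 0) = h $$ (0, 0)"
        unfolding P_tilde_iff[OF odd_k] cs using cL Kx(2) by simp
      have "levi h' \<in> C0 \<longleftrightarrow> mid (levi h') \<in> P_grp (S4 k) \<and> mid (levi h') $$ (0, 0) = levi h' $$ (0, 0) \<and> mid (levi h') \<in> K_grp (S4 k)"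
        unfolding C0_def using lh(6) by (simp add: P_tilde_iff[OF k2])
      then have c2: "levi h' \<in> C0 \<longleftrightarrow> mid x $$ (0, 0) = h $$ (0, 0)"
        unfolding lh m hh(2) Ks(3) using Ks(1) KP by blast
      have sxS: "?s * x * ?s \<in> SO (S4 k)" using Ks(1) KP SO4 by blast
      have eG: "emb (?s * x * ?s) \<in> carrier (GL (S6 k))" using hom_in_carrier[OF emb_hom[OF odd4], of "?s * x * ?s"] sxS by simp
      have "inv\<^bsub>GL (S6 k)\<^esub> ?r \<otimes>\<^bsub>GL (S6 k)\<^esub> emb (?s * x * ?s) \<otimes>\<^bsub>GL (S6 k)\<^esub> ?r = emb x"
        using r_conj_emb[OF odd_k sxS] unfolding r_elt_inv[OF odd_k] s_elt_involution[OF odd_k xc] .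
      moreover have "mid (emb x) = x" by (rule emb_props(2)[OF odd4 SO4[OF Kx(1)]])
      ultimately have "\<tau> (levi h') = \<chi>\<^sub>0 (mid x)"
        unfolding \<tau>_def lh m \<chi>'_def conj_char_def infl_central_def using eG True by (simp del: GL_simps)
      moreover have "\<theta> (core h) = \<chi>\<^sub>0 (mid x)" if "core h \<in> P_tilde (S4 k)" unfolding \<theta>_def cs using that by simp
      ultimately show ?thesis
        unfolding f1_def f2_def h'_def[symmetric] x_def[symmetric] v c2 using c1 Kx by auto
    qed
  qed
  have "cavg (GL (S6 k)) (P_grp (S6 k)) f2 g = cavg (GL (S6 k)) (P_grp (S6 k)) (\<lambda>h. f2 (?r \<otimes>\<^bsub>GL (S6 k)\<^esub> h \<otimes>\<^bsub>GL (S6 k)\<^esub> inv\<^bsub>GL (S6 k)\<^esub> ?r)) g"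
    by (rule cavg_conj[OF P6 rP g, symmetric])
  also have "\<dots> = cavg (GL (S6 k)) (P_grp (S6 k)) f1 g" by (rule cavg_cong[OF P6 g conj])
  finally have avg: "cavg (GL (S6 k)) (P_grp (S6 k)) f2 g = cavg (GL (S6 k)) (P_grp (S6 k)) f1 g" .
  have "card C0 = card (mid ` C0)"
    using card_image[OF inj_on_subset[OF bij_betw_imp_inj_on[OF bij] C0P]] ..
  then have cC0: "card C0 = ?q ^ Suc k * (?q - 1) * card (P_grp (S2 k) :: 'a mat set)" unfolding midC0 card_K[OF odd_k] .
  have cT: "card (P_tilde (S4 k) :: 'a mat set) = card (P_grp (S2 k) :: 'a mat set)" by (rule bij_betw_same_card[OF bij_mid_P_tilde[OF odd_k]])
  have cc: "?q ^ (S4 k) * card C0 = ?q ^ ((S2 k) + Suc (S2 k)) * (?q - 1) * card (P_tilde (S4 k) :: 'a mat set)"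
    unfolding cC0 cT by (simp add: power_add)
  show ?thesis unfolding L R[unfolded \<chi>'_def] avg cc ..
qed

end

section \<open>Irreducibility and the element \<open>t\<close>\<close>

lemma additive_char_Irr:
  fixes \<xi> :: "'a::field \<Rightarrow> complex"
  assumes \<xi>: "\<xi> \<in> Irr additive_group" "\<xi> \<noteq> (\<lambda>_. 1)"
  shows "additive_char \<xi>"
proof -
  have "comm_group (additive_group :: 'a monoid)"
  proof (rule comm_groupI)
    show "\<exists>y\<in>carrier additive_group. y \<otimes>\<^bsub>additive_group\<^esub> x = \<one>\<^bsub>additive_group\<^esub>" for x :: 'a
      by (rule bexI[of _ "- x"]) (simp_all add: additive_group_def)
  qed (simp_all add: additive_group_def ac_simps)
  note \<xi>' = Irr_abelian_mult[OF this \<xi>(1)]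
  have "\<xi> (x + y) = \<xi> x * \<xi> y" "\<xi> 0 = 1" for x y using \<xi>'(1)[of x y] \<xi>'(2) by (simp_all add: additive_group_def)
  then show ?thesis using \<xi>(2) by (auto simp: additive_char_def fun_eq_iff)
qed

section \<open>Characters with U_n in the kernel\<close>

context
  fixes k :: nat
  assumes odd_k: "odd k"
begin

lemma U_grp_iff:
  fixes u :: "'a::field mat"
  shows "u \<in> U_grp (S2 k) \<longleftrightarrow> u \<in> P_grp (S2 k) \<and> u $$ (0, 0) = 1 \<and> mid u = 1\<^sub>m k"
proof
  assume "u \<in> U_grp (S2 k)"
  then show "u \<in> P_grp (S2 k) \<and> u $$ (0, 0) = 1 \<and> mid u = 1\<^sub>m k"
    using u_mat_in_P[OF odd_k, where 'a = 'a] u_mat_simps(2,4)[OF odd_k, where 'a = 'a] by (auto simp: U_grp_def)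
next
  assume u: "u \<in> P_grp (S2 k) \<and> u $$ (0, 0) = 1 \<and> mid u = 1\<^sub>m k"
  then have v: "unip_vec u \<in> carrier_vec k" using P_carrier[OF odd_k] by (intro unip_vec_carrier) blast
  have "u = u_mat (S2 k) (unip_vec u)"
    using u by (intro P_eqI[OF odd_k _ u_mat_in_P[OF odd_k v]]) (simp_all add: u_mat_simps[OF odd_k v])
  then show "u \<in> U_grp (S2 k)" using v by (auto simp: U_grp_def)
qed

lemma P_inv:
  fixes x :: "'a::field mat"
  assumes x: "x \<in> P_grp (S2 k)"
  shows "inv\<^bsub>GL (S2 k)\<^esub> x \<in> P_grp (S2 k)" "(inv\<^bsub>GL (S2 k)\<^esub> x) $$ (0, 0) * x $$ (0, 0) = 1" "mid (inv\<^bsub>GL (S2 k)\<^esub> x) * mid x = 1\<^sub>m k"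
proof -
  interpret group "GL (S2 k) :: 'a mat monoid" by simp
  show i: "inv\<^bsub>GL (S2 k)\<^esub> x \<in> P_grp (S2 k)" by (rule subgroup.m_inv_closed[OF subgroup_P[OF odd_k] x])
  have "inv\<^bsub>GL (S2 k)\<^esub> x * x = 1\<^sub>m (S2 k)" using l_inv[of x] x subgroup.subset[OF subgroup_P[OF odd_k, where 'a = 'a]] by auto
  then show "(inv\<^bsub>GL (S2 k)\<^esub> x) $$ (0, 0) * x $$ (0, 0) = 1" "mid (inv\<^bsub>GL (S2 k)\<^esub> x) * mid x = 1\<^sub>m k"
    using P_mult(2,3)[OF odd_k i x] mid_one[of k, where 'a = 'a] by auto
qed

lemma subgroup_U: "subgroup (U_grp (S2 k) :: 'a::field mat set) (GL (S2 k))"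
proof -
  interpret group "GL (S2 k) :: 'a mat monoid" by simp
  note P = subgroup_P[OF odd_k, where 'a = 'a]
  show ?thesis
  proof (rule subgroupI)
    show "(U_grp (S2 k) :: 'a mat set) \<subseteq> carrier (GL (S2 k))" using subgroup.subset[OF P] by (auto simp: U_grp_iff)
    have "(1\<^sub>m (S2 k) :: 'a mat) \<in> U_grp (S2 k)" using subgroup.one_closed[OF P] by (simp add: U_grp_iff mid_one)
    then show "U_grp (S2 k) \<noteq> ({} :: 'a mat set)" by blast
    show "u \<otimes>\<^bsub>GL (S2 k)\<^esub> v \<in> U_grp (S2 k)" if "u \<in> U_grp (S2 k)" "v \<in> U_grp (S2 k)" for u v :: "'a mat"
    proof -
      have u: "u \<in> P_grp (S2 k)" "u $$ (0, 0) = 1" "mid u = 1\<^sub>m k" and v: "v \<in> P_grp (S2 k)" "v $$ (0, 0) = 1" "mid v = 1\<^sub>m k"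
        using that by (auto simp: U_grp_iff)
      show ?thesis unfolding U_grp_iff GL_simps P_mult(2,3)[OF odd_k u(1) v(1)] u v using P_mult(1)[OF odd_k u(1) v(1)] by simp
    qed
    show "inv\<^bsub>GL (S2 k)\<^esub> u \<in> U_grp (S2 k)" if "u \<in> U_grp (S2 k)" for u :: "'a mat"
    proof -
      have u: "u \<in> P_grp (S2 k)" "u $$ (0, 0) = 1" "mid u = 1\<^sub>m k" using that by (auto simp: U_grp_iff)
      note i = P_inv[OF u(1), unfolded u]
      have "mid (inv\<^bsub>GL (S2 k)\<^esub> u) = 1\<^sub>m k"
        by (rule right_mult_one_mat[OF P_mid_carrier[OF odd_k i(1)], symmetric, THEN trans, OF i(3)])
      then show ?thesis unfolding U_grp_iff using i(1,2) by simp
    qed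
  qed
qed

text \<open>By \<open>normal_in_ker_char\<close> the normal subgroup \<open>U_grp\<close> acts
  trivially, so the representation itself, and not merely its character, depends on
  \<open>levi\<close> alone.\<close>

lemma type_one_rep:
  fixes \<chi> :: "'a::{field,finite} mat \<Rightarrow> complex"
  assumes \<chi>: "\<chi> \<in> Irr ((GL (S2 k))\<lparr>carrier := P_grp (S2 k)\<rparr>)" "U_grp (S2 k) \<subseteq> ker_char ((GL (S2 k))\<lparr>carrier := P_grp (S2 k)\<rparr>) \<chi>"
  obtains d \<rho> where "irreducible_rep ((GL (S2 k))\<lparr>carrier := P_grp (S2 k)\<rparr>) d \<rho>" "\<chi> = rep_char ((GL (S2 k))\<lparr>carrier := P_grp (S2 k)\<rparr>) \<rho>"
    "\<And>x. x \<in> P_grp (S2 k) \<Longrightarrow> \<rho> x = \<rho> (levi x)"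
proof -
  interpret group "GL (S2 k) :: 'a mat monoid" by simp
  let ?G = "(GL (S2 k))\<lparr>carrier := P_grp (S2 k) :: 'a mat set\<rparr>"
  note P = subgroup_P[OF odd_k, where 'a = 'a]
  have G: "group ?G" by (rule subgroup_imp_group[OF P])
  obtain d \<rho> where \<rho>: "irreducible_rep ?G d \<rho>" "\<chi> = rep_char ?G \<rho>" using \<chi>(1) by (auto simp: Irr_def)
  then have rep: "representation ?G d \<rho>" by (simp add: irreducible_rep_def)
  have UP: "U_grp (S2 k) \<subseteq> (P_grp (S2 k) :: 'a mat set)" by (auto simp: U_grp_iff)
  have one: "\<rho> u = 1\<^sub>m d" if u: "u \<in> U_grp (S2 k)" for u
  proof (rule normal_in_ker_char[OF G \<rho>(1) _ _ _ _ u])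
    show "subgroup (U_grp (S2 k)) ?G" by (rule subgroup_incl[OF subgroup_U P UP])
    show "finite (U_grp (S2 k) :: 'a mat set)" by (rule finite_subset[OF UP finite_P[OF odd_k]])
    show "U_grp (S2 k) \<subseteq> ker_char ?G (rep_char ?G \<rho>)" using \<chi>(2) unfolding \<rho>(2) .
    show "inv\<^bsub>?G\<^esub> x \<otimes>\<^bsub>?G\<^esub> u \<otimes>\<^bsub>?G\<^esub> x \<in> U_grp (S2 k)" if "x \<in> carrier ?G" "u \<in> U_grp (S2 k)" for x u
    proof -
      have x: "x \<in> P_grp (S2 k)" using that by simp
      have u: "u \<in> P_grp (S2 k)" "u $$ (0, 0) = 1" "mid u = 1\<^sub>m k" using that by (auto simp: U_grp_iff)
      note i = P_inv[OF x]
      note m = P_mult[OF odd_k i(1) u(1)]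
      note m' = P_mult[OF odd_k m(1) x]
      have "mid (inv\<^bsub>GL (S2 k)\<^esub> x) * 1\<^sub>m k = mid (inv\<^bsub>GL (S2 k)\<^esub> x)" by (rule right_mult_one_mat[OF P_mid_carrier[OF odd_k i(1)]])
      then have "inv\<^bsub>GL (S2 k)\<^esub> x * u * x \<in> U_grp (S2 k)" unfolding U_grp_iff m'(2,3) m(2,3) u using m'(1) i(2,3) by simp
      then show ?thesis unfolding m_inv_consistent[OF P x] by simp
    qed
  qed
  have "\<rho> x = \<rho> (levi x)" if x: "x \<in> P_grp (S2 k)" for x
  proof -
    have v: "unip_vec x \<in> carrier_vec k" by (rule unip_vec_carrier[OF P_carrier[OF odd_k x]])
    have uU: "u_mat (S2 k) (unip_vec x) \<in> U_grp (S2 k)" using v by (auto simp: U_grp_def)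
    have l: "levi x \<in> P_grp (S2 k)" by (rule levi_simps(1)[OF odd_k x])
    have "\<rho> x = \<rho> (u_mat (S2 k) (unip_vec x) * levi x)" using P_decomp[OF odd_k x] by simp
    also have "\<dots> = \<rho> (u_mat (S2 k) (unip_vec x)) * \<rho> (levi x)"
      using rep_mult[OF rep, of "u_mat (S2 k) (unip_vec x)" "levi x"] subsetD[OF UP uU] l by simp
    also have "\<dots> = \<rho> (levi x)" unfolding one[OF uU] using repD(1)[OF rep, of "levi x"] l by simp
    finally show ?thesis .
  qed
  then show ?thesis using that[OF \<rho>] by blast
qed

section \<open>The element t\<close>

lemma t_elt_entry:
  assumes "i < (S2 k)" "j < (S2 k)"
  shows "t_elt (S2 k) $$ (i, j) = (if i = (if j = 0 then Suc k else if j = Suc k then 0 else j)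
    then if i = Suc (k div 2) then - 1 else 1 else (0 :: 'a::field))"
proof -
  have "Suc (k div 2) < Suc k" using odd_pos[OF odd_k] by simp
  then show ?thesis using assms by (auto simp: t_elt_def)
qed

lemma t_elt_carrier: "t_elt (S2 k) \<in> carrier_mat (S2 k) (S2 k)"
  by (simp add: t_elt_def)

lemma t_elt_mult:
  fixes g :: "'a::field mat"
  assumes g: "g \<in> carrier_mat (S2 k) (S2 k)" and ij: "i < (S2 k)" "j < (S2 k)"
  shows "(t_elt (S2 k) * g) $$ (i, j) = (if i = Suc (k div 2) then - 1 else 1) * g $$ (if i = 0 then Suc k else if i = Suc k then 0 else i, j)"
    and "(g * t_elt (S2 k)) $$ (i, j) = (if j = Suc (k div 2) then - 1 else 1) * g $$ (i, if j = 0 then Suc k else if j = Suc k then 0 else j)"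
proof -
  have lt: "Suc (k div 2) < Suc k" using odd_pos[OF odd_k] by simp
  let ?\<tau> = "\<lambda>i. if i = 0 then Suc k else if i = Suc k then 0 else i" and ?\<epsilon> = "\<lambda>i. if i = Suc (k div 2) then - 1 else (1 :: 'a)"
  have e: "t_elt (S2 k) $$ (i, l) = (if l = ?\<tau> i then ?\<epsilon> i else 0)" "t_elt (S2 k) $$ (l, i) = (if l = ?\<tau> i then ?\<epsilon> i else 0)"
    if "i < (S2 k)" "l < (S2 k)" for i l
    using lt that by (auto simp: t_elt_entry)
  have \<tau>: "?\<tau> i < (S2 k)" if "i < (S2 k)" for i using that by simp
  have "(t_elt (S2 k) * g) $$ (i, j) = (\<Sum>l<(S2 k). if l = ?\<tau> i then ?\<epsilon> i * g $$ (l, j) else 0)"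
    unfolding mult_mat_entry[OF t_elt_carrier g ij] by (rule sum.cong[OF refl]) (simp add: e(1)[OF ij(1)])
  also have "\<dots> = ?\<epsilon> i * g $$ (?\<tau> i, j)" using \<tau>[OF ij(1)] by (subst sum.delta) auto
  finally show "(t_elt (S2 k) * g) $$ (i, j) = ?\<epsilon> i * g $$ (?\<tau> i, j)" .
  have "(g * t_elt (S2 k)) $$ (i, j) = (\<Sum>l<(S2 k). if l = ?\<tau> j then ?\<epsilon> j * g $$ (i, l) else 0)"
    unfolding mult_mat_entry[OF g t_elt_carrier ij] by (rule sum.cong[OF refl]) (simp add: e(2)[OF ij(2)])
  also have "\<dots> = ?\<epsilon> j * g $$ (i, ?\<tau> j)" using \<tau>[OF ij(2)] by (subst sum.delta) auto
  finally show "(g * t_elt (S2 k)) $$ (i, j) = ?\<epsilon> j * g $$ (i, ?\<tau> j)" .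
qed

lemma t_elt_square: "t_elt (S2 k) * t_elt (S2 k) = (1\<^sub>m (S2 k) :: 'a::field mat)"
proof (rule eq_matI)
  have lt: "Suc (k div 2) < Suc k" using odd_pos[OF odd_k] by simp
  fix i j assume "i < dim_row (1\<^sub>m (S2 k) :: 'a mat)" "j < dim_col (1\<^sub>m (S2 k) :: 'a mat)"
  then have ij: "i < (S2 k)" "j < (S2 k)" by auto
  show "(t_elt (S2 k) * t_elt (S2 k)) $$ (i, j) = (1\<^sub>m (S2 k) :: 'a mat) $$ (i, j)"
    unfolding t_elt_mult(1)[OF t_elt_carrier ij] using ij lt by (auto simp: t_elt_entry)
qed (auto simp: t_elt_def)

lemma t_elt_vec:
  fixes v :: "'a::field vec"
  assumes v: "v \<in> carrier_vec (S2 k)" and i: "i < (S2 k)"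
  shows "(t_elt (S2 k) *\<^sub>v v) $ i = (if i = Suc (k div 2) then - 1 else 1) * v $ (if i = 0 then Suc k else if i = Suc k then 0 else i)"
proof -
  have lt: "Suc (k div 2) < Suc k" using odd_pos[OF odd_k] by simp
  let ?\<tau> = "if i = 0 then Suc k else if i = Suc k then 0 else i"
  have "(t_elt (S2 k) *\<^sub>v v) $ i = (\<Sum>l<(S2 k). if l = ?\<tau> then (if i = Suc (k div 2) then - 1 else 1) * v $ l else 0)"
    unfolding mult_mat_vec_entry[OF t_elt_carrier v i]
    by (rule sum.cong[OF refl]) (use lt i in \<open>auto simp: t_elt_entry\<close>)
  also have "\<dots> = (if i = Suc (k div 2) then - 1 else 1) * v $ ?\<tau>" using i by (subst sum.delta) auto
  finally show ?thesis .
qed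

text \<open>The sign at the middle index disappears in the square of the middle coordinate, and the
  exchange of the outermost coordinates preserves their product.\<close>

lemma t_elt_isometry: "t_elt (S2 k) \<in> (isometries (S2 k) Q_odd :: 'a::field mat set)"
proof (rule isometriesI[OF t_elt_carrier])
  have "det (t_elt (S2 k) :: 'a mat) * det (t_elt (S2 k) :: 'a mat) = 1"
    using det_mult[OF t_elt_carrier t_elt_carrier] t_elt_square[where 'a = 'a] by (metis det_one)
  then show "det (t_elt (S2 k) :: 'a mat) \<noteq> 0" by auto
  fix v :: "'a vec" assume v: "v \<in> carrier_vec (S2 k)"
  let ?w = "t_elt (S2 k) *\<^sub>v v"
  have lt: "Suc (k div 2) < Suc k" using odd_pos[OF odd_k] by simp
  have w: "?w \<in> carrier_vec (S2 k)" by (rule mult_mat_vec_carrier[OF t_elt_carrier v])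
  have m: "midv ?w $ i = (if i = k div 2 then - 1 else 1) * midv v $ i" if "i < k" for i
    using t_elt_vec[OF v, of "Suc i"] that carrier_vecD[OF v] carrier_vecD[OF w] by (simp add: midv_def del: index_mult_mat_vec dim_mult_mat_vec)
  have d: "dim_vec (midv ?w) = k" "dim_vec (midv v) = k" by (rule carrier_vecD[OF midv_carrier[OF w]], rule carrier_vecD[OF midv_carrier[OF v]])
  have "Q_odd (midv ?w) = Q_odd (midv v)"
  proof -
    have "cf (midv ?w) j * cf' (midv ?w) j = cf (midv v) j * cf' (midv v) j" if "j \<in> {1..k div 2}" for j
    proof -
      have "k div 2 - j < k" "k div 2 - j \<noteq> k div 2" "(k - 1) div 2 + j < k" "(k - 1) div 2 + j \<noteq> k div 2"
        using that odd_k by (auto elim!: oddE)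
      then show ?thesis unfolding cf_def cf'_def d by (simp add: m)
    qed
    moreover have "(cf (midv ?w) 0)\<^sup>2 = (cf (midv v) 0)\<^sup>2" unfolding cf_def d using m[of "k div 2"] odd_pos[OF odd_k] by simp
    ultimately show ?thesis unfolding Q_odd_def d by simp
  qed
  then show "Q_odd ?w = Q_odd v"
    unfolding Q_odd_border[OF w odd_k] Q_odd_border[OF v odd_k]
    using t_elt_vec[OF v, of 0] t_elt_vec[OF v, of "Suc k"] lt by (simp del: index_mult_mat_vec)
qed

lemma t_elt_GL: "t_elt (S2 k) \<in> carrier (GL (S2 k) :: 'a::field mat monoid)" "inv\<^bsub>GL (S2 k)\<^esub> (t_elt (S2 k)) = (t_elt (S2 k) :: 'a mat)"
proof -
  show 1: "t_elt (S2 k) \<in> carrier (GL (S2 k) :: 'a mat monoid)" using t_elt_isometry[where 'a = 'a] by (simp add: isometries_def)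
  show "inv\<^bsub>GL (S2 k)\<^esub> (t_elt (S2 k)) = (t_elt (S2 k) :: 'a mat)" by (rule GL_inv_unique[OF 1 t_elt_carrier t_elt_square])
qed

lemma t_elt_involution:
  "(x :: 'a::field mat) \<in> carrier_mat (S2 k) (S2 k) \<Longrightarrow> t_elt (S2 k) * (t_elt (S2 k) * x * t_elt (S2 k)) * t_elt (S2 k) = x"
  by (rule conj_cancel[OF t_elt_carrier t_elt_carrier t_elt_square])

lemma t_conj_SO:
  fixes x :: "'a::field mat"
  assumes x: "x \<in> SO (S2 k)"
  shows "t_elt (S2 k) * x * t_elt (S2 k) \<in> SO (S2 k)"
proof -
  have xc: "x \<in> carrier_mat (S2 k) (S2 k)" using x by (simp add: SO_iff)
  have tx: "t_elt (S2 k) * x \<in> carrier_mat (S2 k) (S2 k)" by (rule mult_carrier_mat[OF t_elt_carrier xc])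
  have dt: "det (t_elt (S2 k) :: 'a mat) * det (t_elt (S2 k) :: 'a mat) = 1"
    using det_mult[OF t_elt_carrier t_elt_carrier] t_elt_square[where 'a = 'a] by (metis det_one)
  have "det (t_elt (S2 k) * x * t_elt (S2 k)) = det x"
    unfolding det_mult[OF tx t_elt_carrier] det_mult[OF t_elt_carrier xc] using dt by (simp add: algebra_simps)
  moreover have "t_elt (S2 k) * x * t_elt (S2 k) \<in> isometries (S2 k) Q_odd"
    using subgroup.m_closed[OF subgroup_isometries, of _ _ Q_odd] t_elt_isometry SO_isometry[OF x] by (metis GL_simps(1))
  ultimately show ?thesis using x by (simp add: SO_def GO_def)
qed

lemma t_conj_entry:
  fixes x :: "'a::field mat"
  assumes x: "x \<in> carrier_mat (S2 k) (S2 k)" and ij: "i < (S2 k)" "j < (S2 k)"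
  shows "(t_elt (S2 k) * x * t_elt (S2 k)) $$ (i, j) = (if j = Suc (k div 2) then - 1 else 1) * ((if i = Suc (k div 2) then - 1 else 1)
    * x $$ (if i = 0 then Suc k else if i = Suc k then 0 else i, if j = 0 then Suc k else if j = Suc k then 0 else j))"
proof -
  have "t_elt (S2 k) * x \<in> carrier_mat (S2 k) (S2 k)" by (rule mult_carrier_mat[OF t_elt_carrier x])
  from t_elt_mult(2)[OF this ij] show ?thesis using t_elt_mult(1)[OF x ij(1), of "if j = 0 then Suc k else if j = Suc k then 0 else j"] ij(2) by simp
qed

text \<open>Up to signs and the exchange of the two ends, the first column of the conjugate is the
  last column of \<open>x\<close>. The middle part of that column vanishes exactly when
  \<open>unip_vec x\<close> does.\<close>

lemma t_conj_P_L:
  fixes x :: "'a::field mat"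
  assumes x: "x \<in> P_grp (S2 k)"
  shows "t_elt (S2 k) * x * t_elt (S2 k) \<in> P_grp (S2 k) \<longleftrightarrow> x \<in> L_grp (S2 k)"
proof
  have xc: "x \<in> carrier_mat (S2 k) (S2 k)" by (rule P_carrier[OF odd_k x])
  have lt: "Suc (k div 2) < Suc k" using odd_pos[OF odd_k] by simp
  {
    assume a: "t_elt (S2 k) * x * t_elt (S2 k) \<in> P_grp (S2 k)"
    have "x $$ (Suc i, Suc k) = 0" if "i < k" for i
    proof -
      have "(t_elt (S2 k) * x * t_elt (S2 k)) $$ (Suc i, 0) = 0" using a that by (simp add: P_grp_iff)
      then show ?thesis using t_conj_entry[OF xc, of "Suc i" 0] that by (simp split: if_splits)
    qed
    then have "unip_vec x = 0\<^sub>v k" using carrier_matD[OF xc] by (intro eq_vecI) (auto simp: unip_vec_def)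
    then have "levi x = x"
      by (intro P_eqI[OF odd_k levi_simps(1)[OF odd_k x] x levi_simps(2,3)[OF odd_k x]]) (simp only: levi_simps(4)[OF odd_k x])
    then show "x \<in> L_grp (S2 k)" using x by (simp add: L_grp_iff[OF odd_k])
  }
  assume xL: "x \<in> L_grp (S2 k)"
  then obtain y a where ya: "x = s_mat y a" "y \<in> SO k" by (auto simp: L_grp_def)
  have yc: "y \<in> carrier_mat k k" using ya(2) by (simp add: SO_iff)
  have z: "x $$ (0, Suc k) = 0" "x $$ (Suc i, Suc k) = 0" if "i < k" for i
    unfolding ya(1) using s_mat_simps(8,9)[OF yc] that by auto
  have "(t_elt (S2 k) * x * t_elt (S2 k)) $$ (i, 0) = 0" if i: "0 < i" "i < (S2 k)" for i
  proof -
    show ?thesis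
    proof (rule less_Suc_Suc_cases[OF i(2)])
      assume 1: "i = Suc k"
      show ?thesis unfolding 1 t_conj_entry[OF xc lessI zero_less_Suc]
        by (simp only: z(1)[OF odd_pos[OF odd_k]] if_True if_False simp_thms nat.distinct mult_zero_right)
    next
      fix j assume 2: "i = Suc j" "j < k"
      then have "j \<noteq> k" by simp
      then show ?thesis unfolding 2(1) t_conj_entry[OF xc i(2)[unfolded 2(1)] zero_less_Suc]
        by (simp only: z(2)[OF 2(2)] if_True if_False simp_thms nat.distinct nat.inject mult_zero_right)
    qed (use i(1) in simp)
  qed
  then show "t_elt (S2 k) * x * t_elt (S2 k) \<in> P_grp (S2 k)"
    unfolding P_grp_iff[OF zero_less_Suc] using t_conj_SO[OF P_in_SO[OF odd_k x]] by blast
qed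

lemma conj_set_t_iff:
  fixes x :: "'a::field mat"
  assumes x: "x \<in> carrier (GL (S2 k))"
  shows "x \<in> conj_set (GL (S2 k)) (t_elt (S2 k)) (P_grp (S2 k)) \<longleftrightarrow> t_elt (S2 k) * x * t_elt (S2 k) \<in> P_grp (S2 k)"
proof
  assume "x \<in> conj_set (GL (S2 k)) (t_elt (S2 k)) (P_grp (S2 k))"
  then obtain p where p: "p \<in> P_grp (S2 k)" "x = t_elt (S2 k) * p * t_elt (S2 k)" by (auto simp: conj_set_def t_elt_GL(2))
  then show "t_elt (S2 k) * x * t_elt (S2 k) \<in> P_grp (S2 k)" using t_elt_involution[OF P_carrier[OF odd_k p(1)]] by simp
next
  assume a: "t_elt (S2 k) * x * t_elt (S2 k) \<in> P_grp (S2 k)"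
  have "x \<in> carrier_mat (S2 k) (S2 k)" using x by (simp add: GL_carrier)
  from t_elt_involution[OF this] a show "x \<in> conj_set (GL (S2 k)) (t_elt (S2 k)) (P_grp (S2 k))"
    unfolding conj_set_def t_elt_GL(2) GL_simps by (intro rev_image_eqI) auto
qed

lemma conj_set_t_carrier: "conj_set (GL (S2 k)) (t_elt (S2 k)) (P_grp (S2 k) :: 'a::field mat set) \<subseteq> carrier (GL (S2 k))"
proof -
  interpret group "GL (S2 k) :: 'a mat monoid" by simp
  show ?thesis using subgroup.subset[OF subgroup_P[OF odd_k, where 'a = 'a]] t_elt_GL(1) by (auto simp: conj_set_def simp del: GL_simps)
qed

lemma conj_set_t_P: "conj_set (GL (S2 k)) (t_elt (S2 k)) (P_grp (S2 k)) \<inter> P_grp (S2 k) = (L_grp (S2 k) :: 'a::field mat set)"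
proof -
  have "x \<in> conj_set (GL (S2 k)) (t_elt (S2 k)) (P_grp (S2 k)) \<longleftrightarrow> x \<in> L_grp (S2 k)" if "x \<in> P_grp (S2 k)" for x :: "'a mat"
    using conj_set_t_iff[of x] t_conj_P_L[OF that] that subgroup.subset[OF subgroup_P[OF odd_k, where 'a = 'a]] by blast
  moreover have "L_grp (S2 k) \<subseteq> (P_grp (S2 k) :: 'a mat set)" by (auto simp: L_grp_iff[OF odd_k])
  ultimately show ?thesis by blast
qed

lemma t_conj_L:
  fixes x :: "'a::field mat"
  assumes x: "x \<in> carrier_mat (S2 k) (S2 k)"
  shows "t_elt (S2 k) * x * t_elt (S2 k) \<in> L_grp (S2 k) \<longleftrightarrow> x \<in> L_grp (S2 k)"
proof -
  have 1: "t_elt (S2 k) * y * t_elt (S2 k) \<in> L_grp (S2 k)" if "y \<in> L_grp (S2 k)" for y :: "'a mat"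
  proof -
    have yP: "y \<in> P_grp (S2 k)" using that by (simp add: L_grp_iff[OF odd_k])
    then show ?thesis
      using t_conj_P_L[OF yP] t_conj_P_L[of "t_elt (S2 k) * y * t_elt (S2 k)"] that t_elt_involution[OF P_carrier[OF odd_k yP]] by simp
  qed
  show ?thesis using 1[of x] 1[of "t_elt (S2 k) * x * t_elt (S2 k)"] t_elt_involution[OF x] by auto
qed

lemma conj_infl_t:
  fixes \<sigma> :: "'a::field mat \<Rightarrow> complex"
  shows "conj_char (GL (S2 k)) (t_elt (S2 k)) (infl (GL (S2 k)) (U_grp (S2 k)) (L_grp (S2 k)) \<sigma>)
    = (\<lambda>x. if x \<in> conj_set (GL (S2 k)) (t_elt (S2 k)) (P_grp (S2 k)) then \<sigma> (levi (t_elt (S2 k) * x * t_elt (S2 k))) else 0)"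
proof
  fix x :: "'a mat"
  show "conj_char (GL (S2 k)) (t_elt (S2 k)) (infl (GL (S2 k)) (U_grp (S2 k)) (L_grp (S2 k)) \<sigma>) x
    = (if x \<in> conj_set (GL (S2 k)) (t_elt (S2 k)) (P_grp (S2 k)) then \<sigma> (levi (t_elt (S2 k) * x * t_elt (S2 k))) else 0)"
  proof (cases "x \<in> carrier (GL (S2 k))")
    case True
    have e: "inv\<^bsub>GL (S2 k)\<^esub> t_elt (S2 k) \<otimes>\<^bsub>GL (S2 k)\<^esub> x \<otimes>\<^bsub>GL (S2 k)\<^esub> t_elt (S2 k) = t_elt (S2 k) * x * t_elt (S2 k)" by (simp only: t_elt_GL(2) GL_simps)
    show ?thesis unfolding conj_char_def infl_U_L[OF odd_k subset_refl] e conj_set_t_iff[OF True]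
    proof (cases "t_elt (S2 k) * x * t_elt (S2 k) \<in> P_grp (S2 k)")
      case P: True
      show "(if x \<in> carrier (GL (S2 k)) then if t_elt (S2 k) * x * t_elt (S2 k) \<in> P_grp (S2 k) \<and> levi (t_elt (S2 k) * x * t_elt (S2 k)) \<in> L_grp (S2 k)
          then \<sigma> (levi (t_elt (S2 k) * x * t_elt (S2 k))) else 0 else 0)
        = (if t_elt (S2 k) * x * t_elt (S2 k) \<in> P_grp (S2 k) then \<sigma> (levi (t_elt (S2 k) * x * t_elt (S2 k))) else 0)"
        by (simp only: True P levi_simps(6)[OF odd_k P] if_True simp_thms)
    qed (simp only: if_False simp_thms if_cancel)
  next
    case False
    then have "x \<notin> conj_set (GL (S2 k)) (t_elt (S2 k)) (P_grp (S2 k))" using conj_set_t_carrier[where 'a = 'a] by blast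
    then show ?thesis using False by (simp add: conj_char_def)
  qed
qed

text \<open>The class function is the pullback of \<open>\<sigma>\<close> along conjugation by the
  involution \<open>t_elt\<close> followed by \<open>levi\<close>, which is a homomorphism on the
  conjugate group.\<close>

lemma conj_infl_t_character:
  fixes \<sigma> :: "'a::field mat \<Rightarrow> complex"
  assumes "\<sigma> \<in> characters ((GL (S2 k))\<lparr>carrier := L_grp (S2 k)\<rparr>)"
  shows "conj_char (GL (S2 k)) (t_elt (S2 k)) (infl (GL (S2 k)) (U_grp (S2 k)) (L_grp (S2 k)) \<sigma>)
    \<in> characters ((GL (S2 k))\<lparr>carrier := conj_set (GL (S2 k)) (t_elt (S2 k)) (P_grp (S2 k))\<rparr>)"
proof -
  let ?tP = "conj_set (GL (S2 k)) (t_elt (S2 k)) (P_grp (S2 k)) :: 'a mat set" and ?t = "t_elt (S2 k) :: 'a mat"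
  have p: "?t * x * ?t \<in> P_grp (S2 k)" "x \<in> carrier_mat (S2 k) (S2 k)" if "x \<in> ?tP" for x
    using that conj_set_t_iff[of x] conj_set_t_carrier[where 'a = 'a] by (auto simp: GL_carrier)
  have "(\<lambda>x. levi (?t * x * ?t)) \<in> hom ((GL (S2 k))\<lparr>carrier := ?tP\<rparr>) ((GL (S2 k))\<lparr>carrier := L_grp (S2 k)\<rparr>)"
  proof (rule homI)
    show "levi (?t * x * ?t) \<in> carrier ((GL (S2 k))\<lparr>carrier := L_grp (S2 k)\<rparr>)" if "x \<in> carrier ((GL (S2 k))\<lparr>carrier := ?tP\<rparr>)" for x
      using levi_simps(6)[OF odd_k p(1)] that by simp
    fix x y assume "x \<in> carrier ((GL (S2 k))\<lparr>carrier := ?tP\<rparr>)" "y \<in> carrier ((GL (S2 k))\<lparr>carrier := ?tP\<rparr>)"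
    then have xy: "x \<in> ?tP" "y \<in> ?tP" by auto
    note c = p(2)[OF xy(1)] p(2)[OF xy(2)] t_elt_carrier[where 'a = 'a]
    have "(?t * x * ?t) * (?t * y * ?t) = ?t * x * (?t * ?t) * (y * ?t)"
      using c by (simp add: assoc_mult_mat[of _ "(S2 k)" "(S2 k)" _ "(S2 k)" _ "(S2 k)"])
    also have "\<dots> = ?t * (x * y) * ?t"
      unfolding t_elt_square using c by (simp add: assoc_mult_mat[of _ "(S2 k)" "(S2 k)" _ "(S2 k)" _ "(S2 k)"])
    finally have "?t * (x * y) * ?t = (?t * x * ?t) * (?t * y * ?t)" ..
    then show "levi (?t * (x \<otimes>\<^bsub>(GL (S2 k))\<lparr>carrier := ?tP\<rparr>\<^esub> y) * ?t)
        = levi (?t * x * ?t) \<otimes>\<^bsub>(GL (S2 k))\<lparr>carrier := L_grp (S2 k)\<rparr>\<^esub> levi (?t * y * ?t)"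
      using levi_mult[OF odd_k p(1)[OF xy(1)] p(1)[OF xy(2)]] by (simp del: assoc_mult_mat)
  qed
  from characters_pullback[OF assms this] show ?thesis unfolding conj_infl_t by simp
qed

text \<open>Conjugation by \<open>t_elt\<close> maps \<open>L_n\<close> onto itself, and inflation
  does not change values on \<open>L_n\<close>.\<close>

lemma restr_conj_infl_t:
  fixes \<sigma> :: "'a::field mat \<Rightarrow> complex"
  assumes "\<And>x. x \<notin> L_grp (S2 k) \<Longrightarrow> \<sigma> x = 0"
  shows "restr (L_grp (S2 k)) (conj_char (GL (S2 k)) (t_elt (S2 k)) (infl (GL (S2 k)) (U_grp (S2 k)) (L_grp (S2 k)) \<sigma>))
    = conj_char (GL (S2 k)) (t_elt (S2 k)) \<sigma>"
proof
  fix x :: "'a mat"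
  show "restr (L_grp (S2 k)) (conj_char (GL (S2 k)) (t_elt (S2 k)) (infl (GL (S2 k)) (U_grp (S2 k)) (L_grp (S2 k)) \<sigma>)) x
    = conj_char (GL (S2 k)) (t_elt (S2 k)) \<sigma> x"
  proof (cases "x \<in> L_grp (S2 k)")
    case True
    have xG: "x \<in> carrier (GL (S2 k))" using True subgroup.subset[OF subgroup_L[OF odd_k, where 'a = 'a]] by blast
    then have xc: "x \<in> carrier_mat (S2 k) (S2 k)" by (simp add: GL_carrier)
    have tx: "t_elt (S2 k) * x * t_elt (S2 k) \<in> L_grp (S2 k)" using t_conj_L[OF xc] True by simp
    have "x \<in> conj_set (GL (S2 k)) (t_elt (S2 k)) (P_grp (S2 k))" using True conj_set_t_P[where 'a = 'a] by blast
    then show ?thesis unfolding restr_def conj_infl_t using True xG L_grpD(6)[OF odd_k tx]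
      by (simp add: conj_char_def t_elt_GL(2))
  next
    case False
    then have "\<sigma> (t_elt (S2 k) * x * t_elt (S2 k)) = 0" if "x \<in> carrier_mat (S2 k) (S2 k)" using assms t_conj_L[OF that] by simp
    then show ?thesis using False by (auto simp: restr_def conj_char_def t_elt_GL(2) GL_carrier)
  qed
qed

end

lemma ind_zero: "g \<notin> K \<Longrightarrow> ind G H K \<chi> g = 0"
  by (simp add: ind_def)

section \<open>Irreducibility of the inflated characters\<close>

context
  fixes k :: nat
  assumes odd_k: "odd k"
begin

lemma emb_in_K:
  fixes x :: "'a::field mat"
  assumes "x \<in> P_grp (S2 k)"
  shows "emb x \<in> K_grp (S4 k)" "mid (emb x) = x"
  using emb_props[OF odd2[OF odd_k] P_in_SO[OF odd_k assms]] assms by (auto simp: K_grp_I[OF odd_k])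

lemma mid_hom_K: "mid \<in> hom ((GL (S4 k))\<lparr>carrier := K_grp (S4 k)\<rparr>) ((GL (S2 k))\<lparr>carrier := P_grp (S2 k) :: 'a::field mat set\<rparr>)"
  using K_grp_D[OF odd_k, where 'a = 'a] P_mult(3)[OF odd2[OF odd_k], where 'a = 'a] by (intro homI) auto

lemma infl_RQK_Irr:
  fixes \<chi> :: "'a::field mat \<Rightarrow> complex"
  assumes "\<chi> \<in> Irr ((GL (S2 k))\<lparr>carrier := P_grp (S2 k)\<rparr>)"
  shows "infl_RQK (S4 k) \<chi> \<in> Irr ((GL (S4 k))\<lparr>carrier := RQK_grp (S4 k)\<rparr>)"
proof -
  have "carrier ((GL (S2 k))\<lparr>carrier := P_grp (S2 k) :: 'a mat set\<rparr>) \<subseteq> mid ` carrier ((GL (S4 k))\<lparr>carrier := K_grp (S4 k)\<rparr>)"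
  proof
    fix x :: "'a mat" assume "x \<in> carrier ((GL (S2 k))\<lparr>carrier := P_grp (S2 k)\<rparr>)"
    then have "x \<in> P_grp (S2 k)" by simp
    from emb_in_K[OF this] show "x \<in> mid ` carrier ((GL (S4 k))\<lparr>carrier := K_grp (S4 k)\<rparr>)" by (intro rev_image_eqI[of "emb x"]) auto
  qed
  from Irr_pullback[OF assms mid_hom_K this] show ?thesis unfolding RQK_eq[OF odd_k] infl_RQK_eq[OF odd_k] by simp
qed

lemma char_LK_Irr:
  fixes \<chi> :: "'a::{field,finite} mat \<Rightarrow> complex"
  assumes \<chi>: "\<chi> \<in> Irr ((GL (S2 k))\<lparr>carrier := P_grp (S2 k)\<rparr>)" "U_grp (S2 k) \<subseteq> ker_char ((GL (S2 k))\<lparr>carrier := P_grp (S2 k)\<rparr>) \<chi>"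
  shows "char_LK (S4 k) \<chi> \<in> Irr ((GL (S4 k))\<lparr>carrier := LK_grp (S4 k)\<rparr>)"
proof -
  let ?P = "(GL (S2 k))\<lparr>carrier := P_grp (S2 k) :: 'a mat set\<rparr>" and ?L = "(GL (S4 k))\<lparr>carrier := LK_grp (S4 k) :: 'a mat set\<rparr>"
  obtain d \<rho> where \<rho>: "irreducible_rep ?P d \<rho>" "\<chi> = rep_char ?P \<rho>" "\<And>x. x \<in> P_grp (S2 k) \<Longrightarrow> \<rho> x = \<rho> (levi x)"
    using type_one_rep[OF odd_k \<chi>] by blast
  have LK: "c \<in> P_grp (S4 k)" "mid c \<in> P_grp (S2 k)" if "c \<in> LK_grp (S4 k)" for c :: "'a mat"
    using that by (auto simp: LK_eq[OF odd_k] L_grp_iff[OF odd_k] L_grp_iff[OF odd2[OF odd_k]])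
  have hom: "mid \<in> hom ?L ?P"
    using LK P_mult(3)[OF odd2[OF odd_k], where 'a = 'a] by (intro homI) auto
  have sur: "\<exists>c\<in>carrier ?L. \<rho> y = \<rho> (mid c)" if y: "y \<in> carrier ?P" for y
  proof -
    have yP: "y \<in> P_grp (S2 k)" using y by simp
    note l = levi_simps[OF odd_k yP]
    note e = emb_props[OF odd2[OF odd_k] P_in_SO[OF odd_k l(1)]]
    have "emb (levi y) \<in> LK_grp (S4 k)" unfolding LK_eq[OF odd_k] using e(2,5) l(6) by simp
    then show ?thesis using \<rho>(3)[OF yP] e(2) by (intro bexI[of _ "emb (levi y)"]) auto
  qed
  have "irreducible_rep ?L d (\<lambda>c. \<rho> (mid c))" by (rule irreducible_rep_pullback_image[OF \<rho>(1) hom sur])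
  moreover have "char_LK (S4 k) \<chi> = rep_char ?L (\<lambda>c. \<rho> (mid c))"
    using LK(2) by (auto simp: fun_eq_iff char_LK_eq[OF odd_k] rep_char_def \<rho>(2))
  ultimately show ?thesis unfolding Irr_def by blast
qed

lemma core_hom:
  fixes \<phi> :: "'a::field vec \<Rightarrow> 'a"
  assumes \<phi>: "linear_on k \<phi>"
  shows "core \<in> hom ((GL (S4 k))\<lparr>carrier := {c \<in> inertia (S4 k) (\<lambda>v. \<phi> (midv v)). mid c \<in> P_grp (S2 k)}\<rparr>) ((GL (S2 k))\<lparr>carrier := inertia (S2 k) \<phi>\<rparr>)"
    and "inertia (S2 k) \<phi> \<subseteq> core ` {c \<in> inertia (S4 k) (\<lambda>v. \<phi> (midv v)). mid c \<in> P_grp (S2 k)}"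
proof -
  let ?C = "{c \<in> inertia (S4 k) (\<lambda>v. \<phi> (midv v)). mid c \<in> P_grp (S2 k)}"
  have C: "c \<in> L_grp (S4 k)" "mid c \<in> P_grp (S2 k)" "core c \<in> inertia (S2 k) \<phi>" if "c \<in> ?C" for c
  proof -
    show "c \<in> L_grp (S4 k)" "mid c \<in> P_grp (S2 k)" using that by (auto simp: inertia_def)
    then show "core c \<in> inertia (S2 k) \<phi>" using inertia_border[OF odd_k \<phi>] that by blast
  qed
  show "core \<in> hom ((GL (S4 k))\<lparr>carrier := ?C\<rparr>) ((GL (S2 k))\<lparr>carrier := inertia (S2 k) \<phi>\<rparr>)"
  proof (rule homI)
    show "core c \<in> carrier ((GL (S2 k))\<lparr>carrier := inertia (S2 k) \<phi>\<rparr>)" if "c \<in> carrier ((GL (S4 k))\<lparr>carrier := ?C\<rparr>)" for c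
      using C(3) that by simp
    fix c d assume "c \<in> carrier ((GL (S4 k))\<lparr>carrier := ?C\<rparr>)" "d \<in> carrier ((GL (S4 k))\<lparr>carrier := ?C\<rparr>)"
    then have cd: "c \<in> ?C" "d \<in> ?C" by simp_all
    note L = C(1)[OF cd(1)] C(1)[OF cd(2)]
    note P = L_grpD(4)[OF odd2[OF odd_k] L(1)] L_grpD(4)[OF odd2[OF odd_k] L(2)]
    note m = C(2)[OF cd(1)] C(2)[OF cd(2)]
    have "core (c * d) = core c * core d"
      unfolding core_def P_mult(2,3)[OF odd2[OF odd_k] P] P_mult(3)[OF odd_k m]
      using s_mat_mult[OF odd_k P_par(4)[OF odd_k m(1)] L_grpD(3)[OF odd2[OF odd_k] L(1)] P_par(4)[OF odd_k m(2)] L_grpD(3)[OF odd2[OF odd_k] L(2)]] ..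
    then show "core (c \<otimes>\<^bsub>(GL (S4 k))\<lparr>carrier := ?C\<rparr>\<^esub> d) = core c \<otimes>\<^bsub>(GL (S2 k))\<lparr>carrier := inertia (S2 k) \<phi>\<rparr>\<^esub> core d" by simp
  qed
  show "inertia (S2 k) \<phi> \<subseteq> core ` ?C"
  proof
    fix l assume l: "l \<in> inertia (S2 k) \<phi>"
    note lD = inertiaD[OF odd_k l]
    \<comment> \<open>The lift of \<open>l\<close> with inner unipotent vector \<open>0\<close> and
      inner torus entry \<open>1\<close>.\<close>
    note c = s_mat_s_mat_in_L[OF odd_k zero_carrier_vec lD(2) one_neq_zero lD(3)]
    let ?x = "u_mat (S2 k) (0\<^sub>v k) * s_mat (mid l) 1"
    have cl: "core (s_mat ?x (l $$ (0, 0))) = l" unfolding c(8) by (rule lD(1))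
    have m: "mid (s_mat ?x (l $$ (0, 0))) \<in> P_grp (S2 k)" unfolding c(3) by (rule c(2))
    have "s_mat ?x (l $$ (0, 0)) \<in> inertia (S4 k) (\<lambda>v. \<phi> (midv v))"
      unfolding inertia_border[OF odd_k \<phi> c(1) m] cl c(3,5) using l linear_onD(3)[OF \<phi>] by simp
    then show "l \<in> core ` ?C" using cl m by (intro image_eqI[of _ _ "s_mat ?x (l $$ (0, 0))"]) auto
  qed
qed

end

context
  fixes k :: nat
  assumes odd_k: "odd k"
begin

lemma central_hom:
  "(\<lambda>g. mid (mid g)) \<in> hom ((GL (S6 k))\<lparr>carrier := emb ` K_grp (S4 k)\<rparr>) ((GL (S2 k))\<lparr>carrier := P_grp (S2 k) :: 'a::field mat set\<rparr>)"
  "P_grp (S2 k) \<subseteq> (\<lambda>g. mid (mid g)) ` (emb ` (K_grp (S4 k) :: 'a mat set))"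
proof -
  note k2 = odd2[OF odd_k]
  have S: "x \<in> SO (S4 k)" if "x \<in> K_grp (S4 k)" for x :: "'a mat" by (rule P_in_SO[OF k2 K_grp_D(1)[OF odd_k that]])
  have m: "mid (emb x) = x" "emb x \<in> P_grp (S6 k)" if "x \<in> K_grp (S4 k)" for x :: "'a mat"
    using emb_props[OF odd2[OF k2] S[OF that]] by simp_all
  show "(\<lambda>g. mid (mid g)) \<in> hom ((GL (S6 k))\<lparr>carrier := emb ` K_grp (S4 k)\<rparr>) ((GL (S2 k))\<lparr>carrier := P_grp (S2 k) :: 'a mat set\<rparr>)"
  proof (rule homI)
    show "mid (mid g) \<in> carrier ((GL (S2 k))\<lparr>carrier := P_grp (S2 k)\<rparr>)" if "g \<in> carrier ((GL (S6 k))\<lparr>carrier := emb ` K_grp (S4 k)\<rparr>)" for g :: "'a mat"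
      using that m(1) K_grp_D(2)[OF odd_k] by auto
    fix g h :: "'a mat" assume "g \<in> carrier ((GL (S6 k))\<lparr>carrier := emb ` K_grp (S4 k)\<rparr>)" "h \<in> carrier ((GL (S6 k))\<lparr>carrier := emb ` K_grp (S4 k)\<rparr>)"
    then obtain x y where x: "x \<in> K_grp (S4 k)" "g = emb x" and y: "y \<in> K_grp (S4 k)" "h = emb y" by auto
    have "mid (mid (g * h)) = mid (mid g) * mid (mid h)"
      unfolding x(2) y(2) P_mult(3)[OF odd2[OF k2] m(2)[OF x(1)] m(2)[OF y(1)]] m(1)[OF x(1)] m(1)[OF y(1)]
      by (rule P_mult(3)[OF k2 K_grp_D(1)[OF odd_k x(1)] K_grp_D(1)[OF odd_k y(1)]])
    then show "mid (mid (g \<otimes>\<^bsub>(GL (S6 k))\<lparr>carrier := emb ` K_grp (S4 k)\<rparr>\<^esub> h))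
      = mid (mid g) \<otimes>\<^bsub>(GL (S2 k))\<lparr>carrier := P_grp (S2 k)\<rparr>\<^esub> mid (mid h)" by simp
  qed
  show "P_grp (S2 k) \<subseteq> (\<lambda>g. mid (mid g)) ` (emb ` (K_grp (S4 k) :: 'a mat set))"
  proof
    fix x :: "'a mat" assume x: "x \<in> P_grp (S2 k)"
    show "x \<in> (\<lambda>g. mid (mid g)) ` (emb ` K_grp (S4 k))"
    proof (rule image_eqI)
      show "x = mid (mid (emb (emb x)))" using emb_in_K(2)[OF odd_k x] m(1)[OF emb_in_K(1)[OF odd_k x]] by simp
      show "emb (emb x) \<in> emb ` K_grp (S4 k)" by (rule imageI[OF emb_in_K(1)[OF odd_k x]])
    qed
  qed
qed

lemma r_elt_GL: "r_elt (S6 k) \<in> carrier (GL (S6 k) :: 'a::field mat monoid)"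
  using hom_in_carrier[OF emb_hom[OF odd2[OF odd2[OF odd_k]]], of "s_elt (S4 k) :: 'a mat"] s_elt_SO[OF odd_k, where 'a = 'a]
  unfolding r_elt_eq by simp

lemma r_conj_H:
  fixes g :: "'a::field mat"
  assumes g: "g \<in> carrier (GL (S6 k))"
  shows "r_elt (S6 k) * g * r_elt (S6 k) \<in> emb ` K_grp (S4 k) \<longleftrightarrow> g \<in> emb ` K_grp (S4 k)"
    and "r_elt (S6 k) * (r_elt (S6 k) * g * r_elt (S6 k)) * r_elt (S6 k) = g"
proof -
  have 1: "r_elt (S6 k) * h * r_elt (S6 k) \<in> emb ` K_grp (S4 k)" if "h \<in> emb ` K_grp (S4 k)" for h :: "'a mat"
  proof -
    from that obtain x where x: "x \<in> K_grp (S4 k)" "h = emb x" by blast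
    have "r_elt (S6 k) * h * r_elt (S6 k) = emb (s_elt (S4 k) * x * s_elt (S4 k))"
      using r_conj_emb[OF odd_k P_in_SO[OF odd2[OF odd_k] K_grp_D(1)[OF odd_k x(1)]]] unfolding r_elt_inv[OF odd_k] x(2) by simp
    then show ?thesis using K_conj_simps(1)[OF odd_k x(1)] by blast
  qed
  have rc: "(r_elt (S6 k) :: 'a mat) \<in> carrier_mat (S6 k) ((S6 k))" "g \<in> carrier_mat (S6 k) ((S6 k))" using r_elt_GL[where 'a = 'a] g by (auto simp: GL_carrier)
  have "r_elt (S6 k) * r_elt (S6 k) = (1\<^sub>m (S6 k) :: 'a mat)"
    using GL_inv(2)[OF r_elt_GL[where 'a = 'a]] unfolding r_elt_inv[OF odd_k] .
  then show 2: "r_elt (S6 k) * (r_elt (S6 k) * g * r_elt (S6 k)) * r_elt (S6 k) = g" by (rule conj_cancel[OF rc(1,1) _ rc(2)])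
  show "r_elt (S6 k) * g * r_elt (S6 k) \<in> emb ` K_grp (S4 k) \<longleftrightarrow> g \<in> emb ` K_grp (S4 k)" using 1[of g] 1[of "r_elt (S6 k) * g * r_elt (S6 k)"] unfolding 2 by blast
qed

lemma H_carrier: "emb ` K_grp (S4 k) \<subseteq> carrier (GL (S6 k) :: 'a::field mat monoid)"
proof -
  have "x \<in> SO (S4 k)" if "x \<in> K_grp (S4 k)" for x :: "'a mat" by (rule P_in_SO[OF odd2[OF odd_k] K_grp_D(1)[OF odd_k that]])
  then show ?thesis using hom_in_carrier[OF emb_hom[OF odd2[OF odd2[OF odd_k]], where 'a = 'a]] by auto
qed

lemma conj_set_r_H: "conj_set (GL (S6 k)) (r_elt (S6 k)) (emb ` K_grp (S4 k)) = emb ` (K_grp (S4 k) :: 'a::field mat set)"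
proof -
  have *: "r_elt (S6 k) * h * r_elt (S6 k) \<in> emb ` K_grp (S4 k)" "r_elt (S6 k) * (r_elt (S6 k) * h * r_elt (S6 k)) * r_elt (S6 k) = h"
    if "h \<in> emb ` K_grp (S4 k)" for h :: "'a mat"
    using r_conj_H[of h] that H_carrier[where 'a = 'a] by blast+
  show ?thesis unfolding conj_set_def r_elt_inv[OF odd_k] GL_simps
  proof (intro equalityI subsetI)
    fix h :: "'a mat" assume h: "h \<in> emb ` K_grp (S4 k)"
    show "h \<in> (\<lambda>x. r_elt (S6 k) * x * r_elt (S6 k)) ` emb ` K_grp (S4 k)"
    proof (rule image_eqI)
      show "h = r_elt (S6 k) * (r_elt (S6 k) * h * r_elt (S6 k)) * r_elt (S6 k)" by (rule *(2)[OF h, symmetric])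
    qed (rule *(1)[OF h])
  qed (use *(1) in blast)
qed

text \<open>Irreducibility of the twisted character follows by pulling back along the automorphism
  of the intersection given by conjugation with the involution \<open>r_elt\<close>.\<close>

lemma infl_central_Irr:
  fixes \<chi> :: "'a::field mat \<Rightarrow> complex"
  assumes \<chi>: "\<chi> \<in> Irr ((GL (S2 k))\<lparr>carrier := P_grp (S2 k)\<rparr>)"
  shows "infl_central (emb ` K_grp (S4 k)) \<chi> \<in> Irr ((GL (S6 k))\<lparr>carrier := emb ` K_grp (S4 k)\<rparr>)"
    and "conj_char (GL (S6 k)) (r_elt (S6 k)) (infl_central (emb ` K_grp (S4 k)) \<chi>) \<in> Irr ((GL (S6 k))\<lparr>carrier := emb ` K_grp (S4 k)\<rparr>)"
proof -
  let ?H = "emb ` K_grp (S4 k) :: 'a mat set" and ?r = "r_elt (S6 k) :: 'a mat"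
  show 1: "infl_central ?H \<chi> \<in> Irr ((GL (S6 k))\<lparr>carrier := ?H\<rparr>)"
    using Irr_pullback[OF \<chi> central_hom(1)] central_hom(2) unfolding infl_central_def by simp
  have rc: "?r \<in> carrier_mat (S6 k) ((S6 k))" using r_elt_GL[where 'a = 'a] by (simp add: GL_carrier)
  have rr: "?r * ?r = 1\<^sub>m (S6 k)" using GL_inv(2)[OF r_elt_GL[where 'a = 'a]] unfolding r_elt_inv[OF odd_k] .
  have *: "?r * h * ?r \<in> ?H" "?r * (?r * h * ?r) * ?r = h" "h \<in> carrier_mat (S6 k) ((S6 k))" if "h \<in> ?H" for h
    using r_conj_H[of h] that H_carrier[where 'a = 'a] by (auto simp: GL_carrier)
  have hom: "(\<lambda>g. ?r * g * ?r) \<in> hom ((GL (S6 k))\<lparr>carrier := ?H\<rparr>) ((GL (S6 k))\<lparr>carrier := ?H\<rparr>)"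
  proof (rule homI)
    show "?r * g * ?r \<in> carrier ((GL (S6 k))\<lparr>carrier := ?H\<rparr>)" if "g \<in> carrier ((GL (S6 k))\<lparr>carrier := ?H\<rparr>)" for g using * that by simp
    fix x y assume "x \<in> carrier ((GL (S6 k))\<lparr>carrier := ?H\<rparr>)" "y \<in> carrier ((GL (S6 k))\<lparr>carrier := ?H\<rparr>)"
    then have c: "x \<in> carrier_mat (S6 k) ((S6 k))" "y \<in> carrier_mat (S6 k) ((S6 k))" using *(3) by simp_all
    have "(?r * x * ?r) * (?r * y * ?r) = ?r * x * (?r * ?r) * (y * ?r)"
      using c rc by (simp add: assoc_mult_mat[of _ "(S6 k)" "(S6 k)" _ "(S6 k)" _ "(S6 k)"])
    also have "\<dots> = ?r * (x * y) * ?r"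
      unfolding rr using c rc by (simp add: assoc_mult_mat[of _ "(S6 k)" "(S6 k)" _ "(S6 k)" _ "(S6 k)"])
    finally have e: "(?r * x * ?r) * (?r * y * ?r) = ?r * (x * y) * ?r" .
    have m: "monoid.mult ((GL (S6 k))\<lparr>carrier := ?H\<rparr>) = (*)" by simp
    show "?r * (x \<otimes>\<^bsub>(GL (S6 k))\<lparr>carrier := ?H\<rparr>\<^esub> y) * ?r = ?r * x * ?r \<otimes>\<^bsub>(GL (S6 k))\<lparr>carrier := ?H\<rparr>\<^esub> (?r * y * ?r)"
      unfolding m by (rule e[symmetric])
  qed
  have "?H \<subseteq> (\<lambda>g. ?r * g * ?r) ` ?H" using conj_set_r_H[where 'a = 'a] unfolding conj_set_def r_elt_inv[OF odd_k] GL_simps by blast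
  then have "(\<lambda>g. if g \<in> ?H then infl_central ?H \<chi> (?r * g * ?r) else 0) \<in> Irr ((GL (S6 k))\<lparr>carrier := ?H\<rparr>)"
    using Irr_pullback[OF 1 hom] by simp
  moreover have "conj_char (GL (S6 k)) ?r (infl_central ?H \<chi>) = (\<lambda>g. if g \<in> ?H then infl_central ?H \<chi> (?r * g * ?r) else 0)"
  proof
    fix g
    show "conj_char (GL (S6 k)) ?r (infl_central ?H \<chi>) g = (if g \<in> ?H then infl_central ?H \<chi> (?r * g * ?r) else 0)"
      using r_conj_H(1)[of g] H_carrier[where 'a = 'a] unfolding conj_char_def r_elt_inv[OF odd_k] GL_simps by (auto simp: infl_central_def)
  qed
  ultimately show "conj_char (GL (S6 k)) ?r (infl_central ?H \<chi>) \<in> Irr ((GL (S6 k))\<lparr>carrier := ?H\<rparr>)" by simp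
qed

end

section \<open>The theorem\<close>

context
  fixes k :: nat
  assumes odd_k: "odd k"
begin

lemma inertia_cong:
  fixes \<phi> :: "'a::field vec \<Rightarrow> 'a"
  assumes "\<And>v. v \<in> carrier_vec k \<Longrightarrow> \<phi> v = \<phi>' v"
  shows "inertia (S2 k) \<phi> = inertia (S2 k) \<phi>'"
proof -
  have "\<phi> (mid c *\<^sub>v v) = \<phi>' (mid c *\<^sub>v v)" if "c \<in> L_grp (S2 k)" "v \<in> carrier_vec k" for c v
    by (rule assms, rule mult_mat_vec_carrier[OF P_mid_carrier[OF odd_k L_grpD(4)[OF odd_k that(1)]] that(2)])
  then show ?thesis using assms by (auto simp: inertia_iff[OF odd_k])
qed

end

context
  fixes k :: nat
  assumes odd_k: "odd k"
begin

text \<open>Serves both signs: \<open>core\<close> maps \<open>C0\<close> homomorphically onto the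
  complement one size down.\<close>

lemma infl_core_Irr:
  fixes \<phi> :: "'a::field vec \<Rightarrow> 'a"
  assumes \<phi>: "linear_on k \<phi>" and \<phi>': "\<And>v. v \<in> carrier_vec (S2 k) \<Longrightarrow> \<phi>' v = \<phi> (midv v)"
    and \<theta>: "\<theta> \<in> Irr ((GL (S2 k))\<lparr>carrier := inertia (S2 k) \<phi>\<rparr>)"
    and C0: "C0 = {c \<in> inertia (S4 k) \<phi>'. mid c \<in> P_grp (S2 k)}"
    and \<tau>: "\<And>c. \<tau> c = (if c \<in> C0 then \<theta> (core c) else 0)"
  shows "\<tau> \<in> Irr ((GL (S4 k))\<lparr>carrier := C0\<rparr>)"
proof -
  have i: "inertia (S4 k) \<phi>' = inertia (S4 k) (\<lambda>v. \<phi> (midv v))" by (rule inertia_cong[OF odd2[OF odd_k] \<phi>'])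
  have C: "C0 = {c \<in> inertia (S4 k) (\<lambda>v. \<phi> (midv v)). mid c \<in> P_grp (S2 k)}" unfolding C0 i ..
  have "\<tau> = (\<lambda>c. if c \<in> C0 then \<theta> (core c) else 0)" using \<tau> by blast
  then show ?thesis using Irr_pullback[OF \<theta> core_hom(1)[OF odd_k \<phi>]] core_hom(2)[OF odd_k \<phi>] unfolding C by simp
qed

lemma linear_cf: "linear_on k (\<lambda>v :: 'a::field vec. cf v 0)"
  using odd_pos[OF odd_k] by (auto simp: linear_on_def cf_def)

lemma cf_midv: "v \<in> carrier_vec (S2 k) \<Longrightarrow> cf v 0 = cf (midv (v :: 'a::field vec)) 0"
  using odd_pos[OF odd_k] by (auto simp: cf_def dest!: carrier_vecD)

lemma L_plus_trivial:
  assumes k: "k = 1" and l: "(l :: 'a::field mat) \<in> L_plus (S2 k)"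
  shows "l = 1\<^sub>m (S2 k)"
proof -
  note I = l[unfolded L_plus_eq[OF odd_k]]
  note lD = inertiaD[OF odd_k I]
  have m: "mid l \<in> carrier_mat 1 1" "det (mid l) = 1" using lD(2) k by (auto simp: SO_iff)
  have m1: "mid l = 1\<^sub>m k" using m det_single[OF m(1)] k by (intro eq_matI) auto
  have "l $$ (0, 0) * cf (mid l *\<^sub>v unit_vec k 0) 0 = cf (unit_vec k 0) 0" by (rule lD(4)) simp
  then have l0: "l $$ (0, 0) = 1" unfolding m1 using k by (simp add: cf_def)
  have lL: "l \<in> L_grp (S2 k)" using I by (simp add: inertia_def)
  have o: "1\<^sub>m (S2 k) \<in> (L_grp (S2 k) :: 'a mat set)" using subgroup.one_closed[OF subgroup_L[OF odd_k, where 'a = 'a]] by simp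
  show ?thesis
    by (rule P_eqI[OF odd_k L_grpD(4)[OF odd_k lL] L_grpD(4)[OF odd_k o]])
      (simp_all add: l0 m1 mid_one L_grpD(5)[OF odd_k lL] L_grpD(5)[OF odd_k o])
qed

text \<open>For \<open>n = 5\<close> the inflation is defined to be \<open>1\<close>. This agrees
  with \<open>\<theta> (core c)\<close>, because \<open>L_plus\<close> of size \<open>3\<close> is
  trivial and its irreducible character takes the value \<open>1\<close>.\<close>

lemma infl_P_plus_core:
  fixes \<theta> :: "'a::field mat \<Rightarrow> complex"
  assumes \<theta>: "\<theta> \<in> Irr ((GL (S2 k))\<lparr>carrier := L_plus (S2 k)\<rparr>)"
  shows "infl_P_plus (S4 k) \<theta> c = (if c \<in> P_plus (S4 k) then \<theta> (core c) else 0)"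
proof (cases "c \<in> P_plus (S4 k) \<and> k = 1")
  case False
  then show ?thesis by (auto simp: infl_P_plus_def core_def)
next
  case True
  interpret group "GL (S2 k) :: 'a mat monoid" by simp
  have S: "subgroup (L_plus (S2 k) :: 'a mat set) (GL (S2 k))" unfolding L_plus_eq[OF odd_k] by (rule subgroup_inertia[OF odd_k])
  note triv = L_plus_trivial[OF conjunct2[OF True], where 'a = 'a]
  have "comm_group ((GL (S2 k))\<lparr>carrier := L_plus (S2 k) :: 'a mat set\<rparr>)"
  proof (rule group.group_comm_groupI[OF subgroup_imp_group[OF S]])
    fix x y :: "'a mat" assume "x \<in> carrier ((GL (S2 k))\<lparr>carrier := L_plus (S2 k)\<rparr>)" "y \<in> carrier ((GL (S2 k))\<lparr>carrier := L_plus (S2 k)\<rparr>)"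
    then have "x = y" using triv[of x] triv[of y] by simp
    then show "x \<otimes>\<^bsub>(GL (S2 k))\<lparr>carrier := L_plus (S2 k)\<rparr>\<^esub> y = y \<otimes>\<^bsub>(GL (S2 k))\<lparr>carrier := L_plus (S2 k)\<rparr>\<^esub> x" by (simp only:)
  qed
  from Irr_abelian_mult(2)[OF this \<theta>] have \<theta>1: "\<theta> (1\<^sub>m (S2 k)) = 1" by simp
  have c: "c \<in> L_plus (S4 k)" "mid c \<in> P_grp (S2 k)" using True unfolding P_plus_eq[OF odd_k] by auto
  have i: "inertia (S4 k) (\<lambda>v :: 'a vec. cf v 0) = inertia (S4 k) (\<lambda>v. cf (midv v) 0)"
    by (rule inertia_cong[OF odd2[OF odd_k] cf_midv])
  have cI: "c \<in> inertia (S4 k) (\<lambda>v. cf (midv v) 0)"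
    using c(1) unfolding L_plus_eq[OF odd2[OF odd_k]] i .
  then have "c \<in> L_grp (S4 k)" by (simp add: inertia_def)
  then have "core c \<in> L_plus (S2 k)" using inertia_border[OF odd_k linear_cf _ c(2)] cI unfolding L_plus_eq[OF odd_k] by blast
  then have "core c = 1\<^sub>m (S2 k)" by (rule triv)
  then show ?thesis using True \<theta>1 by (simp add: infl_P_plus_def)
qed

lemma type_plus:
  fixes \<xi> :: "'a::{field,finite} \<Rightarrow> complex"
  assumes \<xi>: "additive_char \<xi>" and \<theta>: "\<theta> \<in> Irr ((GL (S2 k))\<lparr>carrier := L_plus (S2 k)\<rparr>)" and \<chi>: "\<chi> = psi_plus \<xi> (S2 k) \<theta>"
  shows "infl_P_plus (S4 k) \<theta> \<in> Irr ((GL (S4 k))\<lparr>carrier := P_plus (S4 k)\<rparr>)"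
    and "ind (GL (S4 k)) (RQK_grp (S4 k)) (P_grp (S4 k)) (conj_char (GL (S4 k)) (s_elt (S4 k)) (infl_RQK (S4 k) \<chi>))
      = psi_plus \<xi> (S4 k) (ind (GL (S4 k)) (P_plus (S4 k)) (L_plus (S4 k)) (infl_P_plus (S4 k) \<theta>))"
proof -
  note \<tau> = infl_P_plus_core[OF \<theta>]
  have P: "P_plus (S4 k) = {c \<in> inertia (S4 k) (\<lambda>v :: 'a vec. cf v 0). mid c \<in> P_grp (S2 k)}"
    unfolding P_plus_eq[OF odd_k] L_plus_eq[OF odd2[OF odd_k]] ..
  show "infl_P_plus (S4 k) \<theta> \<in> Irr ((GL (S4 k))\<lparr>carrier := P_plus (S4 k)\<rparr>)"
    by (rule infl_core_Irr[OF linear_cf cf_midv \<theta>[unfolded L_plus_eq[OF odd_k]] P \<tau>])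
  have z: "unit_vec k (k div 2) \<in> carrier_vec k" "cf (unit_vec k (k div 2) :: 'a vec) 0 = 1"
    using odd_pos[OF odd_k] by (simp_all add: cf_def)
  show "ind (GL (S4 k)) (RQK_grp (S4 k)) (P_grp (S4 k)) (conj_char (GL (S4 k)) (s_elt (S4 k)) (infl_RQK (S4 k) \<chi>))
      = psi_plus \<xi> (S4 k) (ind (GL (S4 k)) (P_plus (S4 k)) (L_plus (S4 k)) (infl_P_plus (S4 k) \<theta>))"
  proof
    fix g :: "'a mat"
    show "ind (GL (S4 k)) (RQK_grp (S4 k)) (P_grp (S4 k)) (conj_char (GL (S4 k)) (s_elt (S4 k)) (infl_RQK (S4 k) \<chi>)) g
      = psi_plus \<xi> (S4 k) (ind (GL (S4 k)) (P_plus (S4 k)) (L_plus (S4 k)) (infl_P_plus (S4 k) \<theta>)) g"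
    proof (cases "g \<in> P_grp (S4 k)")
      case True
      show ?thesis unfolding psi_plus_def I_plus_def lam_plus_def
        by (rule ind_RQK_inertia_functional[OF odd_k \<xi> linear_cf True z L_plus_eq[OF odd_k] L_plus_eq[OF odd2[OF odd_k]]
              P_plus_eq[OF odd_k] cf_midv \<chi>[unfolded psi_plus_def I_plus_def lam_plus_def]]) (simp_all add: \<tau>)
    qed (simp add: psi_plus_def ind_zero)
  qed
qed

lemma type_minus:
  fixes \<xi> :: "'a::{field,finite} \<Rightarrow> complex"
  assumes irr: "irreducible [:\<nu>, 1, 1:]" and nu': "\<nu>' \<noteq> 0" and b3: "b3 \<in> carrier (GL 3)"
    and b_mat: "\<forall>l\<ge>1. \<forall>v\<in>carrier_vec (2 * l + 1).
      Q_odd' \<nu> (b_mat \<nu>' b3 (2 * l + 1) *\<^sub>v v) = \<nu>' * Q_odd v" and k3: "k \<ge> 3"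
    and \<xi>: "additive_char \<xi>" and \<theta>: "\<theta> \<in> Irr ((GL (S2 k))\<lparr>carrier := L_minus \<nu> \<nu>' b3 (S2 k)\<rparr>)" and \<chi>: "\<chi> = psi_minus \<xi> \<nu> \<nu>' b3 (S2 k) \<theta>"
  shows "infl_P_minus \<nu> \<nu>' b3 (S4 k) \<theta> \<in> Irr ((GL (S4 k))\<lparr>carrier := P_minus \<nu> \<nu>' b3 (S4 k)\<rparr>)"
    and "ind (GL (S4 k)) (RQK_grp (S4 k)) (P_grp (S4 k)) (conj_char (GL (S4 k)) (s_elt (S4 k)) (infl_RQK (S4 k) \<chi>))
      = psi_minus \<xi> \<nu> \<nu>' b3 (S4 k) (ind (GL (S4 k)) (P_minus \<nu> \<nu>' b3 (S4 k)) (L_minus \<nu> \<nu>' b3 (S4 k)) (infl_P_minus \<nu> \<nu>' b3 (S4 k) \<theta>))"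
proof -
  note a = irr nu' b3 b_mat odd_k k3
  note L2 = L_minus_eq[OF a] and L4 = L_minus_eq2[OF a] and PL = P_minus_eq[OF a] and core = infl_P_minus_core[OF a]
  note lin = linear_b[OF a] and border = cf_b_border[OF a]
  have \<tau>: "infl_P_minus \<nu> \<nu>' b3 (S4 k) \<theta> c = (if c \<in> P_minus \<nu> \<nu>' b3 (S4 k) then \<theta> (core c) else 0)" for c
    using core[of c \<theta>] by (auto simp: infl_P_minus_def)
  have P: "P_minus \<nu> \<nu>' b3 (S4 k) = {c \<in> inertia (S4 k) (\<lambda>v. cf (b_mat \<nu>' b3 (S2 k) *\<^sub>v v) 0). mid c \<in> P_grp (S2 k)}"
    unfolding PL L4 ..
  show "infl_P_minus \<nu> \<nu>' b3 (S4 k) \<theta> \<in> Irr ((GL (S4 k))\<lparr>carrier := P_minus \<nu> \<nu>' b3 (S4 k)\<rparr>)"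
    by (rule infl_core_Irr[OF lin border \<theta>[unfolded L2] P \<tau>])
  define b where "b = b_mat \<nu>' b3 k"
  have bG: "b \<in> carrier (GL k)" unfolding b_def by (rule b_mat_GL[OF b3 nu' odd_k k3])
  then have bc: "b \<in> carrier_mat k k" by (simp add: GL_carrier)
  \<comment> \<open>The preimage of \<open>e_0\<close> under \<open>b_mat\<close>, at which the
    functional takes the value \<open>1\<close>.\<close>
  define z where "z = inv\<^bsub>GL k\<^esub> b *\<^sub>v unit_vec k (k div 2)"
  have z1: "z \<in> carrier_vec k" unfolding z_def by (rule mult_mat_vec_carrier[OF GL_inv(1)[OF bG] unit_vec_carrier])
  have "b *\<^sub>v z = unit_vec k (k div 2)"
    unfolding z_def assoc_mult_mat_vec[OF bc GL_inv(1)[OF bG] unit_vec_carrier, symmetric] GL_inv(2)[OF bG] by simp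
  then have z2: "cf (b_mat \<nu>' b3 k *\<^sub>v z) 0 = 1" unfolding b_def using k3 by (simp add: cf_def)
  have s: "(S2 k) - 2 = k" "(S4 k) - 2 = (S2 k)" by simp_all
  show "ind (GL (S4 k)) (RQK_grp (S4 k)) (P_grp (S4 k)) (conj_char (GL (S4 k)) (s_elt (S4 k)) (infl_RQK (S4 k) \<chi>))
      = psi_minus \<xi> \<nu> \<nu>' b3 (S4 k) (ind (GL (S4 k)) (P_minus \<nu> \<nu>' b3 (S4 k)) (L_minus \<nu> \<nu>' b3 (S4 k)) (infl_P_minus \<nu> \<nu>' b3 (S4 k) \<theta>))"
  proof
    fix g :: "'a mat"
    show "ind (GL (S4 k)) (RQK_grp (S4 k)) (P_grp (S4 k)) (conj_char (GL (S4 k)) (s_elt (S4 k)) (infl_RQK (S4 k) \<chi>)) g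
      = psi_minus \<xi> \<nu> \<nu>' b3 (S4 k) (ind (GL (S4 k)) (P_minus \<nu> \<nu>' b3 (S4 k)) (L_minus \<nu> \<nu>' b3 (S4 k)) (infl_P_minus \<nu> \<nu>' b3 (S4 k) \<theta>)) g"
    proof (cases "g \<in> P_grp (S4 k)")
      case True
      show ?thesis unfolding psi_minus_def I_minus_def lam_minus_def s(2)
        by (rule ind_RQK_inertia_functional[OF odd_k \<xi> lin True z1 z2 L2 L4 PL border
              \<chi>[unfolded psi_minus_def I_minus_def lam_minus_def s(1)]]) (simp_all add: \<tau>)
    qed (simp add: psi_minus_def ind_zero)
  qed
qed

lemma type_one:
  fixes \<xi> :: "'a::{field,finite} \<Rightarrow> complex"
  assumes \<xi>: "additive_char \<xi>"
    and \<chi>: "\<chi> \<in> Irr ((GL (S2 k))\<lparr>carrier := P_grp (S2 k)\<rparr>)" "U_grp (S2 k) \<subseteq> ker_char ((GL (S2 k))\<lparr>carrier := P_grp (S2 k)\<rparr>) \<chi>"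
  shows "ind (GL (S4 k)) (RQK_grp (S4 k)) (P_grp (S4 k)) (conj_char (GL (S4 k)) (s_elt (S4 k)) (infl_RQK (S4 k) \<chi>))
    = (\<lambda>g. psi_zero \<xi> (S4 k) \<chi> g + psi_one (S4 k) (HC_LK (S4 k) (conj_char (GL (S4 k)) (s_elt (S4 k)) (char_LK (S4 k) \<chi>))) g)"
proof
  fix g :: "'a mat"
  obtain d \<rho> where \<rho>: "\<chi> = rep_char ((GL (S2 k))\<lparr>carrier := P_grp (S2 k)\<rparr>) \<rho>" "\<And>x. x \<in> P_grp (S2 k) \<Longrightarrow> \<rho> x = \<rho> (levi x)"
    using type_one_rep[OF odd_k \<chi>] by metis
  have levi: "\<chi> x = \<chi> (levi x)" if "x \<in> P_grp (S2 k)" for x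
    unfolding \<rho>(1) rep_char_def using \<rho>(2)[OF that] levi_simps(1)[OF odd_k that] that by simp
  show "ind (GL (S4 k)) (RQK_grp (S4 k)) (P_grp (S4 k)) (conj_char (GL (S4 k)) (s_elt (S4 k)) (infl_RQK (S4 k) \<chi>)) g
    = psi_zero \<xi> (S4 k) \<chi> g + psi_one (S4 k) (HC_LK (S4 k) (conj_char (GL (S4 k)) (s_elt (S4 k)) (char_LK (S4 k) \<chi>))) g"
  proof (cases "g \<in> P_grp (S4 k)")
    case True
    show ?thesis by (rule ind_RQK_type_one[where \<chi> = \<chi>, OF odd_k \<xi> True]) (rule levi)
  qed (simp add: psi_zero_def psi_one_def ind_zero infl_U_L[OF odd2[OF odd_k] subset_refl])
qed

lemma type_zero:
  fixes \<xi> :: "'a::{field,finite} \<Rightarrow> complex"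
  assumes \<xi>: "additive_char \<xi>" and \<chi>: "\<chi> = psi_zero \<xi> (S4 k) \<chi>\<^sub>0"
  shows "ind (GL (S6 k)) (RQK_grp (S6 k)) (P_grp (S6 k)) (conj_char (GL (S6 k)) (s_elt (S6 k)) (infl_RQK (S6 k) \<chi>))
    = psi_zero \<xi> (S6 k) (ind (GL (S6 k)) (emb ` K_grp (S4 k)) (P_emb (S6 k))
        (conj_char (GL (S6 k)) (r_elt (S6 k)) (infl_central (emb ` K_grp (S4 k)) \<chi>\<^sub>0)) \<circ> emb)"
proof
  fix g :: "'a mat"
  show "ind (GL (S6 k)) (RQK_grp (S6 k)) (P_grp (S6 k)) (conj_char (GL (S6 k)) (s_elt (S6 k)) (infl_RQK (S6 k) \<chi>)) g
    = psi_zero \<xi> (S6 k) (ind (GL (S6 k)) (emb ` K_grp (S4 k)) (P_emb (S6 k))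
        (conj_char (GL (S6 k)) (r_elt (S6 k)) (infl_central (emb ` K_grp (S4 k)) \<chi>\<^sub>0)) \<circ> emb) g"
    by (cases "g \<in> P_grp (S6 k)") (rule ind_RQK_type_zero[OF odd_k \<xi> _ \<chi>], simp_all add: psi_zero_def ind_zero)
qed

end

theorem theorem4p3:
  fixes \<nu> \<nu>' :: "'a::{field,finite}" and b3 :: "'a mat" and \<xi> :: "'a \<Rightarrow> complex"
    and m n :: nat and \<sigma> :: "'a mat \<Rightarrow> complex"
  assumes irreducible_poly: "irreducible [:\<nu>, 1, 1:]"
    and nu': "\<nu>' \<noteq> 0"
    and b3: "b3 \<in> carrier (GL 3)"
    and b_mat: "\<forall>l\<ge>1. \<forall>v\<in>carrier_vec (2 * l + 1).
      Q_odd' \<nu> (b_mat \<nu>' b3 (2 * l + 1) *\<^sub>v v) = \<nu>' * Q_odd v"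
    and xi: "\<xi> \<in> Irr additive_group" "\<xi> \<noteq> (\<lambda>_. 1)"
    and m: "m \<ge> 2"
    and n: "n = 2 * m + 1"
    and sigma: "\<sigma> \<in> Irr ((GL n)\<lparr>carrier := L_grp n\<rparr>)"
      "A_grp n \<subseteq> ker_char ((GL n)\<lparr>carrier := L_grp n\<rparr>) \<sigma>"
  shows
    "(let G = GL n; t = t_elt n; P = P_grp n; L = L_grp n;
          tP = conj_set G t P; t\<sigma> = conj_char G t (infl G (U_grp n) L \<sigma>)
      in t\<sigma> \<in> characters (G\<lparr>carrier := tP\<rparr>) \<and>
         restr L t\<sigma> = conj_char G t \<sigma> \<and>
         ind G (tP \<inter> P) P (restr (tP \<inter> P) t\<sigma>) = ind G L P (conj_char G t \<sigma>))
     \<and>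
     (\<forall>\<chi>. \<chi> \<in> Irr ((GL (n - 2))\<lparr>carrier := P_grp (n - 2)\<rparr>) \<and>
          U_grp (n - 2) \<subseteq> ker_char ((GL (n - 2))\<lparr>carrier := P_grp (n - 2)\<rparr>) \<chi> \<longrightarrow>
        char_LK n \<chi> \<in> Irr ((GL n)\<lparr>carrier := LK_grp n\<rparr>) \<and>
        infl_RQK n \<chi> \<in> Irr ((GL n)\<lparr>carrier := RQK_grp n\<rparr>) \<and>
        (let \<Sigma> = HC_LK n (conj_char (GL n) (s_elt n) (char_LK n \<chi>))
         in ind (GL n) (RQK_grp n) (P_grp n) (conj_char (GL n) (s_elt n) (infl_RQK n \<chi>))
            = (\<lambda>g. psi_zero \<xi> n \<chi> g + psi_one n \<Sigma> g)))
     \<and>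
     (m \<ge> 3 \<longrightarrow>
       (\<forall>\<chi> \<chi>\<^sub>0. \<chi> \<in> Irr ((GL (n - 2))\<lparr>carrier := P_grp (n - 2)\<rparr>) \<and>
          \<chi>\<^sub>0 \<in> Irr ((GL (n - 4))\<lparr>carrier := P_grp (n - 4)\<rparr>) \<and>
          \<chi> = psi_zero \<xi> (n - 2) \<chi>\<^sub>0 \<longrightarrow>
        (let G = GL n; r = r_elt n; H = conj_set G r (P_emb n) \<inter> P_emb n;
             \<Sigma> = ind G H (P_emb n) (conj_char G r (infl_central H \<chi>\<^sub>0)) \<circ> emb
         in conj_set G r H = H \<and>
            infl_central H \<chi>\<^sub>0 \<in> Irr (G\<lparr>carrier := H\<rparr>) \<and>
            conj_char G r (infl_central H \<chi>\<^sub>0) \<in> Irr (G\<lparr>carrier := H\<rparr>) \<and>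
            ind G (RQK_grp n) (P_grp n) (conj_char G (s_elt n) (infl_RQK n \<chi>))
            = psi_zero \<xi> n \<Sigma>)))
     \<and>
     (\<forall>\<chi> \<theta>\<^sub>0. \<chi> \<in> Irr ((GL (n - 2))\<lparr>carrier := P_grp (n - 2)\<rparr>) \<and>
          \<theta>\<^sub>0 \<in> Irr ((GL (n - 2))\<lparr>carrier := L_plus (n - 2)\<rparr>) \<and>
          \<chi> = psi_plus \<xi> (n - 2) \<theta>\<^sub>0 \<longrightarrow>
        infl_P_plus n \<theta>\<^sub>0 \<in> Irr ((GL n)\<lparr>carrier := P_plus n\<rparr>) \<and>
        (let \<theta> = ind (GL n) (P_plus n) (L_plus n) (infl_P_plus n \<theta>\<^sub>0)
         in ind (GL n) (RQK_grp n) (P_grp n) (conj_char (GL n) (s_elt n) (infl_RQK n \<chi>))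
            = psi_plus \<xi> n \<theta>))
     \<and>
     (m \<ge> 3 \<longrightarrow>
       (\<forall>\<chi> \<theta>\<^sub>0. \<chi> \<in> Irr ((GL (n - 2))\<lparr>carrier := P_grp (n - 2)\<rparr>) \<and>
          \<theta>\<^sub>0 \<in> Irr ((GL (n - 2))\<lparr>carrier := L_minus \<nu> \<nu>' b3 (n - 2)\<rparr>) \<and>
          \<chi> = psi_minus \<xi> \<nu> \<nu>' b3 (n - 2) \<theta>\<^sub>0 \<longrightarrow>
        infl_P_minus \<nu> \<nu>' b3 n \<theta>\<^sub>0 \<in> Irr ((GL n)\<lparr>carrier := P_minus \<nu> \<nu>' b3 n\<rparr>) \<and>
        (let \<theta> = ind (GL n) (P_minus \<nu> \<nu>' b3 n) (L_minus \<nu> \<nu>' b3 n) (infl_P_minus \<nu> \<nu>' b3 n \<theta>\<^sub>0)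
         in ind (GL n) (RQK_grp n) (P_grp n) (conj_char (GL n) (s_elt n) (infl_RQK n \<chi>))
            = psi_minus \<xi> \<nu> \<nu>' b3 n \<theta>)))"
proof -
  \<comment> \<open>\<open>k\<close> is \<open>n - 4\<close>. For \<open>m \<ge> 3\<close> it is
    again of the form \<open>Suc (Suc j)\<close>, with \<open>j = n - 6\<close> the size of the
    innermost block in (c).\<close>
  define k where "k = Suc (2 * (m - 2))"
  have k: "odd k" and n4: "n = (S4 k)" and k2: "odd (S2 k)" using m n by (simp_all add: k_def)
  have s: "(S4 k) - 2 = (S2 k)" "(S4 k) - 4 = k" by simp_all
  have k3: "\<exists>j. k = Suc (Suc j) \<and> odd j" if "m \<ge> 3"
    using that by (intro exI[of _ "Suc (2 * (m - 3))"]) (simp add: k_def)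
  note \<xi> = additive_char_Irr[OF xi]
  note sigma = sigma(1)[unfolded n4]
  have zero: "\<sigma> x = 0" if "x \<notin> L_grp (S4 k)" for x using Irr_zero[OF sigma, of x] that by simp
  have restr: "restr (L_grp (S4 k)) (conj_char (GL (S4 k)) (t_elt (S4 k)) (infl (GL (S4 k)) (U_grp (S4 k)) (L_grp (S4 k)) \<sigma>)) = conj_char (GL (S4 k)) (t_elt (S4 k)) \<sigma>"
    by (rule restr_conj_infl_t[OF k2]) (rule zero)
  show ?thesis unfolding n4 s Let_def
  \<comment> \<open>Goals 1 to 3 belong to (a), 4 to 6 to (b), 7 to 10 to (c), 11 and 12 to (d), 13
    and 14 to (e).\<close>
  proof (intro conjI allI impI, goal_cases)
    case 1
    show ?case by (rule conj_infl_t_character[OF k2 Irr_characters[OF sigma]])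
  next
    case 2
    show ?case by (rule restr)
  next
    case 3
    show ?case unfolding conj_set_t_P[OF k2] restr ..
  next
    case (4 \<chi>)
    then show ?case using char_LK_Irr[OF k, of \<chi>] by blast
  next
    case (5 \<chi>)
    then show ?case using infl_RQK_Irr[OF k, of \<chi>] by blast
  next
    case (6 \<chi>)
    then show ?case using type_one[OF k \<xi>, of \<chi>] by blast
  next
    case (7 \<chi> \<chi>\<^sub>0)
    obtain j where j: "k = Suc (Suc j)" "odd j" using k3[OF 7(1)] by blast
    show ?case unfolding j(1) r_conj_P_emb[OF j(2)] by (rule conj_set_r_H[OF j(2)])
  next
    case (8 \<chi> \<chi>\<^sub>0)
    obtain j where j: "k = Suc (Suc j)" "odd j" using k3[OF 8(1)] by blast
    from 8(2) have "\<chi>\<^sub>0 \<in> Irr ((GL k)\<lparr>carrier := P_grp k\<rparr>)" by blast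
    then show ?case unfolding j(1) r_conj_P_emb[OF j(2)] by (rule infl_central_Irr(1)[OF j(2)])
  next
    case (9 \<chi> \<chi>\<^sub>0)
    obtain j where j: "k = Suc (Suc j)" "odd j" using k3[OF 9(1)] by blast
    from 9(2) have "\<chi>\<^sub>0 \<in> Irr ((GL k)\<lparr>carrier := P_grp k\<rparr>)" by blast
    then show ?case unfolding j(1) r_conj_P_emb[OF j(2)] by (rule infl_central_Irr(2)[OF j(2)])
  next
    case (10 \<chi> \<chi>\<^sub>0)
    obtain j where j: "k = Suc (Suc j)" "odd j" using k3[OF 10(1)] by blast
    from 10(2) have "\<chi> = psi_zero \<xi> (S2 k) \<chi>\<^sub>0" by blast
    then show ?case unfolding j(1) r_conj_P_emb[OF j(2)] by (rule type_zero[OF j(2) \<xi>])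
  next
    case (11 \<chi> \<theta>\<^sub>0)
    then show ?case using type_plus(1)[OF k \<xi>, of \<theta>\<^sub>0 \<chi>] by blast
  next
    case (12 \<chi> \<theta>\<^sub>0)
    then show ?case using type_plus(2)[OF k \<xi>, of \<theta>\<^sub>0 \<chi>] by blast
  next
    case (13 \<chi> \<theta>\<^sub>0)
    have "k \<ge> 3" using 13(1) by (simp add: k_def)
    then show ?case using type_minus(1)[OF k irreducible_poly nu' b3 b_mat _ \<xi>, of \<theta>\<^sub>0 \<chi>] 13(2) by blast
  next
    case (14 \<chi> \<theta>\<^sub>0)
    have "k \<ge> 3" using 14(1) by (simp add: k_def)
    then show ?case using type_minus(2)[OF k irreducible_poly nu' b3 b_mat _ \<xi>, of \<theta>\<^sub>0 \<chi>] 14(2) by blast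
  qed
qed

end
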